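(* For every $\ell\in\mathbb{N}$ there exist $H_\ell^0, H_\ell^+ \in (0,1)$ such that (with $\alpha=\arccos h$) $E_h$ does not attain its infimum in $\mathcal{A}_h(\ell)$ for any $h\in(H_\ell^0,1)$, and $E_h$ does not attain its infimum in $\mathcal{A}_h(\ell+\alpha/\pi)$ for any $h\in(H_\ell^+,1)$.
   Context: $\mathbb{N} = \{1,2,\dots\}$ and $\mathbb{S}^1 \subset \mathbb{R}^2$ is the unit circle. For $h \in [0,1]$ put $\alpha = \arccos h \in [0,\pi/2]$; this relation between $h$ and $\alpha$ is assumed throughout. For $m = (m_1,m_2) \in H^1_{\mathrm{loc}}(\mathbb{R};\mathbb{S}^1)$ define $$E_h(m) = \frac12\left(\|m'\|_{L^2(\mathbb{R})}^2 + \|m_1-h\|_{\dot H^{1/2}(\mathbb{R})}^2 + \|m_1-h\|_{L^2(\mathbb{R})}^2\right) \in [0,\infty], \qquad \|f\|_{\dot H^{1/2}(\mathbb{R})}^2 = \frac{1}{2\pi}\int_{\mathbb{R}}\int_{\mathbb{R}} \frac{|f(s)-f(t)|^2}{|s-t|^2}\,ds\,dt.$$ Every $m \in H^1_{\mathrm{loc}}(\mathbb{R};\mathbb{S}^1)$ is continuous and has a continuous lifting $\phi\colon\mathbb{R}\to\mathbb{R}$ with $m = (\cos\phi,\sin\phi)$, unique up to a constant. If $E_h(m)<\infty$, then at each of $+\infty$ and $-\infty$ the map $m$ converges to one of the points $(\cos\alpha,\pm\sin\alpha)$, and the winding number $\deg(m) = \frac{1}{2\pi}\lim_{x_1\to\infty}(\phi(x_1)-\phi(-x_1))$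 is well-defined and belongs to $\mathbb{Z}\pm\{0,\alpha/\pi\} := \mathbb{Z}\cup(\mathbb{Z}+\alpha/\pi)\cup(\mathbb{Z}-\alpha/\pi)$. For $d$ in this set, $$\mathcal{A}_h(d) = \{m\in H^1_{\mathrm{loc}}(\mathbb{R};\mathbb{S}^1) : E_h(m)<\infty,\ \deg(m)=d\}.$$ "$E_h$ attains its infimum in $\mathcal{A}_h(d)$" means that there is $m\in\mathcal{A}_h(d)$ with $E_h(m) = \inf_{\mathcal{A}_h(d)}E_h$. *)

theory Defs
  imports "HOL-Analysis.Analysis"
begin

definition locally_integrable :: "(real \<Rightarrow> 'a::{banach, second_countable_topology}) \<Rightarrow> bool" where
  "locally_integrable g \<longleftrightarrow> (\<forall>a b. set_integrable lborel {a..b} g)"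

definition locally_L2 :: "(real \<Rightarrow> 'a::{banach, second_countable_topology}) \<Rightarrow> bool" where
  "locally_L2 g \<longleftrightarrow> g \<in> borel_measurable lborel \<and>
     (\<forall>a b. (\<integral>\<^sup>+x\<in>{a..b}. ennreal ((norm (g x))\<^sup>2) \<partial>lborel) < \<infinity>)"

definition L2_norm_sq :: "(real \<Rightarrow> 'a::{banach, second_countable_topology}) \<Rightarrow> ennreal" where
  "L2_norm_sq f = (\<integral>\<^sup>+x. ennreal ((norm (f x))\<^sup>2) \<partial>lborel)"

text \<open>The integrand has the value 0 on the diagonal (division by zero), which is a null set.\<close>

definition H_half_norm_sq :: "(real \<Rightarrow> real) \<Rightarrow> ennreal" where
  "H_half_norm_sq f = ennreal (1 / (2 * pi)) *
     (\<integral>\<^sup>+t. (\<integral>\<^sup>+s. ennreal (\<bar>f s - f t\<bar>\<^sup>2 / \<bar>s - t\<bar>\<^sup>2) \<partial>lborel) \<partial>lborel)"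

text \<open>Test functions are the compactly supported functions of class \<open>C\<^sup>1\<close>, as is usual for
  Sobolev spaces in one dimension.\<close>

definition test_function :: "(real \<Rightarrow> real) \<Rightarrow> bool" where
  "test_function \<psi> \<longleftrightarrow> \<psi> C1_differentiable_on UNIV \<and> compact (closure {x. \<psi> x \<noteq> 0})"

definition has_weak_derivative ::
    "(real \<Rightarrow> 'a::{banach, second_countable_topology}) \<Rightarrow> (real \<Rightarrow> 'a) \<Rightarrow> bool" where
  "has_weak_derivative f g \<longleftrightarrow> locally_integrable f \<and> locally_integrable g \<and>
     (\<forall>\<psi>. test_function \<psi> \<longrightarrow>
        (\<integral>x. deriv \<psi> x *\<^sub>R f x \<partial>lborel) = - (\<integral>x. \<psi> x *\<^sub>R g x \<partial>lborel))"

text \<open>A weak derivative is unique only up to a null set. The choice made here is immaterial, since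
  \<open>weak_deriv\<close> is used only inside integrals.\<close>

definition weak_deriv ::
    "(real \<Rightarrow> 'a::{banach, second_countable_topology}) \<Rightarrow> real \<Rightarrow> 'a" where
  "weak_deriv f = (SOME g. has_weak_derivative f g)"

text \<open>The space \<open>H\<^sup>1\<^sub>l\<^sub>o\<^sub>c(\<real>; S\<^sup>1)\<close>, each class of almost everywhere equal maps being represented by its
  unique continuous member.\<close>

definition H1_loc_circle :: "(real \<Rightarrow> real \<times> real) set" where
  "H1_loc_circle = {m. continuous_on UNIV m \<and> range m \<subseteq> sphere 0 1 \<and> locally_L2 m \<and>
     (\<exists>g. has_weak_derivative m g \<and> locally_L2 g)}"

definition energy :: "real \<Rightarrow> (real \<Rightarrow> real \<times> real) \<Rightarrow> ennreal" where
  "energy h m = ennreal (1 / 2) *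
     (L2_norm_sq (weak_deriv m) + H_half_norm_sq (\<lambda>x. fst (m x) - h) + L2_norm_sq (\<lambda>x. fst (m x) - h))"

definition is_lifting :: "(real \<Rightarrow> real) \<Rightarrow> (real \<Rightarrow> real \<times> real) \<Rightarrow> bool" where
  "is_lifting \<phi> m \<longleftrightarrow> continuous_on UNIV \<phi> \<and> (\<forall>x. m x = (cos (\<phi> x), sin (\<phi> x)))"

text \<open>The winding number is a relation, since the limit need not exist for an arbitrary map. Two
  liftings of the same map differ by a constant, so the value does not depend on the lifting.\<close>

definition has_degree :: "(real \<Rightarrow> real \<times> real) \<Rightarrow> real \<Rightarrow> bool" where
  "has_degree m d \<longleftrightarrow>
     (\<exists>\<phi>. is_lifting \<phi> m \<and> ((\<lambda>x. 1 / (2 * pi) * (\<phi> x - \<phi> (- x))) \<longlongrightarrow> d) at_top)"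

definition admissible :: "real \<Rightarrow> real \<Rightarrow> (real \<Rightarrow> real \<times> real) set" where
  "admissible h d = {m \<in> H1_loc_circle. energy h m < \<infinity> \<and> has_degree m d}"

definition attains_infimum :: "real \<Rightarrow> real \<Rightarrow> bool" where
  "attains_infimum h d \<longleftrightarrow>
     (\<exists>m\<in>admissible h d. energy h m = (INF m'\<in>admissible h d. energy h m'))"

end

theory Submission
  imports Defs
begin

text \<open>
  A minimiser lifts, up to reflections and shifts, to an angle \<open>\<phi>\<close> that runs from \<open>\<plusminus>\<alpha>\<close> to \<open>2\<pi>l + \<alpha>\<close> and is
  minimal among all angles with these limits. Put \<open>f = cos \<phi> - h\<close>. In the nonlocal energy the regions
  \<open>f > 0\<close> and \<open>f < 0\<close> repel each other, while regions of equal sign attract each other. Since \<open>f \<le> 1 - h\<close> is small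
  where it is positive, the negative parts dominate. First, two points with \<open>cos \<phi> \<le> 0\<close> cannot be separated by a
  long interval with \<open>cos \<phi> > 0\<close>: excising a piece of the interval would bring the attracting negative
  parts closer together. Hence the core between the points where \<open>\<phi> = \<pi>\<close> and \<open>\<phi> = 2\<pi>l - \<pi>\<close> has bounded length.
  Second, the positive part of \<open>f\<close> outside of the core has small integral. Third, to the right of the core \<open>\<phi>\<close>
  must cross \<open>2\<pi>l\<close>, so \<open>f\<close> has a positive part there, and it is repelled by the core more strongly than it is
  attracted by the other positive parts; moving it to infinity strictly lowers the energy, which is impossible.
\<close>

text \<open>All steps are comparisons of energies; no Euler-Lagrange equation and no decay of the
  angle at infinity enters. This shapes the proof twice. Interaction integrals of \<open>f\<close>
  may diverge, so they are kept in \<open>ennreal\<close>, attraction and repulsion are separate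
  terms, and subtraction waits until finiteness is known. And a cut of the angle at scale S causes
  an error proportional to the local energy and to the attraction of the outer parts, while the gain
  from excision is only of order 1/S^2. The gain itself absorbs the attraction terms; the local
  energy is driven down by nesting the cuts, each with a factor of order 1/\<sigma>, where S =
  \<sigma>^4. The energy bound N, the Hoelder scale \<tau>, the gap length and the core length
  depend on the degree alone, so h is chosen after them. The positive part outside the core has
  integral at most 62 e / (1 - h), where e is the cost of a transition layer from -\<alpha> to
  \<alpha>. A layer of width W costs O((1 - h) / W + (1 - h)^2 W), which for large W and h close to
  1 is small compared with 1 - h.\<close>

abbreviation L2 :: "(real \<Rightarrow> real) \<Rightarrow> ennreal" where "L2 \<equiv> L2_norm_sq"
abbreviation Hh :: "(real \<Rightarrow> real) \<Rightarrow> ennreal" where "Hh \<equiv> H_half_norm_sq"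
abbreviation nn_lborel :: "(real \<Rightarrow> ennreal) \<Rightarrow> ennreal" (binder "NN " 10) where "nn_lborel F \<equiv> nn_integral lborel F"

lemmas ennreal_real = ennreal_plus[symmetric] ennreal_mult[symmetric]

section \<open>Absolutely continuous functions with square-integrable derivative\<close>

text \<open>A representative of the derivative is carried along as a second argument, so that bounds
  on it can be stated pointwise. Square-integrability is global, as finite energy provides it, and
  yields one Hoelder constant for the whole line.\<close>

definition sob :: "(real \<Rightarrow> real) \<Rightarrow> (real \<Rightarrow> real) \<Rightarrow> bool" where
  "sob \<phi> g \<longleftrightarrow> g \<in> borel_measurable borel \<and> L2 g < \<infinity> \<and>
     (\<forall>a b. a \<le> b \<longrightarrow> \<phi> b - \<phi> a = (LBINT x:{a..b}. g x))"

lemma sobI: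
  assumes "g \<in> borel_measurable borel" "L2 g < \<infinity>"
    "\<And>a b. a \<le> b \<Longrightarrow> \<phi> b - \<phi> a = (LBINT x:{a..b}. g x)"
  shows "sob \<phi> g"
  using assms by (auto simp: sob_def)

section \<open>Elementary L2 estimates and Hoelder continuity\<close>

lemma L2_norm_sq_real: "L2 (f :: real \<Rightarrow> real) = (NN x. ennreal ((f x)^2))"
  by (simp add: L2_norm_sq_def)

lemma L2_norm_sq_mono:
  fixes f g :: "real \<Rightarrow> real"
  assumes "\<And>x. \<bar>f x\<bar> \<le> \<bar>g x\<bar>"
  shows "L2 f \<le> L2 g"
  unfolding L2_norm_sq_def using assms
  by (intro nn_integral_mono ennreal_leI power_mono) auto

lemma L2_norm_sq_mult_const:
  fixes f :: "real \<Rightarrow> real"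
  assumes "f \<in> borel_measurable borel"
  shows "L2 (\<lambda>x. c * f x) = ennreal (c^2) * L2 f"
  unfolding L2_norm_sq_real using assms
  by (subst nn_integral_cmult[symmetric])
     (auto intro!: nn_integral_cong simp: ennreal_mult[symmetric] power_mult_distrib)

lemma square_add_le:
  fixes a b e :: real assumes "e > 0"
  shows "(a + b)^2 \<le> (1 + e) * a^2 + (1 + 1 / e) * b^2"
proof -
  have "0 \<le> (e * a - b)^2 / e" using assms by simp
  also have "\<dots> = e * a^2 - 2 * a * b + b^2 / e"
    using assms by (simp add: power2_eq_square field_simps)
  finally show ?thesis by (simp add: power2_eq_square algebra_simps)
qed

lemma L2_norm_sq_add:
  fixes f g :: "real \<Rightarrow> real"
  assumes [measurable]: "f \<in> borel_measurable borel" "g \<in> borel_measurable borel" and e: "e > 0"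
  shows "L2 (\<lambda>x. f x + g x) \<le> ennreal (1 + e) * L2 f + ennreal (1 + 1 / e) * L2 g"
proof -
  have "L2 (\<lambda>x. f x + g x) \<le> (NN x. ennreal (1 + e) * ennreal ((f x)^2) + ennreal (1 + 1 / e) * ennreal ((g x)^2))"
    unfolding L2_norm_sq_real using square_add_le[OF e] e
    by (intro nn_integral_mono) (auto simp: ennreal_real simp del: ennreal_plus)
  also have "\<dots> = ennreal (1 + e) * L2 f + ennreal (1 + 1 / e) * L2 g"
    unfolding L2_norm_sq_real
    by (subst nn_integral_add) (auto simp: nn_integral_cmult)
  finally show ?thesis .
qed

lemma L2_finite_add:
  fixes f g :: "real \<Rightarrow> real"
  assumes "f \<in> borel_measurable borel" "g \<in> borel_measurable borel"
    "L2 f < \<infinity>" "L2 g < \<infinity>"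
  shows "L2 (\<lambda>x. f x + g x) < \<infinity>"
  using L2_norm_sq_add[of f g 1] assms
  by (auto simp: ennreal_mult_less_top intro: le_less_trans)

lemma L2_set_integrable:
  fixes g :: "real \<Rightarrow> real"
  assumes [measurable]: "g \<in> borel_measurable borel" and fin: "L2 g < \<infinity>"
  shows "set_integrable lborel {a..b} g"
  unfolding set_integrable_def integrable_iff_bounded
proof (intro conjI)
  have "(NN x. ennreal (norm (indicat_real {a..b} x *\<^sub>R g x)))
     \<le> (NN x. indicator {a..b} x + ennreal ((g x)^2))"
  proof (intro nn_integral_mono)
    fix x
    have "\<bar>g x\<bar> \<le> 1 + (g x)^2"
      using zero_le_power2[of "\<bar>g x\<bar> - 1/2"] by (simp add: power2_eq_square algebra_simps)
    then show "ennreal (norm (indicat_real {a..b} x *\<^sub>R g x)) \<le> indicator {a..b} x + ennreal ((g x)^2)"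
      by (auto simp: indicator_def ennreal_plus[symmetric] ennreal_1[symmetric] simp del: ennreal_plus ennreal_1)
  qed
  also have "\<dots> = emeasure lborel {a..b} + L2 g"
    by (subst nn_integral_add) (auto simp: L2_norm_sq_real)
  also have "\<dots> < \<infinity>" using fin by (simp add: emeasure_lborel_Icc_eq)
  finally show "(NN x. ennreal (norm (indicat_real {a..b} x *\<^sub>R g x))) < \<infinity>" .
qed simp

lemma sob_meas[measurable_dest]: "sob \<phi> g \<Longrightarrow> g \<in> borel_measurable borel"
  and sob_L2: "sob \<phi> g \<Longrightarrow> L2 g < \<infinity>"
  and sob_eq: "sob \<phi> g \<Longrightarrow> a \<le> b \<Longrightarrow> \<phi> b - \<phi> a = (LBINT x:{a..b}. g x)"
  and sob_int: "sob \<phi> g \<Longrightarrow> set_integrable lborel {a..b} g"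
  using L2_set_integrable[of g a b] by (auto simp: sob_def)

lemma sob_holder_local:
  assumes s: "sob \<phi> g" and ab: "a \<le> b"
  shows "ennreal ((\<phi> b - \<phi> a)^2) \<le> ennreal (b - a) * (\<integral>\<^sup>+x\<in>{a..b}. ennreal ((g x)^2) \<partial>lborel)"
proof (cases "a = b")
  case False
  then have ab: "a < b" using ab by simp
  note [measurable] = sob_meas[OF s]
  define I where "I = \<phi> b - \<phi> a"
  define m where "m = I / (b - a)"
  have I: "I = (LBINT x:{a..b}. g x)" unfolding I_def using sob_eq[OF s] ab by simp
  have g2: "set_integrable lborel {a..b} (\<lambda>x. (g x)^2)"
    unfolding set_integrable_def integrable_iff_bounded
  proof (intro conjI)
    have "(NN x. ennreal (norm (indicat_real {a..b} x *\<^sub>R (g x)^2))) \<le> L2 g"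
      unfolding L2_norm_sq_real by (intro nn_integral_mono) (auto simp: indicator_def)
    then show "(NN x. ennreal (norm (indicat_real {a..b} x *\<^sub>R (g x)^2))) < \<infinity>"
      using sob_L2[OF s] by (auto intro: le_less_trans)
  qed simp
  have c: "set_integrable lborel {a..b} (\<lambda>x. m^2)" "(LBINT x:{a..b}. m^2) = m^2 * (b - a)"
    using ab by (auto simp: set_integrable_def set_lebesgue_integral_def)
  have gi: "set_integrable lborel {a..b} (\<lambda>x. 2 * m * g x)" using sob_int[OF s] by simp
  \<comment> \<open>The variance of \<open>g\<close> about its mean \<open>m\<close> is nonnegative,
    which is Cauchy-Schwarz on the interval.\<close>
  have "0 \<le> (LBINT x:{a..b}. (g x)^2 + m^2 - 2 * m * g x)"
    unfolding set_lebesgue_integral_def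
  proof (intro Bochner_Integration.integral_nonneg)
    fix x
    have "(g x)^2 + m^2 - 2 * m * g x = (g x - m)^2" by (simp add: power2_eq_square algebra_simps)
    then show "0 \<le> indicat_real {a..b} x *\<^sub>R ((g x)^2 + m^2 - 2 * m * g x)" by simp
  qed
  also have "\<dots> = (LBINT x:{a..b}. (g x)^2) + m^2 * (b - a) - 2 * m * I"
    using g2 c gi by (simp add: set_integral_add set_integral_diff I)
  finally have "m * I \<le> (LBINT x:{a..b}. (g x)^2)"
    using ab by (simp add: m_def power2_eq_square)
  then have "I^2 \<le> (b - a) * (LBINT x:{a..b}. (g x)^2)"
    using ab by (simp add: m_def power2_eq_square field_simps)
  moreover have "ennreal (LBINT x:{a..b}. (g x)^2) = (\<integral>\<^sup>+x\<in>{a..b}. ennreal ((g x)^2) \<partial>lborel)"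
    unfolding set_lebesgue_integral_def
    using g2 by (subst nn_integral_eq_integral[symmetric])
      (auto simp: set_integrable_def indicator_def intro!: nn_integral_cong)
  ultimately show ?thesis
    using ab unfolding I_def[symmetric] by (metis ennreal_leI ennreal_mult' diff_ge_0_iff_ge less_imp_le)
qed simp

lemma sob_holder:
  assumes s: "sob \<phi> g" and K: "L2 g \<le> ennreal K" "K \<ge> 0"
  shows "(\<phi> y - \<phi> x)^2 \<le> K * \<bar>y - x\<bar>"
proof -
  have *: "(\<phi> b - \<phi> a)^2 \<le> K * (b - a)" if "a \<le> b" for a b
  proof -
    have "ennreal ((\<phi> b - \<phi> a)^2) \<le> ennreal (b - a) * (\<integral>\<^sup>+x\<in>{a..b}. ennreal ((g x)^2) \<partial>lborel)"
      by (rule sob_holder_local[OF s that])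
    also have "\<dots> \<le> ennreal (b - a) * ennreal K"
    proof (intro mult_left_mono order_trans[OF _ K(1)])
      show "(\<integral>\<^sup>+x\<in>{a..b}. ennreal ((g x)^2) \<partial>lborel) \<le> L2 g"
        unfolding L2_norm_sq_real by (intro nn_integral_mono) (auto simp: indicator_def)
    qed simp
    finally show ?thesis using that K(2) by (simp add: ennreal_mult[symmetric] mult.commute)
  qed
  show ?thesis using *[of x y] *[of y x] by (cases "x \<le> y") (auto simp: power2_commute)
qed

lemma sob_continuous: assumes s: "sob \<phi> g" shows "continuous_on UNIV \<phi>"
proof -
  obtain K where K: "L2 g = ennreal K" "K \<ge> 0"
    using sob_L2[OF s] by (cases "L2 g") auto
  have "isCont \<phi> x" for x
    unfolding isCont_def
  proof (rule Lim_null[THEN iffD2])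
    have "((\<lambda>y. sqrt (K * \<bar>y - x\<bar>)) \<longlongrightarrow> sqrt (K * \<bar>x - x\<bar>)) (at x)"
      by (intro tendsto_intros)
    then have 0: "((\<lambda>y. sqrt (K * \<bar>y - x\<bar>)) \<longlongrightarrow> 0) (at x)" by simp
    show "((\<lambda>y. \<phi> y - \<phi> x) \<longlongrightarrow> 0) (at x)"
    proof (rule Lim_null_comparison[OF _ 0], intro always_eventually allI)
      fix y show "norm (\<phi> y - \<phi> x) \<le> sqrt (K * \<bar>y - x\<bar>)"
        using sob_holder[OF s, of K y x] K by (simp add: real_le_rsqrt)
    qed
  qed
  then show ?thesis by (simp add: continuous_at_imp_continuous_on)
qed

lemma sob_cont_at: "sob \<phi> g \<Longrightarrow> isCont \<phi> x"
  using sob_continuous continuous_on_eq_continuous_at by blast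

lemma sob_borel[measurable_dest]: "sob \<phi> g \<Longrightarrow> \<phi> \<in> borel_measurable borel"
  by (rule borel_measurable_continuous_onI) (rule sob_continuous)

lemma set_integral_abs_bound:
  fixes f g :: "real \<Rightarrow> real"
  assumes "set_integrable lborel A f" "set_integrable lborel A g" "\<And>x. x \<in> A \<Longrightarrow> \<bar>f x\<bar> \<le> g x"
  shows "\<bar>LBINT x:A. f x\<bar> \<le> (LBINT x:A. g x)"
  unfolding set_lebesgue_integral_def real_norm_def[symmetric]
  by (rule Bochner_Integration.integral_norm_bound_integral)
     (use assms in \<open>auto simp: set_integrable_def indicator_def\<close>)

lemma lborel_set_integral_combine:
  fixes f :: "real \<Rightarrow> real"
  assumes "a \<le> b" "b \<le> c" "set_integrable lborel {a..c} f"
  shows "(LBINT x:{a..c}. f x) = (LBINT x:{a..b}. f x) + (LBINT x:{b..c}. f x)"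
proof -
  have i: "set_integrable lborel {a..b} f" "set_integrable lborel {b..c} f"
    using assms by (auto intro: set_integrable_subset[OF assms(3)])
  have "(LBINT x:{a..b} \<union> {b..c}. f x) = (LBINT x:{a..b}. f x) + (LBINT x:{b..c}. f x)"
  proof (rule set_integral_Un_AE)
    have "AE x in lborel. x \<noteq> b"
      by (rule AE_lborel_singleton)
    then show "AE x in lborel. \<not> (x \<in> {a..b} \<and> x \<in> {b..c})"
      by eventually_elim auto
  qed (use i in auto)
  then show ?thesis using assms by (simp add: ivl_disj_un_two_touch)
qed

lemma L2_mult_bounded:
  fixes g u :: "real \<Rightarrow> real"
  assumes [measurable]: "g \<in> borel_measurable borel" and "L2 g < \<infinity>" "\<And>x. \<bar>u x\<bar> \<le> B"
  shows "L2 (\<lambda>x. u x * g x) < \<infinity>"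
proof -
  have "L2 (\<lambda>x. u x * g x) \<le> L2 (\<lambda>x. B * g x)"
    using assms(3) by (intro L2_norm_sq_mono) (simp add: abs_mult mult_mono order_trans[OF _ abs_ge_self])
  also have "\<dots> < \<infinity>" using assms by (simp add: L2_norm_sq_mult_const ennreal_mult_less_top)
  finally show ?thesis .
qed

text \<open>A bound \<open>\<bar>T (\<phi> b) - T (\<phi> a) - \<integral> T'(\<phi>) g\<bar> \<le> \<epsilon> \<integral> \<bar>g\<bar>\<close> is additive in the interval, so it only has
  to be checked on short intervals, where \<open>T' \<circ> \<phi>\<close> is almost constant.\<close>

lemma sob_compose:
  assumes s: "sob \<phi> g"
    and T: "\<And>x. (T has_real_derivative T' (\<phi> x)) (at (\<phi> x))"
    and T'c: "continuous_on UNIV (\<lambda>x. T' (\<phi> x))" and B: "\<And>x. \<bar>T' (\<phi> x)\<bar> \<le> B"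
  shows "sob (\<lambda>x. T (\<phi> x)) (\<lambda>x. T' (\<phi> x) * g x)"
proof (rule sobI)
  note [measurable] = sob_meas[OF s]
  have [measurable]: "(\<lambda>x. T' (\<phi> x)) \<in> borel_measurable borel"
    by (rule borel_measurable_continuous_onI[OF T'c])
  show m: "(\<lambda>x. T' (\<phi> x) * g x) \<in> borel_measurable borel" by measurable
  show L: "L2 (\<lambda>x. T' (\<phi> x) * g x) < \<infinity>"
    by (rule L2_mult_bounded[OF sob_meas[OF s] sob_L2[OF s] B])
  have int: "set_integrable lborel {a..b} (\<lambda>x. T' (\<phi> x) * g x)" for a b
    by (rule L2_set_integrable[OF m L])
  have gabs: "set_integrable lborel {a..b} (\<lambda>x. \<bar>g x\<bar>)" for a b
    using sob_int[OF s] by (rule set_integrable_abs)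
  fix a b :: real assume ab: "a \<le> b"
  define \<Delta> where "\<Delta> a b = T (\<phi> b) - T (\<phi> a) - (LBINT x:{a..b}. T' (\<phi> x) * g x)" for a b
  have main: "\<bar>\<Delta> a b\<bar> \<le> e * (LBINT x:{a..b}. \<bar>g x\<bar>)" if e: "e > 0" for e
    using ab
  proof (induction a b rule: Bolzano)
    case (trans a b c)
    have "\<Delta> a c = \<Delta> a b + \<Delta> b c"
      using lborel_set_integral_combine[OF trans(3,4) int] by (simp add: \<Delta>_def)
    moreover have "(LBINT x:{a..c}. \<bar>g x\<bar>) = (LBINT x:{a..b}. \<bar>g x\<bar>) + (LBINT x:{b..c}. \<bar>g x\<bar>)"
      by (rule lborel_set_integral_combine[OF trans(3,4) gabs])
    ultimately show ?case using trans(1,2) by (simp add: algebra_simps)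
  next
    case (local x)
    have "isCont (\<lambda>x. T' (\<phi> x)) x" using T'c continuous_on_eq_continuous_at by blast
    then obtain d where d: "d > 0" "\<And>y. \<bar>y - x\<bar> < d \<Longrightarrow> \<bar>T' (\<phi> y) - T' (\<phi> x)\<bar> < e / 2"
      unfolding continuous_at_eps_delta dist_real_def using e by (metis half_gt_zero)
    have "\<bar>\<Delta> u v\<bar> \<le> e * (LBINT x:{u..v}. \<bar>g x\<bar>)" if uv: "u \<le> x" "x \<le> v" "v - u < d" for u v
    proof -
      have "\<exists>y\<in>{u..v}. T (\<phi> v) - T (\<phi> u) = T' (\<phi> y) * (\<phi> v - \<phi> u)"
      proof -
        \<comment> \<open>\<open>T\<close> is known to be differentiable on the range of \<phi>
          only, so the values between the end values have to be attained by \<phi> before the mean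
          value theorem applies.\<close>
        have rng: "\<exists>y\<in>{u..v}. \<phi> y = z" if "min (\<phi> u) (\<phi> v) \<le> z" "z \<le> max (\<phi> u) (\<phi> v)" for z
          using that IVT'[of \<phi> u z v] IVT2'[of \<phi> v z u] uv
            continuous_on_subset[OF sob_continuous[OF s], of "{u..v}"]
          by (cases "\<phi> u \<le> \<phi> v") (auto simp: min_def max_def)
        have der: "(T has_real_derivative T' z) (at z)" if "min (\<phi> u) (\<phi> v) \<le> z" "z \<le> max (\<phi> u) (\<phi> v)" for z
          using rng[OF that] T by auto
        consider "\<phi> u = \<phi> v" | "\<phi> u < \<phi> v" | "\<phi> v < \<phi> u" by linarith
        then show ?thesis
        proof cases
          case 1 then show ?thesis using uv by (auto intro!: bexI[of _ u])
        next
          case 2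
          obtain z where "z > \<phi> u" "z < \<phi> v" "T (\<phi> v) - T (\<phi> u) = (\<phi> v - \<phi> u) * T' z"
            using MVT2[OF 2, of T T'] der 2 by auto
          then show ?thesis using rng[of z] by (auto simp: mult.commute)
        next
          case 3
          obtain z where "z > \<phi> v" "z < \<phi> u" "T (\<phi> u) - T (\<phi> v) = (\<phi> u - \<phi> v) * T' z"
            using MVT2[OF 3, of T T'] der 3 by auto
          then show ?thesis using rng[of z] by (auto simp: algebra_simps intro!: bexI)
        qed
      qed
      then obtain y where y: "y \<in> {u..v}" "T (\<phi> v) - T (\<phi> u) = T' (\<phi> y) * (\<phi> v - \<phi> u)" by blast
      have "\<Delta> u v = (LBINT t:{u..v}. (T' (\<phi> y) - T' (\<phi> t)) * g t)"
        unfolding \<Delta>_def y(2) using sob_eq[OF s, of u v] uv int[of u v] sob_int[OF s, of u v]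
        by (simp add: left_diff_distrib set_integral_diff)
      also have "\<bar>\<dots>\<bar> \<le> (LBINT t:{u..v}. e * \<bar>g t\<bar>)"
      proof (rule set_integral_abs_bound)
        show "set_integrable lborel {u..v} (\<lambda>t. (T' (\<phi> y) - T' (\<phi> t)) * g t)"
          using int[of u v] sob_int[OF s, of u v] by (simp add: left_diff_distrib set_integral_diff)
        show "set_integrable lborel {u..v} (\<lambda>t. e * \<bar>g t\<bar>)" using gabs by simp
        fix t assume t: "t \<in> {u..v}"
        have "\<bar>T' (\<phi> y) - T' (\<phi> x)\<bar> < e/2" "\<bar>T' (\<phi> t) - T' (\<phi> x)\<bar> < e/2"
          using d(2)[of y] d(2)[of t] y(1) t uv by auto
        then have "\<bar>T' (\<phi> y) - T' (\<phi> t)\<bar> \<le> e" by linarith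
        then show "\<bar>(T' (\<phi> y) - T' (\<phi> t)) * g t\<bar> \<le> e * \<bar>g t\<bar>"
          by (simp add: abs_mult mult_right_mono)
      qed
      finally show ?thesis by simp
    qed
    then show ?case using d(1) by blast
  qed
  have "\<bar>\<Delta> a b\<bar> \<le> 0"
  proof (rule field_le_epsilon)
    fix e :: real assume e: "e > 0"
    define G where "G = (LBINT x:{a..b}. \<bar>g x\<bar>)"
    have G: "G \<ge> 0" unfolding G_def set_lebesgue_integral_def by (intro Bochner_Integration.integral_nonneg) auto
    have "\<bar>\<Delta> a b\<bar> \<le> (e / (G + 1)) * G" using main[of "e / (G+1)"] e G by (simp add: G_def)
    also have "\<dots> \<le> e" using e G by (simp add: field_simps)
    finally show "\<bar>\<Delta> a b\<bar> \<le> 0 + e" by simp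
  qed
  then show "T (\<phi> b) - T (\<phi> a) = (LBINT x:{a..b}. T' (\<phi> x) * g x)" by (simp add: \<Delta>_def)
qed

text \<open>Nonsmooth outer functions such as \<open>abs\<close> and \<open>arccos\<close> are
  reached by regularising them: the regularised derivatives share the bound \<open>G\<close>, and
  dominated convergence passes to the limit in the integral identity.\<close>

lemma sob_limit:
  fixes G :: "real \<Rightarrow> real"
  assumes s: "\<And>i::nat. sob (u i) (g i)"
    and u: "\<And>x. (\<lambda>i. u i x) \<longlonglongrightarrow> \<phi> x" and g: "\<And>x. (\<lambda>i. g i x) \<longlonglongrightarrow> \<gamma> x"
    and G: "G \<in> borel_measurable borel" "L2 G < \<infinity>" "\<And>i x. \<bar>g i x\<bar> \<le> \<bar>G x\<bar>"
  shows "sob \<phi> \<gamma>"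
proof (rule sobI)
  note [measurable] = sob_meas[OF s] G(1)
  show [measurable]: "\<gamma> \<in> borel_measurable borel"
    by (rule borel_measurable_LIMSEQ_real[OF g]) simp
  have \<gamma>G: "\<bar>\<gamma> x\<bar> \<le> \<bar>G x\<bar>" for x
    using G(3) by (intro tendsto_upperbound[OF tendsto_rabs[OF g[of x]]]) auto
  show "L2 \<gamma> < \<infinity>"
    using L2_norm_sq_mono[of \<gamma> G] \<gamma>G G(2) by (auto intro: le_less_trans)
  fix a b :: real assume ab: "a \<le> b"
  have "(\<lambda>i. LBINT x:{a..b}. g i x) \<longlonglongrightarrow> (LBINT x:{a..b}. \<gamma> x)"
    unfolding set_lebesgue_integral_def
  proof (rule integral_dominated_convergence[where w="\<lambda>x. indicator {a..b} x * \<bar>G x\<bar>"])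
    show "integrable lborel (\<lambda>x. indicat_real {a..b} x * \<bar>G x\<bar>)"
      using set_integrable_abs[OF L2_set_integrable[OF G(1,2), of a b]] by (simp add: set_integrable_def)
    show "AE x in lborel. (\<lambda>i. indicat_real {a..b} x *\<^sub>R g i x) \<longlonglongrightarrow> indicat_real {a..b} x *\<^sub>R \<gamma> x"
      using g by (auto intro!: tendsto_intros)
  qed (use G(3) in \<open>auto simp: indicator_def\<close>)
  moreover have "(\<lambda>i. u i b - u i a) \<longlonglongrightarrow> \<phi> b - \<phi> a" by (intro tendsto_intros u)
  ultimately show "\<phi> b - \<phi> a = (LBINT x:{a..b}. \<gamma> x)"
    using sob_eq[OF s ab] LIMSEQ_unique by fastforce
qed

section \<open>Calculus of absolutely continuous functions: algebra, gluing, lattice operations,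
  trigonometric functions\<close>

lemma sob_const: "sob (\<lambda>x. c) (\<lambda>x. 0)"
  by (rule sobI) (auto simp: L2_norm_sq_def)

lemma sob_add: assumes "sob u g" "sob v k" shows "sob (\<lambda>x. u x + v x) (\<lambda>x. g x + k x)"
proof (rule sobI)
  note [measurable] = sob_meas[OF assms(1)] sob_meas[OF assms(2)]
  show "(\<lambda>x. g x + k x) \<in> borel_measurable borel" by simp
  show "L2 (\<lambda>x. g x + k x) < \<infinity>"
    using L2_finite_add[of g k] sob_L2[OF assms(1)] sob_L2[OF assms(2)] by simp
  fix a b :: real assume "a \<le> b"
  then show "u b + v b - (u a + v a) = (LBINT x:{a..b}. g x + k x)"
    using sob_eq[OF assms(1), of a b] sob_eq[OF assms(2), of a b]
    by (simp add: set_integral_add[OF sob_int[OF assms(1)] sob_int[OF assms(2)]])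
qed

lemma sob_cmult: assumes "sob u g" shows "sob (\<lambda>x. c * u x) (\<lambda>x. c * g x)"
proof (rule sobI)
  note [measurable] = sob_meas[OF assms(1)]
  show "(\<lambda>x. c * g x) \<in> borel_measurable borel" by simp
  show "L2 (\<lambda>x. c * g x) < \<infinity>"
    using sob_L2[OF assms(1)] by (simp add: L2_norm_sq_mult_const ennreal_mult_less_top)
  fix a b :: real assume "a \<le> b"
  then show "c * u b - c * u a = (LBINT x:{a..b}. c * g x)"
    using sob_eq[OF assms(1), of a b] by (simp add: right_diff_distrib[symmetric])
qed

lemma sob_minus: "sob u g \<Longrightarrow> sob (\<lambda>x. - u x) (\<lambda>x. - g x)"
  using sob_cmult[of u g "-1"] by simp

lemma sob_diff: "sob u g \<Longrightarrow> sob v k \<Longrightarrow> sob (\<lambda>x. u x - v x) (\<lambda>x. g x - k x)"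
  using sob_add[OF _ sob_minus, of u g v k] by simp

lemma sob_shift_const: "sob u g \<Longrightarrow> sob (\<lambda>x. c + u x) g"
  using sob_add[OF sob_const, of u g c] by simp

text \<open>Polarisation reduces the product rule to the chain rule for squares; bounded factors
  keep the derivative of a square in L2.\<close>

lemma sob_mult:
  assumes u: "sob u g" and v: "sob v k" and B: "\<And>x. \<bar>u x\<bar> \<le> B" "\<And>x. \<bar>v x\<bar> \<le> C"
  shows "sob (\<lambda>x. u x * v x) (\<lambda>x. u x * k x + v x * g x)"
proof -
  have sq: "sob (\<lambda>x. (w x)^2) (\<lambda>x. (2 * w x) * l x)" if w: "sob w l" and b: "\<And>x. \<bar>w x\<bar> \<le> D" for w l D
  proof (rule sob_compose[OF w, where T = "\<lambda>x. x^2" and T' = "\<lambda>x. 2 * x" and B = "2 * D"])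
    show "continuous_on UNIV (\<lambda>x. 2 * w x)" by (intro continuous_intros sob_continuous[OF w])
  qed (use b in \<open>auto intro!: derivative_eq_intros simp: abs_mult\<close>)
  have p: "\<bar>u x + v x\<bar> \<le> B + C" "\<bar>u x - v x\<bar> \<le> B + C" for x using B(1,2)[of x] by linarith+
  have "sob (\<lambda>x. 1/4 * ((u x + v x)^2 - (u x - v x)^2))
     (\<lambda>x. 1/4 * ((2 * (u x + v x)) * (g x + k x) - (2 * (u x - v x)) * (g x - k x)))"
    by (intro sob_cmult sob_diff sq[OF sob_add[OF u v] p(1)] sq[OF sob_diff[OF u v] p(2)])
  moreover have "(\<lambda>x. 1/4 * ((u x + v x)^2 - (u x - v x)^2)) = (\<lambda>x. u x * v x)"
    by (simp add: power2_eq_square algebra_simps fun_eq_iff)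
  moreover have "(\<lambda>x. 1/4 * ((2 * (u x + v x)) * (g x + k x) - (2 * (u x - v x)) * (g x - k x))) = (\<lambda>x. u x * k x + v x * g x)"
    by (simp add: field_simps fun_eq_iff)
  ultimately show ?thesis by simp
qed

lemma sob_join:
  assumes u: "sob u g" and v: "sob v k" and p: "u p = v p"
  shows "sob (\<lambda>x. if x \<le> p then u x else v x) (\<lambda>x. if x \<le> p then g x else k x)"
proof (rule sobI)
  let ?w = "\<lambda>x. if x \<le> p then u x else v x"
  let ?l = "\<lambda>x. if x \<le> p then g x else k x"
  note [measurable] = sob_meas[OF u] sob_meas[OF v]
  show m: "?l \<in> borel_measurable borel" by simp
  have "L2 ?l \<le> (NN x. ennreal ((g x)^2) + ennreal ((k x)^2))"
    unfolding L2_norm_sq_real by (intro nn_integral_mono) auto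
  also have "\<dots> = L2 g + L2 k"
    unfolding L2_norm_sq_real by (subst nn_integral_add) auto
  also have "\<dots> < \<infinity>" using sob_L2[OF u] sob_L2[OF v] by simp
  finally show L: "L2 ?l < \<infinity>" .
  have l: "?w b - ?w a = (LBINT x:{a..b}. ?l x)" if "a \<le> b" "b \<le> p" for a b
  proof -
    have "(LBINT x:{a..b}. ?l x) = (LBINT x:{a..b}. g x)"
      by (rule set_lebesgue_integral_cong) (use that in auto)
    then show ?thesis using that sob_eq[OF u, of a b] by simp
  qed
  have r: "?w b - ?w a = (LBINT x:{a..b}. ?l x)" if "a \<le> b" "p \<le> a" for a b
  proof -
    have "(LBINT x:{a..b}. ?l x) = (LBINT x:{a..b}. k x)"
    proof (rule set_lebesgue_integral_cong_AE)
      have "AE x in lborel. x \<noteq> p" by (rule AE_lborel_singleton)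
      then show "AE x\<in>{a..b} in lborel. ?l x = k x" by eventually_elim (use that in auto)
    qed (use m in auto)
    then show ?thesis using that sob_eq[OF v, of a b] p by (cases "a = b"; cases "a = p") auto
  qed
  fix a b :: real assume ab: "a \<le> b"
  consider "b \<le> p" | "p \<le> a" | "a \<le> p" "p \<le> b" by linarith
  then show "?w b - ?w a = (LBINT x:{a..b}. ?l x)"
  proof cases
    case 3
    show ?thesis
      using l[of a p] r[of p b] 3 lborel_set_integral_combine[OF 3 L2_set_integrable[OF m L]] by auto
  qed (use l r ab in auto)
qed

lemma sob_affine:
  assumes u: "sob u g" and \<sigma>: "\<sigma> = 1 \<or> \<sigma> = - 1"
  shows "sob (\<lambda>x. u (c + \<sigma> * x)) (\<lambda>x. \<sigma> * g (c + \<sigma> * x))"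
proof (rule sobI)
  note [measurable] = sob_meas[OF u]
  have \<sigma>2: "\<sigma> \<noteq> 0" "\<sigma>^2 = 1" "\<bar>\<sigma>\<bar> = 1" using \<sigma> by auto
  show "(\<lambda>x. \<sigma> * g (c + \<sigma> * x)) \<in> borel_measurable borel" by measurable
  have "L2 (\<lambda>x. \<sigma> * g (c + \<sigma> * x)) = L2 g"
    unfolding L2_norm_sq_real
    by (subst (2) nn_integral_real_affine[OF _ \<sigma>2(1), of _ c]) (auto simp: \<sigma>2 power_mult_distrib)
  then show "L2 (\<lambda>x. \<sigma> * g (c + \<sigma> * x)) < \<infinity>" using sob_L2[OF u] by simp
  have sub: "(LBINT x:{p..q}. g x) = (LBINT x:{x. c + \<sigma> * x \<in> {p..q}}. g (c + \<sigma> * x))" for p q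
    unfolding set_lebesgue_integral_def
    by (subst lborel_integral_real_affine[OF \<sigma>2(1), of _ c]) (simp add: \<sigma>2 indicator_def)
  fix a b :: real assume ab: "a \<le> b"
  show "u (c + \<sigma> * b) - u (c + \<sigma> * a) = (LBINT x:{a..b}. \<sigma> * g (c + \<sigma> * x))"
    using \<sigma>
  proof
    assume "\<sigma> = 1"
    moreover have "{x. c + x \<in> {c+a..c+b}} = {a..b}" by auto
    ultimately show ?thesis using sob_eq[OF u, of "c+a" "c+b"] sub[of "c+a" "c+b"] ab by simp
  next
    assume "\<sigma> = -1"
    moreover have "{x. c - x \<in> {c-b..c-a}} = {a..b}" by auto
    ultimately show ?thesis using sob_eq[OF u, of "c-b" "c-a"] sub[of "c-b" "c-a"] ab
      by (simp add: set_lebesgue_integral_def)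
  qed
qed

text \<open>|x| is regularised to sqrt (x^2 + 1/(i+1)), whose derivative is bounded by 1 and
  vanishes at 0. Hence the value \<open>sgn 0 = 0\<close> at the zeros of \<open>u\<close>, and
  later the average of the two derivatives of a maximum or minimum at ties.\<close>

lemma sob_abs: assumes u: "sob u g" shows "sob (\<lambda>x. \<bar>u x\<bar>) (\<lambda>x. sgn (u x) * g x)"
proof (rule sob_limit[where G = g])
  let ?e = "\<lambda>i::nat. inverse (real (Suc i))"
  let ?T = "\<lambda>i x. sqrt (x^2 + ?e i)"
  have pos: "x^2 + ?e i > 0" for x :: real and i by (intro add_nonneg_pos) auto
  have b1: "\<bar>x / ?T i x\<bar> \<le> 1" for x :: real and i
  proof -
    have "\<bar>x\<bar> = sqrt (x^2)" by simp
    also have "\<dots> \<le> ?T i x" by (intro real_sqrt_le_mono) simp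
    finally show ?thesis using pos[of x i] by (simp add: divide_simps)
  qed
  show "sob (\<lambda>x. ?T i (u x)) (\<lambda>x. u x / ?T i (u x) * g x)" for i
  proof (rule sob_compose[OF u, where T = "?T i" and T' = "\<lambda>x. x / ?T i x" and B = 1])
    show "(?T i has_real_derivative u x / ?T i (u x)) (at (u x))" for x
      using pos[of "u x" i] by (auto intro!: derivative_eq_intros simp: divide_simps)
    show "continuous_on UNIV (\<lambda>x. u x / ?T i (u x))"
      using pos by (intro continuous_intros sob_continuous[OF u]) (metis less_irrefl real_sqrt_eq_0_iff)
  qed (use b1 in auto)
  have e0: "?e \<longlonglongrightarrow> 0" by (rule LIMSEQ_inverse_real_of_nat)
  have T0: "(\<lambda>i. ?T i x) \<longlonglongrightarrow> \<bar>x\<bar>" for x :: real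
  proof -
    have "(\<lambda>i. ?T i x) \<longlonglongrightarrow> sqrt (x^2 + 0)" by (intro tendsto_intros e0)
    then show ?thesis by simp
  qed
  show "(\<lambda>i. ?T i (u x)) \<longlonglongrightarrow> \<bar>u x\<bar>" for x by (rule T0)
  show "(\<lambda>i. u x / ?T i (u x) * g x) \<longlonglongrightarrow> sgn (u x) * g x" for x
  proof (cases "u x = 0")
    case False
    have "(\<lambda>i. u x / ?T i (u x) * g x) \<longlonglongrightarrow> u x / \<bar>u x\<bar> * g x"
      using False by (intro tendsto_intros T0) auto
    then show ?thesis by (simp add: sgn_div_norm divide_inverse mult.commute)
  qed simp
  show "\<bar>u x / ?T i (u x) * g x\<bar> \<le> \<bar>g x\<bar>" for i x
    using mult_right_mono[OF b1[of "u x" i], of "\<bar>g x\<bar>"] by (simp add: abs_mult)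
qed (use sob_meas[OF u] sob_L2[OF u] in auto)

lemma sob_max:
  assumes u: "sob u g" and v: "sob v k"
  shows "sob (\<lambda>x. max (u x) (v x)) (\<lambda>x. (g x + k x + sgn (u x - v x) * (g x - k x)) / 2)"
proof -
  have "sob (\<lambda>x. 1/2 * (u x + v x + \<bar>u x - v x\<bar>)) (\<lambda>x. 1/2 * (g x + k x + sgn (u x - v x) * (g x - k x)))"
    by (intro sob_cmult sob_add u v sob_abs[OF sob_diff[OF u v]])
  moreover have "(\<lambda>x. max (u x) (v x)) = (\<lambda>x. 1/2 * (u x + v x + \<bar>u x - v x\<bar>))" by (auto simp: max_def fun_eq_iff)
  ultimately show ?thesis by simp
qed

lemma sob_min:
  assumes u: "sob u g" and v: "sob v k"
  shows "sob (\<lambda>x. min (u x) (v x)) (\<lambda>x. (g x + k x - sgn (u x - v x) * (g x - k x)) / 2)"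
proof -
  have "sob (\<lambda>x. 1/2 * (u x + v x - \<bar>u x - v x\<bar>)) (\<lambda>x. 1/2 * (g x + k x - sgn (u x - v x) * (g x - k x)))"
    by (intro sob_cmult sob_add sob_diff u v sob_abs[OF sob_diff[OF u v]])
  moreover have "(\<lambda>x. min (u x) (v x)) = (\<lambda>x. 1/2 * (u x + v x - \<bar>u x - v x\<bar>))" by (auto simp: min_def fun_eq_iff)
  ultimately show ?thesis by simp
qed

lemma sob_cos: assumes u: "sob u g" shows "sob (\<lambda>x. cos (u x)) (\<lambda>x. - sin (u x) * g x)"
  by (rule sob_compose[OF u, where T = cos and T' = "\<lambda>x. - sin x" and B = 1])
     (auto intro!: derivative_eq_intros continuous_intros sob_continuous[OF u])

lemma sob_sin: assumes u: "sob u g" shows "sob (\<lambda>x. sin (u x)) (\<lambda>x. cos (u x) * g x)"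
  by (rule sob_compose[OF u, where T = sin and T' = "cos" and B = 1])
     (auto intro!: derivative_eq_intros continuous_intros sob_continuous[OF u])

text \<open>The composition is 1-Lipschitz in the angle, although \<open>arccos\<close> is singular
  at the end points. Damping the cosine by a factor \<open>r i\<close> below 1 avoids the
  singularity, and the derivatives of the damped functions are still bounded by 1.\<close>

lemma sob_arccos_cos:
  assumes u: "sob u g"
  shows "sob (\<lambda>x. arccos (cos (u x))) (\<lambda>x. sgn (sin (u x)) * g x)"
proof (rule sob_limit[where G = g])
  define r where "r i = 1 - inverse (real (Suc (Suc i)))" for i
  have r: "0 < r i" "r i < 1" for i by (auto simp: r_def field_simps)
  have rl: "r \<longlonglongrightarrow> 1"
  proof -
    have "r \<longlonglongrightarrow> 1 - 0"
      unfolding r_def by (intro tendsto_diff tendsto_const LIMSEQ_Suc[OF LIMSEQ_inverse_real_of_nat])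
    then show ?thesis by simp
  qed
  have bd: "\<bar>r i * cos y\<bar> < 1" for i y
  proof -
    have "\<bar>r i * cos y\<bar> \<le> r i * 1" using r[of i] by (simp add: abs_mult mult_left_mono del: mult_1_right)
    then show ?thesis using r[of i] by simp
  qed
  have pos: "0 < 1 - (r i * cos y)^2" for i y
    using bd[of i y] abs_square_less_1[of "r i * cos y"] by simp
  let ?T = "\<lambda>i y. arccos (r i * cos y)"
  let ?T' = "\<lambda>i y. r i * sin y / sqrt (1 - (r i * cos y)^2)"
  have b1: "\<bar>?T' i y\<bar> \<le> 1" for i y
  proof -
    have "(r i * sin y)^2 \<le> 1 - (r i * cos y)^2"
    proof -
      have "(r i * sin y)^2 + (r i * cos y)^2 = (r i)^2 * ((sin y)^2 + (cos y)^2)"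
        by (simp only: power_mult_distrib distrib_left)
      also have "\<dots> \<le> 1" using r[of i] by (simp add: power_le_one)
      finally show ?thesis by simp
    qed
    then have "\<bar>r i * sin y\<bar> \<le> sqrt (1 - (r i * cos y)^2)" by (simp add: real_le_rsqrt)
    then show ?thesis using pos[of i y] by (simp add: divide_simps)
  qed
  show "sob (\<lambda>x. ?T i (u x)) (\<lambda>x. ?T' i (u x) * g x)" for i
  proof (rule sob_compose[OF u, where T = "?T i" and T' = "?T' i" and B = 1])
    show "(?T i has_real_derivative ?T' i (u x)) (at (u x))" for x
      using bd[of i "u x"] pos[of i "u x"]
      by (auto intro!: derivative_eq_intros simp: abs_less_iff divide_simps)
    show "continuous_on UNIV (\<lambda>x. ?T' i (u x))"
      using pos by (intro continuous_intros sob_continuous[OF u]) (metis less_irrefl real_sqrt_eq_0_iff)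
  qed (use b1 in auto)
  show "(\<lambda>i. ?T i (u x)) \<longlonglongrightarrow> arccos (cos (u x))" for x
  proof -
    have "(\<lambda>i. r i * cos (u x)) \<longlonglongrightarrow> 1 * cos (u x)" by (intro tendsto_intros rl)
    then have l: "(\<lambda>i. r i * cos (u x)) \<longlonglongrightarrow> cos (u x)" by simp
    show ?thesis
      by (rule continuous_on_tendsto_compose[OF continuous_on_arccos' l])
         (use bd in \<open>auto intro!: always_eventually simp: abs_less_iff less_imp_le minus_le_iff\<close>)
  qed
  show "(\<lambda>i. ?T' i (u x) * g x) \<longlonglongrightarrow> sgn (sin (u x)) * g x" for x
  proof (cases "sin (u x) = 0")
    case False
    have s2: "1 - (cos (u x))^2 = (sin (u x))^2" by (simp add: sin_squared_eq)
    have "(\<lambda>i. ?T' i (u x) * g x) \<longlonglongrightarrow> (1 * sin (u x) / sqrt (1 - (1 * cos (u x))^2)) * g x"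
      using False by (intro tendsto_intros rl) (auto simp: s2)
    then show ?thesis by (simp add: s2 sgn_div_norm divide_inverse mult.commute)
  qed simp
  show "\<bar>?T' i (u x) * g x\<bar> \<le> \<bar>g x\<bar>" for i x
    using mult_right_mono[OF b1[of i "u x"], of "\<bar>g x\<bar>"] by (simp add: abs_mult)
qed (use sob_meas[OF u] sob_L2[OF u] in auto)

lemma sob_C1:
  assumes d: "\<And>x. (u has_real_derivative g x) (at x)" and c: "continuous_on UNIV g" and L: "L2 g < \<infinity>"
  shows "sob u g"
proof (rule sobI[OF borel_measurable_continuous_onI[OF c] L])
  fix a b :: real assume "a \<le> b"
  then show "u b - u a = (LBINT x:{a..b}. g x)"
    unfolding set_lebesgue_integral_def
    by (intro integral_FTC_atLeastAtMost[symmetric])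
       (auto intro: continuous_on_subset[OF c] has_field_derivative_at_within[OF d]
          simp: has_real_derivative_iff_has_vector_derivative[symmetric])
qed

section \<open>Liftings of admissible maps\<close>

text \<open>On each bounded interval the positive and the negative part of \<open>f\<close> are
  densities of two finite measures that agree on all half-lines, hence are equal.\<close>

lemma AE_zero_of_interval_integrals:
  fixes f :: "real \<Rightarrow> real"
  assumes int: "\<And>a b. set_integrable lborel {a..b} f"
    and zero: "\<And>a b. a \<le> b \<Longrightarrow> (LBINT x:{a..b}. f x) = 0"
  shows "AE x in lborel. f x = 0"
proof -
  have "AE x in lborel. indicator {- real n..real n} x * f x = 0" for n
  proof -
    define u where "u x = indicator {- real n..real n} x * f x" for x
    have ui: "integrable lborel u" using int[of "- real n" "real n"] by (simp add: set_integrable_def u_def[abs_def])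
    note [measurable] = borel_measurable_integrable[OF ui]
    have fin: "(NN x. ennreal (u x * indicator A x)) < \<infinity>" "(NN x. ennreal (- u x * indicator A x)) < \<infinity>" for A
    proof -
      have "(NN x. ennreal (norm (u x))) < \<infinity>" using ui by (simp add: integrable_iff_bounded)
      moreover have "(NN x. ennreal (u x * indicator A x)) \<le> (NN x. ennreal (norm (u x)))"
        "(NN x. ennreal (- u x * indicator A x)) \<le> (NN x. ennreal (norm (u x)))"
        by (intro nn_integral_mono ennreal_leI; auto simp: indicator_def)+
      ultimately show "(NN x. ennreal (u x * indicator A x)) < \<infinity>" "(NN x. ennreal (- u x * indicator A x)) < \<infinity>"
        by (auto intro: le_less_trans)
    qed
    have eq: "(NN x. ennreal (u x * indicator {a<..} x)) = (NN x. ennreal (- u x * indicator {a<..} x))" for a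
    proof -
      have "(\<integral>x. u x * indicator {a<..} x \<partial>lborel) = 0"
      proof (cases "max a (- real n) \<le> real n")
        case True
        have "(\<integral>x. u x * indicator {a<..} x \<partial>lborel) = (LBINT x:{max a (- real n)..real n}. f x)"
          unfolding set_lebesgue_integral_def
        proof (rule integral_cong_AE)
          have "AE x in lborel. x \<noteq> a" by (rule AE_lborel_singleton)
          then show "AE x in lborel. u x * indicator {a<..} x = indicat_real {max a (- real n)..real n} x *\<^sub>R f x"
            by eventually_elim (auto simp: u_def indicator_def)
          show "(\<lambda>x. indicat_real {max a (- real n)..real n} x *\<^sub>R f x) \<in> borel_measurable lborel"
            using int[of "max a (- real n)" "real n"] by (simp add: set_integrable_def borel_measurable_integrable)
        qed simp
        then show ?thesis using zero[OF True] by simp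
      next
        case False
        then have "(\<lambda>x. u x * indicator {a<..} x) = (\<lambda>x. 0)" by (auto simp: u_def indicator_def fun_eq_iff)
        then show ?thesis by simp
      qed
      then have "enn2real (NN x. ennreal (u x * indicator {a<..} x)) = enn2real (NN x. ennreal (- u x * indicator {a<..} x))"
        using integrable_real_mult_indicator[OF _ ui, of "{a<..}"] by (subst (asm) real_lebesgue_integral_def) auto
      then show ?thesis using fin[of "{a<..}"] by (metis ennreal_enn2real infinity_ennreal_def)
    qed
    let ?M = "density lborel (\<lambda>x. ennreal (u x))" and ?N = "density lborel (\<lambda>x. ennreal (- u x))"
    have em: "emeasure ?M {a<..} = (NN x. ennreal (u x * indicator {a<..} x))"
      "emeasure ?N {a<..} = (NN x. ennreal (- u x * indicator {a<..} x))" for a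
      by (auto simp: emeasure_density indicator_def intro!: nn_integral_cong)
    have "?M = ?N"
      by (rule measure_eqI_lessThan) (simp_all only: em eq fin sets_density sets_lborel)
    then have "AE x in lborel. ennreal (u x) = ennreal (- u x)"
      using sigma_finite_measure.density_unique_iff[OF sigma_finite_lborel, of "\<lambda>x. ennreal (u x)" "\<lambda>x. ennreal (- u x)"] by simp
    then show ?thesis
    proof eventually_elim
      case (elim x)
      have "u x = 0"
      proof (rule ccontr)
        assume "u x \<noteq> 0"
        then show False using elim by (cases "u x > 0") (auto simp: ennreal_neg ennreal_eq_0_iff dest!: sym[of _ "ennreal _"])
      qed
      then show ?case by (simp add: u_def)
    qed
  qed
  then have "AE x in lborel. \<forall>n. indicator {- real n..real n} x * f x = 0"
    by (subst AE_all_countable) blast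
  then show ?thesis
  proof eventually_elim
    case (elim x)
    obtain n where "\<bar>x\<bar> \<le> real n" using real_arch_simple by blast
    then show ?case using elim[rule_format, of n] by (simp add: indicator_def abs_le_iff minus_le_iff)
  qed
qed

text \<open>A step of class C1 from 0 to 1 over the unit interval, made of two parabolas that meet
  at 1/2; its derivative is a hat function of integral 1.\<close>

definition bspline :: "real \<Rightarrow> real" where
  "bspline u = 2 * ((max 0 u)^2 - 2 * (max 0 (u - 1/2))^2 + (max 0 (u - 1))^2)"

definition bspline' :: "real \<Rightarrow> real" where
  "bspline' u = 4 * (max 0 u - 2 * max 0 (u - 1/2) + max 0 (u - 1))"

lemma DERIV_max0_sq: "((\<lambda>u. (max 0 u)^2) has_real_derivative 2 * max 0 u) (at (u :: real))"
proof -
  consider "u > 0" | "u < 0" | "u = 0" by linarith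
  then show ?thesis
  proof cases
    case 1
    have "((\<lambda>u. u^2) has_real_derivative 2 * max 0 u) (at u)"
      using 1 by (auto intro!: derivative_eq_intros)
    moreover have "eventually (\<lambda>x. x^2 = (max 0 x)^2) (nhds u)"
      using eventually_nhds_in_open[of "{0<..}" u] 1 by (auto elim!: eventually_mono simp: max_def)
    ultimately show ?thesis by (rule DERIV_cong_ev[OF refl _ refl, THEN iffD1, rotated])
  next
    case 2
    have "((\<lambda>u. 0) has_real_derivative 2 * max 0 u) (at u)"
      using 2 by (auto intro!: derivative_eq_intros)
    moreover have "eventually (\<lambda>x. 0 = (max 0 x)^2) (nhds u)"
      using eventually_nhds_in_open[of "{..<0}" u] 2 by (auto elim!: eventually_mono simp: max_def)
    ultimately show ?thesis by (rule DERIV_cong_ev[OF refl _ refl, THEN iffD1, rotated])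
  next
    case 3
    have "((\<lambda>y. (max 0 y)^2 / y) \<longlongrightarrow> 0) (at (0::real))"
    proof (rule Lim_null_comparison)
      show "\<forall>\<^sub>F y in at (0::real). norm ((max 0 y)^2 / y) \<le> \<bar>y\<bar>"
        by (rule always_eventually) (auto simp: max_def power2_eq_square)
      show "((\<lambda>y. \<bar>y\<bar>) \<longlongrightarrow> 0) (at (0::real))" using tendsto_rabs_zero[OF tendsto_ident_at] by simp
    qed
    then show ?thesis using 3 by (simp add: has_field_derivative_iff)
  qed
qed

lemma bspline_deriv: "(bspline has_real_derivative bspline' u) (at u)"
proof -
  have "((\<lambda>u. (max 0 (u - c))^2) has_real_derivative 2 * max 0 (u - c)) (at u)" for c :: real
  proof -
    have "((\<lambda>u. u - c) has_real_derivative 1) (at u)" by (auto intro!: derivative_eq_intros)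
    from DERIV_chain2[where f = "\<lambda>u. (max 0 u)^2", OF DERIV_max0_sq this] show ?thesis by simp
  qed
  then have "((\<lambda>u. 2 * ((max 0 u)^2 - 2 * (max 0 (u - 1/2))^2 + (max 0 (u - 1))^2)) has_real_derivative
      2 * (2 * max 0 u - 2 * (2 * max 0 (u - 1/2)) + 2 * max 0 (u - 1))) (at u)"
    by (intro DERIV_cmult DERIV_add DERIV_diff DERIV_max0_sq)
  then show ?thesis by (simp add: bspline_def[abs_def] bspline'_def algebra_simps)
qed

lemma bspline'_cont: "continuous_on A bspline'"
  unfolding bspline'_def by (intro continuous_intros)

lemma bspline_cont: "continuous_on A bspline"
  unfolding bspline_def by (intro continuous_intros)

lemma bspline_vals: "u \<le> 0 \<Longrightarrow> bspline u = 0" "u \<ge> 1 \<Longrightarrow> bspline u = 1"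
  "u \<le> 0 \<Longrightarrow> bspline' u = 0" "u \<ge> 1 \<Longrightarrow> bspline' u = 0"
  by (auto simp: bspline_def bspline'_def max_def power2_eq_square algebra_simps)

lemma bspline_range: "0 \<le> bspline u" "bspline u \<le> 1"
proof -
  consider "u \<le> 0" | "u \<ge> 1" | "0 \<le> u" "u \<le> 1/2" | "1/2 \<le> u" "u \<le> 1" by linarith
  then have "0 \<le> bspline u \<and> bspline u \<le> 1"
  proof cases
    case 3
    have e: "bspline u = 2 * u^2" using 3 by (auto simp: bspline_def max_def)
    show ?thesis unfolding e using 3 power_mono[OF 3(2,1), of 2] by (auto simp: power2_eq_square)
  next
    case 4
    have e: "bspline u = 1 - 2 * (1 - u)^2"
      using 4 by (auto simp: bspline_def max_def power2_eq_square algebra_simps)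
    have "(1-u)^2 \<le> (1/2)^2" using 4 by (intro power_mono) auto
    then show ?thesis unfolding e by (auto simp: power2_eq_square)
  qed (auto simp: bspline_vals)
  then show "0 \<le> bspline u" "bspline u \<le> 1" by auto
qed

text \<open>The fundamental lemma of the calculus of variations: the test functions are smoothed
  indicator functions of the interval.\<close>

lemma has_weak_derivative_FTC:
  fixes f :: "real \<Rightarrow> 'a::{banach, second_countable_topology}"
  assumes w: "has_weak_derivative f g" and fc: "continuous_on UNIV f" and xy: "x \<le> y"
  shows "f y - f x = (LBINT t:{x..y}. g t)"
proof -
  have g: "set_integrable lborel {a..b} g" for a b
    using w by (auto simp: has_weak_derivative_def locally_integrable_def)
  let ?k = "\<lambda>i. real (Suc i)"
  \<comment> \<open>The test function rises on [x, x + 1/k] and falls on [y, y + 1/k]: it tends to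
    the indicator of \<open>{x<..y}\<close>, and its derivative is a difference of two approximate
    identities, concentrating at x and at y.\<close>
  define \<psi> where "\<psi> i t = bspline (?k i * (t - x)) - bspline (?k i * (t - y))" for i t
  have k1: "?k i \<ge> 1" for i by simp
  have kd: "((\<lambda>t. bspline (?k i * (t - z))) has_real_derivative ?k i * bspline' (?k i * (t - z))) (at t)" for i z t
  proof -
    have "((\<lambda>t. ?k i * (t - z)) has_real_derivative ?k i) (at t)" by (auto intro!: derivative_eq_intros)
    from DERIV_chain2[where f = bspline, OF bspline_deriv this] show ?thesis by (simp add: mult.commute)
  qed
  have d\<psi>: "(\<psi> i has_real_derivative ?k i * bspline' (?k i * (t - x)) - ?k i * bspline' (?k i * (t - y))) (at t)" for i t
    unfolding \<psi>_def[abs_def] by (intro DERIV_diff kd)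
  have big: "?k i * (t - z) \<ge> 1" if "t \<ge> z + 1" for i t z
    using mult_mono[of 1 "?k i" 1 "t - z"] that by simp
  have small: "?k i * (t - z) \<le> 0" if "t \<le> z" for i t z
    using that by (simp add: mult_nonneg_nonpos)
  have \<psi>0: "\<psi> i t = 0" if "t \<notin> {x..y+1}" for i t
    using that xy big[of x t i] big[of y t i] small[of t x i] small[of t y i]
    by (cases "t < x") (auto simp: \<psi>_def bspline_vals)
  have test: "test_function (\<psi> i)" for i
    unfolding test_function_def
  proof
    show "\<psi> i C1_differentiable_on UNIV"
      unfolding C1_differentiable_on_def
    proof (intro exI conjI ballI)
      show "(\<psi> i has_vector_derivative (?k i * bspline' (?k i * (t - x)) - ?k i * bspline' (?k i * (t - y)))) (at t)" for t
        using d\<psi> by (simp add: has_real_derivative_iff_has_vector_derivative)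
      show "continuous_on UNIV (\<lambda>t. ?k i * bspline' (?k i * (t - x)) - ?k i * bspline' (?k i * (t - y)))"
        by (intro continuous_intros continuous_on_compose2[OF bspline'_cont]) auto
    qed
    have "{t. \<psi> i t \<noteq> 0} \<subseteq> {x..y+1}" using \<psi>0 by blast
    then show "compact (closure {t. \<psi> i t \<noteq> 0})"
      using bounded_subset[OF bounded_closed_interval] compact_closure by blast
  qed
  have eq: "(\<integral>t. deriv (\<psi> i) t *\<^sub>R f t \<partial>lborel) = - (\<integral>t. \<psi> i t *\<^sub>R g t \<partial>lborel)" for i
    using w test by (auto simp: has_weak_derivative_def)
  have R: "(\<lambda>i. \<integral>t. \<psi> i t *\<^sub>R g t \<partial>lborel) \<longlonglongrightarrow> (\<integral>t. indicator {x<..y} t *\<^sub>R g t \<partial>lborel)"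
  proof (rule integral_dominated_convergence[where w="\<lambda>t. norm (indicator {x..y+1} t *\<^sub>R g t)"])
    have gi: "integrable lborel (\<lambda>t. indicator {x..y+1} t *\<^sub>R g t)" using g by (simp add: set_integrable_def)
    then show "integrable lborel (\<lambda>t. norm (indicator {x..y+1} t *\<^sub>R g t))" by (rule integrable_norm)
    have e: "\<psi> i t *\<^sub>R g t = \<psi> i t *\<^sub>R (indicator {x..y+1} t *\<^sub>R g t)" for i t
      using \<psi>0[of t i] by (auto simp: indicator_def)
    have [measurable]: "\<psi> i \<in> borel_measurable borel" for i
      unfolding \<psi>_def by (intro borel_measurable_continuous_onI continuous_intros continuous_on_compose2[OF bspline_cont]) auto
    note [measurable] = borel_measurable_integrable[OF gi]
    show "(\<lambda>t. \<psi> i t *\<^sub>R g t) \<in> borel_measurable lborel" for i by (subst e) measurable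
    have "set_integrable lborel {x<..y} g" by (rule set_integrable_subset[OF g[of x y]]) auto
    then show "(\<lambda>t. indicator {x<..y} t *\<^sub>R g t) \<in> borel_measurable lborel"
      by (simp add: set_integrable_def borel_measurable_integrable)
    show "AE t in lborel. (\<lambda>i. \<psi> i t *\<^sub>R g t) \<longlonglongrightarrow> indicator {x<..y} t *\<^sub>R g t"
    proof (intro AE_I2 tendsto_scaleR tendsto_const)
      fix t
      have "(\<lambda>i. bspline (?k i * (t - z))) \<longlonglongrightarrow> (if z < t then 1 else 0)" for z
      proof (cases "z < t")
        case True
        obtain n where n: "1 / (t - z) < real n" using reals_Archimedean2 by blast
        have "\<forall>i\<ge>n. bspline (?k i * (t - z)) = 1"
        proof (intro allI impI bspline_vals)
          fix i assume "n \<le> i"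
          then have "1 / (t - z) \<le> ?k i" using n by linarith
          then show "1 \<le> ?k i * (t - z)" using True by (simp add: divide_simps)
        qed
        then show ?thesis using True by (auto intro!: tendsto_eventually eventually_sequentiallyI[of n])
      next
        case False
        then show ?thesis using small[of t z] by (auto simp: bspline_vals)
      qed
      from tendsto_diff[OF this[of x] this[of y]]
      show "(\<lambda>i. \<psi> i t) \<longlonglongrightarrow> indicator {x<..y} t"
        using xy by (auto simp: \<psi>_def indicator_def split: if_splits)
    qed
    show "AE t in lborel. norm (\<psi> i t *\<^sub>R g t) \<le> norm (indicator {x..y+1} t *\<^sub>R g t)" for i
    proof (intro AE_I2)
      fix t
      have "\<bar>\<psi> i t\<bar> \<le> 1" unfolding \<psi>_def
        using bspline_range[of "?k i * (t - x)"] bspline_range[of "?k i * (t - y)"] by linarith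
      then show "norm (\<psi> i t *\<^sub>R g t) \<le> norm (indicator {x..y+1} t *\<^sub>R g t)"
        using \<psi>0[of t i] mult_right_mono[of "\<bar>\<psi> i t\<bar>" 1 "norm (g t)"] by (cases "t \<in> {x..y+1}") auto
    qed
  qed
  have Iz: "integrable lborel (\<lambda>t. (?k i * bspline' (?k i * (t - z))) *\<^sub>R f t)"
    and Lz: "(\<lambda>i. \<integral>t. (?k i * bspline' (?k i * (t - z))) *\<^sub>R f t \<partial>lborel) \<longlonglongrightarrow> f z" for i z
  proof -
    show "integrable lborel (\<lambda>t. (?k i * bspline' (?k i * (t - z))) *\<^sub>R f t)" for i
    proof -
      have "integrable lborel (\<lambda>t. indicator {z..z+1} t *\<^sub>R ((?k i * bspline' (?k i * (t - z))) *\<^sub>R f t))"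
        by (intro borel_integrable_compact compact_Icc continuous_intros continuous_on_compose2[OF bspline'_cont]
            continuous_on_subset[OF fc]) auto
      moreover have "(\<lambda>t. indicator {z..z+1} t *\<^sub>R ((?k i * bspline' (?k i * (t - z))) *\<^sub>R f t)) = (\<lambda>t. (?k i * bspline' (?k i * (t - z))) *\<^sub>R f t)"
      proof
        fix t show "indicator {z..z+1} t *\<^sub>R ((?k i * bspline' (?k i * (t - z))) *\<^sub>R f t) = (?k i * bspline' (?k i * (t - z))) *\<^sub>R f t"
          using big[of z t i] small[of t z i]
          by (cases "t < z"; cases "t > z + 1") (auto simp: indicator_def bspline_vals(3,4))
      qed
      ultimately show ?thesis by (simp only:)
    qed
    \<comment> \<open>Rescaling moves the dependence on \<open>i\<close> into the argument of
      \<open>f\<close>, where continuity gives the limit under the fixed hat function.\<close>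
    have sub: "(\<integral>t. (?k i * bspline' (?k i * (t - z))) *\<^sub>R f t \<partial>lborel) = (\<integral>u. bspline' u *\<^sub>R f (z + u / ?k i) \<partial>lborel)" for i
      by (subst lborel_integral_real_affine[of "1 / ?k i" _ z]) (auto simp: divide_simps simp flip: integral_scaleR_right)
    have "compact (f ` {z..z+1})" by (intro compact_continuous_image continuous_on_subset[OF fc]) auto
    then obtain B where B: "\<And>t. t \<in> {z..z+1} \<Longrightarrow> norm (f t) \<le> B"
      using compact_imp_bounded[of "f ` {z..z+1}"] unfolding bounded_iff ball_simps by blast
    have one: "has_bochner_integral lborel (\<lambda>x. bspline' x * indicator {0..1} x) (bspline 1 - bspline 0)"
      by (rule has_bochner_integral_FTC_Icc_real)
         (use bspline_deriv bspline'_cont[of UNIV] in \<open>auto simp: continuous_on_eq_continuous_at\<close>)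
    have ind: "bspline' x * indicator {0..1} x = bspline' x" for x
      by (cases "x < 0"; cases "x > 1") (auto simp: indicator_def bspline_vals(3,4))
    have int1: "integrable lborel bspline'" "(\<integral>u. bspline' u \<partial>lborel) = 1"
      using one by (auto simp: ind has_bochner_integral_iff bspline_vals)
    have "(\<lambda>i. \<integral>u. bspline' u *\<^sub>R f (z + u / ?k i) \<partial>lborel) \<longlonglongrightarrow> (\<integral>u. bspline' u *\<^sub>R f z \<partial>lborel)"
    proof (rule integral_dominated_convergence[where w="\<lambda>u. B * \<bar>bspline' u\<bar>"])
      note [measurable] = borel_measurable_continuous_onI[OF fc] borel_measurable_continuous_onI[OF bspline'_cont[of UNIV]]
      show "(\<lambda>u. bspline' u *\<^sub>R f (z + u / ?k i)) \<in> borel_measurable lborel" for i by measurable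
      show "(\<lambda>u. bspline' u *\<^sub>R f z) \<in> borel_measurable lborel" by measurable
      show "integrable lborel (\<lambda>u. B * \<bar>bspline' u\<bar>)" using int1(1) by simp
      show "AE u in lborel. (\<lambda>i. bspline' u *\<^sub>R f (z + u / ?k i)) \<longlonglongrightarrow> bspline' u *\<^sub>R f z"
      proof (intro AE_I2 tendsto_scaleR tendsto_const)
        fix u
        have "(\<lambda>i. z + u * inverse (?k i)) \<longlonglongrightarrow> z + u * 0" by (intro tendsto_intros LIMSEQ_inverse_real_of_nat)
        then have "(\<lambda>i. z + u / ?k i) \<longlonglongrightarrow> z" by (simp add: divide_inverse)
        then show "(\<lambda>i. f (z + u / ?k i)) \<longlonglongrightarrow> f z"
          using continuous_on_tendsto_compose[OF fc] by auto
      qed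
      show "AE u in lborel. norm (bspline' u *\<^sub>R f (z + u / ?k i)) \<le> B * \<bar>bspline' u\<bar>" for i
      proof (intro AE_I2)
        fix u :: real
        show "norm (bspline' u *\<^sub>R f (z + u / ?k i)) \<le> B * \<bar>bspline' u\<bar>"
        proof (cases "u \<in> {0..1}")
          case True
          then have "u / ?k i \<le> 1 / 1" "0 \<le> u / ?k i" by (auto intro!: divide_left_mono[THEN order_trans[rotated]] simp: divide_simps)
          then show ?thesis using mult_left_mono[OF B[of "z + u / ?k i"], of "\<bar>bspline' u\<bar>"] by (simp add: mult.commute)
        qed (auto simp: bspline_vals)
      qed
    qed
    then show "(\<lambda>i. \<integral>t. (?k i * bspline' (?k i * (t - z))) *\<^sub>R f t \<partial>lborel) \<longlonglongrightarrow> f z"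
      using int1 unfolding sub by simp
  qed
  have "(\<integral>t. deriv (\<psi> i) t *\<^sub>R f t \<partial>lborel) = (\<integral>t. (?k i * bspline' (?k i * (t - x))) *\<^sub>R f t \<partial>lborel) - (\<integral>t. (?k i * bspline' (?k i * (t - y))) *\<^sub>R f t \<partial>lborel)" for i
    using DERIV_imp_deriv[OF d\<psi>] Iz by (simp add: scaleR_left_diff_distrib)
  then have "(\<lambda>i. \<integral>t. deriv (\<psi> i) t *\<^sub>R f t \<partial>lborel) \<longlonglongrightarrow> f x - f y"
    using tendsto_diff[OF Lz[of x] Lz[of y]] by simp
  moreover have "(\<lambda>i. \<integral>t. deriv (\<psi> i) t *\<^sub>R f t \<partial>lborel) \<longlonglongrightarrow> - (\<integral>t. indicator {x<..y} t *\<^sub>R g t \<partial>lborel)"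
    unfolding eq by (intro tendsto_minus R)
  ultimately have "f x - f y = - (\<integral>t. indicator {x<..y} t *\<^sub>R g t \<partial>lborel)" by (rule LIMSEQ_unique)
  moreover have "(\<integral>t. indicator {x<..y} t *\<^sub>R g t \<partial>lborel) = (LBINT t:{x..y}. g t)"
    unfolding set_lebesgue_integral_def
  proof (rule integral_cong_AE)
    have "AE t in lborel. t \<noteq> x" by (rule AE_lborel_singleton)
    then show "AE t in lborel. indicat_real {x<..y} t *\<^sub>R g t = indicat_real {x..y} t *\<^sub>R g t"
      by eventually_elim (auto simp: indicator_def)
    have "set_integrable lborel {x<..y} g" by (rule set_integrable_subset[OF g[of x y]]) auto
    then show "(\<lambda>t. indicat_real {x<..y} t *\<^sub>R g t) \<in> borel_measurable lborel"
      by (simp add: set_integrable_def borel_measurable_integrable)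
    show "(\<lambda>t. indicat_real {x..y} t *\<^sub>R g t) \<in> borel_measurable lborel"
      using g[of x y] by (simp add: set_integrable_def borel_measurable_integrable)
  qed
  ultimately show ?thesis by (metis minus_diff_eq minus_minus)
qed

section \<open>Weak derivatives of circle-valued maps and of their liftings\<close>

lemma sob_primitive:
  assumes [measurable]: "g \<in> borel_measurable borel" and L: "L2 g < \<infinity>"
  shows "\<exists>u. sob u g \<and> u 0 = c"
proof -
  define u where "u x = (if 0 \<le> x then c + (LBINT t:{0..x}. g t) else c - (LBINT t:{x..0}. g t))" for x
  have i: "set_integrable lborel {a..b} g" for a b by (rule L2_set_integrable[OF assms])
  have z: "(LBINT t:{a..a}. g t) = 0" for a
    using lborel_set_integral_combine[of a a a g] i by simp
  have un: "u x = c - (LBINT t:{x..0}. g t)" if "x \<le> 0" for x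
    using that z[of 0] by (cases "x = 0") (auto simp: u_def)
  have up: "u x = c + (LBINT t:{0..x}. g t)" if "0 \<le> x" for x
    using that by (simp add: u_def)
  have "u b - u a = (LBINT x:{a..b}. g x)" if ab: "a \<le> b" for a b
  proof -
    consider "0 \<le> a" | "b \<le> 0" | "a < 0" "0 < b" by linarith
    then show ?thesis
    proof cases
      case 1 then show ?thesis using lborel_set_integral_combine[OF _ _ i, of 0 a b] ab up[of a] up[of b] by simp
    next
      case 2 then show ?thesis using lborel_set_integral_combine[OF _ _ i, of a b 0] ab un[of a] un[of b] by simp
    next
      case 3 then show ?thesis using lborel_set_integral_combine[OF _ _ i, of a 0 b] ab un[of a] up[of b] by simp
    qed
  qed
  moreover have "u 0 = c" using z[of 0] by (simp add: u_def)
  ultimately show ?thesis using assms by (auto simp: sob_def)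
qed

lemma sob_deriv_unique:
  assumes u: "sob u g" and v: "sob u k"
  shows "AE x in lborel. g x = k x"
proof -
  have "AE x in lborel. g x - k x = 0"
  proof (rule AE_zero_of_interval_integrals)
    show "set_integrable lborel {a..b} (\<lambda>x. g x - k x)" for a b
      using sob_int[OF u] sob_int[OF v] by (simp add: set_integral_diff)
    fix a b :: real assume "a \<le> b"
    then show "(LBINT x:{a..b}. g x - k x) = 0"
      using sob_eq[OF u, of a b] sob_eq[OF v, of a b]
      by (simp add: set_integral_diff(2)[OF sob_int[OF u] sob_int[OF v]])
  qed
  then show ?thesis by eventually_elim simp
qed

text \<open>The weak derivative of the lifting is \<open>m\<^sub>1 m\<^sub>2' - m\<^sub>2 m\<^sub>1'\<close>; its primitive is compared with the given
  continuous lifting through the cosine of their difference.\<close>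

lemma lift_of_weak_deriv:
  assumes w: "has_weak_derivative m G" and mc: "continuous_on UNIV m" and L: "L2_norm_sq G < \<infinity>"
    and lift: "is_lifting \<phi> m"
  shows "\<exists>g. sob \<phi> g \<and> L2_norm_sq g \<le> L2_norm_sq G"
proof -
  have m: "m x = (cos (\<phi> x), sin (\<phi> x))" for x using lift by (simp add: is_lifting_def)
  have \<phi>c: "continuous_on UNIV \<phi>" using lift by (simp add: is_lifting_def)
  have Gi: "set_integrable lborel {a..b} G" for a b
    using w by (auto simp: has_weak_derivative_def locally_integrable_def)
  have Gm[measurable]: "G \<in> borel_measurable borel"
  proof (rule borel_measurable_LIMSEQ_metric)
    show "(\<lambda>x. indicator {- real n..real n} x *\<^sub>R G x) \<in> borel_measurable borel" for n
      using borel_measurable_integrable[OF Gi[of "- real n" "real n", unfolded set_integrable_def]] by simp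
    fix x
    obtain N where N: "\<bar>x\<bar> \<le> real N" using real_arch_simple by blast
    have "indicator {- real n..real n} x *\<^sub>R G x = G x" if "n \<ge> N" for n
    proof -
      have "\<bar>x\<bar> \<le> real n" using N that by linarith
      then show ?thesis by (auto simp: indicator_def)
    qed
    then show "(\<lambda>n. indicator {- real n..real n} x *\<^sub>R G x) \<longlonglongrightarrow> G x"
      by (auto intro!: tendsto_eventually eventually_sequentiallyI[of N])
  qed
  let ?G1 = "\<lambda>x. fst (G x)" and ?G2 = "\<lambda>x. snd (G x)"
  have n2: "(norm (G x))^2 = (?G1 x)^2 + (?G2 x)^2" for x
    by (cases "G x") (simp add: norm_Pair)
  have le: "L2_norm_sq k \<le> L2_norm_sq G" if "\<And>x. (k x)^2 \<le> (norm (G x))^2" for k :: "real \<Rightarrow> real"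
    unfolding L2_norm_sq_def using that by (intro nn_integral_mono ennreal_leI) simp
  have [measurable]: "?G1 \<in> borel_measurable borel" "?G2 \<in> borel_measurable borel"
    by (rule measurable_compose[OF Gm], simp add: borel_measurable_continuous_onI continuous_intros)+
  have c1: "sob (\<lambda>x. cos (\<phi> x)) ?G1" and c2: "sob (\<lambda>x. sin (\<phi> x)) ?G2"
  proof -
    have f: "m b - m a = (LBINT t:{a..b}. G t)" if "a \<le> b" for a b
      by (rule has_weak_derivative_FTC[OF w mc that])
    have e: "fst (LBINT t:{a..b}. G t) = (LBINT t:{a..b}. ?G1 t)" "snd (LBINT t:{a..b}. G t) = (LBINT t:{a..b}. ?G2 t)" for a b
      unfolding set_lebesgue_integral_def
      using integral_bounded_linear[OF bounded_linear_fst Gi[of a b, unfolded set_integrable_def]]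
        integral_bounded_linear[OF bounded_linear_snd Gi[of a b, unfolded set_integrable_def]]
      by simp_all
    show "sob (\<lambda>x. cos (\<phi> x)) ?G1"
      by (rule sobI) (use f[THEN arg_cong[where f=fst]] e m le[of ?G1] n2 L in \<open>auto intro: le_less_trans\<close>)
    show "sob (\<lambda>x. sin (\<phi> x)) ?G2"
      by (rule sobI) (use f[THEN arg_cong[where f=snd]] e m le[of ?G2] n2 L in \<open>auto intro: le_less_trans\<close>)
  qed
  define g where "g x = cos (\<phi> x) * ?G2 x - sin (\<phi> x) * ?G1 x" for x
  note [measurable] = borel_measurable_continuous_onI[OF \<phi>c]
  have gm[measurable]: "g \<in> borel_measurable borel" unfolding g_def by measurable
  have gle: "L2_norm_sq g \<le> L2_norm_sq G"
  proof (rule le)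
    fix x
    have "(g x)^2 + (cos (\<phi> x) * ?G1 x + sin (\<phi> x) * ?G2 x)^2 = ((cos (\<phi> x))^2 + (sin (\<phi> x))^2) * ((?G1 x)^2 + (?G2 x)^2)"
      unfolding g_def by algebra
    then show "(g x)^2 \<le> (norm (G x))^2" unfolding n2
      by (metis le_add_same_cancel1 mult_1 sin_cos_squared_add2 zero_le_power2)
  qed
  \<comment> \<open>Differentiating |m|^2 = 1 shows that the derivative of m is orthogonal to
    m.\<close>
  have orth: "AE x in lborel. cos (\<phi> x) * ?G1 x + sin (\<phi> x) * ?G2 x = 0"
  proof -
    have "sob (\<lambda>x. cos (\<phi> x) * cos (\<phi> x) + sin (\<phi> x) * sin (\<phi> x))
      (\<lambda>x. (cos (\<phi> x) * ?G1 x + cos (\<phi> x) * ?G1 x) + (sin (\<phi> x) * ?G2 x + sin (\<phi> x) * ?G2 x))"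
      by (intro sob_add sob_mult[where B=1 and C=1] c1 c2) auto
    then have "sob (\<lambda>x. 1) (\<lambda>x. (cos (\<phi> x) * ?G1 x + cos (\<phi> x) * ?G1 x) + (sin (\<phi> x) * ?G2 x + sin (\<phi> x) * ?G2 x))"
      by (simp flip: power2_eq_square)
    from sob_deriv_unique[OF this sob_const] show ?thesis by eventually_elim linarith
  qed
  obtain u where u: "sob u g" "u 0 = \<phi> 0"
    using sob_primitive[OF gm, of "\<phi> 0"] gle L by (auto intro: le_less_trans)
  define C where "C x = cos (\<phi> x) * cos (u x) + sin (\<phi> x) * sin (u x)" for x
  define k where "k x = (cos (\<phi> x) * (- sin (u x) * g x) + cos (u x) * ?G1 x) + (sin (\<phi> x) * (cos (u x) * g x) + sin (u x) * ?G2 x)" for x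
  have "sob C k" unfolding C_def[abs_def] k_def[abs_def]
    by (intro sob_add sob_mult[where B=1 and C=1] c1 c2 sob_cos[OF u(1)] sob_sin[OF u(1)]) auto
  \<comment> \<open>By orthogonality the derivative of m is \<open>g\<close> times the tangent (-sin
    \<phi>, cos \<phi>), and with this the summands of \<open>k\<close> cancel.\<close>
  moreover have "AE x in lborel. k x = 0"
    using orth
  proof eventually_elim
    case (elim x)
    let ?c = "cos (\<phi> x)" and ?s = "sin (\<phi> x)"
    have q: "?c * ?c = 1 - ?s * ?s" by (metis cos_squared_eq power2_eq_square)
    have "?G1 x - ?s * g x * (-1) = ?G1 x * (1 - ?s * ?s) + ?s * ?c * ?G2 x" by (simp add: g_def algebra_simps)
    also have "\<dots> = ?c * (?c * ?G1 x + ?s * ?G2 x)" by (simp add: q[symmetric] algebra_simps)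
    finally have a: "?G1 x + ?s * g x = 0" using elim by simp
    have "?G2 x - ?c * g x = ?G2 x * (1 - ?c * ?c) + ?s * ?c * ?G1 x" by (simp add: g_def algebra_simps)
    also have "\<dots> = ?s * (?c * ?G1 x + ?s * ?G2 x)" by (simp add: q algebra_simps)
    finally have b: "?G2 x - ?c * g x = 0" using elim by simp
    have "k x = cos (u x) * (?G1 x + ?s * g x) + sin (u x) * (?G2 x - ?c * g x)"
      by (simp add: k_def algebra_simps)
    then show ?case using a b by simp
  qed
  ultimately have Cc: "C b = C a" if "a \<le> b" for a b
  proof -
    have "C b - C a = (LBINT x:{a..b}. k x)" using \<open>sob C k\<close> that by (rule sob_eq)
    also have "\<dots> = (LBINT x:{a..b}. 0)"
      unfolding set_lebesgue_integral_def
      by (rule integral_cong_AE) (use sob_meas[OF \<open>sob C k\<close>] \<open>AE x in lborel. k x = 0\<close> in \<open>auto\<close>)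
    finally show ?thesis by simp
  qed
  have C1: "cos (\<phi> x - u x) = 1" for x
  proof -
    have "C x = C 0" using Cc[of x 0] Cc[of 0 x] by (metis linear)
    moreover have "C 0 = 1" using u(2) by (simp add: C_def flip: power2_eq_square)
    ultimately show ?thesis by (simp add: C_def cos_diff)
  qed
  \<comment> \<open>The difference is continuous with values in the discrete set of multiples of 2
    pi.\<close>
  have "(\<lambda>x. \<phi> x - u x) constant_on UNIV"
  proof (rule continuous_discrete_range_constant)
    show "continuous_on UNIV (\<lambda>x. \<phi> x - u x)" by (intro continuous_intros \<phi>c sob_continuous[OF u(1)])
    fix x :: real
    have "2 * pi \<le> norm ((\<phi> y - u y) - (\<phi> x - u x))" if "\<phi> y - u y \<noteq> \<phi> x - u x" for y
    proof -
      obtain i j :: int where i: "\<phi> y - u y = i * 2 * pi" and j: "\<phi> x - u x = j * 2 * pi"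
        using C1[of x] C1[of y] by (auto simp: cos_one_2pi_int)
      have "i \<noteq> j" using that i j by auto
      then have "1 \<le> \<bar>real_of_int (i - j)\<bar>" by linarith
      then have "1 * (2 * pi) \<le> \<bar>real_of_int (i - j)\<bar> * (2 * pi)" by (intro mult_right_mono) auto
      also have "\<dots> = \<bar>real_of_int (i - j) * (2 * pi)\<bar>" by (simp add: abs_mult)
      also have "real_of_int (i - j) * (2 * pi) = (\<phi> y - u y) - (\<phi> x - u x)" unfolding i j by (simp add: algebra_simps)
      finally show ?thesis by simp
    qed
    then show "\<exists>e>0. \<forall>y. y \<in> UNIV \<and> \<phi> y - u y \<noteq> \<phi> x - u x \<longrightarrow> e \<le> norm ((\<phi> y - u y) - (\<phi> x - u x))"
      by (intro exI[of _ "2 * pi"]) auto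
  qed auto
  then obtain c where c: "\<And>x. \<phi> x - u x = c" by (auto simp: constant_on_def)
  have "\<phi> x = u x" for x using c[of x] c[of 0] u(2) by simp
  then have "\<phi> = u" by auto
  then show ?thesis using u(1) gle by auto
qed

lemma test_function_by_parts:
  assumes t: "test_function \<psi>" and u: "sob u k" and B: "\<And>x. \<bar>u x\<bar> \<le> B"
  shows "integrable lborel (\<lambda>x. deriv \<psi> x * u x)" "integrable lborel (\<lambda>x. \<psi> x * k x)"
    "(\<integral>x. deriv \<psi> x * u x \<partial>lborel) = - (\<integral>x. \<psi> x * k x \<partial>lborel)"
proof -
  obtain D where D: "\<And>x. (\<psi> has_real_derivative D x) (at x)" and Dc: "continuous_on UNIV D"
    using t by (auto simp: test_function_def C1_differentiable_on_def has_real_derivative_iff_has_vector_derivative)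
  have dD: "deriv \<psi> = D" using DERIV_imp_deriv[OF D] by auto
  have "bounded (closure {x. \<psi> x \<noteq> 0})" using t by (auto simp: test_function_def compact_imp_bounded)
  then have "bounded {x. \<psi> x \<noteq> 0}" using bounded_subset closure_subset by blast
  then obtain R0 where R0: "\<And>x. \<psi> x \<noteq> 0 \<Longrightarrow> \<bar>x\<bar> \<le> R0" by (auto simp: bounded_iff)
  \<comment> \<open>The margin 1 puts every point with |x| \<ge> R into an open set on which \<psi>
    vanishes, so that its derivative vanishes there too.\<close>
  define R where "R = \<bar>R0\<bar> + 1"
  have R: "R > 0" "\<And>x. \<bar>x\<bar> \<ge> R \<Longrightarrow> \<psi> x = 0" using R0 by (force simp: R_def)+
  have DR: "D x = 0" if "\<bar>x\<bar> \<ge> R" for x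
  proof -
    have "x \<in> - {- \<bar>R0\<bar>..\<bar>R0\<bar>}" using that by (auto simp: R_def)
    then have "eventually (\<lambda>y. y \<in> - {- \<bar>R0\<bar>..\<bar>R0\<bar>}) (nhds x)" by (intro eventually_nhds_in_open) auto
    then have "eventually (\<lambda>y. \<psi> y = 0) (nhds x)"
      by eventually_elim (use R0 in force)
    then have "(\<psi> has_real_derivative 0) (at x)"
      by (rule DERIV_cong_ev[OF refl _ refl, THEN iffD2]) simp
    then show ?thesis using D DERIV_unique by blast
  qed
  have "continuous_on {-R..R} D" "continuous_on {-R..R} \<psi>"
    using continuous_on_subset[OF Dc] DERIV_continuous_on[OF has_field_derivative_at_within[OF D]] by auto
  then have "compact (D ` {-R..R})" "compact (\<psi> ` {-R..R})"
    by (auto intro!: compact_continuous_image)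
  then have "bounded (D ` {-R..R})" "bounded (\<psi> ` {-R..R})" by (auto intro: compact_imp_bounded)
  then obtain M N where MN: "\<And>x. x \<in> {-R..R} \<Longrightarrow> \<bar>D x\<bar> \<le> M" "\<And>x. x \<in> {-R..R} \<Longrightarrow> \<bar>\<psi> x\<bar> \<le> N"
    unfolding bounded_iff ball_simps real_norm_def by blast
  have M0: "0 \<le> M" "0 \<le> N" using MN(1)[of 0] MN(2)[of 0] R(1) by auto
  have M: "\<bar>D x\<bar> \<le> M" "\<bar>\<psi> x\<bar> \<le> N" for x
  proof -
    have "\<bar>D x\<bar> \<le> M \<and> \<bar>\<psi> x\<bar> \<le> N"
    proof (cases "\<bar>x\<bar> \<ge> R")
      case True then show ?thesis using R(2)[OF True] DR[OF True] M0 by simp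
    next
      case False
      then have "x \<in> {-R..R}" by auto
      then show ?thesis using MN by blast
    qed
    then show "\<bar>D x\<bar> \<le> M" "\<bar>\<psi> x\<bar> \<le> N" by auto
  qed
  have DL: "L2_norm_sq D < \<infinity>"
  proof -
    have "L2_norm_sq D \<le> (\<integral>\<^sup>+x\<in>{-R..R}. ennreal (M^2) \<partial>lborel)"
      unfolding L2_norm_sq_real
    proof (intro nn_integral_mono)
      fix x
      show "ennreal ((D x)^2) \<le> ennreal (M^2) * indicator {-R..R} x"
        using M(1)[of x] DR[of x] power_mono[of "\<bar>D x\<bar>" M 2] by (auto simp: indicator_def intro!: ennreal_leI)
    qed
    also have "\<dots> < \<infinity>" by (simp add: nn_integral_cmult ennreal_mult_less_top emeasure_lborel_Icc_eq)
    finally show ?thesis .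
  qed
  have s\<psi>: "sob \<psi> D" by (rule sob_C1[OF D Dc DL])
  have p: "sob (\<lambda>x. \<psi> x * u x) (\<lambda>x. \<psi> x * k x + u x * D x)"
    by (rule sob_mult[OF s\<psi> u M(2) B])
  have uD: "L2_norm_sq (\<lambda>x. u x * D x) < \<infinity>" by (rule L2_mult_bounded[OF sob_meas[OF s\<psi>] DL B])
  have \<psi>k: "L2_norm_sq (\<lambda>x. \<psi> x * k x) < \<infinity>" by (rule L2_mult_bounded[OF sob_meas[OF u] sob_L2[OF u] M(2)])
  note [measurable] = sob_meas[OF s\<psi>] sob_meas[OF u] sob_borel[OF s\<psi>] sob_borel[OF u]
  have i1: "set_integrable lborel {-R..R} (\<lambda>x. u x * D x)" by (rule L2_set_integrable[OF _ uD]) measurable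
  have i2: "set_integrable lborel {-R..R} (\<lambda>x. \<psi> x * k x)" by (rule L2_set_integrable[OF _ \<psi>k]) measurable
  have e1: "indicator {-R..R} x *\<^sub>R (u x * D x) = D x * u x" for x
    using DR[of x] by (cases "\<bar>x\<bar> \<le> R") (auto simp: indicator_def)
  have e2: "indicator {-R..R} x *\<^sub>R (\<psi> x * k x) = \<psi> x * k x" for x
    using R(2)[of x] by (cases "\<bar>x\<bar> \<le> R") (auto simp: indicator_def)
  show "integrable lborel (\<lambda>x. deriv \<psi> x * u x)" using i1 by (simp only: dD set_integrable_def e1)
  show "integrable lborel (\<lambda>x. \<psi> x * k x)" using i2 by (simp only: set_integrable_def e2)
  have "0 = (LBINT x:{-R..R}. \<psi> x * k x + u x * D x)"
    using sob_eq[OF p, of "-R" R] R by simp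
  also have "\<dots> = (LBINT x:{-R..R}. \<psi> x * k x) + (LBINT x:{-R..R}. u x * D x)"
    by (rule set_integral_add(2)[OF i2 i1])
  also have "\<dots> = (\<integral>x. \<psi> x * k x \<partial>lborel) + (\<integral>x. D x * u x \<partial>lborel)"
    unfolding set_lebesgue_integral_def e1 e2 ..
  finally show "(\<integral>x. deriv \<psi> x * u x \<partial>lborel) = - (\<integral>x. \<psi> x * k x \<partial>lborel)"
    unfolding dD by linarith
qed

text \<open>This serves both directions of the translation between maps and angles: it computes the
  energy of a given map and makes angles into admissible competitors.\<close>

lemma circle_map_sob:
  assumes s: "sob \<phi> g" and m: "m = (\<lambda>x. (cos (\<phi> x), sin (\<phi> x)))"
  shows "m \<in> H1_loc_circle" "L2_norm_sq (weak_deriv m) = L2_norm_sq g"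
proof -
  define G where "G x = (- sin (\<phi> x) * g x, cos (\<phi> x) * g x)" for x
  note [measurable] = sob_meas[OF s] sob_borel[OF s]
  have mc: "continuous_on UNIV m" unfolding m by (intro continuous_intros sob_continuous[OF s])
  have Gm: "G \<in> borel_measurable borel" unfolding G_def by measurable
  have c1: "sob (\<lambda>x. cos (\<phi> x)) (\<lambda>x. - sin (\<phi> x) * g x)" and c2: "sob (\<lambda>x. sin (\<phi> x)) (\<lambda>x. cos (\<phi> x) * g x)"
    using sob_cos[OF s] sob_sin[OF s] by auto
  have Gn: "(norm (G x))^2 = (g x)^2" for x
  proof -
    have "(norm (G x))^2 = (- sin (\<phi> x) * g x)^2 + (cos (\<phi> x) * g x)^2" by (simp add: G_def norm_Pair)
    also have "\<dots> = ((sin (\<phi> x))^2 + (cos (\<phi> x))^2) * (g x)^2" by (simp only: power_mult_distrib distrib_right power2_minus)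
    finally show ?thesis by simp
  qed
  have GL: "L2_norm_sq G = L2_norm_sq g" by (simp add: L2_norm_sq_def Gn)
  have dec: "(a, b) = a *\<^sub>R (1, 0) + b *\<^sub>R (0, 1)" for a b :: real by simp
  have Gi: "set_integrable lborel {a..b} G" for a b
  proof -
    have "set_integrable lborel {a..b} (\<lambda>x. (- sin (\<phi> x) * g x) *\<^sub>R (1::real, 0::real) + (cos (\<phi> x) * g x) *\<^sub>R (0, 1))"
      by (intro set_integral_add set_integrable_scaleR_left sob_int[OF c1] sob_int[OF c2])
    then show ?thesis unfolding G_def[abs_def] by simp
  qed
  have w: "has_weak_derivative m G"
    unfolding has_weak_derivative_def locally_integrable_def
  proof (intro conjI allI impI)
    show "set_integrable lborel {a..b} m" for a b
      by (rule borel_integrable_atLeastAtMost') (rule continuous_on_subset[OF mc], simp)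
    show "set_integrable lborel {a..b} G" for a b by (rule Gi)
    fix \<psi> assume t: "test_function \<psi>"
    note b1 = test_function_by_parts[OF t c1, of 1, simplified] and b2 = test_function_by_parts[OF t c2, of 1, simplified]
    have "(\<integral>x. deriv \<psi> x *\<^sub>R m x \<partial>lborel) = (\<integral>x. (deriv \<psi> x * cos (\<phi> x)) *\<^sub>R (1::real, 0::real) + (deriv \<psi> x * sin (\<phi> x)) *\<^sub>R (0, 1) \<partial>lborel)"
      by (simp add: m)
    also have "\<dots> = (\<integral>x. deriv \<psi> x * cos (\<phi> x) \<partial>lborel) *\<^sub>R (1, 0) + (\<integral>x. deriv \<psi> x * sin (\<phi> x) \<partial>lborel) *\<^sub>R (0, 1)"
      using b1(1) b2(1) by (subst Bochner_Integration.integral_add) (auto simp del: scaleR_Pair)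
    also have "\<dots> = - ((\<integral>x. \<psi> x * (- sin (\<phi> x) * g x) \<partial>lborel) *\<^sub>R (1, 0) + (\<integral>x. \<psi> x * (cos (\<phi> x) * g x) \<partial>lborel) *\<^sub>R (0, 1))"
      using b1(3) b2(3) by simp
    also have "(\<integral>x. \<psi> x * (- sin (\<phi> x) * g x) \<partial>lborel) *\<^sub>R (1, 0) + (\<integral>x. \<psi> x * (cos (\<phi> x) * g x) \<partial>lborel) *\<^sub>R (0, 1)
       = (\<integral>x. (\<psi> x * (- sin (\<phi> x) * g x)) *\<^sub>R (1::real, 0::real) + (\<psi> x * (cos (\<phi> x) * g x)) *\<^sub>R (0, 1) \<partial>lborel)"
      using b1(2) b2(2) by (subst Bochner_Integration.integral_add) (auto simp del: scaleR_Pair)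
    also have "\<dots> = (\<integral>x. \<psi> x *\<^sub>R G x \<partial>lborel)" by (simp add: G_def)
    finally show "(\<integral>x. deriv \<psi> x *\<^sub>R m x \<partial>lborel) = - (\<integral>x. \<psi> x *\<^sub>R G x \<partial>lborel)" .
  qed
  have loc: "(\<integral>\<^sup>+x\<in>{a..b}. ennreal ((norm (G x))^2) \<partial>lborel) < \<infinity>" for a b
  proof -
    have "(\<integral>\<^sup>+x\<in>{a..b}. ennreal ((norm (G x))^2) \<partial>lborel) \<le> L2_norm_sq G"
      unfolding L2_norm_sq_def by (intro nn_integral_mono) (auto simp: indicator_def)
    then show ?thesis using GL sob_L2[OF s] by (auto intro: le_less_trans)
  qed
  have nm: "norm (m x) = 1" for x by (simp add: m norm_Pair)
  show "m \<in> H1_loc_circle"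
    unfolding H1_loc_circle_def locally_L2_def
  proof (intro CollectI conjI exI[of _ G] allI)
    show "m \<in> borel_measurable lborel" using borel_measurable_continuous_onI[OF mc] by simp
    show "(\<integral>\<^sup>+x\<in>{a..b}. ennreal ((norm (m x))^2) \<partial>lborel) < \<infinity>" for a b
      by (simp add: nm emeasure_lborel_Icc_eq)
  qed (use mc w Gm loc nm in auto)
  \<comment> \<open>\<open>weak_deriv m\<close> is an unspecified choice. It agrees with
    \<open>G\<close> almost everywhere because both integrate to the increments of \<open>m\<close>;
    this is tested on each component.\<close>
  have w': "has_weak_derivative m (weak_deriv m)"
    unfolding weak_deriv_def by (rule someI[of "has_weak_derivative m"]) (rule w)
  have Wi: "set_integrable lborel {a..b} (weak_deriv m)" for a b
    using w' by (auto simp: has_weak_derivative_def locally_integrable_def)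
  have "AE x in lborel. p (weak_deriv m x) - p (G x) = 0" if p: "bounded_linear p" for p :: "real \<times> real \<Rightarrow> real"
  proof (rule AE_zero_of_interval_integrals)
    have iW: "set_integrable lborel {a..b} (\<lambda>x. p (weak_deriv m x))" and iG: "set_integrable lborel {a..b} (\<lambda>x. p (G x))" for a b
      using integrable_bounded_linear[OF p Wi[of a b, unfolded set_integrable_def]]
        integrable_bounded_linear[OF p Gi[of a b, unfolded set_integrable_def]]
      by (auto simp: set_integrable_def linear_scale bounded_linear.linear[OF p])
    show "set_integrable lborel {a..b} (\<lambda>x. p (weak_deriv m x) - p (G x))" for a b
      using iW iG by (simp add: set_integral_diff)
    have eW: "(LBINT x:{a..b}. p (weak_deriv m x)) = p (LBINT x:{a..b}. weak_deriv m x)" and eG: "(LBINT x:{a..b}. p (G x)) = p (LBINT x:{a..b}. G x)" for a b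
      using integral_bounded_linear[OF p Wi[of a b, unfolded set_integrable_def]]
        integral_bounded_linear[OF p Gi[of a b, unfolded set_integrable_def]]
      by (auto simp: set_lebesgue_integral_def linear_scale bounded_linear.linear[OF p])
    fix a b :: real assume ab: "a \<le> b"
    show "(LBINT x:{a..b}. p (weak_deriv m x) - p (G x)) = 0"
      using has_weak_derivative_FTC[OF w mc ab] has_weak_derivative_FTC[OF w' mc ab]
      by (simp add: set_integral_diff(2)[OF iW iG] eW eG)
  qed
  from this[OF bounded_linear_fst] this[OF bounded_linear_snd]
  have "AE x in lborel. weak_deriv m x = G x" by eventually_elim (simp add: prod_eq_iff)
  then have "L2_norm_sq (weak_deriv m) = L2_norm_sq G"
    unfolding L2_norm_sq_def by (intro nn_integral_cong_AE) (auto elim: eventually_mono)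
  then show "L2_norm_sq (weak_deriv m) = L2_norm_sq g" using GL by simp
qed

text \<open>Twice the energy of \<open>(cos \<phi>, sin \<phi>)\<close>, with \<open>g\<close> in the place of the derivative of \<open>\<phi>\<close>.\<close>

definition ee :: "real \<Rightarrow> (real \<Rightarrow> real) \<Rightarrow> (real \<Rightarrow> real) \<Rightarrow> ennreal" where
  "ee h \<phi> g = L2 g + Hh (\<lambda>x. cos (\<phi> x) - h) + L2 (\<lambda>x. cos (\<phi> x) - h)"

text \<open>Together with \<open>admissible_of_lift\<close> this replaces maps by angles, and the
  energy by an expression free of the chosen weak derivative.\<close>

lemma admissible_lift:
  assumes "m \<in> admissible h d"
  shows "\<exists>\<phi> g. sob \<phi> g \<and> m = (\<lambda>x. (cos (\<phi> x), sin (\<phi> x))) \<and> energy h m = ennreal (1/2) * ee h \<phi> g \<and> ee h \<phi> g < \<infinity> \<and>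
     ((\<lambda>x. 1 / (2 * pi) * (\<phi> x - \<phi> (- x))) \<longlongrightarrow> d) at_top"
proof -
  have H: "m \<in> H1_loc_circle" and E: "energy h m < \<infinity>" and D: "has_degree m d"
    using assms by (auto simp: admissible_def)
  obtain \<phi> where \<phi>: "is_lifting \<phi> m" "((\<lambda>x. 1 / (2 * pi) * (\<phi> x - \<phi> (- x))) \<longlongrightarrow> d) at_top"
    using D by (auto simp: has_degree_def)
  have w: "has_weak_derivative m (weak_deriv m)"
    unfolding weak_deriv_def
    using someI_ex[of "has_weak_derivative m"] H by (auto simp: H1_loc_circle_def)
  have L: "L2_norm_sq (weak_deriv m) < \<infinity>"
    using E by (auto simp: energy_def ennreal_mult_less_top)
  obtain g where g: "sob \<phi> g"
    using lift_of_weak_deriv[OF w _ L \<phi>(1)] H by (auto simp: H1_loc_circle_def)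
  have m: "m = (\<lambda>x. (cos (\<phi> x), sin (\<phi> x)))" using \<phi>(1) by (auto simp: is_lifting_def)
  have e: "energy h m = ennreal (1/2) * ee h \<phi> g"
    unfolding energy_def ee_def circle_map_sob(2)[OF g m] by (simp add: m)
  moreover have "ee h \<phi> g < \<infinity>" using E unfolding e by (auto simp: ennreal_mult_less_top)
  ultimately show ?thesis using g m \<phi>(2) by blast
qed

lemma admissible_of_lift:
  assumes g: "sob \<phi> g" and E: "ee h \<phi> g < \<infinity>"
    and d: "((\<lambda>x. 1 / (2 * pi) * (\<phi> x - \<phi> (- x))) \<longlongrightarrow> d) at_top"
  shows "(\<lambda>x. (cos (\<phi> x), sin (\<phi> x))) \<in> admissible h d"
    "energy h (\<lambda>x. (cos (\<phi> x), sin (\<phi> x))) = ennreal (1/2) * ee h \<phi> g"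
proof -
  let ?m = "\<lambda>x. (cos (\<phi> x), sin (\<phi> x))"
  show e: "energy h ?m = ennreal (1/2) * ee h \<phi> g"
    unfolding energy_def ee_def circle_map_sob(2)[OF g refl] by simp
  have "energy h ?m < \<infinity>" unfolding e using E by (auto simp: ennreal_mult_less_top simp del: ennreal_half)
  have "is_lifting \<phi> ?m" using sob_continuous[OF g] by (simp add: is_lifting_def)
  then show "?m \<in> admissible h d"
    using circle_map_sob(1)[OF g refl] \<open>energy h ?m < \<infinity>\<close> d unfolding admissible_def has_degree_def by blast
qed

section \<open>The seminorm of order one half\<close>

text \<open>Negative values of the integrand are truncated to 0 by \<open>ennreal\<close>; hence the
  sign conditions in \<open>DI_add\<close>.\<close>

definition DI :: "(real \<Rightarrow> real \<Rightarrow> real) \<Rightarrow> ennreal" where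
  "DI F = (NN t. (NN s. ennreal (F s t)))"

abbreviation meas2 :: "(real \<Rightarrow> real \<Rightarrow> real) \<Rightarrow> bool" where
  "meas2 F \<equiv> (\<lambda>(s, t). F s t) \<in> borel_measurable (borel \<Otimes>\<^sub>M borel)"

lemma meas2_inner:
  assumes [measurable]: "meas2 F"
  shows "(\<lambda>s. ennreal (F s t)) \<in> borel_measurable lborel" "(\<lambda>t. (NN s. ennreal (F s t))) \<in> borel_measurable lborel"
  by measurable

lemma DI_mono: "(\<And>s t. F s t \<le> G s t) \<Longrightarrow> DI F \<le> DI G"
  unfolding DI_def by (intro nn_integral_mono ennreal_leI) auto

lemma DI_add:
  assumes F: "meas2 F" "\<And>s t. 0 \<le> F s t" and G: "meas2 G" "\<And>s t. 0 \<le> G s t"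
  shows "DI (\<lambda>s t. F s t + G s t) = DI F + DI G"
proof -
  have "DI (\<lambda>s t. F s t + G s t) = (NN t. (NN s. ennreal (F s t)) + (NN s. ennreal (G s t)))"
    unfolding DI_def using meas2_inner[OF F(1)] meas2_inner[OF G(1)] F(2) G(2)
    by (intro nn_integral_cong) (subst nn_integral_add[symmetric], auto simp: ennreal_plus)
  also have "\<dots> = DI F + DI G"
    unfolding DI_def using meas2_inner[OF F(1)] meas2_inner[OF G(1)] by (intro nn_integral_add) auto
  finally show ?thesis .
qed

lemma DI_cmult:
  assumes F: "meas2 F" and c: "0 \<le> c"
  shows "DI (\<lambda>s t. c * F s t) = ennreal c * DI F"
proof -
  have "DI (\<lambda>s t. c * F s t) = (NN t. ennreal c * (NN s. ennreal (F s t)))"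
    unfolding DI_def using meas2_inner[OF F] c
    by (intro nn_integral_cong) (subst nn_integral_cmult[symmetric], auto simp: ennreal_mult')
  also have "\<dots> = ennreal c * DI F"
    unfolding DI_def using meas2_inner[OF F] by (intro nn_integral_cmult) auto
  finally show ?thesis .
qed

lemma DI_swap:
  assumes F: "meas2 F" shows "DI (\<lambda>s t. F t s) = DI F"
proof -
  have "(\<lambda>(x, y). ennreal (F x y)) \<in> borel_measurable (lborel \<Otimes>\<^sub>M lborel)" using F by measurable
  from lborel_pair.Fubini'[OF this] show ?thesis unfolding DI_def by simp
qed

lemma Hh_eq: "Hh f = ennreal (1 / (2 * pi)) * DI (\<lambda>s t. (f s - f t)^2 / (s - t)^2)"
  by (simp add: H_half_norm_sq_def DI_def)

lemma meas2_Hh: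
  assumes [measurable]: "f \<in> borel_measurable borel"
  shows "meas2 (\<lambda>s t. (f s - f t)^2 / (s - t)^2)"
  by measurable

text \<open>This is the contraction property of Dirichlet forms. It lets the positive part of
  \<open>f\<close> be compared with its image under a Lipschitz change.\<close>

lemma Hh_lipschitz:
  assumes k: "k \<ge> 0" "\<And>s t. \<bar>a s - a t\<bar> \<le> k * \<bar>b s - b t\<bar>" and b: "b \<in> borel_measurable borel"
  shows "Hh a \<le> ennreal (k^2) * Hh b"
proof -
  have "DI (\<lambda>s t. (a s - a t)^2 / (s - t)^2) \<le> DI (\<lambda>s t. k^2 * ((b s - b t)^2 / (s - t)^2))"
  proof (rule DI_mono)
    fix s t
    have "(a s - a t)^2 \<le> (k * \<bar>b s - b t\<bar>)^2" using power_mono[OF k(2) abs_ge_zero, of s t 2] by simp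
    then have "(a s - a t)^2 \<le> k^2 * (b s - b t)^2" by (simp add: power_mult_distrib)
    then show "(a s - a t)^2 / (s - t)^2 \<le> k^2 * ((b s - b t)^2 / (s - t)^2)"
      by (simp add: divide_right_mono)
  qed
  also have "\<dots> = ennreal (k^2) * DI (\<lambda>s t. (b s - b t)^2 / (s - t)^2)"
    by (rule DI_cmult[OF meas2_Hh[OF b]]) simp
  finally have "ennreal (1 / (2 * pi)) * DI (\<lambda>s t. (a s - a t)^2 / (s - t)^2)
      \<le> ennreal (1 / (2 * pi)) * (ennreal (k^2) * DI (\<lambda>s t. (b s - b t)^2 / (s - t)^2))"
    by (rule mult_left_mono) simp
  then show ?thesis unfolding Hh_eq by (simp only: mult.left_commute)
qed

lemma Hh_add_le:
  assumes a: "a \<in> borel_measurable borel" and b: "b \<in> borel_measurable borel" and e: "e > 0"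
  shows "Hh (\<lambda>x. a x + b x) \<le> ennreal (1 + e) * Hh a + ennreal (1 + 1/e) * Hh b"
proof -
  note [measurable] = a b
  let ?F = "\<lambda>f s t. (f s - f t)^2 / (s - t)^2 :: real"
  have "DI (?F (\<lambda>x. a x + b x)) \<le> DI (\<lambda>s t. (1 + e) * ?F a s t + (1 + 1/e) * ?F b s t)"
  proof (rule DI_mono)
    fix s t
    have "(a s + b s - (a t + b t))^2 \<le> (1 + e) * (a s - a t)^2 + (1 + 1/e) * (b s - b t)^2"
      using square_add_le[OF e, of "a s - a t" "b s - b t"] by (simp add: algebra_simps)
    then have "(a s + b s - (a t + b t))^2 / (s - t)^2 \<le> ((1 + e) * (a s - a t)^2 + (1 + 1/e) * (b s - b t)^2) / (s - t)^2"
      by (rule divide_right_mono) simp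
    then show "?F (\<lambda>x. a x + b x) s t \<le> (1 + e) * ?F a s t + (1 + 1/e) * ?F b s t"
      by (simp add: add_divide_distrib)
  qed
  also have "\<dots> = ennreal (1 + e) * DI (?F a) + ennreal (1 + 1/e) * DI (?F b)"
  proof -
    have m: "meas2 (\<lambda>s t. (1 + e) * ?F a s t)" "meas2 (\<lambda>s t. (1 + 1/e) * ?F b s t)" by measurable
    have n: "0 \<le> (1 + e) * ?F a s t" "0 \<le> (1 + 1/e) * ?F b s t" for s t using e by auto
    have c: "0 \<le> 1 + e" "0 \<le> 1 + 1/e" using e by auto
    show ?thesis
      unfolding DI_add[OF m(1) n(1) m(2) n(2)] DI_cmult[OF meas2_Hh[OF a] c(1)] DI_cmult[OF meas2_Hh[OF b] c(2)] ..
  qed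
  finally have "ennreal (1 / (2 * pi)) * DI (?F (\<lambda>x. a x + b x)) \<le> ennreal (1 / (2 * pi)) * (ennreal (1 + e) * DI (?F a) + ennreal (1 + 1/e) * DI (?F b))"
    by (rule mult_left_mono) simp
  then show ?thesis unfolding Hh_eq by (simp add: distrib_left mult.left_commute)
qed

lemma L2_affine:
  assumes \<sigma>: "\<sigma> = 1 \<or> \<sigma> = - 1" and [measurable]: "(f :: real \<Rightarrow> real) \<in> borel_measurable borel"
  shows "L2 (\<lambda>x. f (c + \<sigma> * x)) = L2 f"
  unfolding L2_norm_sq_real using \<sigma>
  by (subst (2) nn_integral_real_affine[of _ \<sigma> c]) auto

lemma Hh_affine:
  assumes \<sigma>: "\<sigma> = 1 \<or> \<sigma> = - 1" and [measurable]: "f \<in> borel_measurable borel"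
  shows "Hh (\<lambda>x. f (c + \<sigma> * x)) = Hh f"
proof -
  have s: "\<sigma> \<noteq> 0" "\<bar>\<sigma>\<bar> = 1" using \<sigma> by auto
  have k: "(c + \<sigma> * s - (c + \<sigma> * t))^2 = (s - t)^2" for s t
    using \<sigma> by (auto simp: power2_commute)
  have "DI (\<lambda>s t. (f s - f t)^2 / (s - t)^2)
     = (NN t. (NN s. ennreal ((f s - f (c + \<sigma> * t))^2 / (s - (c + \<sigma> * t))^2)))"
    unfolding DI_def
    by (subst nn_integral_real_affine[where f = "\<lambda>t. (NN s. ennreal ((f s - f t)^2 / (s - t)^2))" and t = c, OF _ s(1)]) (auto simp: s)
  also have "\<dots> = (NN t. (NN s. ennreal ((f (c + \<sigma> * s) - f (c + \<sigma> * t))^2 / (c + \<sigma> * s - (c + \<sigma> * t))^2)))"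
  proof (rule nn_integral_cong)
    fix t
    show "(NN s. ennreal ((f s - f (c + \<sigma> * t))^2 / (s - (c + \<sigma> * t))^2)) = (NN s. ennreal ((f (c + \<sigma> * s) - f (c + \<sigma> * t))^2 / (c + \<sigma> * s - (c + \<sigma> * t))^2))"
      by (subst nn_integral_real_affine[where f = "\<lambda>s. ennreal ((f s - f (c + \<sigma> * t))^2 / (s - (c + \<sigma> * t))^2)" and t = c, OF _ s(1)]) (auto simp: s)
  qed
  finally show ?thesis unfolding Hh_eq k DI_def by simp
qed

lemma nn_integral_inverse_square:
  assumes "s < y"
  shows "(\<integral>\<^sup>+t\<in>{y..}. ennreal (1 / (t - s)^2) \<partial>lborel) = ennreal (1 / (y - s))"
proof -
  have "(\<integral>\<^sup>+t\<in>{y..}. ennreal (1 / (t - s)^2) \<partial>lborel) = ennreal (0 - (- 1 / (y - s)))"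
  proof (rule nn_integral_FTC_atLeast)
    show "((\<lambda>t. - 1 / (t - s)) has_real_derivative 1 / (x - s)^2) (at x)" if "y \<le> x" for x
      using that assms by (auto intro!: derivative_eq_intros simp: power2_eq_square)
    have "((\<lambda>t. - 1 * inverse (t - s)) \<longlongrightarrow> - 1 * 0) at_top"
      by (intro tendsto_mult tendsto_const tendsto_inverse_0_at_top)
         (simp add: filterlim_tendsto_add_at_top[OF tendsto_const filterlim_ident, of "- s", simplified])
    then show "((\<lambda>t. - 1 / (t - s)) \<longlongrightarrow> 0) at_top" by (simp add: divide_inverse)
  qed auto
  then show ?thesis by simp
qed

lemma nn_integral_inverse_square':
  assumes "y < t"
  shows "(\<integral>\<^sup>+s\<in>{..y}. ennreal (1 / (t - s)^2) \<partial>lborel) = ennreal (1 / (t - y))"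
proof -
  have "(\<integral>\<^sup>+s\<in>{..y}. ennreal (1 / (t - s)^2) \<partial>lborel)
     = (NN s. ennreal (1 / (t - (- s))^2) * indicator {..y} (- s))"
    by (subst nn_integral_real_affine[of _ "-1" 0]) auto
  also have "\<dots> = (\<integral>\<^sup>+s\<in>{-y..}. ennreal (1 / (s - (- t))^2) \<partial>lborel)"
    by (intro nn_integral_cong) (auto simp: indicator_def add.commute)
  also have "\<dots> = ennreal (1 / (- y - (- t)))" by (rule nn_integral_inverse_square) (use assms in simp)
  finally show ?thesis by simp
qed

text \<open>The difference quotient is estimated by the derivative for \<open>\<bar>s - t\<bar> \<le> 1\<close> and by the function
  itself for \<open>\<bar>s - t\<bar> > 1\<close>.\<close>

lemma Hh_le_H1:
  assumes e: "sob e g"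
  shows "Hh e \<le> ennreal (1 / (2 * pi)) * (2 * L2 g + 8 * L2 e)"
proof -
  note [measurable] = sob_meas[OF e] sob_borel[OF e]
  have "DI (\<lambda>s t. (e s - e t)^2 / (s - t)^2) = (NN t. (NN u. ennreal ((e (t + u) - e t)^2 / u^2)))"
    unfolding DI_def
  proof (rule nn_integral_cong)
    fix t
    show "(NN s. ennreal ((e s - e t)^2 / (s - t)^2)) = (NN u. ennreal ((e (t + u) - e t)^2 / u^2))"
      by (subst nn_integral_real_affine[where f = "\<lambda>s. ennreal ((e s - e t)^2 / (s - t)^2)" and c = 1 and t = t]) auto
  qed
  also have "\<dots> = (NN u. (NN t. ennreal ((e (t + u) - e t)^2 / u^2)))"
    by (rule lborel_pair.Fubini') measurable
  \<comment> \<open>The range |u| \<le> 1 contributes its length 2; the two half-lines beyond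
    contribute 4 (1 + 1) = 8.\<close>
  also have "\<dots> \<le> (NN u. L2 g * indicator {-1..1} u + (4 * L2 e) * (ennreal (1 / u^2) * indicator {..-1} u + ennreal (1 / u^2) * indicator {1..} u))"
  proof (rule nn_integral_mono)
    fix u :: real
    show "(NN t. ennreal ((e (t + u) - e t)^2 / u^2)) \<le> L2 g * indicator {-1..1} u + (4 * L2 e) * (ennreal (1 / u^2) * indicator {..-1} u + ennreal (1 / u^2) * indicator {1..} u)"
    proof (cases "\<bar>u\<bar> \<le> 1")
      case True
      have "(NN t. ennreal ((e (t + u) - e t)^2 / u^2)) \<le> L2 g"
      proof (cases "u = 0")
        case False
        \<comment> \<open>The segment between t and t + u. After exchanging the integrals, each x
          lies in these segments for a set of t of measure |u|, which cancels the factor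
          1/|u|.\<close>
        define I where "I t = {min t (t + u)..max t (t + u)}" for t
        have I: "x \<in> I t \<longleftrightarrow> t \<in> {min x (x - u)..max x (x - u)}" for x t by (auto simp: I_def min_def max_def)
        have "ennreal ((e (t + u) - e t)^2 / u^2) \<le> ennreal (1 / \<bar>u\<bar>) * (NN x. ennreal ((g x)^2) * indicator (I t) x)" for t
        proof -
          have "ennreal ((e (t + u) - e t)^2) \<le> ennreal \<bar>u\<bar> * (NN x. ennreal ((g x)^2) * indicator (I t) x)"
            using sob_holder_local[OF e, of t "t + u"] sob_holder_local[OF e, of "t + u" t]
            by (cases "u \<ge> 0") (auto simp: I_def min_def max_def power2_commute)
          then have "ennreal (1 / u^2) * ennreal ((e (t + u) - e t)^2) \<le> ennreal (1 / u^2) * (ennreal \<bar>u\<bar> * (NN x. ennreal ((g x)^2) * indicator (I t) x))"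
            by (rule mult_left_mono) simp
          moreover have "1 / u^2 * \<bar>u\<bar> = 1 / \<bar>u\<bar>" using False by (simp add: power2_eq_square divide_simps)
          ultimately show ?thesis by (simp add: ennreal_mult[symmetric] mult.assoc[symmetric])
        qed
        then have "(NN t. ennreal ((e (t + u) - e t)^2 / u^2)) \<le> (NN t. ennreal (1 / \<bar>u\<bar>) * (NN x. ennreal ((g x)^2) * indicator (I t) x))"
          by (rule nn_integral_mono)
        also have "\<dots> = ennreal (1 / \<bar>u\<bar>) * (NN t. (NN x. ennreal ((g x)^2) * indicator (I t) x))"
          unfolding I_def indicator_def atLeastAtMost_iff by (rule nn_integral_cmult) measurable
        also have "(NN t. (NN x. ennreal ((g x)^2) * indicator (I t) x)) = (NN x. (NN t. ennreal ((g x)^2) * indicator (I t) x))"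
          unfolding I_def indicator_def atLeastAtMost_iff by (rule lborel_pair.Fubini') measurable
        also have "\<dots> = (NN x. ennreal ((g x)^2) * ennreal \<bar>u\<bar>)"
        proof (rule nn_integral_cong)
          fix x
          have "(NN t. ennreal ((g x)^2) * indicator (I t) x) = (\<integral>\<^sup>+t\<in>{min x (x - u)..max x (x - u)}. ennreal ((g x)^2) \<partial>lborel)"
            using I by (intro nn_integral_cong) (auto simp: indicator_def)
          also have "\<dots> = ennreal ((g x)^2) * ennreal \<bar>u\<bar>"
            by (subst nn_integral_cmult) (auto simp: min_def max_def emeasure_lborel_Icc_eq)
          finally show "(NN t. ennreal ((g x)^2) * indicator (I t) x) = ennreal ((g x)^2) * ennreal \<bar>u\<bar>" .
        qed
        also have "\<dots> = L2 g * ennreal \<bar>u\<bar>" unfolding L2_norm_sq_real by (rule nn_integral_multc) simp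
        also have "ennreal (1 / \<bar>u\<bar>) * (L2 g * ennreal \<bar>u\<bar>) = L2 g * ennreal (1 / \<bar>u\<bar> * \<bar>u\<bar>)"
          by (subst ennreal_mult) (auto simp: ac_simps)
        finally show ?thesis using False by simp
      qed simp
      then show ?thesis using True by (auto simp: indicator_def abs_le_iff intro: order_trans)
    next
      case False
      have "(NN t. ennreal ((e (t + u) - e t)^2 / u^2)) \<le> (NN t. ennreal (2 / u^2) * (ennreal ((e (t + u))^2) + ennreal ((e t)^2)))"
      proof (rule nn_integral_mono)
        fix t
        have "(e (t + u) - e t)^2 \<le> 2 * ((e (t + u))^2 + (e t)^2)"
          using square_add_le[of 1 "e (t+u)" "- e t"] by simp
        then have "(e (t + u) - e t)^2 / u^2 \<le> 2 / u^2 * ((e (t + u))^2 + (e t)^2)" by (simp add: divide_right_mono)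
        then show "ennreal ((e (t + u) - e t)^2 / u^2) \<le> ennreal (2 / u^2) * (ennreal ((e (t + u))^2) + ennreal ((e t)^2))"
          by (simp add: ennreal_real ennreal_leI del: ennreal_plus)
      qed
      also have "\<dots> = ennreal (2 / u^2) * ((NN t. ennreal ((e (t + u))^2)) + L2 e)"
        unfolding L2_norm_sq_real by (subst nn_integral_cmult, simp, subst nn_integral_add) auto
      also have "(NN t. ennreal ((e (t + u))^2)) = L2 e"
        using L2_affine[of 1 e u] by (simp add: L2_norm_sq_real add.commute)
      also have "ennreal (2 / u^2) * (L2 e + L2 e) = 4 * L2 e * ennreal (1 / u^2)"
      proof -
        have "ennreal (2 / u^2) = 2 * ennreal (1 / u^2)"
          by (subst ennreal_numeral[symmetric], subst ennreal_mult[symmetric]) auto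
        moreover have "L2 e + L2 e = 2 * L2 e" by (simp add: mult_2)
        ultimately show ?thesis by (simp add: ac_simps mult_numeral_left_semiring_numeral)
      qed
      finally show ?thesis using False by (auto simp: indicator_def)
    qed
  qed
  also have "\<dots> = 2 * L2 g + 8 * L2 e"
  proof -
    have n: "(\<integral>\<^sup>+u\<in>{1::real..}. ennreal (1 / u^2) \<partial>lborel) = 1" "(\<integral>\<^sup>+u\<in>{..-1::real}. ennreal (1 / u^2) \<partial>lborel) = 1"
      using nn_integral_inverse_square[of 0 1] nn_integral_inverse_square'[of "-1" 0] by simp_all
    have "4 * X * (1 + 1) = 8 * X" for X :: ennreal
    proof -
      have "4 * X * (1 + 1) = (2 * 4) * X" unfolding one_add_one by (simp only: mult.commute mult.left_commute mult.assoc)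
      then show ?thesis by simp
    qed
    moreover have "L2 g * emeasure lborel {-1..1::real} = 2 * L2 g" by (simp add: emeasure_lborel_Icc_eq mult.commute)
    ultimately show ?thesis
      by (subst nn_integral_add, simp, simp, subst nn_integral_cmult, simp, subst nn_integral_add, simp, simp, subst nn_integral_cmult) (auto simp: n)
  qed
  finally show ?thesis unfolding Hh_eq by (intro mult_left_mono) auto
qed

definition Qp :: "(real \<Rightarrow> real) \<Rightarrow> (real \<Rightarrow> real) \<Rightarrow> ennreal" where
  "Qp a b = DI (\<lambda>s t. max 0 (a s * b t) / (s - t)^2)"

text \<open>Two functions with disjoint supports: \<open>Qp a b\<close> and \<open>Qp (- a) b\<close> are the positive and the
  negative part of the (possibly divergent) interaction integral.\<close>

lemma Hh_split:
  assumes a[measurable]: "a \<in> borel_measurable borel" and b[measurable]: "b \<in> borel_measurable borel"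
    and dis: "\<And>x. a x = 0 \<or> b x = 0"
  shows "Hh (\<lambda>x. a x + b x) + ennreal (2 / pi) * Qp a b
       = Hh a + Hh b + ennreal (2 / pi) * Qp (\<lambda>x. - a x) b"
proof -
  let ?F = "\<lambda>f s t. (f s - f t)^2 / (s - t)^2 :: real"
  let ?P = "\<lambda>s t. max 0 (a s * b t) / (s - t)^2"
  let ?N = "\<lambda>s t. max 0 (- a s * b t) / (s - t)^2"
  \<comment> \<open>For disjoint supports the cross term of the square is -2 (a s b t + a t b s).
    Its two signs are placed on different sides, so that all terms are nonnegative and no infinite
    quantity is subtracted.\<close>
  have pw: "?F (\<lambda>x. a x + b x) s t + 2 * (?P s t + ?P t s) = (?F a s t + ?F b s t) + 2 * (?N s t + ?N t s)" for s t
  proof -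
    have m: "max 0 y - max 0 (- y) = y" for y :: real by (auto simp: max_def)
    have "(a s + b s - (a t + b t))^2 + 2 * (max 0 (a s * b t) + max 0 (a t * b s))
      = ((a s - a t)^2 + (b s - b t)^2) + 2 * (max 0 (- (a s * b t)) + max 0 (- (a t * b s)))"
      using dis[of s] dis[of t] m[of "a s * b t"] m[of "a t * b s"] by (auto simp: power2_eq_square algebra_simps)
    then have "((a s + b s - (a t + b t))^2 + 2 * (max 0 (a s * b t) + max 0 (a t * b s))) / (s - t)^2
      = (((a s - a t)^2 + (b s - b t)^2) + 2 * (max 0 (- (a s * b t)) + max 0 (- (a t * b s)))) / (s - t)^2" by simp
    then show ?thesis by (simp add: add_divide_distrib power2_commute[of t s])
  qed
  have mP: "meas2 ?P" "meas2 (\<lambda>s t. ?P t s)" and mN: "meas2 ?N" "meas2 (\<lambda>s t. ?N t s)" by measurable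
  have n0: "0 \<le> ?P s t" "0 \<le> ?N s t" for s t by auto
  have ab: "(\<lambda>x. a x + b x) \<in> borel_measurable borel" by simp
  have m2: "meas2 (\<lambda>s t. ?P s t + ?P t s)" "meas2 (\<lambda>s t. ?N s t + ?N t s)" "meas2 (\<lambda>s t. ?F a s t + ?F b s t)" by measurable
  have m3: "meas2 (\<lambda>s t. 2 * (?P s t + ?P t s))" "meas2 (\<lambda>s t. 2 * (?N s t + ?N t s))" by measurable
  have n2: "0 \<le> ?P s t + ?P t s" "0 \<le> ?N s t + ?N t s" "0 \<le> ?F f s t" "0 \<le> ?F a s t + ?F b s t"
    "0 \<le> 2 * (?P s t + ?P t s)" "0 \<le> 2 * (?N s t + ?N t s)" for s t f
    using n0(1)[of s t] n0(1)[of t s] n0(2)[of s t] n0(2)[of t s] by (simp_all add: add_nonneg_nonneg)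
  have L: "DI (\<lambda>s t. ?F (\<lambda>x. a x + b x) s t + 2 * (?P s t + ?P t s)) = DI (?F (\<lambda>x. a x + b x)) + ennreal 2 * (DI ?P + DI ?P)"
    unfolding DI_add[OF meas2_Hh[OF ab] n2(3) m3(1) n2(5)] DI_cmult[OF m2(1) zero_le_numeral]
      DI_add[OF mP(1) n0(1) mP(2) n0(1)] DI_swap[OF mP(1)] ..
  have R: "DI (\<lambda>s t. (?F a s t + ?F b s t) + 2 * (?N s t + ?N t s)) = DI (?F a) + DI (?F b) + ennreal 2 * (DI ?N + DI ?N)"
    unfolding DI_add[OF m2(3) n2(4) m3(2) n2(6)] DI_cmult[OF m2(2) zero_le_numeral]
      DI_add[OF mN(1) n0(2) mN(2) n0(2)] DI_swap[OF mN(1)] DI_add[OF meas2_Hh[OF a] n2(3) meas2_Hh[OF b] n2(3)] ..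
  have eq: "DI (?F (\<lambda>x. a x + b x)) + 2 * (DI ?P + DI ?P) = DI (?F a) + DI (?F b) + 2 * (DI ?N + DI ?N)"
    using L R by (simp only: pw ennreal_numeral)
  have c: "ennreal (1 / (2 * pi)) * (2 * (X + X)) = ennreal (2 / pi) * X" for X
  proof -
    have "ennreal (1 / (2 * pi)) * (2 * (X + X)) = ennreal (1 / (2 * pi)) * ennreal 4 * X"
      by (simp add: mult_2[symmetric] mult.assoc[symmetric])
    also have "ennreal (1 / (2 * pi)) * ennreal 4 = ennreal (2 / pi)"
      by (subst ennreal_mult[symmetric]) auto
    finally show ?thesis .
  qed
  have d: "ennreal (1 / (2 * pi)) * (U + 2 * (X + X)) = ennreal (1 / (2 * pi)) * U + ennreal (2 / pi) * X" for U X
    by (simp only: distrib_left[of "ennreal (1 / (2 * pi))" U "2 * (X + X)"] c)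
  show ?thesis
    using arg_cong[OF eq, of "\<lambda>x. ennreal (1 / (2 * pi)) * x"]
    unfolding d unfolding Hh_eq Qp_def by (simp only: distrib_left)
qed

text \<open>The IMS localisation formula; only the product \<open>f s * f t\<close> enters the error term, so
  nothing is lost on the diagonal.\<close>

lemma Hh_localise:
  assumes f[measurable]: "f \<in> borel_measurable borel" and b[measurable]: "b \<in> borel_measurable borel"
  shows "Hh (\<lambda>x. cos (b x) * f x) \<le> Hh f
    + ennreal (1 / (2 * pi)) * DI (\<lambda>s t. \<bar>f s\<bar> * \<bar>f t\<bar> * (2 - 2 * cos (b s - b t)) / (s - t)^2)"
proof -
  let ?E = "\<lambda>s t. \<bar>f s\<bar> * \<bar>f t\<bar> * (2 - 2 * cos (b s - b t)) / (s - t)^2"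
  have "DI (\<lambda>s t. (cos (b s) * f s - cos (b t) * f t)^2 / (s - t)^2) \<le> DI (\<lambda>s t. (f s - f t)^2 / (s - t)^2 + ?E s t)"
  proof (rule DI_mono)
    fix s t
    \<comment> \<open>cos^2 + sin^2 = 1 is a quadratic partition of unity; the sine part is
      nonnegative and is discarded.\<close>
    have id: "(cos (b s) * f s - cos (b t) * f t)^2 + (sin (b s) * f s - sin (b t) * f t)^2 = (f s - f t)^2 + f s * f t * (2 - 2 * cos (b s - b t))"
    proof -
      have "(cos (b s) * f s - cos (b t) * f t)^2 + (sin (b s) * f s - sin (b t) * f t)^2
        = ((cos (b s))^2 + (sin (b s))^2) * (f s)^2 + ((cos (b t))^2 + (sin (b t))^2) * (f t)^2 - 2 * (f s * f t * cos (b s - b t))"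
        unfolding cos_diff by algebra
      then show ?thesis by (simp add: power2_eq_square algebra_simps)
    qed
    have "f s * f t * (2 - 2 * cos (b s - b t)) \<le> \<bar>f s\<bar> * \<bar>f t\<bar> * (2 - 2 * cos (b s - b t))"
      by (intro mult_right_mono) (auto simp: abs_mult[symmetric])
    then have "(cos (b s) * f s - cos (b t) * f t)^2 \<le> (f s - f t)^2 + \<bar>f s\<bar> * \<bar>f t\<bar> * (2 - 2 * cos (b s - b t))"
      using id zero_le_power2[of "sin (b s) * f s - sin (b t) * f t"] by linarith
    then have "(cos (b s) * f s - cos (b t) * f t)^2 / (s - t)^2 \<le> ((f s - f t)^2 + \<bar>f s\<bar> * \<bar>f t\<bar> * (2 - 2 * cos (b s - b t))) / (s - t)^2"
      by (rule divide_right_mono) simp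
    then show "(cos (b s) * f s - cos (b t) * f t)^2 / (s - t)^2 \<le> (f s - f t)^2 / (s - t)^2 + ?E s t"
      by (simp add: add_divide_distrib)
  qed
  also have "\<dots> = DI (\<lambda>s t. (f s - f t)^2 / (s - t)^2) + DI ?E"
    by (intro DI_add meas2_Hh[OF f]) (auto intro!: divide_nonneg_nonneg mult_nonneg_nonneg)
  finally show ?thesis unfolding Hh_eq by (simp add: distrib_left[symmetric] mult_left_mono)
qed

section \<open>Profiles and their concatenation\<close>

lemma sob_ramp:
  assumes ab: "a \<le> b"
  shows "sob (\<lambda>x. min b (max a x)) (indicator {a..b})"
proof (rule sobI)
  have "L2 (indicat_real {a..b}) = (NN x. indicator {a..b} x)"
    unfolding L2_norm_sq_real by (intro nn_integral_cong) (auto simp: indicator_def)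
  then show "L2 (indicat_real {a..b}) < \<infinity>" by (simp add: emeasure_lborel_Icc_eq)
  fix p q :: real assume pq: "p \<le> q"
  have "(LBINT x:{p..q}. indicat_real {a..b} x) = (\<integral>x. indicator {max p a..min q b} x \<partial>lborel)"
    unfolding set_lebesgue_integral_def by (intro Bochner_Integration.integral_cong) (auto simp: indicator_def)
  also have "\<dots> = measure lborel {max p a..min q b}" by simp
  also have "\<dots> = min b (max a q) - min b (max a p)"
    using pq ab by (cases "max p a \<le> min q b") (auto simp: measure_def max_def min_def split: if_splits)
  finally show "min b (max a q) - min b (max a p) = (LBINT x:{p..q}. indicat_real {a..b} x)" ..
qed simp

lemma sob_clamp:
  assumes u: "sob u g"
  shows "\<exists>k. sob (\<lambda>x. max a (min b (u x))) k \<and> (\<forall>x. \<bar>k x\<bar> \<le> \<bar>g x\<bar>)"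
proof -
  have s: "\<bar>(y + 0 + sgn z * (y - 0)) / 2\<bar> \<le> \<bar>y\<bar>" "\<bar>(y + 0 - sgn z * (y - 0)) / 2\<bar> \<le> \<bar>y\<bar>" "\<bar>(0 + y + sgn z * (0 - y)) / 2\<bar> \<le> \<bar>y\<bar>" "\<bar>(0 + y - sgn z * (0 - y)) / 2\<bar> \<le> \<bar>y\<bar>"
    for y z :: real by (auto simp: sgn_if)
  note m = sob_min[OF sob_const[of b] u]
  note M = sob_max[OF sob_const[of a] m]
  show ?thesis
  proof (intro exI conjI allI, rule M)
    fix x
    show "\<bar>(0 + (0 + g x - sgn (b - u x) * (0 - g x)) / 2 + sgn (a - min b (u x)) * (0 - (0 + g x - sgn (b - u x) * (0 - g x)) / 2)) / 2\<bar> \<le> \<bar>g x\<bar>"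
      using order_trans[OF s(3) s(4)] .
  qed
qed

lemma ee_cong:
  assumes "\<And>x. cos (\<phi> x) = cos (\<phi>' x)" "\<And>x. \<bar>g x\<bar> = \<bar>g' x\<bar>"
  shows "ee h \<phi> g = ee h \<phi>' g'"
proof -
  have "(g x)^2 = (g' x)^2" for x using assms(2)[of x] by (metis power2_abs)
  then show ?thesis unfolding ee_def L2_norm_sq_real using assms(1) by simp
qed

lemma ee_affine:
  assumes s: "sob \<phi> g" and \<sigma>: "\<sigma> = 1 \<or> \<sigma> = - 1"
  shows "ee h (\<lambda>x. \<phi> (c + \<sigma> * x)) (\<lambda>x. \<sigma> * g (c + \<sigma> * x)) = ee h \<phi> g"
proof -
  note [measurable] = sob_meas[OF s] sob_borel[OF s]
  have "L2 (\<lambda>x. \<sigma> * g (c + \<sigma> * x)) = L2 (\<lambda>x. g (c + \<sigma> * x))"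
    using \<sigma> by (auto simp: L2_norm_sq_real)
  also have "\<dots> = L2 g" by (rule L2_affine[OF \<sigma>]) simp
  finally show ?thesis
    unfolding ee_def
    using L2_affine[OF \<sigma>, of "\<lambda>x. cos (\<phi> x) - h" c] Hh_affine[OF \<sigma>, of "\<lambda>x. cos (\<phi> x) - h" c] by simp
qed

lemma nn_integral_tail:
  fixes X0 :: real
  assumes [measurable]: "F \<in> borel_measurable borel" and fin: "(NN x. F x) < \<infinity>" and e: "e > 0"
  shows "\<exists>X\<ge>X0. (\<integral>\<^sup>+x\<in>{X..}. F x \<partial>lborel) < e"
proof -
  have "(\<lambda>n::nat. \<integral>\<^sup>+x\<in>{real n..}. F x \<partial>lborel) \<longlonglongrightarrow> (\<integral>\<^sup>+x. 0 \<partial>(lborel :: real measure))"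
  proof (rule nn_integral_dominated_convergence[where w = F and u = "\<lambda>n x. F x * indicator {real n..} x" and u' = "\<lambda>x. 0"])
    show "AE x in lborel. (\<lambda>n::nat. F x * indicator {real n..} x) \<longlonglongrightarrow> 0"
    proof (intro AE_I2 tendsto_eventually)
      fix x :: real
      obtain N :: nat where "x < real N" using reals_Archimedean2 by blast
      then show "\<forall>\<^sub>F n in sequentially. F x * indicator {real n..} x = 0"
        by (intro eventually_sequentiallyI[of N]) (auto simp: indicator_def)
    qed
  qed (use fin in \<open>auto simp: indicator_def\<close>)
  then have "\<forall>\<^sub>F n in sequentially. (\<integral>\<^sup>+x\<in>{real n..}. F x \<partial>lborel) < e"
    using e by (auto intro: order_tendstoD)
  moreover have "\<forall>\<^sub>F n in sequentially. X0 \<le> real n"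
    using eventually_ge_at_top[of "nat \<lceil>X0\<rceil>"] by eventually_elim linarith
  ultimately have "\<forall>\<^sub>F n in sequentially. X0 \<le> real n \<and> (\<integral>\<^sup>+x\<in>{real n..}. F x \<partial>lborel) < e"
    by eventually_elim auto
  then show ?thesis unfolding eventually_sequentially by blast
qed

text \<open>The limit of the angle is a nondegenerate zero of cos - h. Near it the deviation of the
  angle is therefore controlled by \<open>f\<close>, and is square-integrable in the tail.\<close>

lemma cos_lower_bound_near:
  fixes \<rho> :: real
  assumes "sin \<rho> \<noteq> 0"
  shows "\<exists>r>0. \<forall>y. \<bar>y - \<rho>\<bar> < r \<longrightarrow> \<bar>sin \<rho>\<bar> / 2 * \<bar>y - \<rho>\<bar> \<le> \<bar>cos y - cos \<rho>\<bar>"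
proof -
  have "((\<lambda>y. (cos y - cos \<rho>) / (y - \<rho>)) \<longlongrightarrow> - sin \<rho>) (at \<rho>)"
    using DERIV_cos[of \<rho>] by (simp add: has_field_derivative_iff)
  then have "((\<lambda>y. \<bar>(cos y - cos \<rho>) / (y - \<rho>)\<bar>) \<longlongrightarrow> \<bar>- sin \<rho>\<bar>) (at \<rho>)" by (rule tendsto_rabs)
  then have "\<forall>\<^sub>F y in at \<rho>. \<bar>sin \<rho>\<bar> / 2 < \<bar>(cos y - cos \<rho>) / (y - \<rho>)\<bar>"
    by (rule order_tendstoD) (use assms in auto)
  then obtain r where r: "r > 0" "\<And>y. y \<noteq> \<rho> \<Longrightarrow> \<bar>y - \<rho>\<bar> < r \<Longrightarrow> \<bar>sin \<rho>\<bar> / 2 < \<bar>(cos y - cos \<rho>) / (y - \<rho>)\<bar>"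
    unfolding eventually_at dist_real_def by auto
  have "\<bar>sin \<rho>\<bar> / 2 * \<bar>y - \<rho>\<bar> \<le> \<bar>cos y - cos \<rho>\<bar>" if "\<bar>y - \<rho>\<bar> < r" for y
    using r(2)[of y] that by (cases "y = \<rho>") (auto simp: abs_divide divide_simps)
  then show ?thesis using r(1) by blast
qed

lemma abs_cos_diff_le: "\<bar>cos x - cos y\<bar> \<le> \<bar>x - y\<bar>" for x y :: real
proof -
  have *: "\<bar>cos x - cos y\<bar> \<le> \<bar>x - y\<bar>" if xy: "x < y" for x y :: real
  proof -
    obtain z where "cos y - cos x = (y - x) * (- sin z)"
      using MVT2[OF xy, of cos "\<lambda>z. - sin z"] by (auto intro!: derivative_eq_intros)
    then have "\<bar>cos y - cos x\<bar> = \<bar>y - x\<bar> * \<bar>sin z\<bar>" by (simp add: abs_mult)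
    also have "\<dots> \<le> \<bar>y - x\<bar> * 1" by (intro mult_left_mono) auto
    finally show ?thesis by (simp add: abs_minus_commute)
  qed
  show ?thesis using *[of x y] *[of y x] by (cases x y rule: linorder_cases) (auto simp: abs_minus_commute)
qed

text \<open>Both limits are prescribed instead of the degree, so that pieces with matching limits
  can be concatenated.\<close>

definition profile :: "real \<Rightarrow> real \<Rightarrow> real \<Rightarrow> (real \<Rightarrow> real) \<Rightarrow> (real \<Rightarrow> real) \<Rightarrow> bool" where
  "profile h \<beta> \<rho> \<phi> g \<longleftrightarrow> sob \<phi> g \<and> ee h \<phi> g < \<infinity> \<and> (\<phi> \<longlongrightarrow> \<beta>) at_bot \<and> (\<phi> \<longlongrightarrow> \<rho>) at_top"

text \<open>Makes a profile exactly constant near infinity at arbitrarily small cost. The deviation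
  from \<rho> is multiplied by a linear cutoff far out; the change of cos \<phi> is then small in
  H1, hence in the half-order seminorm by \<open>Hh_le_H1\<close>.\<close>

lemma cut_right:
  assumes s: "sob \<phi> g" and fin: "ee h \<phi> g < \<infinity>" and lim: "(\<phi> \<longlongrightarrow> \<rho>) at_top"
    and \<rho>: "cos \<rho> = h" "sin \<rho> \<noteq> 0" and \<delta>: "\<delta> > 0"
  shows "\<exists>\<phi>' g' X. sob \<phi>' g' \<and> (\<forall>x\<ge>X. \<phi>' x = \<rho>) \<and> (\<exists>Y. \<forall>x\<le>Y. \<phi>' x = \<phi> x) \<and> ee h \<phi>' g' \<le> ee h \<phi> g + ennreal \<delta>"
proof -
  note [measurable] = sob_meas[OF s] sob_borel[OF s]
  define f where "f x = cos (\<phi> x) - h" for x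
  define c where "c = 4 / (sin \<rho>)^2 + 1"
  have c1: "c \<ge> 1" by (simp add: c_def)
  obtain E where E: "ee h \<phi> g = ennreal E" "E \<ge> 0" using fin by (cases "ee h \<phi> g") auto
  \<comment> \<open>Weight of the cross terms between the old function and its change: the old
    energy E grows by at most \<eta> E \<le> \<delta>/2, and the tail beyond \<open>X\<close> is
    afterwards taken small relative to 1/\<eta>.\<close>
  define \<eta> where "\<eta> = \<delta> / (2 * (E + 1))"
  have \<eta>: "\<eta> > 0" using \<delta> E by (simp add: \<eta>_def)
  have \<eta>E: "\<eta> * E \<le> \<delta> / 2" using \<delta> E by (simp add: \<eta>_def field_simps)
  \<comment> \<open>2 comes from the derivative of the new angle, 5 = 4 + 1 from the half-order
    seminorm and the L2 norm of the change, each weighted by 1 + 1/\<eta>; \<open>c\<close> converts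
    the squared deviation from \<rho> into f^2.\<close>
  define C where "C = (2 + 5 * (1 + 1/\<eta>)) * c"
  have C: "C > 0" using \<eta> c1 by (simp add: C_def add_pos_pos)
  obtain r where r: "r > 0" "\<And>y. \<bar>y - \<rho>\<bar> < r \<Longrightarrow> \<bar>sin \<rho>\<bar> / 2 * \<bar>y - \<rho>\<bar> \<le> \<bar>cos y - cos \<rho>\<bar>"
    using cos_lower_bound_near[OF \<rho>(2)] by blast
  have "\<forall>\<^sub>F x in at_top. dist (\<phi> x) \<rho> < min r 1" using tendstoD[OF lim, of "min r 1"] r(1) by simp
  then obtain X0 where X0: "\<And>x. x \<ge> X0 \<Longrightarrow> \<bar>\<phi> x - \<rho>\<bar> < r \<and> \<bar>\<phi> x - \<rho>\<bar> < 1"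
    unfolding eventually_at_top_linorder dist_real_def by auto
  have fm[measurable]: "f \<in> borel_measurable borel" unfolding f_def by measurable
  have "(NN x. ennreal ((g x)^2) + ennreal ((f x)^2)) \<le> ee h \<phi> g"
    unfolding ee_def L2_norm_sq_real f_def
    by (subst nn_integral_add) (auto intro!: add_mono)
  then have "(NN x. ennreal ((g x)^2) + ennreal ((f x)^2)) < \<infinity>" using fin by (rule le_less_trans)
  from nn_integral_tail[OF _ this, of "ennreal (\<delta> / (2 * C))" X0]
  obtain X where X: "X \<ge> X0" "(\<integral>\<^sup>+x\<in>{X..}. (ennreal ((g x)^2) + ennreal ((f x)^2)) \<partial>lborel) < ennreal (\<delta> / (2 * C))"
    using \<delta> C by auto
  define \<omega> where "\<omega> x = \<phi> x - \<rho>" for x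
  define T where "T = (\<integral>\<^sup>+x\<in>{X..}. ennreal ((g x)^2 + (\<omega> x)^2) \<partial>lborel)"
  have \<omega>m[measurable]: "\<omega> \<in> borel_measurable borel" unfolding \<omega>_def by measurable
  have \<omega>1: "\<bar>\<omega> x\<bar> < 1" "(\<omega> x)^2 \<le> (c - 1) * (f x)^2" if "x \<ge> X" for x
  proof -
    have x: "\<bar>\<phi> x - \<rho>\<bar> < r" "\<bar>\<phi> x - \<rho>\<bar> < 1" using X0[of x] X(1) that by auto
    then show "\<bar>\<omega> x\<bar> < 1" by (simp add: \<omega>_def)
    have "(\<bar>sin \<rho>\<bar> / 2 * \<bar>\<omega> x\<bar>)^2 \<le> \<bar>f x\<bar>^2"
      using r(2)[OF x(1)] \<rho>(1) by (intro power_mono) (auto simp: f_def \<omega>_def)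
    then show "(\<omega> x)^2 \<le> (c - 1) * (f x)^2"
      using \<rho>(2) by (simp add: c_def power_mult_distrib power_divide field_simps)
  qed
  have T: "ennreal (C / c) * T \<le> ennreal (\<delta> / 2)"
  proof -
    have "T \<le> (NN x. ennreal c * ((ennreal ((g x)^2) + ennreal ((f x)^2)) * indicator {X..} x))"
      unfolding T_def
    proof (rule nn_integral_mono)
      fix x
      have "(g x)^2 + (\<omega> x)^2 \<le> c * ((g x)^2 + (f x)^2)" if "x \<ge> X"
        using \<omega>1(2)[OF that] c1 mult_right_mono[OF c1 zero_le_power2[of "g x"]] zero_le_power2[of "f x"]
        unfolding distrib_left left_diff_distrib mult_1 by linarith
      then show "ennreal ((g x)^2 + (\<omega> x)^2) * indicator {X..} x \<le> ennreal c * ((ennreal ((g x)^2) + ennreal ((f x)^2)) * indicator {X..} x)"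
        using c1 by (auto simp: indicator_def ennreal_real simp del: ennreal_plus intro!: ennreal_leI)
    qed
    also have "\<dots> = ennreal c * (\<integral>\<^sup>+x\<in>{X..}. (ennreal ((g x)^2) + ennreal ((f x)^2)) \<partial>lborel)"
      by (rule nn_integral_cmult) simp
    also have "\<dots> \<le> ennreal c * ennreal (\<delta> / (2 * C))" using X(2) by (intro mult_left_mono) auto
    finally have "ennreal (C / c) * T \<le> ennreal (C / c) * (ennreal c * ennreal (\<delta> / (2 * C)))" by (rule mult_left_mono) simp
    also have "\<dots> = ennreal (\<delta> / 2)"
      using C c1 \<delta> by (simp add: ennreal_mult[symmetric])
    finally show ?thesis .
  qed
  obtain k where k: "sob (\<lambda>x. max (-1) (min 1 (- \<rho> + \<phi> x))) k" "\<And>x. \<bar>k x\<bar> \<le> \<bar>g x\<bar>"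
    using sob_clamp[OF sob_shift_const[OF s, of "- \<rho>"], of "-1" 1] by blast
  define K where "K x = X + 1 - min (X + 1) (max X x)" for x
  have Ks: "sob K (\<lambda>x. 0 - indicator {X..X+1} x)"
    unfolding K_def[abs_def] by (intro sob_diff sob_const sob_ramp) simp
  \<comment> \<open>The product rule wants factors bounded on the whole line, so the deviation from
    \<rho> is clamped to [-1, 1]. Beyond \<open>X\<close> the clamp is inactive.\<close>
  define w where "w x = max (-1) (min 1 (- \<rho> + \<phi> x))" for x
  have K01: "0 \<le> K x" "K x \<le> 1" for x by (auto simp: K_def)
  have w\<omega>: "w x = \<omega> x" if "x \<ge> X" for x using \<omega>1(1)[OF that] by (auto simp: w_def \<omega>_def)
  have ws: "sob w k" using k(1) by (simp add: w_def[abs_def])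
  have Kw: "sob (\<lambda>x. K x * w x) (\<lambda>x. K x * k x + w x * (0 - indicator {X..X+1} x))"
    by (rule sob_mult[OF Ks ws, of 1 1]) (use K01 in \<open>auto simp: w_def\<close>)
  define \<phi>' where "\<phi>' x = (if x \<le> X then \<phi> x else \<rho> + K x * w x)" for x
  define g' where "g' x = (if x \<le> X then g x else K x * k x + w x * (0 - indicator {X..X+1} x))" for x
  have "\<phi> X = \<rho> + K X * w X" by (simp add: w\<omega> \<omega>_def K_def)
  then have s': "sob \<phi>' g'" unfolding \<phi>'_def[abs_def] g'_def[abs_def]
    by (rule sob_join[OF s sob_shift_const[OF Kw]])
  note [measurable] = sob_meas[OF s'] sob_borel[OF s']
  have g'le: "\<bar>g' x\<bar> \<le> \<bar>g x\<bar> + \<bar>\<omega> x\<bar>" if "x \<ge> X" for x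
  proof (cases "x = X")
    case False
    then have "g' x = K x * k x + w x * (0 - indicator {X..X+1} x)" using that by (simp add: g'_def)
    also have "\<bar>\<dots>\<bar> \<le> \<bar>K x * k x\<bar> + \<bar>w x * (0 - indicator {X..X+1} x)\<bar>" by (rule abs_triangle_ineq)
    also have "\<bar>K x * k x\<bar> \<le> 1 * \<bar>g x\<bar>" unfolding abs_mult using K01[of x] k(2)[of x] by (intro mult_mono) auto
    also have "\<bar>w x * (0 - indicator {X..X+1} x)\<bar> \<le> \<bar>\<omega> x\<bar>" using w\<omega>[OF that] by (auto simp: indicator_def)
    finally show ?thesis by simp
  qed (simp add: g'_def)
  have sq: "(\<bar>p\<bar> + \<bar>q\<bar>)^2 \<le> 2 * (p^2 + q^2)" for p q :: real
    using square_add_le[of 1 "\<bar>p\<bar>" "\<bar>q\<bar>"] by simp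
  have Lg': "L2 g' \<le> L2 g + ennreal 2 * T"
  proof -
    have "L2 g' \<le> (NN x. ennreal ((g x)^2) + ennreal 2 * (ennreal ((g x)^2 + (\<omega> x)^2) * indicator {X..} x))"
      unfolding L2_norm_sq_real
    proof (rule nn_integral_mono)
      fix x
      show "ennreal ((g' x)^2) \<le> ennreal ((g x)^2) + ennreal 2 * (ennreal ((g x)^2 + (\<omega> x)^2) * indicator {X..} x)"
      proof (cases "x \<ge> X")
        case True
        have "(g' x)^2 \<le> (\<bar>g x\<bar> + \<bar>\<omega> x\<bar>)^2" using g'le[OF True] by (metis abs_ge_zero power2_abs power_mono)
        then have "(g' x)^2 \<le> (g x)^2 + 2 * ((g x)^2 + (\<omega> x)^2)" using sq[of "g x" "\<omega> x"] by (smt (verit) zero_le_power2)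
        then show ?thesis using True by (simp add: ennreal_real ennreal_leI del: ennreal_plus ennreal_numeral)
      qed (simp add: g'_def)
    qed
    also have "\<dots> = L2 g + ennreal 2 * T"
      unfolding L2_norm_sq_real T_def by (subst nn_integral_add, simp, simp, subst nn_integral_cmult) auto
    finally show ?thesis .
  qed
  define e where "e x = cos (\<phi>' x) - cos (\<phi> x)" for x
  define l where "l x = - sin (\<phi>' x) * g' x - - sin (\<phi> x) * g x" for x
  have es: "sob e l" unfolding e_def[abs_def] l_def[abs_def] by (intro sob_diff sob_cos s s')
  note [measurable] = sob_meas[OF es] sob_borel[OF es]
  have e0: "e x = 0" "l x = 0" if "x < X" for x using that by (auto simp: e_def l_def \<phi>'_def g'_def)
  have e1: "(e x)^2 \<le> (g x)^2 + (\<omega> x)^2" if "x \<ge> X" for x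
  proof -
    have "\<bar>e x\<bar> \<le> \<bar>\<phi>' x - \<phi> x\<bar>" unfolding e_def by (rule abs_cos_diff_le)
    also have "\<dots> \<le> \<bar>\<omega> x\<bar>"
    proof (cases "x = X")
      case False
      then have "\<phi>' x - \<phi> x = (K x - 1) * \<omega> x" using that unfolding \<phi>'_def w\<omega>[OF that] by (simp add: \<omega>_def algebra_simps)
      also have "\<bar>\<dots>\<bar> \<le> 1 * \<bar>\<omega> x\<bar>" unfolding abs_mult using K01[of x] by (intro mult_right_mono) auto
      finally show ?thesis by simp
    qed (simp add: \<phi>'_def)
    finally have "(e x)^2 \<le> (\<omega> x)^2" by (metis abs_ge_zero power2_abs power_mono)
    then show ?thesis by (smt (verit) zero_le_power2)
  qed
  have l1: "(l x)^2 \<le> 8 * ((g x)^2 + (\<omega> x)^2)" if "x \<ge> X" for x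
  proof -
    have "\<bar>l x\<bar> \<le> \<bar>sin (\<phi>' x)\<bar> * \<bar>g' x\<bar> + \<bar>sin (\<phi> x)\<bar> * \<bar>g x\<bar>"
      unfolding l_def abs_mult[symmetric] by linarith
    also have "\<dots> \<le> 1 * \<bar>g' x\<bar> + 1 * \<bar>g x\<bar>" by (intro add_mono mult_right_mono) auto
    also have "\<dots> \<le> 2 * (\<bar>g x\<bar> + \<bar>\<omega> x\<bar>)" using g'le[OF that] by simp
    finally have "\<bar>l x\<bar>^2 \<le> (2 * (\<bar>g x\<bar> + \<bar>\<omega> x\<bar>))^2" by (intro power_mono) auto
    then have "(l x)^2 \<le> 4 * (\<bar>g x\<bar> + \<bar>\<omega> x\<bar>)^2" by (simp only: power_mult_distrib power2_abs) simp
    then show ?thesis using sq[of "g x" "\<omega> x"] by linarith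
  qed
  have Le: "L2 e \<le> T"
    unfolding L2_norm_sq_real T_def
  proof (rule nn_integral_mono)
    fix x show "ennreal ((e x)^2) \<le> ennreal ((g x)^2 + (\<omega> x)^2) * indicator {X..} x"
      using e0[of x] e1[of x] by (cases "x \<ge> X") (auto simp del: ennreal_plus intro!: ennreal_leI)
  qed
  have Ll: "L2 l \<le> ennreal 8 * T"
  proof -
    have "L2 l \<le> (NN x. ennreal 8 * (ennreal ((g x)^2 + (\<omega> x)^2) * indicator {X..} x))"
      unfolding L2_norm_sq_real
    proof (rule nn_integral_mono)
      fix x show "ennreal ((l x)^2) \<le> ennreal 8 * (ennreal ((g x)^2 + (\<omega> x)^2) * indicator {X..} x)"
        using e0[of x] l1[of x] by (cases "x \<ge> X") (auto simp: ennreal_mult[symmetric] simp del: ennreal_plus ennreal_numeral intro!: ennreal_leI)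
    qed
    also have "\<dots> = ennreal 8 * T" unfolding T_def by (rule nn_integral_cmult) simp
    finally show ?thesis .
  qed
  have He: "Hh e \<le> ennreal 4 * T"
  proof -
    have "Hh e \<le> ennreal (1 / (2 * pi)) * (2 * (ennreal 8 * T) + 8 * T)"
      using Hh_le_H1[OF es] Ll Le by (elim order_trans) (intro mult_left_mono add_mono; simp)
    also have "2 * (ennreal 8 * T) + 8 * T = ennreal 24 * T"
    proof -
      have "2 * (ennreal 8 * T) + 8 * T = (2 * 8 + 8) * T" by (simp only: distrib_right ennreal_numeral mult.assoc)
      then show ?thesis by simp
    qed
    also have "ennreal (1 / (2 * pi)) * (ennreal 24 * T) = ennreal (1 / (2 * pi) * 24) * T"
      by (subst ennreal_mult) (auto simp: mult.assoc)
    also have "\<dots> \<le> ennreal 4 * T"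
      using pi_gt3 by (intro mult_right_mono ennreal_leI) (auto simp: field_simps)
    finally show ?thesis .
  qed
  have f': "(\<lambda>x. cos (\<phi>' x) - h) = (\<lambda>x. f x + e x)" by (auto simp: f_def e_def)
  have "ee h \<phi>' g' = L2 g' + Hh (\<lambda>x. f x + e x) + L2 (\<lambda>x. f x + e x)"
    by (simp add: ee_def f')
  also have "\<dots> \<le> (L2 g + ennreal 2 * T) + (ennreal (1 + \<eta>) * Hh f + ennreal (1 + 1/\<eta>) * (ennreal 4 * T))
     + (ennreal (1 + \<eta>) * L2 f + ennreal (1 + 1/\<eta>) * T)"
    by (intro add_mono Lg' order_trans[OF Hh_add_le[OF _ _ \<eta>]] order_trans[OF L2_norm_sq_add[OF _ _ \<eta>]] mult_left_mono He Le) auto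
  also have "\<dots> \<le> ennreal (1 + \<eta>) * ee h \<phi> g + ennreal (C / c) * T"
  proof -
    have "L2 g \<le> ennreal (1 + \<eta>) * L2 g"
      using mult_right_mono[of 1 "ennreal (1 + \<eta>)" "L2 g"] \<eta> by (simp del: ennreal_plus)
    moreover have "ennreal 2 * T + ennreal (1 + 1/\<eta>) * (ennreal 4 * T) + ennreal (1 + 1/\<eta>) * T = ennreal (C / c) * T"
    proof -
      have "C / c = 2 + (1 + 1/\<eta>) * 4 + (1 + 1/\<eta>)" using c1 by (simp add: C_def)
      moreover have "ennreal (2 + (1 + 1/\<eta>) * 4 + (1 + 1/\<eta>)) = ennreal 2 + ennreal (1 + 1/\<eta>) * ennreal 4 + ennreal (1 + 1/\<eta>)"
        using \<eta> by (simp add: ennreal_real del: ennreal_plus ennreal_numeral)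
      ultimately show ?thesis by (simp only: distrib_right mult.assoc)
    qed
    moreover have "(G + t2) + (a + t4) + (b + t1) = (G + (a + b)) + (t2 + t4 + t1)" for G t2 a t4 b t1 :: ennreal
      by (simp only: ac_simps)
    ultimately show ?thesis
      unfolding ee_def f_def[symmetric] distrib_left by (simp only:) (simp only: add.assoc add_mono order_refl)
  qed
  also have "\<dots> \<le> ennreal (1 + \<eta>) * ennreal E + ennreal (\<delta> / 2)" using T E by (intro add_mono) auto
  also have "\<dots> = ennreal ((1 + \<eta>) * E + \<delta> / 2)" using \<eta> E \<delta> by (simp add: ennreal_real del: ennreal_plus)
  also have "\<dots> \<le> ennreal (E + \<delta>)" using \<eta>E by (intro ennreal_leI) (simp add: algebra_simps)
  also have "\<dots> = ee h \<phi> g + ennreal \<delta>" using E \<delta> by simp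
  finally have ee: "ee h \<phi>' g' \<le> ee h \<phi> g + ennreal \<delta>" .
  have "\<forall>x\<ge>X+1. \<phi>' x = \<rho>" by (auto simp: \<phi>'_def K_def)
  moreover have "\<forall>x\<le>X. \<phi>' x = \<phi> x" by (simp add: \<phi>'_def)
  ultimately show ?thesis using s' ee by blast
qed

lemma cut_left:
  assumes s: "sob \<phi> g" and fin: "ee h \<phi> g < \<infinity>" and lim: "(\<phi> \<longlongrightarrow> \<rho>) at_bot"
    and \<rho>: "cos \<rho> = h" "sin \<rho> \<noteq> 0" and \<delta>: "\<delta> > 0"
  shows "\<exists>\<phi>' g' X. sob \<phi>' g' \<and> (\<forall>x\<le>X. \<phi>' x = \<rho>) \<and> (\<exists>Y. \<forall>x\<ge>Y. \<phi>' x = \<phi> x) \<and> ee h \<phi>' g' \<le> ee h \<phi> g + ennreal \<delta>"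
proof -
  have r: "sob (\<lambda>x. \<phi> (- x)) (\<lambda>x. - g (- x))" "ee h (\<lambda>x. \<phi> (- x)) (\<lambda>x. - g (- x)) = ee h \<phi> g"
    using sob_affine[OF s, of "-1" 0] ee_affine[OF s, of "-1" h 0] by auto
  have "((\<lambda>x. \<phi> (- x)) \<longlongrightarrow> \<rho>) at_top" using lim by (simp add: filterlim_at_bot_mirror)
  then obtain \<phi>' g' X Y where c: "sob \<phi>' g'" "\<And>x. x \<ge> X \<Longrightarrow> \<phi>' x = \<rho>" "\<And>x. x \<le> Y \<Longrightarrow> \<phi>' x = \<phi> (- x)" "ee h \<phi>' g' \<le> ee h \<phi> g + ennreal \<delta>"
    using cut_right[OF r(1) _ _ \<rho> \<delta>] r(2) fin by auto
  have r': "sob (\<lambda>x. \<phi>' (- x)) (\<lambda>x. - g' (- x))" "ee h (\<lambda>x. \<phi>' (- x)) (\<lambda>x. - g' (- x)) = ee h \<phi>' g'"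
    using sob_affine[OF c(1), of "-1" 0] ee_affine[OF c(1), of "-1" h 0] by auto
  moreover have "\<forall>x\<le>-X. \<phi>' (- x) = \<rho>" "\<forall>x\<ge>-Y. \<phi>' (- x) = \<phi> x" using c(2,3) by auto
  ultimately show ?thesis using c(4) by metis
qed

text \<open>Young's inequality separates the two factors, and integrating the kernel over the
  opposite half-line leaves 1/(q - p). Square-integrability is enough for the interaction across a
  gap to be finite.\<close>

lemma Qp_far:
  assumes [measurable]: "a \<in> borel_measurable borel" "b \<in> borel_measurable borel"
    and a: "\<And>x. x > p \<Longrightarrow> a x = 0" and b: "\<And>x. x < q \<Longrightarrow> b x = 0" and pq: "p < q"
  shows "Qp a b \<le> ennreal (1 / (2 * (q - p))) * (L2 a + L2 b)"
proof -
  let ?A = "\<lambda>s t. 1/2 * ((a s)^2 * (1 / (t - s)^2) * indicator {q..} t * indicator {..p} s)"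
  let ?B = "\<lambda>s t. 1/2 * ((b t)^2 * (1 / (t - s)^2) * indicator {q..} t * indicator {..p} s)"
  have m: "meas2 ?A" "meas2 ?B" unfolding indicator_def by measurable
  have "Qp a b \<le> DI (\<lambda>s t. ?A s t + ?B s t)"
    unfolding Qp_def
  proof (rule DI_mono)
    fix s t
    show "max 0 (a s * b t) / (s - t)^2 \<le> ?A s t + ?B s t"
    proof (cases "s \<le> p \<and> q \<le> t")
      case True
      have "max 0 (a s * b t) \<le> 1/2 * ((a s)^2 + (b t)^2)"
        using zero_le_power2[of "a s - b t"] by (simp add: power2_eq_square algebra_simps max_def)
      then have "max 0 (a s * b t) / (s - t)^2 \<le> 1/2 * ((a s)^2 + (b t)^2) / (s - t)^2" by (rule divide_right_mono) simp
      then show ?thesis using True by (simp add: add_divide_distrib power2_commute[of t s])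
    next
      case False
      then have "a s * b t = 0" using a[of s] b[of t] by auto
      moreover have "0 \<le> ?A s t + ?B s t" by (intro add_nonneg_nonneg) auto
      ultimately show ?thesis by (simp only: max.idem div_0)
    qed
  qed
  also have "\<dots> = DI ?A + DI ?B" by (rule DI_add[OF m(1) _ m(2)]) auto
  also have "DI ?A = DI (\<lambda>s t. ?A t s)" by (rule DI_swap[OF m(1), symmetric])
  also have "\<dots> \<le> (NN t. ennreal ((a t)^2) * ennreal (1 / (2 * (q - p))))"
    unfolding DI_def
  proof (rule nn_integral_mono)
    fix t
    show "(NN s. ennreal (?A t s)) \<le> ennreal ((a t)^2) * ennreal (1 / (2 * (q - p)))"
    proof (cases "t \<le> p")
      case True
      have "(NN s. ennreal (?A t s)) = (NN s. ennreal (1/2 * (a t)^2) * (ennreal (1 / (s - t)^2) * indicator {q..} s))"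
        using True by (intro nn_integral_cong) (auto simp: indicator_def ennreal_mult[symmetric])
      also have "\<dots> = ennreal (1/2 * (a t)^2) * (\<integral>\<^sup>+s\<in>{q..}. ennreal (1 / (s - t)^2) \<partial>lborel)"
        by (rule nn_integral_cmult) simp
      also have "\<dots> = ennreal (1/2 * (a t)^2) * ennreal (1 / (q - t))"
        using True pq by (simp add: nn_integral_inverse_square)
      also have "\<dots> \<le> ennreal (1/2 * (a t)^2) * ennreal (1 / (q - p))"
        using True pq by (intro mult_left_mono ennreal_leI divide_left_mono) auto
      also have "\<dots> = ennreal ((a t)^2) * ennreal (1 / (2 * (q - p)))"
        using pq by (simp add: ennreal_mult[symmetric])
      finally show ?thesis .
    qed (simp add: indicator_def)
  qed
  also have "\<dots> = L2 a * ennreal (1 / (2 * (q - p)))" unfolding L2_norm_sq_real by (rule nn_integral_multc) simp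
  also have "DI ?B \<le> (NN t. ennreal ((b t)^2) * ennreal (1 / (2 * (q - p))))"
    unfolding DI_def
  proof (rule nn_integral_mono)
    fix t
    show "(NN s. ennreal (?B s t)) \<le> ennreal ((b t)^2) * ennreal (1 / (2 * (q - p)))"
    proof (cases "t \<ge> q")
      case True
      have "(NN s. ennreal (?B s t)) = (NN s. ennreal (1/2 * (b t)^2) * (ennreal (1 / (t - s)^2) * indicator {..p} s))"
        using True by (intro nn_integral_cong) (auto simp: indicator_def ennreal_mult[symmetric])
      also have "\<dots> = ennreal (1/2 * (b t)^2) * (\<integral>\<^sup>+s\<in>{..p}. ennreal (1 / (t - s)^2) \<partial>lborel)"
        by (rule nn_integral_cmult) simp
      also have "\<dots> = ennreal (1/2 * (b t)^2) * ennreal (1 / (t - p))"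
        using True pq by (simp add: nn_integral_inverse_square')
      also have "\<dots> \<le> ennreal (1/2 * (b t)^2) * ennreal (1 / (q - p))"
        using True pq by (intro mult_left_mono ennreal_leI divide_left_mono) auto
      also have "\<dots> = ennreal ((b t)^2) * ennreal (1 / (2 * (q - p)))"
        using pq by (simp add: ennreal_mult[symmetric])
      finally show ?thesis .
    qed (simp add: indicator_def)
  qed
  also have "\<dots> = L2 b * ennreal (1 / (2 * (q - p)))" unfolding L2_norm_sq_real by (rule nn_integral_multc) simp
  finally have "Qp a b \<le> L2 a * ennreal (1 / (2 * (q - p))) + L2 b * ennreal (1 / (2 * (q - p)))"
    by (simp add: add_mono)
  then show ?thesis by (simp only: distrib_right[symmetric] mult.commute)
qed

lemma L2_disjoint:
  fixes a b :: "real \<Rightarrow> real"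
  assumes [measurable]: "a \<in> borel_measurable borel" "b \<in> borel_measurable borel" and d: "\<And>x. a x = 0 \<or> b x = 0"
  shows "L2 (\<lambda>x. a x + b x) = L2 a + L2 b"
proof -
  have "ennreal ((a x + b x)^2) = ennreal ((a x)^2) + ennreal ((b x)^2)" for x using d[of x] by auto
  then show ?thesis unfolding L2_norm_sq_real by (simp add: nn_integral_add)
qed

lemma L2_uminus: "L2 (\<lambda>x. - f x) = L2 (f :: real \<Rightarrow> real)"
  by (simp add: L2_norm_sq_real)

text \<open>The pieces are constant where they meet, so a constant stretch of any length can be
  inserted between them; a long one makes their interaction negligible.\<close>

lemma glue_profiles:
  assumes A: "sob \<phi>A gA" "ee h \<phi>A gA < \<infinity>" "\<And>x. x \<ge> XA \<Longrightarrow> \<phi>A x = \<mu>"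
    and B: "sob \<phi>B gB" "ee h \<phi>B gB < \<infinity>" "\<And>x. x \<le> XB \<Longrightarrow> \<phi>B x = \<mu>" and \<mu>: "cos \<mu> = h" and \<delta>: "\<delta> > 0"
  shows "\<exists>\<phi> g c. sob \<phi> g \<and> (\<forall>x\<le>XA. \<phi> x = \<phi>A x) \<and> (\<forall>x\<ge>XA. \<phi> x = \<phi>B (c + x)) \<and> ee h \<phi> g \<le> ee h \<phi>A gA + ee h \<phi>B gB + ennreal \<delta>"
proof -
  define a where "a x = cos (\<phi>A x) - h" for x
  obtain EA EB where E: "ee h \<phi>A gA = ennreal EA" "EA \<ge> 0" "ee h \<phi>B gB = ennreal EB" "EB \<ge> 0"
    using A(2) B(2) by (cases "ee h \<phi>A gA"; cases "ee h \<phi>B gB") auto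
  \<comment> \<open>Length of the inserted stretch: \<open>Qp_far\<close> bounds the interaction by
    (EA + EB) / (2 R). The summand 1 keeps \<open>R\<close> positive.\<close>
  define R where "R = (EA + EB + 1) / \<delta>"
  have R: "R > 0" using E \<delta> by (simp add: R_def)
  define c where "c = XB - XA - R"
  note Bs = sob_affine[OF B(1), of 1 c, simplified]
  define b where "b x = cos (\<phi>B (c + x)) - h" for x
  define \<phi> where "\<phi> x = (if x \<le> XA then \<phi>A x else \<phi>B (c + x))" for x
  define g where "g x = (if x \<le> XA then gA x else gB (c + x))" for x
  have gl: "\<phi>A XA = \<phi>B (c + XA)" using A(3)[of XA] B(3)[of "c + XA"] R by (simp add: c_def)
  have s: "sob \<phi> g" unfolding \<phi>_def[abs_def] g_def[abs_def] by (rule sob_join[OF A(1) Bs gl])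
  note [measurable] = sob_borel[OF A(1)] sob_borel[OF B(1)] sob_borel[OF s] sob_meas[OF s] sob_meas[OF A(1)] sob_meas[OF B(1)]
  have am[measurable]: "a \<in> borel_measurable borel" "b \<in> borel_measurable borel" by (simp_all add: a_def[abs_def] b_def[abs_def])
  have a0: "a x = 0" if "x \<ge> XA" for x using A(3)[OF that] \<mu> by (simp add: a_def)
  have b0: "b x = 0" if "x \<le> XA + R" for x using B(3)[of "c + x"] that \<mu> by (simp add: b_def c_def)
  have dis: "a x = 0 \<or> b x = 0" for x using a0[of x] b0[of x] R by linarith
  have f: "(\<lambda>x. cos (\<phi> x) - h) = (\<lambda>x. a x + b x)"
  proof
    fix x show "cos (\<phi> x) - h = a x + b x"
      using a0[of x] b0[of x] R by (cases "x \<le> XA") (auto simp: \<phi>_def a_def b_def)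
  qed
  have eB: "ee h \<phi>B gB = L2 gB + Hh b + L2 b"
    unfolding ee_def b_def[abs_def]
    using L2_affine[of 1 "\<lambda>x. cos (\<phi>B x) - h" c] Hh_affine[of 1 "\<lambda>x. cos (\<phi>B x) - h" c] by simp
  have eA: "ee h \<phi>A gA = L2 gA + Hh a + L2 a"
    by (simp add: ee_def a_def[abs_def])
  have Lg: "L2 g \<le> L2 gA + L2 gB"
  proof -
    have "L2 g \<le> (NN x. ennreal ((gA x)^2) + ennreal ((gB (c + x))^2))"
      unfolding L2_norm_sq_real by (intro nn_integral_mono) (auto simp: g_def)
    also have "\<dots> = L2 gA + L2 (\<lambda>x. gB (c + x))"
      unfolding L2_norm_sq_real by (subst nn_integral_add) auto
    finally show ?thesis using L2_affine[of 1 gB c] by simp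
  qed
  have Q: "ennreal (2 / pi) * Qp (\<lambda>x. - a x) b \<le> ennreal \<delta>"
  proof -
    have "Qp (\<lambda>x. - a x) b \<le> ennreal (1 / (2 * (XA + R - XA))) * (L2 (\<lambda>x. - a x) + L2 b)"
      by (rule Qp_far) (use a0 b0 R in auto)
    also have "\<dots> \<le> ennreal (1 / (2 * R)) * (ennreal EA + ennreal EB)"
      unfolding L2_uminus E(1,3)[symmetric] eA eB by (intro mult_mono add_mono) auto
    also have "\<dots> = ennreal (1 / (2 * R) * (EA + EB))"
      using E R by (simp add: ennreal_real del: ennreal_plus)
    finally have "ennreal (2 / pi) * Qp (\<lambda>x. - a x) b \<le> ennreal (2 / pi) * ennreal (1 / (2 * R) * (EA + EB))"
      by (rule mult_left_mono) simp
    also have "\<dots> = ennreal (2 / pi * (1 / (2 * R) * (EA + EB)))" using E R by (simp add: ennreal_mult[symmetric])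
    also have "\<dots> \<le> ennreal \<delta>"
    proof (rule ennreal_leI)
      have "2 / pi * (1 / (2 * R) * (EA + EB)) = (EA + EB) / (pi * R)" using R by (simp add: divide_simps)
      also have "\<dots> \<le> (EA + EB) / R" using E R pi_gt3 by (intro divide_left_mono) auto
      also have "\<dots> \<le> \<delta>" using E \<delta> by (simp add: R_def divide_simps)
      finally show "2 / pi * (1 / (2 * R) * (EA + EB)) \<le> \<delta>" .
    qed
    finally show ?thesis .
  qed
  have "Hh (\<lambda>x. a x + b x) \<le> Hh (\<lambda>x. a x + b x) + ennreal (2 / pi) * Qp a b" by simp
  also have "\<dots> = Hh a + Hh b + ennreal (2 / pi) * Qp (\<lambda>x. - a x) b"
    by (rule Hh_split[OF am dis])
  also have "\<dots> \<le> Hh a + Hh b + ennreal \<delta>" using Q by (intro add_left_mono)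
  finally have H: "Hh (\<lambda>x. a x + b x) \<le> Hh a + Hh b + ennreal \<delta>" .
  have "ee h \<phi> g \<le> (L2 gA + L2 gB) + (Hh a + Hh b + ennreal \<delta>) + (L2 a + L2 b)"
    unfolding ee_def f L2_disjoint[OF am dis] by (intro add_mono Lg H order_refl)
  also have "\<dots> = ee h \<phi>A gA + ee h \<phi>B gB + ennreal \<delta>" unfolding eA eB by (simp only: ac_simps)
  finally have "ee h \<phi> g \<le> ee h \<phi>A gA + ee h \<phi>B gB + ennreal \<delta>" .
  moreover have "\<forall>x\<le>XA. \<phi> x = \<phi>A x" "\<forall>x\<ge>XA. \<phi> x = \<phi>B (c + x)" using gl by (auto simp: \<phi>_def)
  ultimately show ?thesis using s by blast
qed

lemma profile_concat:
  assumes A: "profile h \<beta> \<mu> \<phi>A gA" and B: "profile h \<mu> \<rho> \<phi>B gB" and \<mu>: "cos \<mu> = h" "sin \<mu> \<noteq> 0" and \<delta>: "\<delta> > 0"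
  shows "\<exists>\<phi> g. profile h \<beta> \<rho> \<phi> g \<and> ee h \<phi> g \<le> ee h \<phi>A gA + ee h \<phi>B gB + ennreal \<delta>"
proof -
  have d3: "\<delta> / 3 > 0" using \<delta> by simp
  obtain \<phi>1 g1 X1 Y1 where 1: "sob \<phi>1 g1" "\<And>x. x \<ge> X1 \<Longrightarrow> \<phi>1 x = \<mu>" "\<And>x. x \<le> Y1 \<Longrightarrow> \<phi>1 x = \<phi>A x" "ee h \<phi>1 g1 \<le> ee h \<phi>A gA + ennreal (\<delta>/3)"
    using cut_right[OF _ _ _ \<mu> d3, of \<phi>A gA] A by (auto simp: profile_def)
  obtain \<phi>2 g2 X2 Y2 where 2: "sob \<phi>2 g2" "\<And>x. x \<le> X2 \<Longrightarrow> \<phi>2 x = \<mu>" "\<And>x. x \<ge> Y2 \<Longrightarrow> \<phi>2 x = \<phi>B x" "ee h \<phi>2 g2 \<le> ee h \<phi>B gB + ennreal (\<delta>/3)"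
    using cut_left[OF _ _ _ \<mu> d3, of \<phi>B gB] B by (auto simp: profile_def)
  have f1: "ee h \<phi>1 g1 < \<infinity>" "ee h \<phi>2 g2 < \<infinity>" using 1(4) 2(4) A B by (auto simp: profile_def intro: le_less_trans)
  obtain \<phi> g c where 3: "sob \<phi> g" "\<And>x. x \<le> X1 \<Longrightarrow> \<phi> x = \<phi>1 x" "\<And>x. x \<ge> X1 \<Longrightarrow> \<phi> x = \<phi>2 (c + x)" "ee h \<phi> g \<le> ee h \<phi>1 g1 + ee h \<phi>2 g2 + ennreal (\<delta>/3)"
    using glue_profiles[OF 1(1) f1(1) 1(2) 2(1) f1(2) 2(2) \<mu>(1) d3] by blast
  have "ee h \<phi> g \<le> (ee h \<phi>A gA + ennreal (\<delta>/3)) + (ee h \<phi>B gB + ennreal (\<delta>/3)) + ennreal (\<delta>/3)"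
    using 3(4) 1(4) 2(4) by (meson add_mono order_refl order_trans)
  also have "\<dots> = ee h \<phi>A gA + ee h \<phi>B gB + (ennreal (\<delta>/3) + ennreal (\<delta>/3) + ennreal (\<delta>/3))" by (simp only: ac_simps)
  also have "ennreal (\<delta>/3) + ennreal (\<delta>/3) + ennreal (\<delta>/3) = ennreal \<delta>" using \<delta> by (simp add: ennreal_plus[symmetric] del: ennreal_plus)
  finally have e: "ee h \<phi> g \<le> ee h \<phi>A gA + ee h \<phi>B gB + ennreal \<delta>" .
  have "(\<phi> \<longlongrightarrow> \<beta>) at_bot"
  proof (rule Lim_transform_eventually)
    show "(\<phi>A \<longlongrightarrow> \<beta>) at_bot" using A by (simp add: profile_def)
    show "\<forall>\<^sub>F x in at_bot. \<phi>A x = \<phi> x"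
      using eventually_le_at_bot[of "min X1 Y1"] by eventually_elim (simp add: 1(3) 3(2))
  qed
  moreover have "(\<phi> \<longlongrightarrow> \<rho>) at_top"
  proof (rule Lim_transform_eventually)
    have "filterlim (\<lambda>x. c + x) at_top at_top" by (rule filterlim_tendsto_add_at_top[OF tendsto_const filterlim_ident])
    then show "((\<lambda>x. \<phi>B (c + x)) \<longlongrightarrow> \<rho>) at_top" using B by (auto simp: profile_def intro: filterlim_compose)
    show "\<forall>\<^sub>F x in at_top. \<phi>B (c + x) = \<phi> x"
      using eventually_ge_at_top[of "max X1 (Y2 - c)"] by eventually_elim (simp add: 2(3) 3(3))
  qed
  ultimately have "profile h \<beta> \<rho> \<phi> g" using 3(1) e A B by (auto simp: profile_def intro: le_less_trans)
  then show ?thesis using e by blast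
qed

section \<open>Minimal profiles and subadditivity of the least energy\<close>

definition minimal :: "real \<Rightarrow> real \<Rightarrow> real \<Rightarrow> (real \<Rightarrow> real) \<Rightarrow> (real \<Rightarrow> real) \<Rightarrow> bool" where
  "minimal h \<beta> \<rho> \<phi> g \<longleftrightarrow> profile h \<beta> \<rho> \<phi> g \<and> (\<forall>\<phi>' g'. profile h \<beta> \<rho> \<phi>' g' \<longrightarrow> ee h \<phi> g \<le> ee h \<phi>' g')"

text \<open>A minimal profile may be compared with pieces placed infinitely far apart, which no
  longer interact. This is the formal meaning of moving a part to infinity.\<close>

lemma minimal_concat:
  assumes m: "minimal h \<beta> \<rho> \<phi> g" and A: "profile h \<beta> \<mu> \<phi>A gA" and B: "profile h \<mu> \<rho> \<phi>B gB" and \<mu>: "cos \<mu> = h" "sin \<mu> \<noteq> 0"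
  shows "ee h \<phi> g \<le> ee h \<phi>A gA + ee h \<phi>B gB"
proof (rule ennreal_le_epsilon)
  fix e :: real assume "e > 0"
  from profile_concat[OF A B \<mu> this] obtain \<phi>' g' where
    "profile h \<beta> \<rho> \<phi>' g'" "ee h \<phi>' g' \<le> ee h \<phi>A gA + ee h \<phi>B gB + ennreal e" by blast
  then show "ee h \<phi> g \<le> ee h \<phi>A gA + ee h \<phi>B gB + ennreal e"
    using m by (auto simp: minimal_def intro: order_trans)
qed

lemma minimal_concat3:
  assumes m: "minimal h \<beta> \<rho> \<phi> g" and A: "profile h \<beta> \<mu> \<phi>A gA" and B: "profile h \<mu> \<nu> \<phi>B gB" and C: "profile h \<nu> \<rho> \<phi>C gC"
    and \<mu>: "cos \<mu> = h" "sin \<mu> \<noteq> 0" and \<nu>: "cos \<nu> = h" "sin \<nu> \<noteq> 0"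
  shows "ee h \<phi> g \<le> ee h \<phi>A gA + ee h \<phi>B gB + ee h \<phi>C gC"
proof (rule ennreal_le_epsilon)
  fix e :: real assume "e > 0"
  from profile_concat[OF A B \<mu> this] obtain \<phi>' g' where
    p: "profile h \<beta> \<nu> \<phi>' g'" "ee h \<phi>' g' \<le> ee h \<phi>A gA + ee h \<phi>B gB + ennreal e" by blast
  have "ee h \<phi> g \<le> ee h \<phi>' g' + ee h \<phi>C gC" by (rule minimal_concat[OF m p(1) C \<nu>])
  also have "\<dots> \<le> (ee h \<phi>A gA + ee h \<phi>B gB + ennreal e) + ee h \<phi>C gC" by (intro add_right_mono p(2))
  finally show "ee h \<phi> g \<le> ee h \<phi>A gA + ee h \<phi>B gB + ee h \<phi>C gC + ennreal e" by (simp only: ac_simps)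
qed

section \<open>Limits at infinity of angles of finite energy\<close>

lemma sob_L2_tendsto_0:
  assumes f: "sob f k" and fin: "L2 f < \<infinity>"
  shows "(f \<longlongrightarrow> 0) at_top"
proof (rule tendstoI)
  fix \<epsilon> :: real assume \<epsilon>: "\<epsilon> > 0"
  note [measurable] = sob_borel[OF f]
  obtain K where K: "L2 k = ennreal K" "K \<ge> 0"
    using sob_L2[OF f] by (cases "L2 k") auto
  \<comment> \<open>By Hoelder continuity a value of size \<epsilon> stays above \<epsilon>/2 on a
    length \<open>r\<close>, which uses up \<epsilon>^2 r / 4 of the tail integral.\<close>
  define r where "r = \<epsilon>^2 / (4 * (K + 1))"
  have r: "r > 0" using \<epsilon> K by (simp add: r_def)
  obtain X where X: "(\<integral>\<^sup>+x\<in>{X..}. ennreal ((f x)^2) \<partial>lborel) < ennreal (\<epsilon>^2 / 4 * r)"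
    using nn_integral_tail[of "\<lambda>x. ennreal ((f x)^2)" "ennreal (\<epsilon>^2 / 4 * r)"] fin r \<epsilon> by (auto simp: L2_norm_sq_real)
  have "\<bar>f x\<bar> < \<epsilon>" if x: "x \<ge> X" for x
  proof (rule ccontr)
    assume "\<not> \<bar>f x\<bar> < \<epsilon>"
    then have big: "\<bar>f x\<bar> \<ge> \<epsilon>" by simp
    have half: "\<epsilon> / 2 \<le> \<bar>f y\<bar>" if "y \<in> {x..x+r}" for y
    proof -
      have "(f y - f x)^2 \<le> K * \<bar>y - x\<bar>" by (rule sob_holder[OF f]) (use K in auto)
      also have "\<dots> \<le> (K + 1) * r" using that K by (intro mult_mono) auto
      also have "\<dots> = (\<epsilon> / 2)^2" using K by (simp add: r_def power_divide divide_simps)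
      finally have "\<bar>f y - f x\<bar> \<le> \<epsilon> / 2" using \<epsilon> abs_le_square_iff[of "f y - f x" "\<epsilon> / 2"] by simp
      then show ?thesis using big by linarith
    qed
    have "ennreal (\<epsilon>^2 / 4 * r) = (\<integral>\<^sup>+y\<in>{x..x+r}. ennreal (\<epsilon>^2 / 4) \<partial>lborel)"
      using r by (simp add: nn_integral_cmult emeasure_lborel_Icc_eq ennreal_mult[symmetric])
    also have "\<dots> \<le> (\<integral>\<^sup>+y\<in>{X..}. ennreal ((f y)^2) \<partial>lborel)"
    proof (rule nn_integral_mono)
      fix y
      show "ennreal (\<epsilon>^2 / 4) * indicator {x..x+r} y \<le> ennreal ((f y)^2) * indicator {X..} y"
      proof (cases "y \<in> {x..x+r}")
        case True
        have "(\<epsilon> / 2)^2 \<le> \<bar>f y\<bar>^2" using half[OF True] \<epsilon> by (intro power_mono) auto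
        then show ?thesis using True x by (simp add: power_divide ennreal_leI)
      qed simp
    qed
    finally show False using X by simp
  qed
  then show "\<forall>\<^sub>F x in at_top. dist (f x) 0 < \<epsilon>"
    by (auto simp: eventually_at_top_linorder dist_real_def)
qed

text \<open>cos \<phi> tends to h, which lies strictly between 0 and 1, so the angle eventually
  avoids all multiples of pi and stays in one interval between two of them. There it is a continuous
  function of its cosine.\<close>

lemma energy_limit_at_top:
  assumes s: "sob \<phi> g" and fin: "ee h \<phi> g < \<infinity>" and h: "0 < h" "h < 1"
  shows "\<exists>\<rho>. (\<phi> \<longlongrightarrow> \<rho>) at_top \<and> cos \<rho> = h"
proof -
  have "sob (\<lambda>x. cos (\<phi> x) - h) (\<lambda>x. - sin (\<phi> x) * g x - 0)" by (intro sob_diff sob_cos s sob_const)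
  moreover have "L2 (\<lambda>x. cos (\<phi> x) - h) < \<infinity>" using fin by (simp add: ee_def)
  ultimately have "((\<lambda>x. cos (\<phi> x) - h) \<longlongrightarrow> 0) at_top" by (rule sob_L2_tendsto_0)
  then have c: "((\<lambda>x. cos (\<phi> x)) \<longlongrightarrow> h) at_top" by (simp add: LIM_zero_iff)
  have "\<forall>\<^sub>F x in at_top. 0 < cos (\<phi> x) \<and> cos (\<phi> x) < 1"
    using order_tendstoD[OF c] h by (simp add: eventually_conj)
  then obtain X where X: "\<And>x. x \<ge> X \<Longrightarrow> 0 < cos (\<phi> x) \<and> cos (\<phi> x) < 1" by (auto simp: eventually_at_top_linorder)
  have noteq: "\<phi> x \<noteq> real_of_int n * pi" if "x \<ge> X" for x n
  proof
    assume "\<phi> x = real_of_int n * pi"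
    then have "sin (\<phi> x) = 0" by (auto simp: sin_zero_iff_int2)
    then have "(cos (\<phi> x))^2 = 1" using sin_cos_squared_add[of "\<phi> x"] by simp
    then show False using X[OF that] by (auto simp: power2_eq_1_iff)
  qed
  define n where "n = \<lfloor>\<phi> X / pi\<rfloor>"
  have nX: "real_of_int n * pi < \<phi> X" "\<phi> X < (real_of_int n + 1) * pi"
  proof -
    have "real_of_int n \<le> \<phi> X / pi" "\<phi> X / pi < real_of_int n + 1" by (auto simp: n_def)
    then show "real_of_int n * pi < \<phi> X" "\<phi> X < (real_of_int n + 1) * pi"
      using noteq[of X n] by (auto simp: divide_simps)
  qed
  have cont: "continuous_on {X..x} \<phi>" for x by (rule continuous_on_subset[OF sob_continuous[OF s]]) simp
  have nx: "real_of_int n * pi < \<phi> x \<and> \<phi> x < (real_of_int n + 1) * pi" if x: "x \<ge> X" for x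
  proof (rule ccontr)
    assume neg: "\<not> (real_of_int n * pi < \<phi> x \<and> \<phi> x < (real_of_int n + 1) * pi)"
    then have "(\<exists>y\<ge>X. \<phi> y = real_of_int n * pi) \<or> (\<exists>y\<ge>X. \<phi> y = real_of_int (n + 1) * pi)"
      using IVT2'[of \<phi> x "real_of_int n * pi" X, OF _ _ x cont] IVT'[of \<phi> X "(real_of_int n + 1) * pi" x, OF _ _ x cont] nX
      by auto
    then show False using noteq by blast
  qed
  \<comment> \<open>The parity of \<open>n\<close> decides the sign of the cosine after shifting the
    angle into [0, pi].\<close>
  define \<sigma> :: real where "\<sigma> = (if even n then 1 else - 1)"
  have cn: "cos (y - real_of_int n * pi) = \<sigma> * cos y" for y
    using cos_int_times_real by (simp add: cos_diff \<sigma>_def cos_npi_int sin_npi_int mult.commute)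
  have eq: "\<phi> x = real_of_int n * pi + arccos (\<sigma> * cos (\<phi> x))" if "x \<ge> X" for x
  proof -
    have "arccos (cos (\<phi> x - real_of_int n * pi)) = \<phi> x - real_of_int n * pi"
      using nx[OF that] by (intro arccos_cos) (auto simp: algebra_simps)
    then show ?thesis by (simp add: cn)
  qed
  define \<rho> where "\<rho> = real_of_int n * pi + arccos (\<sigma> * h)"
  have "((\<lambda>x. real_of_int n * pi + arccos (\<sigma> * cos (\<phi> x))) \<longlongrightarrow> \<rho>) at_top"
    unfolding \<rho>_def
  proof (intro tendsto_add tendsto_const)
    have "((\<lambda>x. \<sigma> * cos (\<phi> x)) \<longlongrightarrow> \<sigma> * h) at_top" by (intro tendsto_intros c)
    then show "((\<lambda>x. arccos (\<sigma> * cos (\<phi> x))) \<longlongrightarrow> arccos (\<sigma> * h)) at_top"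
      by (rule continuous_on_tendsto_compose[OF continuous_on_arccos'])
         (use h in \<open>auto simp: \<sigma>_def intro!: always_eventually\<close>)
  qed
  then have lim: "(\<phi> \<longlongrightarrow> \<rho>) at_top"
    by (rule Lim_transform_eventually) (use eq in \<open>auto intro!: eventually_at_top_linorderI[of X]\<close>)
  moreover have "cos \<rho> = h"
    using tendsto_unique[OF _ tendsto_cos[OF lim] c] by simp
  ultimately show ?thesis by blast
qed

lemma energy_limit_at_bot:
  assumes s: "sob \<phi> g" and fin: "ee h \<phi> g < \<infinity>" and h: "0 < h" "h < 1"
  shows "\<exists>\<rho>. (\<phi> \<longlongrightarrow> \<rho>) at_bot \<and> cos \<rho> = h"
  using energy_limit_at_top[OF sob_affine[OF s, of "-1" 0], of h] ee_affine[OF s, of "-1" h 0] fin h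
  by (simp add: filterlim_at_bot_mirror)

text \<open>For \<sigma> = -1 both the line and the angle are reversed, so the difference of the two
  limits is preserved.\<close>

lemma profile_reflect:
  assumes s: "sob \<phi> g" and \<sigma>: "\<sigma> = 1 \<or> \<sigma> = - 1" and k: "k \<in> \<int>"
  shows "sob (\<lambda>x. 2 * pi * k + \<sigma> * \<phi> (0 + \<sigma> * x)) (\<lambda>x. \<sigma> * (\<sigma> * g (0 + \<sigma> * x)))"
    "ee h (\<lambda>x. 2 * pi * k + \<sigma> * \<phi> (0 + \<sigma> * x)) (\<lambda>x. \<sigma> * (\<sigma> * g (0 + \<sigma> * x))) = ee h \<phi> g"
proof -
  show "sob (\<lambda>x. 2 * pi * k + \<sigma> * \<phi> (0 + \<sigma> * x)) (\<lambda>x. \<sigma> * (\<sigma> * g (0 + \<sigma> * x)))"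
    by (intro sob_shift_const sob_cmult sob_affine s \<sigma>)
  have "cos (2 * pi * k + y) = cos y" for y
  proof -
    obtain n where n: "k = real_of_int n" using k by (auto elim: Ints_cases)
    show ?thesis unfolding n cos_add cos_int_2pin sin_int_2pin by simp
  qed
  then have "ee h (\<lambda>x. 2 * pi * k + \<sigma> * \<phi> (0 + \<sigma> * x)) (\<lambda>x. \<sigma> * (\<sigma> * g (0 + \<sigma> * x))) = ee h (\<lambda>x. \<phi> (0 + \<sigma> * x)) (\<lambda>x. \<sigma> * g (0 + \<sigma> * x))"
    using \<sigma> by (intro ee_cong) auto
  then show "ee h (\<lambda>x. 2 * pi * k + \<sigma> * \<phi> (0 + \<sigma> * x)) (\<lambda>x. \<sigma> * (\<sigma> * g (0 + \<sigma> * x))) = ee h \<phi> g"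
    using ee_affine[OF s \<sigma>, of h 0] by simp
qed

section \<open>From maps that attain the infimum to normalised minimal profiles\<close>

lemma attains_infimum_profile:
  assumes att: "attains_infimum h d" and h: "0 < h" "h < 1"
  obtains \<phi> g \<beta> \<rho> where "profile h \<beta> \<rho> \<phi> g" "\<rho> - \<beta> = 2 * pi * d" "cos \<beta> = h" "cos \<rho> = h"
    "\<And>\<phi>' g' \<beta>' \<rho>'. profile h \<beta>' \<rho>' \<phi>' g' \<Longrightarrow> \<rho>' - \<beta>' = 2 * pi * d \<Longrightarrow> ee h \<phi> g \<le> ee h \<phi>' g'"
proof -
  obtain m where m: "m \<in> admissible h d" "energy h m = (INF m'\<in>admissible h d. energy h m')"
    using att by (auto simp: attains_infimum_def)
  obtain \<phi> g where \<phi>: "sob \<phi> g" "energy h m = ennreal (1/2) * ee h \<phi> g" "ee h \<phi> g < \<infinity>"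
    "((\<lambda>x. 1 / (2 * pi) * (\<phi> x - \<phi> (- x))) \<longlongrightarrow> d) at_top"
    using admissible_lift[OF m(1)] by blast
  obtain \<rho> where \<rho>: "(\<phi> \<longlongrightarrow> \<rho>) at_top" "cos \<rho> = h" using energy_limit_at_top[OF \<phi>(1,3) h] by blast
  obtain \<beta> where \<beta>: "(\<phi> \<longlongrightarrow> \<beta>) at_bot" "cos \<beta> = h" using energy_limit_at_bot[OF \<phi>(1,3) h] by blast
  have lim: "((\<lambda>x. 1 / (2 * pi) * (\<phi>' x - \<phi>' (- x))) \<longlongrightarrow> 1 / (2 * pi) * (\<rho>' - \<beta>')) at_top"
    if "(\<phi>' \<longlongrightarrow> \<rho>') at_top" "(\<phi>' \<longlongrightarrow> \<beta>') at_bot" for \<phi>' :: "real \<Rightarrow> real" and \<rho>' \<beta>'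
  proof -
    have "((\<lambda>x. \<phi>' (- x)) \<longlongrightarrow> \<beta>') at_top" using that(2) by (simp add: filterlim_at_bot_mirror)
    then show ?thesis by (intro tendsto_intros that(1))
  qed
  have "d = 1 / (2 * pi) * (\<rho> - \<beta>)"
    using tendsto_unique[OF _ \<phi>(4) lim[OF \<rho>(1) \<beta>(1)]] by simp
  then have d: "\<rho> - \<beta> = 2 * pi * d" by simp
  have min: "ee h \<phi> g \<le> ee h \<phi>' g'" if p: "profile h \<beta>' \<rho>' \<phi>' g'" "\<rho>' - \<beta>' = 2 * pi * d" for \<phi>' g' \<beta>' \<rho>'
  proof -
    have s': "sob \<phi>' g'" "ee h \<phi>' g' < \<infinity>" "(\<phi>' \<longlongrightarrow> \<rho>') at_top" "(\<phi>' \<longlongrightarrow> \<beta>') at_bot" using p by (auto simp: profile_def)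
    have "((\<lambda>x. 1 / (2 * pi) * (\<phi>' x - \<phi>' (- x))) \<longlongrightarrow> d) at_top"
      using lim[OF s'(3,4)] p(2) by simp
    from admissible_of_lift[OF s'(1,2) this]
    have "ennreal (1/2) * ee h \<phi> g \<le> ennreal (1/2) * ee h \<phi>' g'"
      using m(2) \<phi>(2) by (metis INF_lower)
    then have "ennreal 2 * (ennreal (1/2) * ee h \<phi> g) \<le> ennreal 2 * (ennreal (1/2) * ee h \<phi>' g')"
      by (rule mult_left_mono) simp
    moreover have "ennreal 2 * (ennreal (1/2) * X) = X" for X
    proof -
      have "ennreal 2 * ennreal (1/2) = 1" by (subst ennreal_mult[symmetric]) auto
      then show ?thesis by (metis mult.assoc mult_1)
    qed
    ultimately show ?thesis by simp
  qed
  have "profile h \<beta> \<rho> \<phi> g" using \<phi>(1,3) \<rho>(1) \<beta>(1) by (simp add: profile_def)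
  then show ?thesis using d \<beta>(2) \<rho>(2) min by (rule that)
qed

lemma cos_eq_arccos:
  assumes "cos x = h" "\<bar>h\<bar> \<le> 1"
  obtains k s where "k \<in> \<int>" "s = 1 \<or> s = -1" "x = s * arccos h + 2 * pi * k"
proof -
  have "cos x = cos (arccos h)" using assms by simp
  then obtain n where n: "n \<in> \<int>" "x = arccos h + 2 * n * pi \<or> x = - arccos h + 2 * n * pi"
    unfolding cos_eq by blast
  then show ?thesis using that[of n 1] that[of n "-1"] by (auto simp: mult.commute mult.left_commute)
qed

lemma small_integer:
  fixes k :: real assumes "k \<in> \<int>" "\<bar>2 * pi * k\<bar> < 2 * pi" shows "k = 0"
proof -
  obtain n where n: "k = real_of_int n" using assms(1) by (auto elim: Ints_cases)
  have "2 * pi * \<bar>k\<bar> < 2 * pi * 1" using assms(2) by (simp add: abs_mult)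
  then have "\<bar>k\<bar> < 1" by (simp only: mult_less_cancel_left_pos pi_gt_zero mult_pos_pos zero_less_numeral)
  then have "real_of_int \<bar>n\<bar> < 1" using n by simp
  then have "n = 0" by linarith
  then show ?thesis using n by simp
qed

text \<open>With limits s \<alpha> + 2 pi k and s' \<alpha> + 2 pi k', the degree makes (s - s')
  \<alpha>, respectively (s - s' + 2) \<alpha>, a multiple of 2 pi. As \<alpha> < 1, it is 0. So s =
  s' for integer degree, and s = -1, s' = 1 in the other case.\<close>

lemma attains_infimum_minimal:
  fixes l :: nat
  assumes att: "attains_infimum h d" and h: "0 < h" "h < 1" and \<alpha>: "arccos h < 1"
    and d: "d = real l \<or> d = real l + arccos h / pi"
  shows "\<exists>\<beta> \<phi> g. (\<beta> = arccos h \<or> \<beta> = - arccos h) \<and> minimal h \<beta> (2 * pi * real l + arccos h) \<phi> g"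
proof -
  define \<alpha> where "\<alpha> = arccos h"
  have a0: "\<alpha> > 0" "\<alpha> < 1" unfolding \<alpha>_def using h \<alpha> arccos_lt_bounded[of h] by auto
  obtain \<phi> g \<beta> \<rho> where p: "profile h \<beta> \<rho> \<phi> g" "\<rho> - \<beta> = 2 * pi * d" "cos \<beta> = h" "cos \<rho> = h"
    and min: "\<And>\<phi>' g' \<beta>' \<rho>'. profile h \<beta>' \<rho>' \<phi>' g' \<Longrightarrow> \<rho>' - \<beta>' = 2 * pi * d \<Longrightarrow> ee h \<phi> g \<le> ee h \<phi>' g'"
    by (rule attains_infimum_profile[OF att h]) (rule that)
  obtain k s where k: "k \<in> \<int>" "s = 1 \<or> s = -1" "\<beta> = s * \<alpha> + 2 * pi * k"
    using cos_eq_arccos[OF p(3)] h unfolding \<alpha>_def by auto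
  obtain k' s' where k': "k' \<in> \<int>" "s' = 1 \<or> s' = -1" "\<rho> = s' * \<alpha> + 2 * pi * k'"
    using cos_eq_arccos[OF p(4)] h unfolding \<alpha>_def by auto
  have tr: "minimal h (2 * pi * j + \<sigma> * (if \<sigma> = 1 then \<beta> else \<rho>)) (2 * pi * j + \<sigma> * (if \<sigma> = 1 then \<rho> else \<beta>))
      (\<lambda>x. 2 * pi * j + \<sigma> * \<phi> (0 + \<sigma> * x)) (\<lambda>x. \<sigma> * (\<sigma> * g (0 + \<sigma> * x)))"
    if j: "j \<in> \<int>" and \<sigma>: "\<sigma> = 1 \<or> \<sigma> = - 1" for j \<sigma>
  proof -
    have s: "sob \<phi> g" "ee h \<phi> g < \<infinity>" "(\<phi> \<longlongrightarrow> \<beta>) at_bot" "(\<phi> \<longlongrightarrow> \<rho>) at_top" using p(1) by (auto simp: profile_def)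
    note r = profile_reflect[OF s(1) \<sigma> j]
    have l1: "((\<lambda>x. \<phi> (0 + \<sigma> * x)) \<longlongrightarrow> (if \<sigma> = 1 then \<beta> else \<rho>)) at_bot" "((\<lambda>x. \<phi> (0 + \<sigma> * x)) \<longlongrightarrow> (if \<sigma> = 1 then \<rho> else \<beta>)) at_top"
      using \<sigma> s(3,4)[unfolded filterlim_at_bot_mirror] s(3,4)[unfolded filterlim_at_top_mirror]
      by (elim disjE; simp)+
    have "profile h (2 * pi * j + \<sigma> * (if \<sigma> = 1 then \<beta> else \<rho>)) (2 * pi * j + \<sigma> * (if \<sigma> = 1 then \<rho> else \<beta>))
      (\<lambda>x. 2 * pi * j + \<sigma> * \<phi> (0 + \<sigma> * x)) (\<lambda>x. \<sigma> * (\<sigma> * g (0 + \<sigma> * x)))"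
      unfolding profile_def r(2) using r(1) s(2) l1 by (intro conjI tendsto_intros) auto
    moreover have "ee h \<phi> g \<le> ee h \<phi>' g'"
      if "profile h (2 * pi * j + \<sigma> * (if \<sigma> = 1 then \<beta> else \<rho>)) (2 * pi * j + \<sigma> * (if \<sigma> = 1 then \<rho> else \<beta>)) \<phi>' g'" for \<phi>' g'
      using min[OF that] \<sigma> p(2) by auto
    ultimately show ?thesis unfolding minimal_def r(2) by blast
  qed
  have kk: "k' - k - real l \<in> \<int>" using k(1) k'(1) by auto
  from d show ?thesis
  proof
    assume d: "d = real l"
    have e: "(s - s') * \<alpha> = 2 * pi * (k' - k - real l)" using p(2) unfolding k(3) k'(3) d by (simp add: algebra_simps)
    have "\<bar>(s - s') * \<alpha>\<bar> < 2 * pi" using k(2) k'(2) a0 pi_gt3 by auto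
    then have kl: "k' = k + real l" using small_integer[OF kk] e by auto
    then have ss: "s = s'" using e a0 by auto
    show ?thesis
    proof (cases "s = 1")
      case True
      have "2 * pi * (- k) + 1 * \<beta> = \<alpha>" "2 * pi * (- k) + 1 * \<rho> = 2 * pi * real l + \<alpha>"
        using True ss kl unfolding k(3) k'(3) by (auto simp: algebra_simps)
      then show ?thesis using tr[of "- k" 1] k(1) unfolding \<alpha>_def[symmetric] by auto
    next
      \<comment> \<open>If both limits carry the sign -1, the reflection of line and angle turns the
        right limit into \<alpha> and exchanges the roles of the ends.\<close>
      case False
      then have "s = -1" using k(2) by simp
      then have "2 * pi * k' + - 1 * \<rho> = \<alpha>" "2 * pi * k' + - 1 * \<beta> = 2 * pi * real l + \<alpha>"
        using ss kl unfolding k(3) k'(3) by (auto simp: algebra_simps)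
      then show ?thesis using tr[of k' "-1"] k'(1) unfolding \<alpha>_def[symmetric] by auto
    qed
  next
    assume d: "d = real l + arccos h / pi"
    have e: "(s - s' + 2) * \<alpha> = 2 * pi * (k' - k - real l)" using p(2) unfolding k(3) k'(3) d \<alpha>_def[symmetric] by (simp add: algebra_simps)
    have "\<bar>(s - s' + 2) * \<alpha>\<bar> < 2 * pi" using k(2) k'(2) a0 pi_gt3 by auto
    then have kl: "k' = k + real l" using small_integer[OF kk] e by auto
    then have ss: "s = -1" "s' = 1" using e a0 k(2) k'(2) by auto
    have "2 * pi * (- k) + 1 * \<beta> = - \<alpha>" "2 * pi * (- k) + 1 * \<rho> = 2 * pi * real l + \<alpha>"
      using ss kl unfolding k(3) k'(3) by (auto simp: algebra_simps)
    then show ?thesis using tr[of "- k" 1] k(1) unfolding \<alpha>_def[symmetric] by auto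
  qed
qed

section \<open>Interaction estimates\<close>

text \<open>Used with width 1 for an energy bound uniform in h, and with large width for cheap
  transition layers from -\<alpha> to \<alpha>, on which |cos - h| \<le> 1 - h.\<close>

lemma linear_profile:
  assumes W: "W > 0" and br: "\<beta> \<le> \<rho>" and c: "cos \<beta> = h" "cos \<rho> = h"
    and M: "\<And>y. \<beta> \<le> y \<Longrightarrow> y \<le> \<rho> \<Longrightarrow> \<bar>cos y - h\<bar> \<le> M"
  shows "\<exists>\<phi> g. profile h \<beta> \<rho> \<phi> g \<and> ee h \<phi> g \<le> ennreal (2 * (\<rho> - \<beta>)^2 / W + 3 * M^2 * W)"
proof -
  define k where "k = (\<rho> - \<beta>) / W"
  define \<phi> where "\<phi> x = \<beta> + k * min W (max 0 x)" for x
  define g where "g x = k * indicator {0..W} x" for x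
  have k0: "k \<ge> 0" using W br by (simp add: k_def)
  have s: "sob \<phi> g" unfolding \<phi>_def[abs_def] g_def[abs_def]
    by (intro sob_shift_const sob_cmult sob_ramp) (use W in simp)
  have end0: "\<phi> x = \<beta>" if "x \<le> 0" for x using that W by (simp add: \<phi>_def)
  have endW: "\<phi> x = \<rho>" if "x \<ge> W" for x using that W by (simp add: \<phi>_def k_def)
  have rng: "\<beta> \<le> \<phi> x" "\<phi> x \<le> \<rho>" for x
  proof -
    show "\<beta> \<le> \<phi> x" using k0 W by (simp add: \<phi>_def)
    have "k * min W (max 0 x) \<le> k * W" using k0 by (intro mult_left_mono) auto
    then show "\<phi> x \<le> \<rho>" using W by (simp add: \<phi>_def k_def)
  qed
  have M0: "0 \<le> M" using M[of \<beta>] br by auto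
  let ?f = "\<lambda>x. cos (\<phi> x) - h"
  have f0: "?f x = 0" if "x \<notin> {0..W}" for x
    using that end0[of x] endW[of x] c by (cases "x \<le> 0") auto
  have Lg: "L2 g = ennreal ((\<rho> - \<beta>)^2 / W)"
  proof -
    have "L2 g = (\<integral>\<^sup>+x\<in>{0..W}. ennreal (k^2) \<partial>lborel)"
      unfolding L2_norm_sq_real by (intro nn_integral_cong) (auto simp: g_def indicator_def)
    also have "\<dots> = ennreal (k^2 * W)" using W by (simp add: nn_integral_cmult emeasure_lborel_Icc_eq ennreal_mult)
    also have "k^2 * W = (\<rho> - \<beta>)^2 / W" using W by (simp add: k_def power2_eq_square)
    finally show ?thesis .
  qed
  have Lf: "L2 ?f \<le> ennreal (M^2 * W)"
  proof -
    have "L2 ?f \<le> (\<integral>\<^sup>+x\<in>{0..W}. ennreal (M^2) \<partial>lborel)"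
      unfolding L2_norm_sq_real
    proof (intro nn_integral_mono)
      fix x
      have "(?f x)^2 \<le> M^2" using M[OF rng] by (metis abs_ge_zero power2_abs power_mono)
      then show "ennreal ((?f x)^2) \<le> ennreal (M^2) * indicator {0..W} x"
        using f0[of x] by (cases "x \<in> {0..W}") (auto intro: ennreal_leI)
    qed
    also have "\<dots> = ennreal (M^2 * W)" using W by (simp add: nn_integral_cmult emeasure_lborel_Icc_eq ennreal_mult)
    finally show ?thesis .
  qed
  have fs: "sob ?f (\<lambda>x. - sin (\<phi> x) * g x - 0)" by (intro sob_diff sob_cos s sob_const)
  have Lf': "L2 (\<lambda>x. - sin (\<phi> x) * g x - 0) \<le> L2 g"
    by (rule L2_norm_sq_mono) (simp add: abs_mult mult_left_le_one_le)
  have Hf: "Hh ?f \<le> ennreal ((\<rho> - \<beta>)^2 / W + 2 * M^2 * W)"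
  proof -
    have "Hh ?f \<le> ennreal (1 / (2 * pi)) * (ennreal 2 * ennreal ((\<rho> - \<beta>)^2 / W) + ennreal 8 * ennreal (M^2 * W))"
      using Lf' unfolding Lg ennreal_numeral by (intro order_trans[OF Hh_le_H1[OF fs]] mult_left_mono add_mono Lf) auto
    also have "\<dots> = ennreal (1 / (2 * pi) * (2 * ((\<rho> - \<beta>)^2 / W) + 8 * (M^2 * W)))"
      using W by (simp add: ennreal_real del: ennreal_plus ennreal_numeral)
    also have "\<dots> \<le> ennreal (1/2 * (2 * ((\<rho> - \<beta>)^2 / W)) + 1/4 * (8 * (M^2 * W)))"
    proof (rule ennreal_leI)
      have p: "1 / (2 * pi) \<le> 1/4" using pi_gt3 by (simp add: divide_simps)
      have *: "1 / (2 * pi) * (2 * X + 8 * Y) \<le> 1/2 * (2 * X) + 1/4 * (8 * Y)" if "X \<ge> 0" "Y \<ge> 0" for X Y :: real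
      proof -
        have "1 / (2 * pi) * (2 * X + 8 * Y) \<le> 1/4 * (2 * X + 8 * Y)"
          using p that by (intro mult_right_mono) auto
        also have "\<dots> \<le> 1/2 * (2 * X) + 1/4 * (8 * Y)" using that by simp
        finally show ?thesis .
      qed
      show "1 / (2 * pi) * (2 * ((\<rho> - \<beta>)^2 / W) + 8 * (M^2 * W)) \<le> 1/2 * (2 * ((\<rho> - \<beta>)^2 / W)) + 1/4 * (8 * (M^2 * W))"
        by (rule *) (use W in auto)
    qed
    finally show ?thesis by (simp add: mult_ac)
  qed
  have "ee h \<phi> g \<le> ennreal ((\<rho> - \<beta>)^2 / W) + ennreal ((\<rho> - \<beta>)^2 / W + 2 * M^2 * W) + ennreal (M^2 * W)"
    unfolding ee_def Lg by (intro add_mono Hf Lf order_refl)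
  also have "\<dots> = ennreal (2 * (\<rho> - \<beta>)^2 / W + 3 * M^2 * W)"
    using W by (simp add: ennreal_plus[symmetric] del: ennreal_plus)
  finally have e: "ee h \<phi> g \<le> ennreal (2 * (\<rho> - \<beta>)^2 / W + 3 * M^2 * W)" .
  have "(\<phi> \<longlongrightarrow> \<beta>) at_bot" "(\<phi> \<longlongrightarrow> \<rho>) at_top"
    using end0 endW by (auto intro!: tendsto_eventually eventually_at_bot_linorderI[of 0] eventually_at_top_linorderI[of W])
  then have "profile h \<beta> \<rho> \<phi> g" using s e by (auto simp: profile_def intro: le_less_trans)
  then show ?thesis using e by blast
qed

text \<open>Young's inequality with one of the two factors \<open>X\<close> of the quadratic term
  relaxed to an upper bound \<open>Y\<close>; for a potential this bound is its value at the edge of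
  the window.\<close>

lemma ennreal_young:
  fixes X Y :: ennreal
  assumes "a \<ge> 0" "k > 0" "X \<le> Y"
  shows "ennreal (2 * a) * X \<le> ennreal (a^2 / k) + ennreal k * Y * X"
proof (cases "X = \<infinity>")
  case True
  then show ?thesis using assms by (auto simp: top_unique ennreal_mult_eq_top_iff)
next
  case False
  then obtain x where x: "X = ennreal x" "x \<ge> 0" by (cases X) auto
  have "2 * a * x \<le> a^2 / k + k * x * x"
  proof -
    have "0 \<le> (a - k * x)^2 / k" using assms by simp
    also have "\<dots> = a^2 / k - 2 * a * x + k * x * x" using assms by (simp add: power2_eq_square field_simps)
    finally show ?thesis by simp
  qed
  then have "ennreal (2 * a) * X \<le> ennreal (a^2 / k) + ennreal k * X * X"
    using assms x by (simp add: ennreal_real ennreal_leI del: ennreal_plus)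
  also have "\<dots> \<le> ennreal (a^2 / k) + ennreal k * Y * X"
    using assms by (intro add_left_mono mult_right_mono mult_left_mono) auto
  finally show ?thesis .
qed

text \<open>The attraction \<open>\<Phi>\<close> of the left part is bounded by \<open>\<mu> = \<Phi> y\<close> and its integral is small, so
  that \<open>\<integral> \<Phi>^2\<close> is small compared with \<open>\<mu>\<close>; this is what makes it controllable by the gain.\<close>

lemma tail_interaction:
  fixes f :: "real \<Rightarrow> real"
  assumes f[measurable]: "f \<in> borel_measurable borel" and N: "L2 f \<le> ennreal N" "N \<ge> 0" and \<sigma>: "\<sigma> \<ge> 1"
  defines "S \<equiv> \<sigma> ^ 4"
  shows "(NN t. ennreal (2 * \<bar>f t\<bar>) * indicator {y..z} t * (\<integral>\<^sup>+s\<in>{..y}. ennreal (\<bar>f s\<bar> / (S + (t - s))^2) \<partial>lborel))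
    \<le> ennreal (1 / \<sigma>) * (\<integral>\<^sup>+t\<in>{y..z}. ennreal ((f t)^2) \<partial>lborel)
      + ennreal ((N + 1) / \<sigma>) * (\<integral>\<^sup>+s\<in>{..y}. ennreal (\<bar>f s\<bar> / (S + (y - s))^2) \<partial>lborel)"
proof -
  have S1: "S \<ge> 1" using \<sigma> by (simp add: S_def)
  define \<Phi> where "\<Phi> t = (\<integral>\<^sup>+s\<in>{..y}. ennreal (\<bar>f s\<bar> / (S + (t - s))^2) \<partial>lborel)" for t
  have \<Phi>m[measurable]: "\<Phi> \<in> borel_measurable borel" unfolding \<Phi>_def by measurable
  have \<Phi>y: "\<Phi> t \<le> \<Phi> y" if "t \<ge> y" for t
    unfolding \<Phi>_def using that S1
    by (intro nn_integral_mono) (auto simp: indicator_def intro!: ennreal_leI divide_left_mono power_mono mult_pos_pos zero_less_power)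
  \<comment> \<open>The weight \<sigma>^2 in Young's inequality gives N/(2 \<sigma>^2) from
    \<open>f\<close> and (\<sigma>^2/2)(1/S) from the kernel. These balance for S = \<sigma>^4,
    which is the reason for the exponent 4.\<close>
  have int: "(\<integral>\<^sup>+t\<in>{y..z}. \<Phi> t \<partial>lborel) \<le> ennreal ((N + 1) / \<sigma>^2)"
  proof -
    have "(\<integral>\<^sup>+t\<in>{y..z}. \<Phi> t \<partial>lborel) \<le> (\<integral>\<^sup>+t\<in>{y..}. \<Phi> t \<partial>lborel)"
      by (intro nn_integral_mono) (auto simp: indicator_def)
    also have "\<dots> = (NN t. (NN s. ennreal (\<bar>f s\<bar> / (S + (t - s))^2) * indicator {..y} s * indicator {y..} t))"
      unfolding \<Phi>_def by (intro nn_integral_cong nn_integral_multc[symmetric]) measurable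
    also have "\<dots> = (NN s. (NN t. ennreal (\<bar>f s\<bar> / (S + (t - s))^2) * indicator {..y} s * indicator {y..} t))"
      unfolding indicator_def atLeast_iff atMost_iff by (rule lborel_pair.Fubini') measurable
    also have "\<dots> \<le> (NN s. ennreal (1 / (2 * \<sigma>^2)) * ennreal ((f s)^2) + ennreal (\<sigma>^2 / 2) * (ennreal (1 / (y + S - s)^2) * indicator {..y} s))"
    proof (rule nn_integral_mono)
      fix s
      show "(NN t. ennreal (\<bar>f s\<bar> / (S + (t - s))^2) * indicator {..y} s * indicator {y..} t) \<le> ennreal (1 / (2 * \<sigma>^2)) * ennreal ((f s)^2) + ennreal (\<sigma>^2 / 2) * (ennreal (1 / (y + S - s)^2) * indicator {..y} s)"
      proof (cases "s \<le> y")
        case True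
        have "(NN t. ennreal (\<bar>f s\<bar> / (S + (t - s))^2) * indicator {..y} s * indicator {y..} t) = (NN t. ennreal \<bar>f s\<bar> * (ennreal (1 / (t - (s - S))^2) * indicator {y..} t))"
          using True by (intro nn_integral_cong) (auto simp: indicator_def ennreal_mult[symmetric] algebra_simps)
        also have "\<dots> = ennreal \<bar>f s\<bar> * ennreal (1 / (y - (s - S)))"
          using True S1 by (subst nn_integral_cmult) (auto simp: nn_integral_inverse_square)
        also have "\<dots> = ennreal (\<bar>f s\<bar> / (y + S - s))" using True S1 by (simp add: ennreal_mult[symmetric] algebra_simps)
        also have "\<dots> \<le> ennreal (1 / (2 * \<sigma>^2) * (f s)^2 + \<sigma>^2 / 2 * (1 / (y + S - s)^2))"
        proof (rule ennreal_leI)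
          define r where "r = 1 / (y + S - s)"
          have "0 \<le> (\<bar>f s\<bar> / \<sigma> - \<sigma> * r)^2 / 2" by simp
          also have "\<dots> = 1 / (2 * \<sigma>^2) * (f s)^2 + \<sigma>^2 / 2 * r^2 - \<bar>f s\<bar> * r"
            using \<sigma> by (simp add: power2_eq_square field_simps)
          finally show "\<bar>f s\<bar> / (y + S - s) \<le> 1 / (2 * \<sigma>^2) * (f s)^2 + \<sigma>^2 / 2 * (1 / (y + S - s)^2)"
            by (simp add: r_def power_divide)
        qed
        also have "\<dots> = ennreal (1 / (2 * \<sigma>^2)) * ennreal ((f s)^2) + ennreal (\<sigma>^2 / 2) * (ennreal (1 / (y + S - s)^2) * indicator {..y} s)"
          using True by (simp add: ennreal_real del: ennreal_plus)
        finally show ?thesis .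
      qed simp
    qed
    also have "\<dots> = ennreal (1 / (2 * \<sigma>^2)) * L2 f + ennreal (\<sigma>^2 / 2) * ennreal (1 / (y + S - y))"
      using S1 unfolding L2_norm_sq_real
      by (subst nn_integral_add, simp, simp, subst nn_integral_cmult, simp, subst nn_integral_cmult, simp, subst nn_integral_inverse_square'[of y "y + S"]) auto
    also have "\<dots> \<le> ennreal (1 / (2 * \<sigma>^2)) * ennreal N + ennreal (\<sigma>^2 / 2) * ennreal (1 / (y + S - y))"
      by (intro add_right_mono mult_left_mono N) auto
    also have "\<dots> = ennreal (1 / (2 * \<sigma>^2) * N + \<sigma>^2 / 2 * (1 / S))"
      using N S1 by (simp add: ennreal_real del: ennreal_plus)
    also have "\<dots> \<le> ennreal ((N + 1) / \<sigma>^2)"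
    proof (rule ennreal_leI)
      have "\<sigma>^2 / 2 * (1 / S) = 1 / (2 * \<sigma>^2)" using \<sigma> by (simp add: S_def power2_eq_square power4_eq_xxxx)
      then have "1 / (2 * \<sigma>^2) * N + \<sigma>^2 / 2 * (1 / S) = (N + 1) / \<sigma>^2 / 2" by (simp add: add_divide_distrib)
      also have "\<dots> \<le> (N + 1) / \<sigma>^2"
      proof -
        have "x / 2 \<le> x" if "0 \<le> x" for x :: real using that by simp
        moreover have "0 \<le> (N + 1) / \<sigma>^2" using N by simp
        ultimately show ?thesis by blast
      qed
      finally show "1 / (2 * \<sigma>^2) * N + \<sigma>^2 / 2 * (1 / S) \<le> (N + 1) / \<sigma>^2" .
    qed
    finally show ?thesis .
  qed
  have "(NN t. ennreal (2 * \<bar>f t\<bar>) * indicator {y..z} t * \<Phi> t)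
    \<le> (NN t. ennreal (1 / \<sigma>) * (ennreal ((f t)^2) * indicator {y..z} t) + ennreal \<sigma> * \<Phi> y * (\<Phi> t * indicator {y..z} t))"
  proof (rule nn_integral_mono)
    fix t
    have "ennreal (2 * \<bar>f t\<bar>) * \<Phi> t \<le> ennreal (1 / \<sigma>) * ennreal ((f t)^2) + ennreal \<sigma> * \<Phi> y * \<Phi> t" if "t \<ge> y"
      using ennreal_young[of "\<bar>f t\<bar>" \<sigma> "\<Phi> t" "\<Phi> y"] \<Phi>y[OF that] \<sigma> by (simp add: ennreal_mult[symmetric])
    then show "ennreal (2 * \<bar>f t\<bar>) * indicator {y..z} t * \<Phi> t \<le> ennreal (1 / \<sigma>) * (ennreal ((f t)^2) * indicator {y..z} t) + ennreal \<sigma> * \<Phi> y * (\<Phi> t * indicator {y..z} t)"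
      by (auto simp: indicator_def)
  qed
  also have "\<dots> = ennreal (1 / \<sigma>) * (\<integral>\<^sup>+t\<in>{y..z}. ennreal ((f t)^2) \<partial>lborel) + ennreal \<sigma> * \<Phi> y * (\<integral>\<^sup>+t\<in>{y..z}. \<Phi> t \<partial>lborel)"
    by (subst nn_integral_add, simp, simp, subst nn_integral_cmult, simp, subst nn_integral_cmult) auto
  also have "\<dots> \<le> ennreal (1 / \<sigma>) * (\<integral>\<^sup>+t\<in>{y..z}. ennreal ((f t)^2) \<partial>lborel) + ennreal \<sigma> * \<Phi> y * ennreal ((N + 1) / \<sigma>^2)"
    by (intro add_left_mono mult_left_mono int) auto
  also have "ennreal \<sigma> * \<Phi> y * ennreal ((N + 1) / \<sigma>^2) = ennreal ((N + 1) / \<sigma>) * \<Phi> y"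
  proof -
    have "ennreal \<sigma> * ennreal ((N + 1) / \<sigma>^2) = ennreal ((N + 1) / \<sigma>)"
      using \<sigma> N by (subst ennreal_mult[symmetric]) (auto simp: power2_eq_square)
    then show ?thesis by (metis mult.assoc mult.commute)
  qed
  finally show ?thesis unfolding \<Phi>_def .
qed

lemma tail_interaction_right:
  fixes f :: "real \<Rightarrow> real"
  assumes f[measurable]: "f \<in> borel_measurable borel" and N: "L2 f \<le> ennreal N" "N \<ge> 0" and \<sigma>: "\<sigma> \<ge> 1"
  defines "S \<equiv> \<sigma> ^ 4"
  shows "(NN t. ennreal (2 * \<bar>f t\<bar>) * indicator {z..y} t * (\<integral>\<^sup>+s\<in>{y..}. ennreal (\<bar>f s\<bar> / (S + (s - t))^2) \<partial>lborel))
    \<le> ennreal (1 / \<sigma>) * (\<integral>\<^sup>+t\<in>{z..y}. ennreal ((f t)^2) \<partial>lborel)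
      + ennreal ((N + 1) / \<sigma>) * (\<integral>\<^sup>+s\<in>{y..}. ennreal (\<bar>f s\<bar> / (S + (s - y))^2) \<partial>lborel)"
proof -
  have fm: "(\<lambda>x. f (0 + (- 1) * x)) \<in> borel_measurable borel" by measurable
  have N': "L2 (\<lambda>x. f (0 + (- 1) * x)) \<le> ennreal N" using L2_affine[of "-1" f 0] N by simp
  have r: "(NN x. F x) = (NN x. F (- x))" if "F \<in> borel_measurable borel" for F :: "real \<Rightarrow> ennreal"
    using nn_integral_real_affine[OF that, of "-1" 0] by simp
  have i: "indicator {- y..- z} t = (indicator {z..y} (- t) :: ennreal)" "indicator {..- y} t = (indicator {y..} (- t) :: ennreal)" for t y z :: real
    by (auto simp: indicator_def)
  have inner: "(\<integral>\<^sup>+s\<in>{y..}. ennreal (\<bar>f s\<bar> / (S + (s - t))^2) \<partial>lborel) = (\<integral>\<^sup>+s\<in>{..- y}. ennreal (\<bar>f (- s)\<bar> / (S + (- t - s))^2) \<partial>lborel)" for t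
    by (subst r) (auto simp: i algebra_simps)
  show ?thesis
    unfolding inner
    apply (subst r, simp)
    apply (subst (3) r, simp)
    using tail_interaction[OF fm N' N(2) \<sigma>, of "- y" "- z", folded S_def] by (simp add: i)
qed

lemma nn_integral_kernel_abs:
  assumes "S > 0"
  shows "(NN s. ennreal (1 / (S + \<bar>s - t\<bar>)^2)) \<le> ennreal (2 / S)"
proof -
  have "(NN s. ennreal (1 / (S + \<bar>s - t\<bar>)^2)) \<le> (NN s. ennreal (1 / (t + S - s)^2) * indicator {..t} s + ennreal (1 / (s - (t - S))^2) * indicator {t..} s)"
  proof (rule nn_integral_mono)
    fix s show "ennreal (1 / (S + \<bar>s - t\<bar>)^2) \<le> ennreal (1 / (t + S - s)^2) * indicator {..t} s + ennreal (1 / (s - (t - S))^2) * indicator {t..} s"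
      by (cases "s \<le> t") (auto simp: indicator_def algebra_simps)
  qed
  also have "\<dots> = ennreal (1 / (t + S - t)) + ennreal (1 / (t - (t - S)))"
    using assms by (subst nn_integral_add, simp, simp) (simp only: nn_integral_inverse_square nn_integral_inverse_square' less_add_same_cancel1 diff_less)
  also have "\<dots> = ennreal (2 / S)" using assms by (simp add: ennreal_plus[symmetric] del: ennreal_plus)
  finally show ?thesis .
qed

text \<open>At short distance the Lipschitz bound gives 4/S^2, at long distance 2 - 2 cos \<le> 4
  gives 4/|s - t|^2; the larger of S and |s - t| is at least half their sum.\<close>

lemma localisation_kernel:
  fixes b :: "real \<Rightarrow> real"
  assumes S: "S > 0" and b: "\<bar>b s - b t\<bar> \<le> 2 / S * \<bar>s - t\<bar>"
  shows "(2 - 2 * cos (b s - b t)) / (s - t)^2 \<le> 16 / (S + \<bar>s - t\<bar>)^2"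
proof (cases "s = t")
  case False
  define D where "D = \<bar>s - t\<bar>"
  have D: "D > 0" "(s - t)^2 = D^2" using False by (auto simp: D_def)
  have c: "2 - 2 * cos d \<le> d^2" for d :: real
  proof -
    have "1 - cos d = 2 * (sin (d / 2))^2" using cos_double_sin[of "d / 2"] by simp
    moreover have "(sin (d / 2))^2 \<le> (d / 2)^2" using abs_sin_x_le_abs_x[of "d / 2"] unfolding abs_le_square_iff .
    ultimately show ?thesis by (simp add: power_divide)
  qed
  have "2 - 2 * cos (b s - b t) \<le> 4 * D^2 / S^2"
  proof -
    have "(b s - b t)^2 \<le> (2 / S * D)^2" using b by (metis D_def abs_ge_zero power2_abs power_mono)
    then show ?thesis using c[of "b s - b t"] by (simp add: power_mult_distrib power_divide)
  qed
  moreover have "2 - 2 * cos (b s - b t) \<le> 4" using cos_ge_minus_one[of "b s - b t"] by linarith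
  ultimately have "(2 - 2 * cos (b s - b t)) / D^2 \<le> 4 / S^2" "(2 - 2 * cos (b s - b t)) / D^2 \<le> 4 / D^2"
    using D S by (auto simp: divide_simps mult.commute)
  moreover have "4 / (max S D)^2 \<le> 16 / (S + D)^2"
  proof -
    have "(S + D)^2 \<le> (2 * max S D)^2" using S D by (intro power_mono) auto
    then have "16 / (2 * max S D)^2 \<le> 16 / (S + D)^2" using S D by (intro divide_left_mono) (auto intro!: mult_pos_pos zero_less_power add_pos_pos simp: max_def)
    then show ?thesis by (simp add: power_mult_distrib)
  qed
  ultimately show ?thesis unfolding D(2) D_def[symmetric] by (auto simp: max_def split: if_splits)
qed simp

text \<open>The cutoff angle vanishes outside the window, so one of the two points lies in it. The
  other one lies in the window (Young and the integral of the kernel) or to the left or right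
  (\<open>tail_interaction\<close> and its mirror image). The resulting weights are 96, 16 and 16,
  rounded up to 100.\<close>

lemma ims_error:
  fixes f b :: "real \<Rightarrow> real"
  assumes f[measurable]: "f \<in> borel_measurable borel" and N: "L2 f \<le> ennreal N" "N \<ge> 0" and \<sigma>: "\<sigma> \<ge> 1"
    and b[measurable]: "b \<in> borel_measurable borel" and bl: "\<And>s t. \<bar>b s - b t\<bar> \<le> 2 / \<sigma> ^ 4 * \<bar>s - t\<bar>"
    and b0: "\<And>x. x \<notin> {y..z} \<Longrightarrow> b x = 0"
  defines "S \<equiv> \<sigma> ^ 4"
  shows "DI (\<lambda>s t. \<bar>f s\<bar> * \<bar>f t\<bar> * (2 - 2 * cos (b s - b t)) / (s - t)^2)
    \<le> ennreal (100 * (N + 1) / \<sigma>) * ((\<integral>\<^sup>+t\<in>{y..z}. ennreal ((f t)^2) \<partial>lborel)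
      + (\<integral>\<^sup>+s\<in>{..y}. ennreal (\<bar>f s\<bar> / (S + (y - s))^2) \<partial>lborel)
      + (\<integral>\<^sup>+s\<in>{z..}. ennreal (\<bar>f s\<bar> / (S + (s - z))^2) \<partial>lborel))"
    (is "?E \<le> ennreal _ * (?A + ?L + ?R)")
proof -
  have S1: "S \<ge> 1" "S \<ge> \<sigma>" using \<sigma> power_increasing[of 1 4 \<sigma>] by (auto simp: S_def)
  let ?k = "\<lambda>s t. 1 / (S + \<bar>s - t\<bar>)^2"
  let ?G = "\<lambda>s t. 16 * (\<bar>f s\<bar> * \<bar>f t\<bar>) * ?k s t * indicator {y..z} t"
  have Gm: "meas2 ?G" unfolding indicator_def atLeastAtMost_iff by measurable
  have Gm': "meas2 (\<lambda>s t. ?G t s)" unfolding indicator_def atLeastAtMost_iff by measurable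
  have G0: "0 \<le> ?G s t" for s t by (simp add: indicator_def)
  have "?E \<le> DI (\<lambda>s t. ?G s t + ?G t s)"
  proof (rule DI_mono)
    fix s t
    show "\<bar>f s\<bar> * \<bar>f t\<bar> * (2 - 2 * cos (b s - b t)) / (s - t)^2 \<le> ?G s t + ?G t s"
    proof (cases "s \<in> {y..z} \<or> t \<in> {y..z}")
      case True
      have "\<bar>f s\<bar> * \<bar>f t\<bar> * ((2 - 2 * cos (b s - b t)) / (s - t)^2) \<le> \<bar>f s\<bar> * \<bar>f t\<bar> * (16 * ?k s t)"
      proof (intro mult_left_mono)
        have "S > 0" using S1 by simp
        from localisation_kernel[OF this, of b s t] bl[of s t]
        show "(2 - 2 * cos (b s - b t)) / (s - t)^2 \<le> 16 * ?k s t" by (simp add: S_def)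
      qed simp
      also have "\<dots> \<le> ?G s t + ?G t s"
      proof (cases "t \<in> {y..z}")
        case True
        then have "\<bar>f s\<bar> * \<bar>f t\<bar> * (16 * ?k s t) = ?G s t" by simp
        then show ?thesis using G0[where s = t and t = s] by linarith
      next
        case False
        then have "\<bar>f s\<bar> * \<bar>f t\<bar> * (16 * ?k s t) = ?G t s"
          using \<open>s \<in> {y..z} \<or> t \<in> {y..z}\<close> by (auto simp: abs_minus_commute[of s t])
        then show ?thesis using G0[where s = s and t = t] by linarith
      qed
      finally show ?thesis by simp
    next
      case False
      then show ?thesis using b0 by simp
    qed
  qed
  also have "\<dots> = DI ?G + DI ?G"
    unfolding DI_add[OF Gm G0 Gm' G0] DI_swap[OF Gm] ..
  finally have E: "?E \<le> DI ?G + DI ?G" .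
  let ?I1 = "\<lambda>s t. 8 * ((f s)^2 * ?k s t * indicator {y..z} t * indicator {y..z} s)"
  let ?I1' = "\<lambda>s t. 8 * ((f t)^2 * ?k s t * indicator {y..z} t * indicator {y..z} s)"
  let ?I2 = "\<lambda>s t. 8 * (2 * \<bar>f t\<bar> * indicator {y..z} t * (\<bar>f s\<bar> / (S + (t - s))^2 * indicator {..y} s))"
  let ?I3 = "\<lambda>s t. 8 * (2 * \<bar>f t\<bar> * indicator {y..z} t * (\<bar>f s\<bar> / (S + (s - t))^2 * indicator {z..} s))"
  have I1m: "meas2 ?I1" "meas2 ?I1'" unfolding indicator_def atLeastAtMost_iff by measurable
  have I2m: "meas2 ?I2" unfolding indicator_def atLeastAtMost_iff atMost_iff by measurable
  have I3m: "meas2 ?I3" unfolding indicator_def atLeastAtMost_iff atLeast_iff by measurable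
  have I0: "0 \<le> ?I1 s t" "0 \<le> ?I1' s t" "0 \<le> ?I2 s t" "0 \<le> ?I3 s t" for s t by (auto simp: indicator_def)
  have "DI ?G \<le> DI (\<lambda>s t. (?I1 s t + ?I1' s t) + (?I2 s t + ?I3 s t))"
  proof (rule DI_mono)
    fix s t
    show "?G s t \<le> (?I1 s t + ?I1' s t) + (?I2 s t + ?I3 s t)"
    proof (cases "t \<in> {y..z}")
      case True
      consider "s \<in> {y..z}" | "s < y" | "s > z" by fastforce
      then show ?thesis
      proof cases
        case 1
        have "16 * (\<bar>f s\<bar> * \<bar>f t\<bar>) \<le> 8 * (f s)^2 + 8 * (f t)^2"
          using zero_le_power2[of "\<bar>f s\<bar> - \<bar>f t\<bar>"] by (simp add: power2_eq_square algebra_simps)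
        then have "16 * (\<bar>f s\<bar> * \<bar>f t\<bar>) * ?k s t \<le> (8 * (f s)^2 + 8 * (f t)^2) * ?k s t"
          by (rule mult_right_mono) simp
        also have "\<dots> = 8 * (f s)^2 * ?k s t + 8 * (f t)^2 * ?k s t" by (rule distrib_right)
        finally have "?G s t \<le> ?I1 s t + ?I1' s t" using 1 True by simp
        then show ?thesis using I0[where s = s and t = t] by linarith
      next
        case 2
        then have "?G s t = ?I2 s t" using True by simp
        then show ?thesis using I0[where s = s and t = t] by linarith
      next
        case 3
        then have "?G s t = ?I3 s t" using True by simp
        then show ?thesis using I0[where s = s and t = t] by linarith
      qed
    next
      case False then show ?thesis by simp
    qed
  qed
  also have "\<dots> = (DI ?I1 + DI ?I1') + (DI ?I2 + DI ?I3)"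
  proof -
    have m: "meas2 (\<lambda>s t. ?I1 s t + ?I1' s t)" "meas2 (\<lambda>s t. ?I2 s t + ?I3 s t)"
      unfolding indicator_def atLeastAtMost_iff atLeast_iff atMost_iff by measurable
    have n: "0 \<le> ?I1 s t + ?I1' s t" "0 \<le> ?I2 s t + ?I3 s t" for s t using I0[where s = s and t = t] by linarith+
    show ?thesis unfolding DI_add[OF m(1) n(1) m(2) n(2)] DI_add[OF I1m(1) I0(1) I1m(2) I0(2)] DI_add[OF I2m I0(3) I3m I0(4)] ..
  qed
  finally have G: "DI ?G \<le> (DI ?I1 + DI ?I1') + (DI ?I2 + DI ?I3)" .
  have I1': "DI ?I1' \<le> ennreal (16 / S) * ?A"
  proof -
    have "DI ?I1' \<le> (NN t. ennreal (16 / S) * (ennreal ((f t)^2) * indicator {y..z} t))"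
      unfolding DI_def
    proof (rule nn_integral_mono)
      fix t
      have "(NN s. ennreal (?I1' s t)) \<le> (NN s. ennreal (8 * (f t)^2 * indicator {y..z} t) * ennreal (?k s t))"
        by (intro nn_integral_mono) (auto simp: indicator_def ennreal_mult[symmetric])
      also have "\<dots> = ennreal (8 * (f t)^2 * indicator {y..z} t) * (NN s. ennreal (?k s t))"
        by (rule nn_integral_cmult) simp
      also have "\<dots> \<le> ennreal (8 * (f t)^2 * indicator {y..z} t) * ennreal (2 / S)"
        using S1 by (intro mult_left_mono nn_integral_kernel_abs) auto
      also have "\<dots> = ennreal (16 / S) * (ennreal ((f t)^2) * indicator {y..z} t)"
        using S1 by (auto simp: indicator_def ennreal_mult[symmetric])
      finally show "(NN s. ennreal (?I1' s t)) \<le> ennreal (16 / S) * (ennreal ((f t)^2) * indicator {y..z} t)" .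
    qed
    also have "\<dots> = ennreal (16 / S) * ?A" by (rule nn_integral_cmult) simp
    finally show ?thesis .
  qed
  have e1: "(\<lambda>s t. ?I1 t s) = ?I1'" by (auto simp: fun_eq_iff abs_minus_commute mult_ac)
  have I1: "DI ?I1 \<le> ennreal (16 / S) * ?A"
    using I1' DI_swap[OF I1m(1)] unfolding e1 by (simp only:)
  have I2: "DI ?I2 \<le> ennreal 8 * (ennreal (1 / \<sigma>) * ?A + ennreal ((N + 1) / \<sigma>) * ?L)"
  proof -
    have "DI ?I2 = (NN t. ennreal 8 * (ennreal (2 * \<bar>f t\<bar>) * indicator {y..z} t * (\<integral>\<^sup>+s\<in>{..y}. ennreal (\<bar>f s\<bar> / (S + (t - s))^2) \<partial>lborel)))"
      unfolding DI_def
    proof (rule nn_integral_cong)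
      fix t
      have "(NN s. ennreal (?I2 s t)) = (NN s. (ennreal 8 * (ennreal (2 * \<bar>f t\<bar>) * indicator {y..z} t)) * (ennreal (\<bar>f s\<bar> / (S + (t - s))^2) * indicator {..y} s))"
        by (intro nn_integral_cong) (auto simp: indicator_def ennreal_mult[symmetric] mult.assoc simp del: ennreal_numeral)
      then show "(NN s. ennreal (?I2 s t)) = ennreal 8 * (ennreal (2 * \<bar>f t\<bar>) * indicator {y..z} t * (\<integral>\<^sup>+s\<in>{..y}. ennreal (\<bar>f s\<bar> / (S + (t - s))^2) \<partial>lborel))"
        by (subst (asm) nn_integral_cmult) (simp_all add: mult.assoc)
    qed
    also have "\<dots> = ennreal 8 * (NN t. ennreal (2 * \<bar>f t\<bar>) * indicator {y..z} t * (\<integral>\<^sup>+s\<in>{..y}. ennreal (\<bar>f s\<bar> / (S + (t - s))^2) \<partial>lborel))"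
      by (rule nn_integral_cmult) measurable
    also have "\<dots> \<le> ennreal 8 * (ennreal (1 / \<sigma>) * ?A + ennreal ((N + 1) / \<sigma>) * ?L)"
      unfolding S_def by (intro mult_left_mono tail_interaction[OF f N \<sigma>]) auto
    finally show ?thesis .
  qed
  have I3: "DI ?I3 \<le> ennreal 8 * (ennreal (1 / \<sigma>) * ?A + ennreal ((N + 1) / \<sigma>) * ?R)"
  proof -
    have "DI ?I3 = (NN t. ennreal 8 * (ennreal (2 * \<bar>f t\<bar>) * indicator {y..z} t * (\<integral>\<^sup>+s\<in>{z..}. ennreal (\<bar>f s\<bar> / (S + (s - t))^2) \<partial>lborel)))"
      unfolding DI_def
    proof (rule nn_integral_cong)
      fix t
      have "(NN s. ennreal (?I3 s t)) = (NN s. (ennreal 8 * (ennreal (2 * \<bar>f t\<bar>) * indicator {y..z} t)) * (ennreal (\<bar>f s\<bar> / (S + (s - t))^2) * indicator {z..} s))"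
        by (intro nn_integral_cong) (auto simp: indicator_def ennreal_mult[symmetric] mult.assoc simp del: ennreal_numeral)
      then show "(NN s. ennreal (?I3 s t)) = ennreal 8 * (ennreal (2 * \<bar>f t\<bar>) * indicator {y..z} t * (\<integral>\<^sup>+s\<in>{z..}. ennreal (\<bar>f s\<bar> / (S + (s - t))^2) \<partial>lborel))"
        by (subst (asm) nn_integral_cmult) (simp_all add: mult.assoc)
    qed
    also have "\<dots> = ennreal 8 * (NN t. ennreal (2 * \<bar>f t\<bar>) * indicator {y..z} t * (\<integral>\<^sup>+s\<in>{z..}. ennreal (\<bar>f s\<bar> / (S + (s - t))^2) \<partial>lborel))"
      by (rule nn_integral_cmult) measurable
    also have "\<dots> \<le> ennreal 8 * (ennreal (1 / \<sigma>) * ?A + ennreal ((N + 1) / \<sigma>) * ?R)"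
      unfolding S_def by (intro mult_left_mono tail_interaction_right[OF f N \<sigma>]) auto
    finally show ?thesis .
  qed
  have k1: "ennreal (16 / S) * ?A \<le> ennreal (16 * (N + 1) / \<sigma>) * ?A"
    using S1 \<sigma> N by (intro mult_right_mono ennreal_leI frac_le) auto
  have k2: "ennreal 8 * (ennreal (1 / \<sigma>) * U + ennreal ((N + 1) / \<sigma>) * V) \<le> ennreal (8 * (N + 1) / \<sigma>) * (U + V)" for U V
  proof -
    have "ennreal 8 * (ennreal (1 / \<sigma>) * U + ennreal ((N + 1) / \<sigma>) * V) \<le> ennreal 8 * (ennreal ((N + 1) / \<sigma>) * U + ennreal ((N + 1) / \<sigma>) * V)"
      using N \<sigma> by (intro mult_left_mono add_mono mult_right_mono ennreal_leI divide_right_mono) auto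
    also have "\<dots> = ennreal 8 * ennreal ((N + 1) / \<sigma>) * (U + V)" by (simp only: distrib_left mult.assoc)
    also have "ennreal 8 * ennreal ((N + 1) / \<sigma>) = ennreal (8 * (N + 1) / \<sigma>)"
      using N \<sigma> by (simp add: ennreal_mult[symmetric] del: ennreal_numeral)
    finally show ?thesis .
  qed
  define c where "c = (N + 1) / \<sigma>"
  have c0: "c \<ge> 0" using N \<sigma> by (simp add: c_def)
  have "?E \<le> 2 * ((ennreal (16 * c) * ?A + ennreal (16 * c) * ?A) + (ennreal (8 * c) * (?A + ?L) + ennreal (8 * c) * (?A + ?R)))"
    using E G I1 I1' I2 I3 k1 k2[of ?A ?L] k2[of ?A ?R]
    unfolding c_def times_divide_eq_right mult_2 by (meson add_mono order_trans)
  also have "\<dots> \<le> ennreal (100 * c) * (?A + ?L + ?R)"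
  proof -
    have e: "ennreal (16 * c) = 16 * ennreal c" "ennreal (8 * c) = 8 * ennreal c" "ennreal (100 * c) = 100 * ennreal c"
      using c0 by (simp_all add: ennreal_mult)
    have "2 * ((16 * C * A + 16 * C * A) + (8 * C * (A + L) + 8 * C * (A + R))) = 96 * (C * A) + 16 * (C * L) + 16 * (C * R)" for C A L R :: ennreal
    proof -
      have "2 * ((16 * C * A + 16 * C * A) + (8 * C * (A + L) + 8 * C * (A + R)))
        = (2 * 16 * (C * A) + 2 * 16 * (C * A) + 2 * 8 * (C * A) + 2 * 8 * (C * A)) + 2 * 8 * (C * L) + 2 * 8 * (C * R)"
        by (simp only: distrib_left mult.assoc add_ac)
      also have "2 * 16 * (C * A) + 2 * 16 * (C * A) + 2 * 8 * (C * A) + 2 * 8 * (C * A) = (2 * 16 + 2 * 16 + 2 * 8 + 2 * 8) * (C * A)"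
        by (simp only: distrib_right)
      finally show ?thesis by simp
    qed
    moreover have "96 * X + 16 * Y + 16 * Z \<le> 100 * X + 100 * Y + 100 * Z" for X Y Z :: ennreal
      by (intro add_mono mult_right_mono) auto
    ultimately show ?thesis unfolding e by (simp only: distrib_left mult.assoc)
  qed
  finally show ?thesis unfolding c_def by simp
qed

lemma Qp_commute:
  assumes [measurable]: "a \<in> borel_measurable borel" "b \<in> borel_measurable borel"
  shows "Qp a b = Qp b a"
proof -
  have "meas2 (\<lambda>s t. max 0 (a s * b t) / (s - t)^2)" by measurable
  from DI_swap[OF this] show ?thesis unfolding Qp_def by (simp add: mult.commute power2_commute)
qed

lemma Qp_lower:
  assumes [measurable]: "a \<in> borel_measurable borel" "b \<in> borel_measurable borel" "r \<in> borel_measurable borel" "A \<in> sets borel"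
    and \<tau>: "\<tau> > 0" and b: "\<And>t. t \<in> {q..q+\<tau>} \<Longrightarrow> b t \<le> - 1/4"
    and r: "\<And>s t. s \<in> A \<Longrightarrow> t \<in> {q..q+\<tau>} \<Longrightarrow> s \<noteq> t \<and> \<bar>s - t\<bar> \<le> M * r s" and M: "M > 0"
  shows "ennreal (\<tau> / (4 * M^2)) * (\<integral>\<^sup>+s\<in>A. ennreal (max 0 (- a s) / (r s)^2) \<partial>lborel) \<le> Qp a b"
proof -
  have "ennreal (\<tau> / (4 * M^2)) * (\<integral>\<^sup>+s\<in>A. ennreal (max 0 (- a s) / (r s)^2) \<partial>lborel)
     = (NN s. ennreal (\<tau> / (4 * M^2)) * (ennreal (max 0 (- a s) / (r s)^2) * indicator A s))"
    by (rule nn_integral_cmult[symmetric]) simp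
  also have "\<dots> \<le> DI (\<lambda>t s. max 0 (b t * a s) / (t - s)^2)"
    unfolding DI_def
  proof (rule nn_integral_mono)
    fix s
    show "ennreal (\<tau> / (4 * M^2)) * (ennreal (max 0 (- a s) / (r s)^2) * indicator A s) \<le> (NN t. ennreal (max 0 (b t * a s) / (t - s)^2))"
    proof (cases "s \<in> A")
      case True
      have "ennreal (\<tau> / (4 * M^2)) * (ennreal (max 0 (- a s) / (r s)^2) * indicator A s) = (\<integral>\<^sup>+t\<in>{q..q+\<tau>}. ennreal (max 0 (- a s) / (4 * (M * r s)^2)) \<partial>lborel)"
      proof -
        have "(\<integral>\<^sup>+t\<in>{q..q+\<tau>}. ennreal (max 0 (- a s) / (4 * (M * r s)^2)) \<partial>lborel) = ennreal (max 0 (- a s) / (4 * (M * r s)^2)) * ennreal \<tau>"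
          using \<tau> by (subst nn_integral_cmult) (auto simp: emeasure_lborel_Icc_eq)
        then show ?thesis using True \<tau> by (simp add: ennreal_mult[symmetric] power_mult_distrib mult_ac)
      qed
      also have "\<dots> \<le> (NN t. ennreal (max 0 (b t * a s) / (t - s)^2))"
      proof (rule nn_integral_mono)
        fix t
        show "ennreal (max 0 (- a s) / (4 * (M * r s)^2)) * indicator {q..q+\<tau>} t \<le> ennreal (max 0 (b t * a s) / (t - s)^2)"
        proof (cases "t \<in> {q..q+\<tau>}")
          case t: True
          have "max 0 (- a s) / 4 \<le> max 0 (b t * a s)"
          proof (cases "a s < 0")
            case True
            then have "b t * a s \<ge> (- 1/4) * a s" using b[OF t] by (intro mult_right_mono_neg) auto
            then show ?thesis using True by (simp add: max_def)
          qed simp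
          moreover have "(t - s)^2 \<le> (M * r s)^2" "0 < (t - s)^2"
            using r[OF True t] by (auto simp: abs_minus_commute power2_commute abs_le_square_iff[symmetric])
          ultimately have "max 0 (- a s) / 4 / (M * r s)^2 \<le> max 0 (b t * a s) / (t - s)^2"
            by (intro frac_le) auto
          then show ?thesis using t by (simp add: ennreal_leI)
        qed simp
      qed
      finally show ?thesis .
    qed simp
  qed
  also have "\<dots> = Qp b a" by (simp add: Qp_def)
  finally show ?thesis by (simp add: Qp_commute[of a b])
qed

text \<open>If the product is negative, one factor is positive and hence at most \<epsilon>. What
  remains is linear in the other factor and is paired with the kernel by Young's inequality; the gap
  of length 1 keeps the kernel integrals below 1.\<close>

lemma Qp_opposite_sign:
  assumes [measurable]: "a \<in> borel_measurable borel" "b \<in> borel_measurable borel"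
    and a: "\<And>x. x > p \<Longrightarrow> a x = 0" "\<And>x. a x \<le> \<epsilon>" and b: "\<And>x. x < q \<Longrightarrow> b x = 0" "\<And>x. b x \<le> \<epsilon>"
    and pq: "p + 1 \<le> q" and N: "L2 a \<le> ennreal N" "L2 b \<le> ennreal N" "N \<ge> 0" and \<epsilon>: "\<epsilon> \<ge> 0"
  shows "Qp (\<lambda>x. - a x) b \<le> ennreal (\<epsilon> * (N + 1))"
proof -
  let ?k = "\<lambda>s t. 1 / (t - s)^2 * indicator {q..} t * indicator {..p} s"
  let ?A = "\<lambda>s t. \<epsilon> * (\<bar>a s\<bar> * ?k s t)" and ?B = "\<lambda>s t. \<epsilon> * (\<bar>b t\<bar> * ?k s t)"
  have m: "meas2 ?A" "meas2 ?B" unfolding indicator_def atLeast_iff atMost_iff by measurable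
  have nn: "0 \<le> ?A s t" "0 \<le> ?B s t" for s t using \<epsilon> by auto
  have yng: "\<bar>x\<bar> / d \<le> 1/2 * x^2 + 1/2 * (1 / d^2)" for x d :: real
  proof -
    have "0 \<le> (\<bar>x\<bar> - 1 / d)^2" by simp
    also have "\<dots> = x^2 - 2 * (\<bar>x\<bar> / d) + 1 / d^2" by (simp add: power2_diff power_divide)
    finally show ?thesis by linarith
  qed
  have "Qp (\<lambda>x. - a x) b \<le> DI (\<lambda>s t. ?A s t + ?B s t)"
    unfolding Qp_def
  proof (rule DI_mono)
    fix s t
    show "max 0 (- a s * b t) / (s - t)^2 \<le> ?A s t + ?B s t"
    proof (cases "s \<le> p \<and> q \<le> t")
      case True
      have "max 0 (- a s * b t) \<le> \<epsilon> * (\<bar>a s\<bar> + \<bar>b t\<bar>)"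
      proof (cases "- a s * b t > 0")
        case True
        then consider "a s > 0" "b t < 0" | "a s < 0" "b t > 0" by (auto simp: mult_less_0_iff)
        then show ?thesis
        proof cases
          case 1
          then have "a s * (- b t) \<le> \<epsilon> * (- b t)" using a(2) by (intro mult_right_mono) auto
          also have "\<dots> \<le> \<epsilon> * (\<bar>a s\<bar> + \<bar>b t\<bar>)" using \<epsilon> by (intro mult_left_mono) auto
          finally show ?thesis using True by simp
        next
          case 2
          then have "(- a s) * b t \<le> (- a s) * \<epsilon>" using b(2) by (intro mult_left_mono) auto
          also have "\<dots> = \<epsilon> * (- a s)" by simp
          also have "\<dots> \<le> \<epsilon> * (\<bar>a s\<bar> + \<bar>b t\<bar>)" using \<epsilon> by (intro mult_left_mono) auto
          finally show ?thesis using True by simp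
        qed
      qed (use \<epsilon> in simp)
      then have "max 0 (- a s * b t) / (s - t)^2 \<le> \<epsilon> * (\<bar>a s\<bar> + \<bar>b t\<bar>) / (s - t)^2" by (rule divide_right_mono) simp
      then show ?thesis using True by (simp add: power2_commute[of t s] add_divide_distrib distrib_left)
    next
      case False
      then have "- a s * b t = 0" using a(1)[of s] b(1)[of t] by auto
      moreover have "0 \<le> ?A s t + ?B s t" by (intro add_nonneg_nonneg nn)
      ultimately show ?thesis by (simp only: max.idem div_0)
    qed
  qed
  also have "\<dots> = DI ?A + DI ?B" by (rule DI_add[OF m(1) nn(1) m(2) nn(2)])
  also have "DI ?A = DI (\<lambda>s t. ?A t s)" by (rule DI_swap[OF m(1), symmetric])
  also have "\<dots> \<le> (NN t. ennreal (\<epsilon> / 2) * (ennreal ((a t)^2) + ennreal (1 / (q - t)^2) * indicator {..p} t))"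
    unfolding DI_def
  proof (rule nn_integral_mono)
    fix t
    show "(NN s. ennreal (?A t s)) \<le> ennreal (\<epsilon> / 2) * (ennreal ((a t)^2) + ennreal (1 / (q - t)^2) * indicator {..p} t)"
    proof (cases "t \<le> p")
      case True
      have "(NN s. ennreal (?A t s)) = (NN s. ennreal (\<epsilon> * \<bar>a t\<bar>) * (ennreal (1 / (s - t)^2) * indicator {q..} s))"
        using True \<epsilon> by (intro nn_integral_cong) (auto simp: indicator_def ennreal_mult[symmetric])
      also have "\<dots> = ennreal (\<epsilon> * \<bar>a t\<bar>) * ennreal (1 / (q - t))"
        using True pq by (subst nn_integral_cmult) (auto simp: nn_integral_inverse_square)
      also have "\<dots> = ennreal (\<epsilon> * (\<bar>a t\<bar> / (q - t)))" using True pq \<epsilon> by (simp add: ennreal_mult[symmetric])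
      also have "\<dots> \<le> ennreal (\<epsilon> * (1/2 * (a t)^2 + 1/2 * (1 / (q - t)^2)))"
        using yng \<epsilon> by (intro ennreal_leI mult_left_mono) auto
      also have "\<dots> = ennreal (\<epsilon> / 2) * (ennreal ((a t)^2) + ennreal (1 / (q - t)^2) * indicator {..p} t)"
        using True \<epsilon> by (simp add: ennreal_real distrib_left add_divide_distrib del: ennreal_plus)
      finally show ?thesis .
    qed (simp add: indicator_def)
  qed
  also have "\<dots> = ennreal (\<epsilon> / 2) * (L2 a + (\<integral>\<^sup>+t\<in>{..p}. ennreal (1 / (q - t)^2) \<partial>lborel))"
    unfolding L2_norm_sq_real by (subst nn_integral_cmult, simp, subst nn_integral_add) auto
  also have "(\<integral>\<^sup>+t\<in>{..p}. ennreal (1 / (q - t)^2) \<partial>lborel) = ennreal (1 / (q - p))"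
    by (rule nn_integral_inverse_square') (use pq in simp)
  also have "DI ?B \<le> (NN t. ennreal (\<epsilon> / 2) * (ennreal ((b t)^2) + ennreal (1 / (t - p)^2) * indicator {q..} t))"
    unfolding DI_def
  proof (rule nn_integral_mono)
    fix t
    show "(NN s. ennreal (?B s t)) \<le> ennreal (\<epsilon> / 2) * (ennreal ((b t)^2) + ennreal (1 / (t - p)^2) * indicator {q..} t)"
    proof (cases "q \<le> t")
      case True
      have "(NN s. ennreal (?B s t)) = (NN s. ennreal (\<epsilon> * \<bar>b t\<bar>) * (ennreal (1 / (t - s)^2) * indicator {..p} s))"
        using True \<epsilon> by (intro nn_integral_cong) (auto simp: indicator_def ennreal_mult[symmetric])
      also have "\<dots> = ennreal (\<epsilon> * \<bar>b t\<bar>) * ennreal (1 / (t - p))"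
        using True pq by (subst nn_integral_cmult) (auto simp: nn_integral_inverse_square')
      also have "\<dots> = ennreal (\<epsilon> * (\<bar>b t\<bar> / (t - p)))" using True pq \<epsilon> by (simp add: ennreal_mult[symmetric])
      also have "\<dots> \<le> ennreal (\<epsilon> * (1/2 * (b t)^2 + 1/2 * (1 / (t - p)^2)))"
        using yng \<epsilon> by (intro ennreal_leI mult_left_mono) auto
      also have "\<dots> = ennreal (\<epsilon> / 2) * (ennreal ((b t)^2) + ennreal (1 / (t - p)^2) * indicator {q..} t)"
        using True \<epsilon> by (simp add: ennreal_real distrib_left add_divide_distrib del: ennreal_plus)
      finally show ?thesis .
    qed (simp add: indicator_def)
  qed
  also have "\<dots> = ennreal (\<epsilon> / 2) * (L2 b + (\<integral>\<^sup>+t\<in>{q..}. ennreal (1 / (t - p)^2) \<partial>lborel))"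
    unfolding L2_norm_sq_real by (subst nn_integral_cmult, simp, subst nn_integral_add) auto
  also have "(\<integral>\<^sup>+t\<in>{q..}. ennreal (1 / (t - p)^2) \<partial>lborel) = ennreal (1 / (q - p))"
    by (rule nn_integral_inverse_square) (use pq in simp)
  finally have "Qp (\<lambda>x. - a x) b \<le> ennreal (\<epsilon> / 2) * (L2 a + ennreal (1 / (q - p))) + ennreal (\<epsilon> / 2) * (L2 b + ennreal (1 / (q - p)))"
    by (simp add: add_mono)
  also have "\<dots> \<le> ennreal (\<epsilon> / 2) * (ennreal N + ennreal 1) + ennreal (\<epsilon> / 2) * (ennreal N + ennreal 1)"
    using pq N by (intro add_mono mult_left_mono ennreal_leI) (auto simp: divide_simps)
  also have "\<dots> = ennreal (\<epsilon> * (N + 1))"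
    using N \<epsilon> by (simp add: ennreal_real del: ennreal_plus ennreal_1)
  finally show ?thesis .
qed

section \<open>Long intervals with positive cosine\<close>

text \<open>A trapezoid, rising from 0 to pi/2 over a length S and falling back over a length S. It
  is used as an angle: its cosine is 1 outside the window and 0 in the middle.\<close>

definition cutoff :: "real \<Rightarrow> real \<Rightarrow> real \<Rightarrow> real \<Rightarrow> real" where
  "cutoff S y z x = pi / (2 * S) * ((min (y + S) (max y x) - y) - (min z (max (z - S) x) - (z - S)))"

definition cutoff' :: "real \<Rightarrow> real \<Rightarrow> real \<Rightarrow> real \<Rightarrow> real" where
  "cutoff' S y z x = pi / (2 * S) * (indicator {y..y+S} x - indicator {z-S..z} x)"

lemma cutoff_facts:
  assumes S: "S > 0" and yz: "y + S \<le> z - S"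
  shows "sob (cutoff S y z) (cutoff' S y z)"
    "x \<le> y \<Longrightarrow> cutoff S y z x = 0" "z \<le> x \<Longrightarrow> cutoff S y z x = 0"
    "y + S \<le> x \<Longrightarrow> x \<le> z - S \<Longrightarrow> cutoff S y z x = pi / 2"
    "\<bar>cutoff S y z s - cutoff S y z t\<bar> \<le> 2 / S * \<bar>s - t\<bar>"
    "0 \<le> cutoff S y z x" "cutoff S y z x \<le> pi / 2"
    "\<bar>cutoff' S y z x\<bar> \<le> pi / (2 * S)"
    "x \<notin> {y..y+S} \<union> {z-S..z} \<Longrightarrow> cutoff' S y z x = 0"
proof -
  have "sob (\<lambda>x. pi / (2 * S) * ((- y + min (y + S) (max y x)) - (- (z - S) + min z (max (z - S) x)))) (cutoff' S y z)"
    unfolding cutoff'_def[abs_def] by (intro sob_cmult sob_diff sob_shift_const sob_ramp) (use S in auto)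
  then show "sob (cutoff S y z) (cutoff' S y z)" unfolding cutoff_def[abs_def] by (simp add: algebra_simps)
  show "x \<le> y \<Longrightarrow> cutoff S y z x = 0" "z \<le> x \<Longrightarrow> cutoff S y z x = 0" "y + S \<le> x \<Longrightarrow> x \<le> z - S \<Longrightarrow> cutoff S y z x = pi / 2"
    using S yz by (auto simp: cutoff_def min_def max_def)
  let ?r = "\<lambda>x. (min (y + S) (max y x) - y) - (min z (max (z - S) x) - (z - S))"
  have r: "0 \<le> ?r x" "?r x \<le> S" for x using S yz by (auto simp: min_def max_def)
  show "0 \<le> cutoff S y z x" using r(1)[of x] S by (simp add: cutoff_def)
  have "cutoff S y z x \<le> pi / (2 * S) * S" unfolding cutoff_def using r(2)[of x] S by (intro mult_left_mono) auto
  then show "cutoff S y z x \<le> pi / 2" using S by simp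
  have ramp: "0 \<le> min q (max p v) - min q (max p u)" "min q (max p v) - min q (max p u) \<le> v - u" if "u \<le> v" for p q u v :: real
    using that by (auto simp: min_def max_def)
  have gen: "\<bar>(a - k1 - (b - k2)) - (a' - k1 - (b' - k2))\<bar> \<le> \<bar>u - v\<bar>"
    if "0 \<le> a' - a \<and> a' - a \<le> v - u \<and> 0 \<le> b' - b \<and> b' - b \<le> v - u \<or> 0 \<le> a - a' \<and> a - a' \<le> u - v \<and> 0 \<le> b - b' \<and> b - b' \<le> u - v"
    for a b a' b' k1 k2 u v :: real using that by linarith
  have "\<bar>?r s - ?r t\<bar> \<le> \<bar>s - t\<bar>"
    by (rule gen) (use ramp[of s t] ramp[of t s] in \<open>cases "s \<le> t"; simp\<close>)
  moreover have "\<bar>pi / (2 * S) * u - pi / (2 * S) * v\<bar> \<le> 2 / S * d" if "\<bar>u - v\<bar> \<le> d" for u v d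
  proof -
    define k where "k = pi / (2 * S)"
    have "k > 0" using S by (simp add: k_def)
    then have "\<bar>k * u - k * v\<bar> = k * \<bar>u - v\<bar>" by (metis abs_mult abs_of_pos right_diff_distrib)
    then have "\<bar>pi / (2 * S) * u - pi / (2 * S) * v\<bar> = pi / (2 * S) * \<bar>u - v\<bar>" unfolding k_def .
    also have "\<dots> \<le> 2 / S * d"
      using S pi_less_4 that by (intro mult_mono) (auto simp: divide_simps)
    finally show ?thesis .
  qed
  ultimately show "\<bar>cutoff S y z s - cutoff S y z t\<bar> \<le> 2 / S * \<bar>s - t\<bar>" unfolding cutoff_def by blast
  show "\<bar>cutoff' S y z x\<bar> \<le> pi / (2 * S)" using S by (auto simp: cutoff'_def indicator_def abs_mult)
  show "x \<notin> {y..y+S} \<union> {z-S..z} \<Longrightarrow> cutoff' S y z x = 0" by (auto simp: cutoff'_def)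
qed

text \<open>The cut angle \<open>\<omega>\<close> satisfies \<open>1 - cos \<omega> = cos^2 b (1 - cos \<phi>)\<close>: the cut acts multiplicatively on
  \<open>1 - cos \<phi>\<close>, as the localisation formula requires, and it passes through zeros of the angle.\<close>

lemma cut_angle:
  assumes s: "sob \<phi> g" and S: "S > 0" and yz: "y + S \<le> z - S" and k: "c = 2 * pi * of_int k"
    and near: "\<And>x. x \<in> {y..z} \<Longrightarrow> \<bar>\<phi> x - c\<bar> \<le> pi / 2"
  shows "\<exists>\<omega> g\<omega>. sob \<omega> g\<omega> \<and> (\<forall>x. x \<notin> {y..z} \<longrightarrow> \<omega> x = \<phi> x) \<and> (\<forall>x\<in>{y+S..z-S}. \<omega> x = c) \<and>
    (\<forall>x. 1 - cos (\<omega> x) = (cos (cutoff S y z x))^2 * (1 - cos (\<phi> x))) \<and>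
    (\<forall>x. x \<notin> {y..y+S} \<union> {z-S..z} \<longrightarrow> (if x \<in> {y..z} then g\<omega> x = 0 else g\<omega> x = g x)) \<and>
    (\<forall>x. (\<bar>g\<omega> x\<bar> - \<bar>g x\<bar>) \<le> 5 / S * sqrt ((1 - cos (\<phi> x)) / 2))"
proof -
  let ?b = "cutoff S y z" and ?b' = "cutoff' S y z"
  note cf = cutoff_facts[OF S yz]
  have b0: "cos (?b x) = 0" if "y + S \<le> x" "x \<le> z - S" for x unfolding cf(4)[OF that] by simp
  obtain \<psi>' where \<psi>': "sob (\<lambda>x. max (- (pi/2)) (min (pi/2) (- c + \<phi> x))) \<psi>'" "\<And>x. \<bar>\<psi>' x\<bar> \<le> \<bar>g x\<bar>"
    using sob_clamp[OF sob_shift_const[OF s, of "- c"], of "- (pi/2)" "pi/2"] by blast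
  define \<psi> where "\<psi> x = max (- (pi/2)) (min (pi/2) (- c + \<phi> x))" for x
  have \<psi>s: "sob \<psi> \<psi>'" using \<psi>'(1) by (simp add: \<psi>_def[abs_def])
  have \<psi>b: "- (pi/2) \<le> \<psi> x" "\<psi> x \<le> pi/2" for x by (auto simp: \<psi>_def min_def max_def)
  have \<psi>eq: "\<psi> x = \<phi> x - c" if "x \<in> {y..z}" for x using near[OF that] unfolding \<psi>_def by linarith
  \<comment> \<open>Since 1 - cos \<omega> = 2 sin^2(\<omega>/2), the desired relation is a
    multiplication of the sine of the half angle by cos b. The clamp of \<psi> keeps w^2 \<le> 1/2,
    away from the singularities of \<open>arcsin\<close>.\<close>
  define w where "w x = cos (?b x) * sin (1/2 * \<psi> x)" for x
  define w' where "w' x = cos (?b x) * (cos (1/2 * \<psi> x) * (1/2 * \<psi>' x)) + sin (1/2 * \<psi> x) * (- sin (?b x) * ?b' x)" for x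
  have ws: "sob w w'" unfolding w_def[abs_def] w'_def[abs_def]
    by (intro sob_mult[where B = 1 and C = 1] sob_cos sob_sin sob_cmult cf(1) \<psi>s) auto
  have half: "- (pi/4) \<le> 1/2 * \<psi> x" "1/2 * \<psi> x \<le> pi/4" for x using \<psi>b[of x] by auto
  have s2: "(sin (1/2 * \<psi> x))^2 \<le> 1/2" for x
  proof -
    have "\<bar>sin (1/2 * \<psi> x)\<bar> \<le> sin (pi/4)"
      using sin_monotone_2pi_le[of "1/2 * \<psi> x" "pi/4"] sin_monotone_2pi_le[of "- (pi/4)" "1/2 * \<psi> x"] half[of x]
      by (auto simp: abs_le_iff)
    then have "\<bar>sin (1/2 * \<psi> x)\<bar>^2 \<le> (sin (pi/4))^2" by (intro power_mono) auto
    then show ?thesis by (simp add: sin_45 power_divide)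
  qed
  have w2: "(w x)^2 \<le> (sin (1/2 * \<psi> x))^2" for x
  proof -
    have "(cos (?b x))^2 * (sin (1/2 * \<psi> x))^2 \<le> 1 * (sin (1/2 * \<psi> x))^2"
      by (intro mult_right_mono) (auto simp: cos_squared_eq)
    then show ?thesis by (simp add: w_def power_mult_distrib)
  qed
  have w1: "1/2 \<le> 1 - (w x)^2" for x using w2[of x] s2[of x] by linarith
  have wlt: "- 1 < w x" "w x < 1" for x
  proof -
    have "\<bar>w x\<bar> < 1" using w1[of x] by (simp add: abs_square_less_1[symmetric])
    then show "- 1 < w x" "w x < 1" by (auto simp: abs_less_iff)
  qed
  let ?T' = "\<lambda>v. inverse (sqrt (1 - v^2))"
  have As: "sob (\<lambda>x. arcsin (w x)) (\<lambda>x. ?T' (w x) * w' x)"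
  proof (rule sob_compose[OF ws, where T = arcsin and T' = ?T' and B = 2])
    show "(arcsin has_real_derivative ?T' (w x)) (at (w x))" for x by (rule DERIV_arcsin[OF wlt])
    show "continuous_on UNIV (\<lambda>x. ?T' (w x))"
    proof (intro continuous_intros sob_continuous[OF ws] ballI)
      fix x show "sqrt (1 - (w x)^2) \<noteq> 0" using w1[of x] by auto
    qed
    fix x
    have "1/2 \<le> sqrt (1 - (w x)^2)" using w1[of x] by (intro real_le_rsqrt) (simp add: power2_eq_square)
    then have "inverse (sqrt (1 - (w x)^2)) \<le> inverse (1/2)" by (intro le_imp_inverse_le) auto
    then show "\<bar>?T' (w x)\<bar> \<le> 2" using w1[of x] by simp
  qed
  define F where "F x = c + 2 * arcsin (w x)" for x
  define F' where "F' x = 2 * (?T' (w x) * w' x)" for x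
  have Fs: "sob F F'" unfolding F_def[abs_def] F'_def[abs_def] by (intro sob_shift_const sob_cmult As)
  have F0: "F x = \<phi> x" if "x = y \<or> x = z" for x
  proof -
    have "x \<in> {y..z}" using that S yz by auto
    have "?b x = 0" using that cf(2,3)[of x] by auto
    then have "w x = sin (1/2 * \<psi> x)" by (simp add: w_def)
    then have "arcsin (w x) = 1/2 * \<psi> x" using half[of x] pi_gt_zero by (simp only:) (rule arcsin_sin, auto)
    then show ?thesis using \<psi>eq[OF \<open>x \<in> {y..z}\<close>] by (simp add: F_def)
  qed
  define \<omega> where "\<omega> x = (if x \<le> z then (if x \<le> y then \<phi> x else F x) else \<phi> x)" for x
  define g\<omega> where "g\<omega> x = (if x \<le> z then (if x \<le> y then g x else F' x) else g x)" for x
  have "sob \<omega> g\<omega>" unfolding \<omega>_def[abs_def] g\<omega>_def[abs_def]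
  proof (rule sob_join[OF _ s])
    show "sob (\<lambda>x. if x \<le> y then \<phi> x else F x) (\<lambda>x. if x \<le> y then g x else F' x)"
      by (rule sob_join[OF s Fs]) (simp add: F0)
    show "(if z \<le> y then \<phi> z else F z) = \<phi> z" using F0[of z] by simp
  qed
  moreover have "\<forall>x. x \<notin> {y..z} \<longrightarrow> \<omega> x = \<phi> x" by (auto simp: \<omega>_def)
  moreover have "\<forall>x\<in>{y+S..z-S}. \<omega> x = c"
    using b0 S yz by (auto simp: \<omega>_def F_def w_def)
  moreover have cosF: "1 - cos (F x) = (cos (?b x))^2 * (1 - cos (\<psi> x))" for x
  proof -
    have c2: "cos (c + u) = cos u" for u unfolding k cos_add cos_int_2pin sin_int_2pin by simp
    have "1 - cos (F x) = 2 * (sin (arcsin (w x)))^2"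
      unfolding F_def c2 using cos_double_sin[of "arcsin (w x)"] by simp
    also have "\<dots> = 2 * (w x)^2" using wlt[of x] by simp
    also have "\<dots> = (cos (?b x))^2 * (2 * (sin (1/2 * \<psi> x))^2)" by (simp add: w_def power_mult_distrib)
    also have "2 * (sin (1/2 * \<psi> x))^2 = 1 - cos (\<psi> x)" using cos_double_sin[of "1/2 * \<psi> x"] by simp
    finally show ?thesis .
  qed
  have cos\<psi>: "cos (\<psi> x) = cos (\<phi> x)" if "x \<in> {y..z}" for x
  proof -
    have "cos (\<phi> x) = cos (c + \<psi> x)" using \<psi>eq[OF that] by simp
    then show ?thesis unfolding k cos_add cos_int_2pin sin_int_2pin by simp
  qed
  have "\<forall>x. 1 - cos (\<omega> x) = (cos (?b x))^2 * (1 - cos (\<phi> x))"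
  proof
    fix x show "1 - cos (\<omega> x) = (cos (?b x))^2 * (1 - cos (\<phi> x))"
    proof (cases "y < x \<and> x \<le> z")
      case True then show ?thesis using cosF[of x] cos\<psi>[of x] by (simp add: \<omega>_def)
    next
      case False
      then show ?thesis using cf(2,3)[of x] by (auto simp: \<omega>_def)
    qed
  qed
  moreover have "\<forall>x. x \<notin> {y..y+S} \<union> {z-S..z} \<longrightarrow> (if x \<in> {y..z} then g\<omega> x = 0 else g\<omega> x = g x)"
  proof (intro allI impI)
    fix x assume x: "x \<notin> {y..y+S} \<union> {z-S..z}"
    show "if x \<in> {y..z} then g\<omega> x = 0 else g\<omega> x = g x"
    proof (cases "x \<in> {y..z}")
      case True
      then have "cos (?b x) = 0" "?b' x = 0" using x b0[of x] cf(9)[of x] by auto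
      then have "w' x = 0" by (simp add: w'_def)
      moreover have "y < x" "x \<le> z" using x True S by auto
      ultimately have "g\<omega> x = 0" by (simp add: g\<omega>_def F'_def)
      then show ?thesis using True by simp
    next
      case False then show ?thesis by (auto simp: g\<omega>_def)
    qed
  qed
  moreover have "\<forall>x. (\<bar>g\<omega> x\<bar> - \<bar>g x\<bar>) \<le> 5 / S * sqrt ((1 - cos (\<phi> x)) / 2)"
  proof
    fix x
    have nn: "0 \<le> 5 / S * sqrt ((1 - cos (\<phi> x)) / 2)" using S by simp
    show "(\<bar>g\<omega> x\<bar> - \<bar>g x\<bar>) \<le> 5 / S * sqrt ((1 - cos (\<phi> x)) / 2)"
    proof (cases "y < x \<and> x \<le> z")
      case True
      define R where "R = sqrt (1 - (w x)^2)"
      define sn where "sn = \<bar>sin (1/2 * \<psi> x)\<bar>"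
      have R0: "R > 0" using w1[of x] by (simp add: R_def)
      have R2: "1 / R \<le> sqrt 2"
      proof -
        have "sqrt (1/2) \<le> R" unfolding R_def using w1[of x] by (intro real_sqrt_le_mono) auto
        then have "1 / R \<le> 1 / sqrt (1/2)" using R0 by (intro divide_left_mono) auto
        then show ?thesis by (simp add: real_sqrt_divide)
      qed
      \<comment> \<open>As |w| \<le> |sin(\<psi>/2)|, the factor cos(\<psi>/2)/R is at most 1. The
        main term of the derivative thus does not grow, and only the term with b' is an
        error.\<close>
      have Rc: "\<bar>cos (1/2 * \<psi> x)\<bar> \<le> R"
      proof -
        have "(cos (1/2 * \<psi> x))^2 \<le> 1 - (w x)^2" using w2[of x] by (simp add: cos_squared_eq)
        then show ?thesis unfolding R_def by (intro real_le_rsqrt) simp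
      qed
      have "\<bar>w' x\<bar> \<le> \<bar>cos (?b x)\<bar> * (\<bar>cos (1/2 * \<psi> x)\<bar> * (1/2 * \<bar>\<psi>' x\<bar>)) + sn * (\<bar>sin (?b x)\<bar> * \<bar>?b' x\<bar>)"
        unfolding w'_def sn_def by (rule order_trans[OF abs_triangle_ineq]) (simp add: abs_mult)
      also have "\<dots> \<le> 1 * (R * (1/2 * \<bar>g x\<bar>)) + sn * (1 * (pi / (2 * S)))"
        using Rc \<psi>'(2)[of x] cf(8)[of x] R0 S
        by (intro add_mono mult_mono) (auto simp: sn_def)
      finally have "\<bar>w' x\<bar> / R \<le> (R * (1/2 * \<bar>g x\<bar>) + sn * (pi / (2 * S))) / R"
        using R0 by (intro divide_right_mono) auto
      moreover have "\<bar>F' x\<bar> = 2 * (\<bar>w' x\<bar> / R)"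
        unfolding F'_def R_def[symmetric] abs_mult using R0 by (simp add: divide_inverse)
      ultimately have "\<bar>F' x\<bar> \<le> 2 * ((R * (1/2 * \<bar>g x\<bar>) + sn * (pi / (2 * S))) / R)" by linarith
      also have "\<dots> = \<bar>g x\<bar> + sn * (pi / S) * (1 / R)" using R0 S by (simp add: field_simps)
      also have "\<dots> \<le> \<bar>g x\<bar> + sn * (pi / S) * sqrt 2"
        using R2 S by (intro add_left_mono mult_left_mono) (auto simp: sn_def)
      also have "sn * (pi / S) * sqrt 2 \<le> 5 / S * sn"
      proof -
        have "pi * sqrt 2 \<le> 3.2 * 1.5"
        proof (intro mult_mono)
          show "pi \<le> 3.2" using pi_approx by simp
          show "sqrt 2 \<le> 1.5" by (rule real_le_lsqrt) (auto simp: power2_eq_square)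
        qed auto
        then have "pi * sqrt 2 \<le> 5" by simp
        then have "(pi * sqrt 2) * (sn / S) \<le> 5 * (sn / S)" using S by (intro mult_right_mono) (auto simp: sn_def)
        then show ?thesis by (simp add: mult_ac)
      qed
      also have "sn = sqrt ((1 - cos (\<phi> x)) / 2)"
      proof -
        have "(1 - cos (\<psi> x)) / 2 = (sin (1/2 * \<psi> x))^2" using cos_double_sin[of "1/2 * \<psi> x"] by simp
        then show ?thesis using cos\<psi>[of x] True by (simp add: sn_def)
      qed
      finally show ?thesis using True by (simp add: g\<omega>_def)
    next
      case False
      then have "g\<omega> x = g x" by (auto simp: g\<omega>_def)
      then show ?thesis using nn by simp
    qed
  qed
  ultimately show ?thesis by blast
qed

section \<open>Energy balance of cutting and excising\<close>

lemma finite_ennrealE: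
  assumes "X < (\<infinity> :: ennreal)"
  obtains r where "X = ennreal r" "r \<ge> 0"
  using assms by (cases X) auto

definition loc_energy :: "real \<Rightarrow> (real \<Rightarrow> real) \<Rightarrow> (real \<Rightarrow> real) \<Rightarrow> real \<Rightarrow> real \<Rightarrow> ennreal" where
  "loc_energy h \<phi> g a b = (\<integral>\<^sup>+x\<in>{a..b}. ennreal ((g x)^2) \<partial>lborel) + (\<integral>\<^sup>+x\<in>{a..b}. ennreal ((cos (\<phi> x) - h)^2) \<partial>lborel)"

lemma loc_energy_le: "loc_energy h \<phi> g a b \<le> ee h \<phi> g"
proof -
  have "loc_energy h \<phi> g a b \<le> L2 g + L2 (\<lambda>x. cos (\<phi> x) - h)"
    unfolding loc_energy_def L2_norm_sq_real by (intro add_mono nn_integral_mono) (auto simp: indicator_def)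
  also have "\<dots> \<le> ee h \<phi> g" unfolding ee_def by (intro add_right_mono) simp
  finally show ?thesis .
qed

lemma glued_L2:
  fixes f :: "real \<Rightarrow> real"
  assumes [measurable]: "f \<in> borel_measurable borel" and D: "D \<ge> 0"
  shows "L2 (\<lambda>x. if x \<le> p then f x else f (D + x)) \<le> L2 f"
proof -
  have "L2 (\<lambda>x. if x \<le> p then f x else f (D + x)) = (NN x. ennreal ((f x)^2) * indicator {..p} x + ennreal ((f (D + 1 * x))^2) * indicator {p + D<..} (D + 1 * x))"
    unfolding L2_norm_sq_real by (intro nn_integral_cong) (auto simp: indicator_def)
  also have "\<dots> = (\<integral>\<^sup>+x\<in>{..p}. ennreal ((f x)^2) \<partial>lborel) + (NN x. ennreal ((f (D + 1 * x))^2) * indicator {p + D<..} (D + 1 * x))"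
    by (intro nn_integral_add) measurable
  also have "(NN x. ennreal ((f (D + 1 * x))^2) * indicator {p + D<..} (D + 1 * x)) = (\<integral>\<^sup>+x\<in>{p + D<..}. ennreal ((f x)^2) \<partial>lborel)"
    using nn_integral_real_affine[of "\<lambda>x. ennreal ((f x)^2) * indicator {p + D<..} x" 1 D] by simp
  also have "(\<integral>\<^sup>+x\<in>{..p}. ennreal ((f x)^2) \<partial>lborel) + \<dots> = (NN x. ennreal ((f x)^2) * indicator {..p} x + ennreal ((f x)^2) * indicator {p + D<..} x)"
    by (intro nn_integral_add[symmetric]) measurable
  also have "\<dots> \<le> L2 f"
    unfolding L2_norm_sq_real using D by (intro nn_integral_mono) (auto simp: indicator_def)
  finally show ?thesis .
qed

text \<open>The derivative created by the cut has size 1/S times the root of 1 - cos \<phi> \<le> (1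
  - h) + |f|, and it lives on the two ramps; the kinetic energy between the ramps is saved.\<close>

lemma cut_kinetic:
  assumes [measurable]: "g \<in> borel_measurable borel" "g\<omega> \<in> borel_measurable borel" "\<phi> \<in> borel_measurable borel"
    and \<sigma>: "\<sigma> \<ge> 1" and S: "S = \<sigma> ^ 4" and yz: "y + S \<le> z - S" and h: "h \<le> 1"
    and out: "\<And>x. x \<notin> {y..y+S} \<union> {z-S..z} \<Longrightarrow> if x \<in> {y..z} then g\<omega> x = 0 else g\<omega> x = g x"
    and win: "\<And>x. \<bar>g\<omega> x\<bar> - \<bar>g x\<bar> \<le> 5 / S * sqrt ((1 - cos (\<phi> x)) / 2)"
  shows "L2 g\<omega> + (\<integral>\<^sup>+x\<in>{y+S..z-S}. ennreal ((g x)^2) \<partial>lborel)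
    \<le> L2 g + ennreal (13 / \<sigma>) * loc_energy h \<phi> g y z + ennreal (25 / \<sigma> / S^2 + 50 * (1 - h))"
proof -
  define \<epsilon> where "\<epsilon> = 1 - h"
  define f where "f x = cos (\<phi> x) - h" for x
  have e0: "\<epsilon> \<ge> 0" using h by (simp add: \<epsilon>_def)
  have S1: "S \<ge> 1" using \<sigma> by (simp add: S)
  have [measurable]: "f \<in> borel_measurable borel" unfolding f_def by measurable
  \<comment> \<open>Constant part of the pointwise error. The cross term is 25 (1 - cos \<phi>) /
    \<sigma>^7, and Young turns 25 |f| / \<sigma>^7 into 25 f^2 / (2 \<sigma>) + 25 / (2
    \<sigma>^13). Over two ramps of length \<sigma>^4 the last term integrates to 25 / (\<sigma>
    S^2), a factor 1/\<sigma> below the scale of the gain.\<close>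
  define cw where "cw = 25 / 2 / \<sigma> ^ 13 + 25 / \<sigma> ^ 7 * \<epsilon>"
  have cw0: "cw \<ge> 0" using \<sigma> e0 by (simp add: cw_def)
  have pw: "(g\<omega> x)^2 \<le> (g x)^2 + 13 / \<sigma> * ((g x)^2 + (f x)^2) + cw" for x
  proof -
    define e where "e = 5 / S * sqrt ((1 - cos (\<phi> x)) / 2)"
    have e: "0 \<le> e" using S1 by (simp add: e_def)
    have e2: "e^2 = 25 / 2 / S^2 * (1 - cos (\<phi> x))"
      by (simp add: e_def power_mult_distrib power_divide real_sqrt_pow2)
    have "\<bar>g\<omega> x\<bar> \<le> \<bar>g x\<bar> + e" using win[of x] by (simp add: e_def)
    then have "(g\<omega> x)^2 \<le> (\<bar>g x\<bar> + e)^2" by (metis abs_ge_zero power2_abs power_mono)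
    also have "\<dots> \<le> (1 + 1/\<sigma>) * \<bar>g x\<bar>^2 + (1 + 1/(1/\<sigma>)) * e^2" by (rule square_add_le) (use \<sigma> in simp)
    also have "\<dots> \<le> (1 + 1/\<sigma>) * (g x)^2 + 2 * \<sigma> * e^2"
      using \<sigma> by (intro add_mono mult_right_mono) auto
    also have "2 * \<sigma> * e^2 = 25 / \<sigma> ^ 7 * (1 - cos (\<phi> x))"
    proof -
      have "(\<sigma> ^ 4)^2 = \<sigma> * \<sigma> ^ 7" by (simp add: eval_nat_numeral mult.assoc)
      then show ?thesis unfolding e2 S using \<sigma> by simp
    qed
    also have "\<dots> \<le> 25 / \<sigma> ^ 7 * (\<epsilon> + \<bar>f x\<bar>)" using \<sigma> by (intro mult_left_mono) (auto simp: \<epsilon>_def f_def)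
    also have "\<dots> \<le> 25 / 2 / \<sigma> * (f x)^2 + cw"
    proof -
      have "0 \<le> (\<bar>f x\<bar> - 1 / \<sigma> ^ 6)^2 * (25 / 2 / \<sigma>)" using \<sigma> by (intro mult_nonneg_nonneg) auto
      also have "\<dots> = 25 / 2 / \<sigma> * (f x)^2 - 25 / \<sigma> ^ 7 * \<bar>f x\<bar> + 25 / 2 / \<sigma> ^ 13"
      proof -
        define q where "q = 1 / \<sigma> ^ 6"
        have p: "\<sigma> ^ 7 = \<sigma> * \<sigma> ^ 6" "\<sigma> ^ 13 = \<sigma> * (\<sigma> ^ 6)^2" by (simp_all add: eval_nat_numeral mult.assoc)
        have "1 / \<sigma> ^ 7 = 1 / \<sigma> * q" "1 / \<sigma> ^ 13 = 1 / \<sigma> * q^2"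
          unfolding p q_def power_divide by (simp_all only: times_divide_times_eq mult_1 power_one)
        then have "25 * (1 / \<sigma> ^ 7) = 25 * (1 / \<sigma> * q)" "25 / 2 * (1 / \<sigma> ^ 13) = 25 / 2 * (1 / \<sigma> * q^2)"
          by (simp_all only:)
        then have e: "25 / \<sigma> ^ 7 = 25 * (1 / \<sigma>) * q" "25 / 2 / \<sigma> ^ 13 = 25 / 2 * (1 / \<sigma>) * q^2" "25 / 2 / \<sigma> = 25 / 2 * (1 / \<sigma>)"
          by (simp_all only: times_divide_eq_right mult_1_right divide_divide_eq_left mult.assoc)
        have g: "(X - q)^2 * (25 / 2 * u) = 25 / 2 * u * X^2 - 25 * u * q * X + 25 / 2 * u * q^2" for X u :: real
          by (simp add: power2_diff algebra_simps)
        show ?thesis unfolding e q_def[symmetric] using g[of "\<bar>f x\<bar>" "1 / \<sigma>"] by simp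
      qed
      finally show ?thesis by (simp add: cw_def distrib_left)
    qed
    also have "(1 + 1/\<sigma>) * (g x)^2 + (25 / 2 / \<sigma> * (f x)^2 + cw) \<le> (g x)^2 + 13 / \<sigma> * ((g x)^2 + (f x)^2) + cw"
    proof -
      have "1 / \<sigma> * (g x)^2 \<le> 13 / \<sigma> * (g x)^2" "25 / 2 / \<sigma> * (f x)^2 \<le> 13 / \<sigma> * (f x)^2"
        using \<sigma> by (intro mult_right_mono; simp add: divide_simps)+
      then show ?thesis by (simp only: distrib_left distrib_right mult_1)
    qed
    finally show ?thesis by simp
  qed
  have "L2 g\<omega> + (\<integral>\<^sup>+x\<in>{y+S..z-S}. ennreal ((g x)^2) \<partial>lborel)
    = (NN x. ennreal ((g\<omega> x)^2) + ennreal ((g x)^2) * indicator {y+S..z-S} x)"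
    unfolding L2_norm_sq_real by (rule nn_integral_add[symmetric]) auto
  also have "\<dots> \<le> (NN x. ennreal ((g x)^2) + (ennreal (13 / \<sigma>) * (ennreal ((g x)^2) * indicator {y..z} x + ennreal ((f x)^2) * indicator {y..z} x) + ennreal cw * (indicator {y..y+S} x + indicator {z-S..z} x)))"
  proof (rule nn_integral_mono_AE)
    have "AE x in lborel. x \<noteq> y + S" "AE x in lborel. x \<noteq> z - S" by (rule AE_lborel_singleton)+
    then show "AE x in lborel. ennreal ((g\<omega> x)^2) + ennreal ((g x)^2) * indicator {y+S..z-S} x \<le> ennreal ((g x)^2) + (ennreal (13 / \<sigma>) * (ennreal ((g x)^2) * indicator {y..z} x + ennreal ((f x)^2) * indicator {y..z} x) + ennreal cw * (indicator {y..y+S} x + indicator {z-S..z} x))"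
    proof eventually_elim
      case (elim x)
      show ?case
      proof (cases "x \<in> {y..y+S} \<union> {z-S..z}")
        case True
        have i: "indicator {y+S..z-S} x = (0 :: ennreal)" "indicator {y..z} x = (1 :: ennreal)" "(1 :: ennreal) \<le> indicator {y..y+S} x + indicator {z-S..z} x"
          using True elim yz S1 by (auto simp: indicator_def)
        have "ennreal ((g\<omega> x)^2) \<le> ennreal ((g x)^2) + (ennreal (13 / \<sigma>) * (ennreal ((g x)^2) + ennreal ((f x)^2)) + ennreal cw * 1)"
          using pw[of x] \<sigma> cw0 by (simp add: ennreal_real add.assoc ennreal_leI del: ennreal_plus)
        also have "\<dots> \<le> ennreal ((g x)^2) + (ennreal (13 / \<sigma>) * (ennreal ((g x)^2) + ennreal ((f x)^2)) + ennreal cw * (indicator {y..y+S} x + indicator {z-S..z} x))"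
          by (intro add_left_mono mult_left_mono i(3)) simp
        finally show ?thesis unfolding i(1,2) by simp
      next
        case False
        show ?thesis
        proof (cases "x \<in> {y..z}")
          case True
          then have "g\<omega> x = 0" using out[OF False] by simp
          then show ?thesis by (simp add: indicator_def)
        next
          case F: False
          then have "g\<omega> x = g x" using out[OF False] by simp
          moreover have "indicator {y+S..z-S} x = (0 :: ennreal)" using F S1 by auto
          ultimately show ?thesis by simp
        qed
      qed
    qed
  qed
  also have "\<dots> = L2 g + (ennreal (13 / \<sigma>) * loc_energy h \<phi> g y z + ennreal cw * (ennreal S + ennreal S))"
  proof -
    have "(NN x. indicator {y..y+S} x + indicator {z-S..z} x) = ennreal S + ennreal S"
      using S1 by (subst nn_integral_add) (auto simp: emeasure_lborel_Icc_eq)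
    then show ?thesis
      unfolding L2_norm_sq_real loc_energy_def f_def
      by (subst nn_integral_add, simp, simp, subst nn_integral_add, simp, simp, subst nn_integral_cmult, simp, subst nn_integral_add, simp, simp, subst nn_integral_cmult) auto
  qed
  also have "ennreal cw * (ennreal S + ennreal S) \<le> ennreal (25 / \<sigma> / S^2 + 50 * (1 - h))"
  proof -
    have "ennreal cw * (ennreal S + ennreal S) = ennreal (cw * (2 * S))"
      using cw0 S1 by (simp add: ennreal_real del: ennreal_plus)
    also have "\<dots> \<le> ennreal (25 / \<sigma> / S^2 + 50 * (1 - h))"
    proof (rule ennreal_leI)
      have a: "25 / 2 / \<sigma> ^ 13 * (2 * S) = 25 / \<sigma> / S^2"
      proof -
        have "\<sigma> ^ 13 = \<sigma> * (\<sigma> ^ 4)^2 * \<sigma> ^ 4" by (simp add: eval_nat_numeral mult.assoc)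
        then show ?thesis unfolding S using \<sigma> by simp
      qed
      have "1 / \<sigma> ^ 7 * S \<le> 1"
        unfolding S using \<sigma> power_increasing[of 4 7 \<sigma>] by (simp add: divide_simps)
      then have "(1 / \<sigma> ^ 7 * S) * (50 * \<epsilon>) \<le> 1 * (50 * \<epsilon>)" using e0 by (intro mult_right_mono) auto
      then have b: "25 / \<sigma> ^ 7 * \<epsilon> * (2 * S) \<le> 50 * (1 - h)" by (simp add: \<epsilon>_def mult_ac)
      show "cw * (2 * S) \<le> 25 / \<sigma> / S^2 + 50 * (1 - h)"
        unfolding cw_def distrib_right a using b by simp
    qed
    finally show ?thesis .
  qed
  finally show ?thesis by (simp add: add.assoc add_mono)
qed

text \<open>The cut leaves, besides cos^2 b times f, the remainder (1 - h) sin^2 b. After excision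
  its support has length 3 S, so all norms are of order S, and the prefactor makes it negligible for
  h near 1.\<close>

lemma cutoff_bump:
  assumes S: "S \<ge> 1" and D: "D \<ge> 0" and z: "z = y + 3 * S + D" and p: "p = y + S"
  defines "\<kappa> \<equiv> \<lambda>x. (sin (if x \<le> p then cutoff S y z x else cutoff S y z (D + x)))^2"
  shows "\<kappa> \<in> borel_measurable borel" "L2 \<kappa> \<le> ennreal (3 * S)" "Hh \<kappa> \<le> ennreal (20 * S)"
proof -
  have S0: "S > 0" "y + S \<le> z - S" using S D z by auto
  note cf = cutoff_facts[OF S0]
  define B where "B x = (if x \<le> p then cutoff S y z x else cutoff S y z (D + x))" for x
  define B' where "B' x = (if x \<le> p then cutoff' S y z x else cutoff' S y z (D + x))" for x
  have gl: "cutoff S y z p = cutoff S y z (D + p)" using cf(4)[of p] cf(4)[of "D + p"] S D z p by simp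
  have Bs: "sob B B'" unfolding B_def[abs_def] B'_def[abs_def]
    using sob_affine[OF cf(1), of 1 D] by (intro sob_join cf(1) gl) simp
  have "sob (\<lambda>x. sin (B x) * sin (B x)) (\<lambda>x. sin (B x) * (cos (B x) * B' x) + sin (B x) * (cos (B x) * B' x))"
    by (intro sob_mult[where B = 1 and C = 1] sob_sin Bs) auto
  moreover have "\<kappa> = (\<lambda>x. sin (B x) * sin (B x))" by (simp add: \<kappa>_def B_def power2_eq_square)
  ultimately have \<kappa>s: "sob \<kappa> (\<lambda>x. sin (B x) * (cos (B x) * B' x) + sin (B x) * (cos (B x) * B' x))" by simp
  show "\<kappa> \<in> borel_measurable borel" by (rule sob_borel[OF \<kappa>s])
  have z': "x < y \<or> z - D < x \<Longrightarrow> B x = 0 \<and> B' x = 0" for x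
    using cf(2)[of x] cf(3)[of "D + x"] cf(9)[of x] cf(9)[of "D + x"] S D z p by (auto simp: B_def B'_def)
  have len: "(\<integral>\<^sup>+x\<in>{y..z - D}. ennreal c \<partial>lborel) = ennreal (c * (3 * S))" if "c \<ge> 0" for c
    using that S z by (simp add: nn_integral_cmult emeasure_lborel_Icc_eq ennreal_mult)
  have "L2 \<kappa> \<le> (\<integral>\<^sup>+x\<in>{y..z - D}. ennreal 1 \<partial>lborel)"
    unfolding L2_norm_sq_real
  proof (rule nn_integral_mono)
    fix x
    have "\<kappa> x \<le> 1" "0 \<le> \<kappa> x" by (auto simp: \<kappa>_def abs_square_le_1)
    then have "(\<kappa> x)^2 \<le> 1" by (simp add: power_le_one)
    moreover have "\<kappa> x = 0" if "x \<notin> {y..z - D}" using z'[of x] that by (auto simp: \<kappa>_def B_def)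
    ultimately show "ennreal ((\<kappa> x)^2) \<le> ennreal 1 * indicator {y..z - D} x"
      by (cases "x \<in> {y..z - D}") (auto intro: ennreal_leI simp del: ennreal_1)
  qed
  also have "\<dots> = ennreal (3 * S)" using len[of 1] by simp
  finally show L: "L2 \<kappa> \<le> ennreal (3 * S)" .
  have "L2 (\<lambda>x. sin (B x) * (cos (B x) * B' x) + sin (B x) * (cos (B x) * B' x)) \<le> (\<integral>\<^sup>+x\<in>{y..z - D}. ennreal 16 \<partial>lborel)"
    unfolding L2_norm_sq_real
  proof (rule nn_integral_mono)
    fix x
    let ?d = "sin (B x) * (cos (B x) * B' x) + sin (B x) * (cos (B x) * B' x)"
    have "\<bar>B' x\<bar> \<le> pi / (2 * S)" using cf(8) by (auto simp: B'_def)
    also have "\<dots> \<le> 2" using S pi_less_4 by (simp add: divide_simps)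
    finally have B2: "\<bar>B' x\<bar> \<le> 2" .
    have "\<bar>?d\<bar> = 2 * (\<bar>sin (B x)\<bar> * (\<bar>cos (B x)\<bar> * \<bar>B' x\<bar>))" by (simp add: abs_mult)
    also have "\<dots> \<le> 2 * (1 * (1 * 2))" using B2 by (intro mult_left_mono mult_mono) auto
    finally have "\<bar>?d\<bar>^2 \<le> 4^2" by (intro power_mono) auto
    then have d: "?d^2 \<le> 16" by simp
    show "ennreal (?d^2) \<le> ennreal 16 * indicator {y..z - D} x"
    proof (cases "x \<in> {y..z - D}")
      case True then show ?thesis using d by (simp add: ennreal_leI del: ennreal_numeral)
    next
      case False then show ?thesis using z'[of x] by auto
    qed
  qed
  also have "\<dots> = ennreal (48 * S)" using len[of 16] by simp
  finally have L': "L2 (\<lambda>x. sin (B x) * (cos (B x) * B' x) + sin (B x) * (cos (B x) * B' x)) \<le> ennreal (48 * S)" .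
  have "Hh \<kappa> \<le> ennreal (1 / (2 * pi)) * (ennreal 2 * ennreal (48 * S) + ennreal 8 * ennreal (3 * S))"
    using L' unfolding ennreal_numeral by (intro order_trans[OF Hh_le_H1[OF \<kappa>s]] mult_left_mono add_mono L) auto
  also have "\<dots> = ennreal (1 / (2 * pi) * (2 * (48 * S) + 8 * (3 * S)))"
    using S by (simp add: ennreal_real del: ennreal_plus ennreal_numeral)
  also have "\<dots> \<le> ennreal (20 * S)"
    using S pi_gt3 by (intro ennreal_leI) (simp add: divide_simps)
  finally show "Hh \<kappa> \<le> ennreal (20 * S)" .
qed

lemma ennreal_add_leD:
  fixes X Y Z :: ennreal
  assumes "X + Y \<le> Z" shows "X \<le> Z" "Y \<le> Z"
  using assms order_trans[of X "X + Y" Z] order_trans[of Y "X + Y" Z] by auto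

lemma le_ennrealE:
  assumes "X \<le> ennreal r"
  obtains x where "X = ennreal x" "x \<ge> 0"
  using assms by (cases X) (auto simp: top_unique)

text \<open>Serves to make the attraction of the outer parts finite, so that it can be moved between
  the sides of an inequality.\<close>

lemma tail_mass_le:
  fixes f r :: "real \<Rightarrow> real"
  assumes [measurable]: "f \<in> borel_measurable borel" "r \<in> borel_measurable borel" "A \<in> sets borel"
    and r: "\<And>s. s \<in> A \<Longrightarrow> 1 \<le> r s" and i: "(\<integral>\<^sup>+s\<in>A. ennreal (1 / (r s)^2) \<partial>lborel) \<le> 1"
    and N: "L2 f \<le> ennreal N"
  shows "(\<integral>\<^sup>+s\<in>A. ennreal (\<bar>f s\<bar> / (r s)^2) \<partial>lborel) \<le> ennreal N + 1"
proof -
  have "(\<integral>\<^sup>+s\<in>A. ennreal (\<bar>f s\<bar> / (r s)^2) \<partial>lborel) \<le> (NN s. ennreal ((f s)^2) + ennreal (1 / (r s)^2) * indicator A s)"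
  proof (rule nn_integral_mono)
    fix s
    show "ennreal (\<bar>f s\<bar> / (r s)^2) * indicator A s \<le> ennreal ((f s)^2) + ennreal (1 / (r s)^2) * indicator A s"
    proof (cases "s \<in> A")
      case True
      define c where "c = 1 / (r s)^2"
      have c: "0 \<le> c" "c \<le> 1" using r[OF True] by (auto simp: c_def divide_simps)
      have "0 \<le> (\<bar>f s\<bar> - c)^2" by simp
      then have "2 * (\<bar>f s\<bar> * c) \<le> (f s)^2 + c * c" by (simp add: power2_diff power2_eq_square algebra_simps)
      moreover have "c * c \<le> c * 1" using c by (intro mult_left_mono) auto
      moreover have "0 \<le> \<bar>f s\<bar> * c" using c by simp
      ultimately have "\<bar>f s\<bar> * c \<le> (f s)^2 + c" using c by linarith
      then show ?thesis using True c by (simp add: c_def ennreal_plus[symmetric] ennreal_leI del: ennreal_plus)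
    qed simp
  qed
  also have "\<dots> = L2 f + (\<integral>\<^sup>+s\<in>A. ennreal (1 / (r s)^2) \<partial>lborel)"
    unfolding L2_norm_sq_real by (rule nn_integral_add) auto
  also have "\<dots> \<le> ennreal N + 1" by (intro add_mono N i)
  finally show ?thesis .
qed

lemma tail_negative_part:
  fixes f r :: "real \<Rightarrow> real"
  assumes [measurable]: "f \<in> borel_measurable borel" "r \<in> borel_measurable borel" "A \<in> sets borel"
    and i: "(\<integral>\<^sup>+s\<in>A. ennreal (1 / (r s)^2) \<partial>lborel) \<le> 1"
    and f: "\<And>s. f s \<le> \<epsilon>" and \<epsilon>: "\<epsilon> \<ge> 0"
  shows "(\<integral>\<^sup>+s\<in>A. ennreal (\<bar>f s\<bar> / (r s)^2) \<partial>lborel) \<le> (\<integral>\<^sup>+s\<in>A. ennreal (max 0 (- f s) / (r s)^2) \<partial>lborel) + ennreal \<epsilon>"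
proof -
  have "(\<integral>\<^sup>+s\<in>A. ennreal (\<bar>f s\<bar> / (r s)^2) \<partial>lborel) \<le> (NN s. ennreal (max 0 (- f s) / (r s)^2) * indicator A s + ennreal \<epsilon> * (ennreal (1 / (r s)^2) * indicator A s))"
  proof (rule nn_integral_mono)
    fix s
    have "\<bar>f s\<bar> / (r s)^2 \<le> (max 0 (- f s) + \<epsilon>) / (r s)^2" using f[of s] \<epsilon> by (intro divide_right_mono) auto
    then have "\<bar>f s\<bar> / (r s)^2 \<le> max 0 (- f s) / (r s)^2 + \<epsilon> * (1 / (r s)^2)" by (simp add: add_divide_distrib)
    then have "ennreal (\<bar>f s\<bar> / (r s)^2) \<le> ennreal (max 0 (- f s) / (r s)^2) + ennreal \<epsilon> * ennreal (1 / (r s)^2)"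
      using \<epsilon> by (subst ennreal_mult[symmetric], simp, simp, subst ennreal_plus[symmetric]) (auto simp: ennreal_leI simp del: ennreal_plus)
    then show "ennreal (\<bar>f s\<bar> / (r s)^2) * indicator A s \<le> ennreal (max 0 (- f s) / (r s)^2) * indicator A s + ennreal \<epsilon> * (ennreal (1 / (r s)^2) * indicator A s)"
      by (cases "s \<in> A") auto
  qed
  also have "\<dots> = (\<integral>\<^sup>+s\<in>A. ennreal (max 0 (- f s) / (r s)^2) \<partial>lborel) + ennreal \<epsilon> * (\<integral>\<^sup>+s\<in>A. ennreal (1 / (r s)^2) \<partial>lborel)"
    by (subst nn_integral_add, simp, simp, subst nn_integral_cmult) auto
  also have "\<dots> \<le> (\<integral>\<^sup>+s\<in>A. ennreal (max 0 (- f s) / (r s)^2) \<partial>lborel) + ennreal \<epsilon> * 1"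
    by (intro add_left_mono mult_left_mono i) simp
  finally show ?thesis by simp
qed

lemma tail_kernel_left:
  assumes "(S::real) \<ge> 1" shows "(\<integral>\<^sup>+s\<in>{..y}. ennreal (1 / (S + (y - s))^2) \<partial>lborel) \<le> 1"
proof -
  have "(\<integral>\<^sup>+s\<in>{..y}. ennreal (1 / (S + (y - s))^2) \<partial>lborel) = (\<integral>\<^sup>+s\<in>{..y}. ennreal (1 / (y + S - s)^2) \<partial>lborel)"
    by (simp add: algebra_simps)
  also have "\<dots> = ennreal (1 / S)" using nn_integral_inverse_square'[of y "y + S"] assms by simp
  finally show ?thesis using assms by (simp add: ennreal_le_1)
qed

lemma tail_kernel_right:
  assumes "(S::real) \<ge> 1" shows "(\<integral>\<^sup>+s\<in>{z..}. ennreal (1 / (S + (s - z))^2) \<partial>lborel) \<le> 1"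
proof -
  have "(\<integral>\<^sup>+s\<in>{z..}. ennreal (1 / (S + (s - z))^2) \<partial>lborel) = (\<integral>\<^sup>+s\<in>{z..}. ennreal (1 / (s - (z - S))^2) \<partial>lborel)"
    by (simp add: algebra_simps)
  also have "\<dots> = ennreal (1 / S)" using nn_integral_inverse_square[of "z - S" z] assms by simp
  finally show ?thesis using assms by (simp add: ennreal_le_1)
qed

text \<open>Multiplying by cos^2 b is localising twice; the second error is at most the first since
  |cos b f| \<le> |f|. Two errors with weight 1/(2 pi) make 1/pi \<le> 1/3.\<close>

lemma Hh_localise_twice:
  fixes f b :: "real \<Rightarrow> real"
  assumes f[measurable]: "f \<in> borel_measurable borel" and N: "L2 f \<le> ennreal N" "N \<ge> 0" and \<sigma>: "\<sigma> \<ge> 1"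
    and b[measurable]: "b \<in> borel_measurable borel" and bl: "\<And>s t. \<bar>b s - b t\<bar> \<le> 2 / \<sigma> ^ 4 * \<bar>s - t\<bar>"
    and b0: "\<And>x. x \<notin> {y..z} \<Longrightarrow> b x = 0" and S: "S = \<sigma> ^ 4"
  shows "Hh (\<lambda>x. (cos (b x))^2 * f x)
    \<le> Hh f + ennreal (1/3 * (100 * (N + 1) / \<sigma>)) * ((\<integral>\<^sup>+t\<in>{y..z}. ennreal ((f t)^2) \<partial>lborel)
      + (\<integral>\<^sup>+s\<in>{..y}. ennreal (\<bar>f s\<bar> / (S + (y - s))^2) \<partial>lborel)
      + (\<integral>\<^sup>+s\<in>{z..}. ennreal (\<bar>f s\<bar> / (S + (s - z))^2) \<partial>lborel))" (is "_ \<le> _ + _ * ?I")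
proof -
  let ?E = "\<lambda>f. DI (\<lambda>s t. \<bar>f s\<bar> * \<bar>f t\<bar> * (2 - 2 * cos (b s - b t)) / (s - t)^2)"
  have "Hh (\<lambda>x. (cos (b x))^2 * f x) = Hh (\<lambda>x. cos (b x) * (cos (b x) * f x))"
    by (simp add: power2_eq_square mult.assoc)
  also have "\<dots> \<le> Hh (\<lambda>x. cos (b x) * f x) + ennreal (1 / (2 * pi)) * ?E (\<lambda>x. cos (b x) * f x)"
    by (rule Hh_localise) measurable
  also have "?E (\<lambda>x. cos (b x) * f x) \<le> ?E f"
  proof (rule DI_mono)
    fix s t
    have c: "\<bar>cos (b x) * f x\<bar> \<le> \<bar>f x\<bar>" for x using mult_right_mono[OF abs_cos_le_one[of "b x"], of "\<bar>f x\<bar>"] by (simp add: abs_mult)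
    show "\<bar>cos (b s) * f s\<bar> * \<bar>cos (b t) * f t\<bar> * (2 - 2 * cos (b s - b t)) / (s - t)^2 \<le> \<bar>f s\<bar> * \<bar>f t\<bar> * (2 - 2 * cos (b s - b t)) / (s - t)^2"
      using cos_le_one[of "b s - b t"] by (intro divide_right_mono mult_right_mono mult_mono c) auto
  qed
  also have "Hh (\<lambda>x. cos (b x) * f x) \<le> Hh f + ennreal (1 / (2 * pi)) * ?E f"
    by (rule Hh_localise) measurable
  finally have "Hh (\<lambda>x. (cos (b x))^2 * f x) \<le> Hh f + (ennreal (1 / (2 * pi)) * ?E f + ennreal (1 / (2 * pi)) * ?E f)"
    by (simp add: mult_left_mono add_left_mono add.assoc)
  also have "ennreal (1 / (2 * pi)) * ?E f + ennreal (1 / (2 * pi)) * ?E f = ennreal (1 / pi) * ?E f"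
    by (simp add: distrib_right[symmetric] ennreal_plus[symmetric] del: ennreal_plus)
  also have "\<dots> \<le> ennreal (1/3) * (ennreal (100 * (N + 1) / \<sigma>) * ?I)"
    using pi_gt3 ims_error[OF f N \<sigma> b bl b0] unfolding S by (intro mult_mono ennreal_leI) (auto simp: divide_simps)
  also have "\<dots> = ennreal (1/3 * (100 * (N + 1) / \<sigma>)) * ?I"
    using N \<sigma> by (subst ennreal_mult) (auto simp: mult.assoc)
  finally show ?thesis by (simp add: add_left_mono)
qed

text \<open>The function is split into its halves, one half is moved, and they are reassembled.
  Splitting loses the equal-sign interaction across the old gap, at most N/D; reassembling at the
  shorter distance gains \<open>Qp uL uR\<close> and pays for opposite signs a term proportional to
  \<epsilon>.\<close>

lemma excise_Hh:
  fixes u :: "real \<Rightarrow> real"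
  assumes u[measurable]: "u \<in> borel_measurable borel" and N: "L2 u \<le> ennreal N" "N \<ge> 0"
    and S: "S \<ge> 1" and D: "D > 0" and z: "z = p + 2 * S + D"
    and u0: "\<And>x. p \<le> x \<Longrightarrow> x \<le> z - S \<Longrightarrow> u x = 0" and \<epsilon>: "\<epsilon> \<ge> 0" "\<And>x. u x \<le> \<epsilon>"
  defines "uL \<equiv> \<lambda>x. if x \<le> p then u x else 0" and "uR \<equiv> \<lambda>x. if x \<le> p then 0 else u (D + x)"
  shows "Hh (\<lambda>x. uL x + uR x) + ennreal (1/2) * Qp uL uR \<le> Hh u + (ennreal (N / D) + ennreal (\<epsilon> * (N + 1)))"
proof -
  define v where "v x = (if x \<le> p then 0 else u x)" for x
  have [measurable]: "uL \<in> borel_measurable borel" "uR \<in> borel_measurable borel" "v \<in> borel_measurable borel"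
    unfolding uL_def uR_def v_def by measurable
  have uR: "uR = (\<lambda>x. v (D + x))"
  proof
    show "uR x = v (D + x)" for x using u0[of "D + x"] S D by (auto simp: uR_def v_def z)
  qed
  have un: "u = (\<lambda>x. uL x + v x)" by (auto simp: uL_def v_def)
  have p2: "ennreal (1/2) \<le> ennreal (2 / pi)" "ennreal (2 / pi) \<le> 1"
    subgoal by (rule ennreal_leI) (use pi_less_4 in \<open>simp add: divide_simps\<close>)
    subgoal using pi_gt3 by (simp add: ennreal_le_1)
    done
  have HR: "Hh uR = Hh v" unfolding uR using Hh_affine[of 1 v D] by simp
  have "L2 uL \<le> L2 u" "L2 v \<le> L2 u"
    unfolding L2_norm_sq_real by (intro nn_integral_mono; auto simp: uL_def v_def)+
  then have L: "L2 uL \<le> ennreal N" "L2 v \<le> ennreal N" using N by (auto intro: order_trans)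
  have LR: "L2 uR \<le> ennreal N" unfolding uR using L2_affine[of 1 v D] L by simp
  have 1: "Qp uL v \<le> ennreal (N / D)"
  proof -
    have "Qp uL v \<le> ennreal (1 / (2 * (z - S - p))) * (L2 uL + L2 v)"
      by (rule Qp_far) (use u0 S D in \<open>auto simp: uL_def v_def z\<close>)
    also have "\<dots> \<le> ennreal (1 / (2 * D)) * (ennreal N + ennreal N)"
      using S D by (intro mult_mono add_mono L ennreal_leI) (auto simp: z divide_simps)
    also have "\<dots> = ennreal (N / D)" using N D by (simp add: ennreal_real del: ennreal_plus)
    finally show ?thesis .
  qed
  have 2: "Qp (\<lambda>x. - uL x) uR \<le> ennreal (\<epsilon> * (N + 1))"
  proof (rule Qp_opposite_sign[where p = p and q = "p + S"])
    show "uR x = 0" if "x < p + S" for x using u0[of "D + x"] that D by (auto simp: uR_def z)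
  qed (use S \<epsilon> N L LR in \<open>auto simp: uL_def uR_def\<close>)
  have "Hh uL + Hh v \<le> Hh (\<lambda>x. uL x + v x) + ennreal (2/pi) * Qp uL v"
    using Hh_split[of uL v] by (simp add: uL_def v_def)
  also have "\<dots> \<le> Hh u + 1 * Qp uL v" unfolding un[symmetric] by (intro add_left_mono mult_right_mono p2) simp
  also have "\<dots> \<le> Hh u + ennreal (N / D)" using 1 by (simp add: add_left_mono)
  finally have h: "Hh uL + Hh v \<le> Hh u + ennreal (N / D)" .
  have "Hh (\<lambda>x. uL x + uR x) + ennreal (1/2) * Qp uL uR \<le> Hh (\<lambda>x. uL x + uR x) + ennreal (2/pi) * Qp uL uR"
    by (intro add_left_mono mult_right_mono p2) simp
  also have "\<dots> = (Hh uL + Hh v) + ennreal (2/pi) * Qp (\<lambda>x. - uL x) uR"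
    unfolding HR[symmetric] by (rule Hh_split) (auto simp: uL_def uR_def)
  also have "\<dots> \<le> (Hh u + ennreal (N / D)) + 1 * ennreal (\<epsilon> * (N + 1))"
    by (intro add_mono h mult_mono p2 2) auto
  finally show ?thesis by (simp add: add.assoc)
qed

text \<open>The gain of the excision controls both tail terms of the localisation error: each tail
  is attracted by the chunk of length \<tau> on the other side, at distance comparable to S plus its
  distance from the window. The chunk on the left alone makes the left tail at least of order
  1/S^2.\<close>

lemma excise_interaction:
  fixes f uL uR :: "real \<Rightarrow> real"
  assumes [measurable]: "f \<in> borel_measurable borel" "uL \<in> borel_measurable borel" "uR \<in> borel_measurable borel"
    and S: "S \<ge> 1" and D: "D > 0" and z: "z = y + 3 * S + D" and f: "\<And>s. f s \<le> \<epsilon>" and \<epsilon>: "\<epsilon> \<ge> 0"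
    and uL: "\<And>x. x \<le> y \<Longrightarrow> uL x = f x" and uR: "\<And>x. y + 3 * S \<le> x \<Longrightarrow> uR x = f (D + x)"
    and \<tau>: "\<tau> > 0" and m: "m \<ge> 1"
    and qL: "qL + \<tau> \<le> y" "y - qL \<le> m * S" "\<And>x. x \<in> {qL..qL+\<tau>} \<Longrightarrow> f x \<le> - 1/4"
    and qR: "z \<le> qR" "qR + \<tau> - z \<le> m * S" "\<And>x. x \<in> {qR..qR+\<tau>} \<Longrightarrow> f x \<le> - 1/4"
  defines "\<kappa> \<equiv> \<tau> / (4 * (m + 3)^2)"
    and "\<mu>L \<equiv> (\<integral>\<^sup>+s\<in>{..y}. ennreal (\<bar>f s\<bar> / (S + (y - s))^2) \<partial>lborel)"
    and "\<mu>R \<equiv> (\<integral>\<^sup>+s\<in>{z..}. ennreal (\<bar>f s\<bar> / (S + (s - z))^2) \<partial>lborel)"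
  shows "ennreal \<kappa> * \<mu>L \<le> Qp uL uR + ennreal (\<kappa> * \<epsilon>)" "ennreal \<kappa> * \<mu>R \<le> Qp uL uR + ennreal (\<kappa> * \<epsilon>)"
    "ennreal (\<tau> / (4 * (m + 1)^2) / S^2) \<le> \<mu>L"
proof -
  have \<kappa>: "\<kappa> \<ge> 0" using \<tau> by (simp add: \<kappa>_def)
  have ge: "m * S + 3 * S + x \<le> (m + 3) * (S + x)" if "x \<ge> 0" for x
  proof -
    have "0 \<le> (m + 2) * x" using that m by simp
    then show ?thesis by (simp add: algebra_simps)
  qed
  have "\<mu>L \<le> (\<integral>\<^sup>+s\<in>{..y}. ennreal (max 0 (- f s) / (S + (y - s))^2) \<partial>lborel) + ennreal \<epsilon>"
    unfolding \<mu>L_def by (rule tail_negative_part) (use f \<epsilon> S in \<open>auto intro: tail_kernel_left\<close>)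
  also have "(\<integral>\<^sup>+s\<in>{..y}. ennreal (max 0 (- f s) / (S + (y - s))^2) \<partial>lborel) = (\<integral>\<^sup>+s\<in>{..y}. ennreal (max 0 (- uL s) / (S + (y - s))^2) \<partial>lborel)"
    by (intro nn_integral_cong) (auto simp: indicator_def uL)
  finally have "ennreal \<kappa> * \<mu>L \<le> ennreal \<kappa> * (\<integral>\<^sup>+s\<in>{..y}. ennreal (max 0 (- uL s) / (S + (y - s))^2) \<partial>lborel) + ennreal (\<kappa> * \<epsilon>)"
    using \<kappa> \<epsilon> by (simp add: ennreal_mult distrib_left[symmetric] mult_left_mono)
  also have "ennreal \<kappa> * (\<integral>\<^sup>+s\<in>{..y}. ennreal (max 0 (- uL s) / (S + (y - s))^2) \<partial>lborel) \<le> Qp uL uR"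
    unfolding \<kappa>_def
  proof (rule Qp_lower[where q = "qR - D"])
    show "uR t \<le> - 1/4" if "t \<in> {qR - D..qR - D + \<tau>}" for t
      using that qR(3)[of "D + t"] uR[of t] qR(1) z by auto
    show "s \<noteq> t \<and> \<bar>s - t\<bar> \<le> (m + 3) * (S + (y - s))" if "s \<in> {..y}" "t \<in> {qR - D..qR - D + \<tau>}" for s t
      using that ge[of "y - s"] qR(1,2) z S by auto
  qed (use \<tau> m in auto)
  finally show "ennreal \<kappa> * \<mu>L \<le> Qp uL uR + ennreal (\<kappa> * \<epsilon>)" by (simp add: add_right_mono)
  have "\<mu>R \<le> (\<integral>\<^sup>+s\<in>{z..}. ennreal (max 0 (- f s) / (S + (s - z))^2) \<partial>lborel) + ennreal \<epsilon>"
    unfolding \<mu>R_def by (rule tail_negative_part) (use f \<epsilon> S in \<open>auto intro: tail_kernel_right\<close>)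
  also have "(\<integral>\<^sup>+s\<in>{z..}. ennreal (max 0 (- f s) / (S + (s - z))^2) \<partial>lborel)
    = (NN s. ennreal (max 0 (- f (D + 1 * s)) / (S + (D + 1 * s - z))^2) * indicator {z..} (D + 1 * s))"
    by (subst nn_integral_real_affine[where c = 1 and t = D]) auto
  also have "\<dots> = (\<integral>\<^sup>+s\<in>{z - D..}. ennreal (max 0 (- uR s) / (S + (D + s - z))^2) \<partial>lborel)"
    by (intro nn_integral_cong) (auto simp: indicator_def uR z)
  finally have "ennreal \<kappa> * \<mu>R \<le> ennreal \<kappa> * (\<integral>\<^sup>+s\<in>{z - D..}. ennreal (max 0 (- uR s) / (S + (D + s - z))^2) \<partial>lborel) + ennreal (\<kappa> * \<epsilon>)"
    using \<kappa> \<epsilon> by (simp add: ennreal_mult distrib_left[symmetric] mult_left_mono)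
  also have "ennreal \<kappa> * (\<integral>\<^sup>+s\<in>{z - D..}. ennreal (max 0 (- uR s) / (S + (D + s - z))^2) \<partial>lborel) \<le> Qp uR uL"
    unfolding \<kappa>_def
  proof (rule Qp_lower[where q = qL])
    show "uL t \<le> - 1/4" if "t \<in> {qL..qL + \<tau>}" for t
      using that qL(3)[of t] uL[of t] qL(1) by auto
    show "s \<noteq> t \<and> \<bar>s - t\<bar> \<le> (m + 3) * (S + (D + s - z))" if "s \<in> {z - D..}" "t \<in> {qL..qL + \<tau>}" for s t
      using that ge[of "D + s - z"] qL(1,2) z S by auto
  qed (use \<tau> m in auto)
  also have "Qp uR uL = Qp uL uR" by (rule Qp_commute) auto
  finally show "ennreal \<kappa> * \<mu>R \<le> Qp uL uR + ennreal (\<kappa> * \<epsilon>)" by (simp add: add_right_mono)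
  have "ennreal (\<tau> / (4 * (m + 1)^2) / S^2) = (\<integral>\<^sup>+s\<in>{qL..qL+\<tau>}. ennreal (1 / (4 * (m + 1)^2) / S^2) \<partial>lborel)"
    using \<tau> by (subst nn_integral_cmult_indicator) (auto simp: emeasure_lborel_Icc_eq ennreal_mult[symmetric] mult_ac)
  also have "\<dots> \<le> \<mu>L" unfolding \<mu>L_def
  proof (rule nn_integral_mono)
    fix s
    show "ennreal (1 / (4 * (m + 1)^2) / S^2) * indicator {qL..qL+\<tau>} s \<le> ennreal (\<bar>f s\<bar> / (S + (y - s))^2) * indicator {..y} s"
    proof (cases "s \<in> {qL..qL+\<tau>}")
      case True
      have sy: "s \<le> y" using True qL by auto
      have "S + (y - s) \<le> (m + 1) * S" using True qL(2) by (simp add: algebra_simps)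
      then have "(S + (y - s))^2 \<le> ((m + 1) * S)^2" using sy S by (intro power_mono) auto
      then have "1/4 / ((m + 1) * S)^2 \<le> \<bar>f s\<bar> / (S + (y - s))^2"
        using qL(3)[OF True] sy S by (intro frac_le) auto
      then have "1 / (4 * (m + 1)^2) / S^2 \<le> \<bar>f s\<bar> / (S + (y - s))^2" by (simp add: power_mult_distrib)
      then show ?thesis using sy by (auto simp: indicator_def intro: ennreal_leI)
    qed simp
  qed
  finally show "ennreal (\<tau> / (4 * (m + 1)^2) / S^2) \<le> \<mu>L" .
qed

text \<open>Competitor: the angle is cut to a multiple of \<open>2 * pi\<close> in the middle of the interval \<open>{y..z}\<close> and a
  stretch of length \<open>D\<close> is excised, which brings the negative parts of \<open>f\<close> on both sides closer together.\<close>

lemma gap_step: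
  assumes min: "minimal h \<beta> \<rho> \<phi> g" and N: "ee h \<phi> g \<le> ennreal N" "N \<ge> 0" and h: "3/4 \<le> h" "h < 1"
    and \<sigma>: "\<sigma> \<ge> 1" and S: "S = \<sigma> ^ 4" and D: "D > 0" and z: "z = y + 3 * S + D"
    and c: "c = 2 * pi * of_int k" "\<And>x. x \<in> {y..z} \<Longrightarrow> \<bar>\<phi> x - c\<bar> \<le> pi / 2"
    and \<tau>: "\<tau> > 0" "\<tau> \<le> 1" and m: "m \<ge> 1"
    and qL: "qL + \<tau> \<le> y" "y - qL \<le> m * S" "\<And>x. x \<in> {qL..qL+\<tau>} \<Longrightarrow> cos (\<phi> x) - h \<le> - 1/4"
    and qR: "z \<le> qR" "qR + \<tau> - z \<le> m * S" "\<And>x. x \<in> {qR..qR+\<tau>} \<Longrightarrow> cos (\<phi> x) - h \<le> - 1/4"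
    and \<kappa>: "\<kappa> = \<tau> / (4 * (m + 3)^2)" "200 * (N + 1) / \<sigma> \<le> \<kappa> / 8"
  shows "enn2real (loc_energy h \<phi> g (y + S) (z - S)) + \<kappa> * \<tau> / (32 * (m + 1)^2) / S^2
    \<le> 100 * (N + 1) / \<sigma> * enn2real (loc_energy h \<phi> g y z) + 25 / \<sigma> / S^2 + 2 * N / D + (1 - h) * (3 * N + 46 * S + 60)"
proof -
  define \<epsilon> where "\<epsilon> = 1 - h"
  have \<epsilon>: "\<epsilon> > 0" "\<epsilon> \<le> 1/4" using h by (auto simp: \<epsilon>_def)
  define f where "f x = cos (\<phi> x) - h" for x
  have prof: "sob \<phi> g" "ee h \<phi> g < \<infinity>" "(\<phi> \<longlongrightarrow> \<beta>) at_bot" "(\<phi> \<longlongrightarrow> \<rho>) at_top" using min by (auto simp: minimal_def profile_def)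
  note [measurable] = sob_meas[OF prof(1)] sob_borel[OF prof(1)]
  have [measurable]: "f \<in> borel_measurable borel" unfolding f_def by measurable
  have f\<epsilon>: "f x \<le> \<epsilon>" for x by (simp add: f_def \<epsilon>_def)
  have S1: "S \<ge> 1" using \<sigma> by (simp add: S)
  have yz: "S > 0" "y + S \<le> z - S" using S1 D z by auto
  define b where "b = cutoff S y z"
  note cf = cutoff_facts[OF yz, folded b_def]
  have [measurable]: "b \<in> borel_measurable borel" by (rule sob_borel[OF cf(1)])
  have cb0: "cos (b x) = 0" if "y + S \<le> x" "x \<le> z - S" for x unfolding cf(4)[OF that] by simp
  obtain \<omega> g\<omega> where \<omega>: "sob \<omega> g\<omega>" "\<And>x. x \<notin> {y..z} \<Longrightarrow> \<omega> x = \<phi> x" "\<And>x. x \<in> {y+S..z-S} \<Longrightarrow> \<omega> x = c"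
      "\<And>x. 1 - cos (\<omega> x) = (cos (b x))^2 * (1 - cos (\<phi> x))"
      "\<And>x. x \<notin> {y..y+S} \<union> {z-S..z} \<Longrightarrow> if x \<in> {y..z} then g\<omega> x = 0 else g\<omega> x = g x"
      "\<And>x. \<bar>g\<omega> x\<bar> - \<bar>g x\<bar> \<le> 5 / S * sqrt ((1 - cos (\<phi> x)) / 2)"
    using cut_angle[OF prof(1) yz c] unfolding b_def by blast
  note [measurable] = sob_meas[OF \<omega>(1)]
  \<comment> \<open>The stretch from p to p + D lies where \<omega> = c, so the pieces on both sides
    fit together. A zero region of length S remains between them, since the interaction of opposite
    signs must stay bounded.\<close>
  define p where "p = y + S"
  define u where "u x = (cos (b x))^2 * f x" for x
  have [measurable]: "u \<in> borel_measurable borel" unfolding u_def by measurable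
  define uL where "uL x = (if x \<le> p then u x else 0)" for x
  define uR where "uR x = (if x \<le> p then 0 else u (D + x))" for x
  define \<theta> where "\<theta> x = (sin (if x \<le> p then b x else b (D + x)))^2" for x
  have [measurable]: "uL \<in> borel_measurable borel" "uR \<in> borel_measurable borel" "\<theta> \<in> borel_measurable borel"
    unfolding uL_def uR_def \<theta>_def by measurable
  define \<Phi> where "\<Phi> x = (if x \<le> p then \<omega> x else \<omega> (D + x))" for x
  define G where "G x = (if x \<le> p then g\<omega> x else g\<omega> (D + x))" for x
  have "\<omega> p = \<omega> (D + p)" using \<omega>(3)[of p] \<omega>(3)[of "D + p"] S1 D by (simp add: p_def z)
  then have \<Phi>s: "sob \<Phi> G" unfolding \<Phi>_def[abs_def] G_def[abs_def]
    using sob_affine[OF \<omega>(1), of 1 D] by (intro sob_join \<omega>(1)) simp_all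
  \<comment> \<open>1 - cos \<omega> = cos^2 b (1 - cos \<phi>) is rewritten as cos \<omega> - h =
    cos^2 b f + \<epsilon> sin^2 b: a localised function plus a small bump.\<close>
  have fid: "cos (\<Phi> x) - h = (uL x + uR x) + \<epsilon> * \<theta> x" for x
  proof -
    have "cos (\<omega> x) - h = u x + \<epsilon> * (sin (b x))^2" for x
      using \<omega>(4)[of x] by (simp add: u_def f_def \<epsilon>_def sin_squared_eq algebra_simps)
    then show ?thesis by (auto simp: \<Phi>_def uL_def uR_def \<theta>_def)
  qed
  have parts: "L2 g \<le> ennreal N" "Hh f \<le> ennreal N" "L2 f \<le> ennreal N"
  proof -
    have "L2 g \<le> ee h \<phi> g" "Hh f \<le> ee h \<phi> g" "L2 f \<le> ee h \<phi> g"
      unfolding ee_def f_def[symmetric] by (auto simp: add.assoc intro: add_increasing add_increasing2)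
    then show "L2 g \<le> ennreal N" "Hh f \<le> ennreal N" "L2 f \<le> ennreal N" using N(1) by (auto intro: order_trans)
  qed
  obtain rG where rG: "L2 g = ennreal rG" "rG \<ge> 0" by (rule le_ennrealE[OF parts(1)])
  obtain rH where rH: "Hh f = ennreal rH" "rH \<ge> 0" by (rule le_ennrealE[OF parts(2)])
  obtain rF where rF: "L2 f = ennreal rF" "rF \<ge> 0" by (rule le_ennrealE[OF parts(3)])
  have sum: "rG + rH + rF \<le> N"
  proof -
    have "ennreal (rG + rH + rF) \<le> ennreal N" using N(1) rG rH rF unfolding ee_def f_def[symmetric] by simp
    then show ?thesis using N(2) by simp
  qed
  let ?Gm = "\<integral>\<^sup>+x\<in>{y+S..z-S}. ennreal ((g x)^2) \<partial>lborel"
  let ?Fm = "\<integral>\<^sup>+x\<in>{y+S..z-S}. ennreal ((f x)^2) \<partial>lborel"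
  have GF: "?Gm \<le> L2 g" "?Fm \<le> L2 f"
    unfolding L2_norm_sq_real by (intro nn_integral_mono; auto simp: indicator_def)+
  obtain rGm where rGm: "?Gm = ennreal rGm" "rGm \<ge> 0" using GF(1) unfolding rG by (rule le_ennrealE)
  obtain rFm where rFm: "?Fm = ennreal rFm" "rFm \<ge> 0" using GF(2) unfolding rF by (rule le_ennrealE)
  note rm = rGm rFm
  have locm: "enn2real (loc_energy h \<phi> g (y + S) (z - S)) = rGm + rFm"
    unfolding loc_energy_def f_def[symmetric] rm using rm by (simp add: ennreal_plus[symmetric] del: ennreal_plus)
  have "loc_energy h \<phi> g y z < \<infinity>" using loc_energy_le prof(2) by (rule le_less_trans)
  then obtain rA where rA: "loc_energy h \<phi> g y z = ennreal rA" "rA \<ge> 0" by (rule finite_ennrealE)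
  let ?\<mu>L = "\<integral>\<^sup>+s\<in>{..y}. ennreal (\<bar>f s\<bar> / (S + (y - s))^2) \<partial>lborel"
  let ?\<mu>R = "\<integral>\<^sup>+s\<in>{z..}. ennreal (\<bar>f s\<bar> / (S + (s - z))^2) \<partial>lborel"
  have \<mu>N: "?\<mu>L \<le> ennreal N + 1" "?\<mu>R \<le> ennreal N + 1"
    by (intro tail_mass_le parts(3); use S1 in \<open>auto intro: tail_kernel_left tail_kernel_right\<close>)+
  have N1: "ennreal N + 1 = ennreal (N + 1)" using N by simp
  obtain l where l: "?\<mu>L = ennreal l" "l \<ge> 0" using \<mu>N(1) unfolding N1 by (rule le_ennrealE)
  obtain r where r: "?\<mu>R = ennreal r" "r \<ge> 0" using \<mu>N(2) unfolding N1 by (rule le_ennrealE)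
  note lr = l r
  have 1: "L2 G + ennreal rGm \<le> ennreal (rG + 13 / \<sigma> * rA + (25 / \<sigma> / S^2 + 50 * \<epsilon>))"
  proof -
    have "L2 G \<le> L2 g\<omega>" unfolding G_def[abs_def] by (rule glued_L2) (use D in auto)
    then have "L2 G + ennreal rGm \<le> L2 g\<omega> + ?Gm" unfolding rm by (rule add_right_mono)
    also have "\<dots> \<le> ennreal rG + ennreal (13 / \<sigma>) * ennreal rA + ennreal (25 / \<sigma> / S^2 + 50 * (1 - h))"
      using cut_kinetic[OF _ _ _ \<sigma> S yz(2) _ \<omega>(5,6), of h] h unfolding rA rG by simp
    also have "\<dots> = ennreal (rG + 13 / \<sigma> * rA + (25 / \<sigma> / S^2 + 50 * \<epsilon>))"
      unfolding \<epsilon>_def[symmetric] using rG rA \<sigma> \<epsilon> by (simp add: ennreal_real del: ennreal_plus)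
    finally show ?thesis .
  qed
  have wu: "(\<lambda>x. uL x + uR x) = (\<lambda>x. if x \<le> p then u x else u (D + x))" by (auto simp: uL_def uR_def)
  have Lu: "L2 u + ?Fm \<le> L2 f"
  proof -
    have "L2 u + ?Fm = (NN x. ennreal ((u x)^2) + ennreal ((f x)^2) * indicator {y+S..z-S} x)"
      unfolding L2_norm_sq_real by (rule nn_integral_add[symmetric]) auto
    also have "\<dots> \<le> L2 f" unfolding L2_norm_sq_real
    proof (rule nn_integral_mono)
      fix x
      have "((cos (b x))^2 * f x)^2 \<le> 1 * (f x)^2" unfolding power_mult_distrib
        by (rule mult_right_mono[OF power_le_one]) (auto simp: abs_square_le_1)
      moreover have "u x = 0" if "x \<in> {y+S..z-S}" using cb0[of x] that by (simp add: u_def)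
      ultimately show "ennreal ((u x)^2) + ennreal ((f x)^2) * indicator {y+S..z-S} x \<le> ennreal ((f x)^2)"
        by (cases "x \<in> {y+S..z-S}") (auto simp: u_def ennreal_leI)
    qed
    finally show ?thesis .
  qed
  have Luf: "L2 u \<le> ennreal N" by (rule order_trans[OF ennreal_add_leD(1)[OF Lu] parts(3)])
  then obtain ru where ru: "L2 u = ennreal ru" "ru \<ge> 0" by (rule le_ennrealE)
  have ruF: "ru + rFm \<le> rF" using Lu unfolding ru rm rF using ru rm rF by (simp add: ennreal_plus[symmetric] del: ennreal_plus)
  note bump = cutoff_bump[OF S1 less_imp_le[OF D] z p_def, folded b_def, folded \<theta>_def[abs_def]]
  have \<epsilon>\<theta>: "L2 (\<lambda>x. \<epsilon> * \<theta> x) \<le> ennreal (\<epsilon>^2 * (3 * S))" "Hh (\<lambda>x. \<epsilon> * \<theta> x) \<le> ennreal (\<epsilon>^2 * (20 * S))"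
  proof -
    show "L2 (\<lambda>x. \<epsilon> * \<theta> x) \<le> ennreal (\<epsilon>^2 * (3 * S))"
      using bump(2) S1 by (subst L2_norm_sq_mult_const) (auto simp: ennreal_mult mult_left_mono)
    have "Hh (\<lambda>x. \<epsilon> * \<theta> x) \<le> ennreal (\<epsilon>^2) * Hh \<theta>"
      using \<epsilon> by (intro Hh_lipschitz) (auto simp: abs_mult right_diff_distrib[symmetric])
    also have "\<dots> \<le> ennreal (\<epsilon>^2 * (20 * S))" using bump(3) S1 by (simp add: ennreal_mult mult_left_mono)
    finally show "Hh (\<lambda>x. \<epsilon> * \<theta> x) \<le> ennreal (\<epsilon>^2 * (20 * S))" .
  qed
  \<comment> \<open>The weight of the cross terms is \<epsilon> itself: the main terms are
    multiplied by 1 + \<epsilon> and the bump, whose squared norms carry \<epsilon>^2, by 1 +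
    1/\<epsilon>, so that both cost O(\<epsilon>).\<close>
  have e2: "(1 + 1 / \<epsilon>) * (\<epsilon>^2 * (a * S)) \<le> 2 * a * \<epsilon> * S" if "a \<ge> 0" for a
  proof -
    have "(1 + 1 / \<epsilon>) * (\<epsilon>^2 * (a * S)) = (\<epsilon> + 1) * (a * \<epsilon> * S)" using \<epsilon> by (simp add: power2_eq_square field_simps)
    also have "\<dots> \<le> 2 * (a * \<epsilon> * S)" using \<epsilon> that S1 by (intro mult_right_mono) auto
    finally show ?thesis by (simp add: mult_ac)
  qed
  have 2: "L2 (\<lambda>x. cos (\<Phi> x) - h) \<le> ennreal ((1 + \<epsilon>) * ru + 6 * \<epsilon> * S)"
  proof -
    have "L2 (\<lambda>x. cos (\<Phi> x) - h) \<le> ennreal (1 + \<epsilon>) * L2 (\<lambda>x. uL x + uR x) + ennreal (1 + 1/\<epsilon>) * L2 (\<lambda>x. \<epsilon> * \<theta> x)"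
      unfolding fid by (rule L2_norm_sq_add) (use \<epsilon> in auto)
    also have "\<dots> \<le> ennreal (1 + \<epsilon>) * L2 u + ennreal (1 + 1/\<epsilon>) * ennreal (\<epsilon>^2 * (3 * S))"
      unfolding wu by (intro add_mono mult_left_mono \<epsilon>\<theta> glued_L2) (use D in auto)
    also have "\<dots> = ennreal ((1 + \<epsilon>) * ru + (1 + 1/\<epsilon>) * (\<epsilon>^2 * (3 * S)))"
      unfolding ru using ru \<epsilon> S1 by (simp add: ennreal_real del: ennreal_plus)
    also have "\<dots> \<le> ennreal ((1 + \<epsilon>) * ru + 6 * \<epsilon> * S)" using e2[of 3] by (intro ennreal_leI) auto
    finally show ?thesis .
  qed
  let ?w = "Hh (\<lambda>x. uL x + uR x)"
  have 3: "Hh (\<lambda>x. cos (\<Phi> x) - h) \<le> ennreal (1 + \<epsilon>) * ?w + ennreal (40 * \<epsilon> * S)"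
  proof -
    have "Hh (\<lambda>x. cos (\<Phi> x) - h) \<le> ennreal (1 + \<epsilon>) * ?w + ennreal (1 + 1/\<epsilon>) * Hh (\<lambda>x. \<epsilon> * \<theta> x)"
      unfolding fid by (rule Hh_add_le) (use \<epsilon> in auto)
    also have "ennreal (1 + 1/\<epsilon>) * Hh (\<lambda>x. \<epsilon> * \<theta> x) \<le> ennreal (1 + 1/\<epsilon>) * ennreal (\<epsilon>^2 * (20 * S))"
      by (intro mult_left_mono \<epsilon>\<theta>) simp
    also have "\<dots> = ennreal ((1 + 1/\<epsilon>) * (\<epsilon>^2 * (20 * S)))" using \<epsilon> S1 by (intro ennreal_mult[symmetric]) auto
    also have "\<dots> \<le> ennreal (40 * \<epsilon> * S)" using e2[of 20] by (intro ennreal_leI) auto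
    finally show ?thesis by (simp add: add_left_mono)
  qed
  have 4: "?w + ennreal (1/2) * Qp uL uR \<le> Hh u + (ennreal (N / D) + ennreal (\<epsilon> * (N + 1)))"
    unfolding uL_def[abs_def] uR_def[abs_def]
  proof (rule excise_Hh[OF _ Luf N(2) S1 D])
    show "z = p + 2 * S + D" by (simp add: p_def z)
    show "u x = 0" if "p \<le> x" "x \<le> z - S" for x using cb0[of x] that by (simp add: u_def p_def)
    show "u x \<le> \<epsilon>" for x
    proof -
      have "u x \<le> (cos (b x))^2 * \<epsilon>" unfolding u_def by (intro mult_left_mono f\<epsilon>) simp
      also have "\<dots> \<le> 1 * \<epsilon>" using \<epsilon> by (intro mult_right_mono) (auto simp: abs_square_le_1)
      finally show ?thesis by simp
    qed
  qed (use \<epsilon> in auto)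
  define E where "E = 100 * (N + 1) / \<sigma>"
  have E0: "E \<ge> 0" using N \<sigma> by (simp add: E_def)
  have 5: "Hh u \<le> ennreal (rH + E / 3 * (rA + l + r))"
  proof -
    have "Hh u \<le> Hh f + ennreal (1/3 * (100 * (N + 1) / \<sigma>)) * ((\<integral>\<^sup>+t\<in>{y..z}. ennreal ((f t)^2) \<partial>lborel) + ?\<mu>L + ?\<mu>R)"
      unfolding u_def[abs_def]
      by (rule Hh_localise_twice[OF _ parts(3) N(2) \<sigma> _ _ _ S]) (use cf(2,3,5) in \<open>auto simp: S[symmetric]\<close>)
    also have "\<dots> \<le> ennreal rH + ennreal (E / 3) * (ennreal rA + ennreal l + ennreal r)"
      unfolding rH(1) lr
    proof (intro add_left_mono mult_mono)
      have "(\<integral>\<^sup>+t\<in>{y..z}. ennreal ((f t)^2) \<partial>lborel) \<le> loc_energy h \<phi> g y z"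
        unfolding loc_energy_def f_def by simp
      then show "(\<integral>\<^sup>+t\<in>{y..z}. ennreal ((f t)^2) \<partial>lborel) + ennreal l + ennreal r \<le> ennreal rA + ennreal l + ennreal r"
        unfolding rA by (intro add_right_mono)
    qed (auto simp: E_def mult.commute)
    also have "\<dots> = ennreal (rH + E / 3 * (rA + l + r))"
      using rH rA lr E0 by (simp add: ennreal_real del: ennreal_plus)
    finally show ?thesis .
  qed
  have "?w + ennreal (1/2) * Qp uL uR \<le> ennreal (rH + E / 3 * (rA + l + r)) + (ennreal (N / D) + ennreal (\<epsilon> * (N + 1)))"
    by (rule order_trans[OF 4 add_right_mono[OF 5]])
  also have "\<dots> = ennreal (rH + E / 3 * (rA + l + r) + (N / D + \<epsilon> * (N + 1)))" (is "_ = ennreal ?B")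
    using rH rA lr E0 N \<epsilon> D by (simp add: ennreal_plus[symmetric] del: ennreal_plus)
  finally have wq: "?w + ennreal (1/2) * Qp uL uR \<le> ennreal ?B" .
  have "?w \<le> ennreal ?B" by (rule ennreal_add_leD(1)[OF wq])
  then obtain w where w: "?w = ennreal w" "w \<ge> 0" by (rule le_ennrealE)
  have Qfin: "ennreal (1/2) * Qp uL uR \<le> ennreal ?B" by (rule ennreal_add_leD(2)[OF wq])
  have "Qp uL uR < \<infinity>"
  proof (rule ccontr)
    assume "\<not> ?thesis"
    then have "Qp uL uR = \<infinity>"
      using top.not_eq_extremum[of "Qp uL uR"] by (auto simp: infinity_ennreal_def)
    then have "ennreal (1/2) * Qp uL uR = \<infinity>" by (simp add: ennreal_mult_top)
    then show False using Qfin by (simp add: top_unique)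
  qed
  then obtain Q where Q: "Qp uL uR = ennreal Q" "Q \<ge> 0" by (rule finite_ennrealE)
  have B0: "?B \<ge> 0" using rH rA lr E0 N \<epsilon> D by simp
  have wB: "w + Q / 2 \<le> ?B"
  proof -
    have "ennreal (w + 1/2 * Q) \<le> ennreal ?B" using wq unfolding w Q using w Q by (simp only: ennreal_plus ennreal_mult mult_nonneg_nonneg zero_le_divide_1_iff zero_le_numeral)
    then show ?thesis using B0 by simp
  qed
  have \<kappa>0: "\<kappa> > 0" "\<kappa> \<le> 1"
  proof -
    show "\<kappa> > 0" using \<tau> m by (simp add: \<kappa>)
    have "1 \<le> (m + 3)^2" using m by simp
    then show "\<kappa> \<le> 1" using \<tau> unfolding \<kappa> by (simp add: divide_simps)
  qed
  have int: "\<kappa> * l \<le> Q + \<kappa> * \<epsilon>" "\<kappa> * r \<le> Q + \<kappa> * \<epsilon>" "\<tau> / (4 * (m + 1)^2) / S^2 \<le> l"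
  proof -
    have uLf: "uL x = f x" if "x \<le> y" for x using that S1 cf(2)[of x] by (simp add: uL_def u_def p_def)
    have uRf: "uR x = f (D + x)" if "y + 3 * S \<le> x" for x using that S1 cf(3)[of "D + x"] by (simp add: uR_def u_def p_def z)
    note I = excise_interaction[of f uL uR S D z y \<epsilon>, OF _ _ _ S1 D z f\<epsilon> less_imp_le[OF \<epsilon>(1)] uLf uRf \<tau>(1) m qL(1,2) _ qR(1,2), unfolded f_def, OF _ _ _ _ _ qL(3) qR(3), folded f_def, folded \<kappa>(1)]
    have "ennreal (\<kappa> * l) \<le> ennreal (Q + \<kappa> * \<epsilon>)" using I(1) unfolding lr Q using \<kappa>0 lr Q \<epsilon> by (simp add: ennreal_mult)
    then show "\<kappa> * l \<le> Q + \<kappa> * \<epsilon>" using Q \<kappa>0 \<epsilon> by (simp add: ennreal_plus[symmetric] del: ennreal_plus)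
    have "ennreal (\<kappa> * r) \<le> ennreal (Q + \<kappa> * \<epsilon>)" using I(2) unfolding lr Q using \<kappa>0 lr Q \<epsilon> by (simp add: ennreal_mult)
    then show "\<kappa> * r \<le> Q + \<kappa> * \<epsilon>" using Q \<kappa>0 \<epsilon> by (simp add: ennreal_plus[symmetric] del: ennreal_plus)
    show "\<tau> / (4 * (m + 1)^2) / S^2 \<le> l" using I(3) unfolding lr using lr by simp
  qed
  have Gle: "L2 G \<le> ennreal (rG + 13 / \<sigma> * rA + (25 / \<sigma> / S^2 + 50 * \<epsilon>))" by (rule ennreal_add_leD(1)[OF 1])
  then obtain rG' where rG': "L2 G = ennreal rG'" "rG' \<ge> 0" by (rule le_ennrealE)
  have G1: "rG' + rGm \<le> rG + 13 / \<sigma> * rA + (25 / \<sigma> / S^2 + 50 * \<epsilon>)"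
  proof -
    have "ennreal (rG' + rGm) \<le> ennreal (rG + 13 / \<sigma> * rA + (25 / \<sigma> / S^2 + 50 * \<epsilon>))" using 1 unfolding rG' using rG' rm by simp
    moreover have "0 \<le> rG + 13 / \<sigma> * rA + (25 / \<sigma> / S^2 + 50 * \<epsilon>)" using rG rA \<sigma> \<epsilon> by simp
    ultimately show ?thesis by simp
  qed
  have comp: "ee h \<Phi> G \<le> ennreal (rG' + ((1 + \<epsilon>) * w + 40 * \<epsilon> * S) + ((1 + \<epsilon>) * ru + 6 * \<epsilon> * S))"
  proof -
    have "ee h \<Phi> G \<le> ennreal rG' + (ennreal (1 + \<epsilon>) * ennreal w + ennreal (40 * \<epsilon> * S)) + ennreal ((1 + \<epsilon>) * ru + 6 * \<epsilon> * S)"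
      unfolding ee_def rG' using 2 3 unfolding w by (intro add_mono) auto
    also have "\<dots> = ennreal (rG' + ((1 + \<epsilon>) * w + 40 * \<epsilon> * S) + ((1 + \<epsilon>) * ru + 6 * \<epsilon> * S))"
      using rG' w ru \<epsilon> S1 by (simp add: ennreal_real del: ennreal_plus)
    finally show ?thesis .
  qed
  have "profile h \<beta> \<rho> \<Phi> G"
    unfolding profile_def
  proof (intro conjI \<Phi>s)
    show "ee h \<Phi> G < \<infinity>" using comp by (rule le_less_trans) simp
    have "eventually (\<lambda>x. \<phi> x = \<Phi> x) at_bot"
      using eventually_gt_at_bot[of y]
    proof eventually_elim
      case (elim x) then show ?case using \<omega>(2)[of x] S1 by (simp add: \<Phi>_def p_def)
    qed
    then show "(\<Phi> \<longlongrightarrow> \<beta>) at_bot" using prof(3) by (rule Lim_transform_eventually[rotated])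
    have "filterlim (\<lambda>x. D + x) at_top (at_top :: real filter)"
      by (rule filterlim_tendsto_add_at_top[OF tendsto_const filterlim_ident])
    then have t: "((\<lambda>x. \<phi> (D + x)) \<longlongrightarrow> \<rho>) at_top" by (rule filterlim_compose[OF prof(4)])
    have "eventually (\<lambda>x. \<phi> (D + x) = \<Phi> x) at_top"
      using eventually_gt_at_top[of z]
    proof eventually_elim
      case (elim x) then show ?case using \<omega>(2)[of "D + x"] S1 D by (simp add: \<Phi>_def p_def z)
    qed
    then show "(\<Phi> \<longlongrightarrow> \<rho>) at_top" using t by (rule Lim_transform_eventually[rotated])
  qed
  then have "ee h \<phi> g \<le> ee h \<Phi> G" using min by (auto simp: minimal_def)
  then have le: "ennreal (rG + rH + rF) \<le> ennreal (rG' + ((1 + \<epsilon>) * w + 40 * \<epsilon> * S) + ((1 + \<epsilon>) * ru + 6 * \<epsilon> * S))"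
    using comp rG rH rF unfolding ee_def f_def[symmetric] by (auto intro: order_trans)
  have R0: "0 \<le> rG' + ((1 + \<epsilon>) * w + 40 * \<epsilon> * S) + ((1 + \<epsilon>) * ru + 6 * \<epsilon> * S)" using rG' w ru \<epsilon> S1 by simp
  have M: "rG + rH + rF \<le> rG' + ((1 + \<epsilon>) * w + 40 * \<epsilon> * S) + ((1 + \<epsilon>) * ru + 6 * \<epsilon> * S)"
    using le unfolding ennreal_le_iff[OF R0] .
  \<comment> \<open>The interaction gain Q/2 has to pay twice: for the localisation error (E/2)(l +
    r) of the tails, which the lower bound on \<sigma> makes at most (\<kappa>/32)(l + r), and for
    the net gain \<kappa> l / 8, of order at least 1/S^2.\<close>
  have k8: "\<kappa> * \<tau> / (32 * (m + 1)^2) / S^2 \<le> \<kappa> * l / 8"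
    using mult_left_mono[OF int(3), of "\<kappa> / 8"] \<kappa>0 by simp
  have "200 * (N + 1) / \<sigma> = 2 * E" by (simp add: E_def)
  then have "E / 2 \<le> \<kappa> / 32" using \<kappa>(2) by linarith
  then have El: "E / 2 * (l + r) \<le> \<kappa> / 32 * (l + r)" using lr by (intro mult_right_mono) auto
  have w1: "(1 + \<epsilon>) * w \<le> (1 + \<epsilon>) * (rH + E / 3 * (rA + l + r) + (N / D + \<epsilon> * (N + 1))) - Q / 2"
  proof -
    have "(1 + \<epsilon>) * w \<le> (1 + \<epsilon>) * (?B - Q / 2)" using wB \<epsilon> by (intro mult_left_mono) auto
    moreover have "1 * (Q / 2) \<le> (1 + \<epsilon>) * (Q / 2)" using Q \<epsilon> by (intro mult_right_mono) auto
    ultimately show ?thesis by (simp only: right_diff_distrib mult_1)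
  qed
  have w2: "(1 + \<epsilon>) * (rH + E / 3 * (rA + l + r) + (N / D + \<epsilon> * (N + 1))) \<le> rH + \<epsilon> * rH + (E / 2 * rA + E / 2 * (l + r)) + (2 * N / D + 2 * \<epsilon> * (N + 1))"
  proof -
    have "(1 + \<epsilon>) * (E / 3 * (rA + l + r)) \<le> 3/2 * (E / 3 * (rA + l + r))" using \<epsilon> E0 rA lr by (intro mult_right_mono) auto
    moreover have "(1 + \<epsilon>) * (N / D + \<epsilon> * (N + 1)) \<le> 2 * (N / D + \<epsilon> * (N + 1))" using \<epsilon> N D by (intro mult_right_mono) auto
    moreover have "(1 + \<epsilon>) * (rH + E / 3 * (rA + l + r) + (N / D + \<epsilon> * (N + 1))) = rH + \<epsilon> * rH + (1 + \<epsilon>) * (E / 3 * (rA + l + r)) + (1 + \<epsilon>) * (N / D + \<epsilon> * (N + 1))"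
      by (simp only: distrib_left distrib_right mult_1 add_ac)
    moreover have "3/2 * (E / 3 * (rA + l + r)) = E / 2 * rA + E / 2 * (l + r)"
      unfolding distrib_left[symmetric] by (simp add: add.assoc)
    moreover have "2 * (N / D + \<epsilon> * (N + 1)) = 2 * N / D + 2 * \<epsilon> * (N + 1)" by (simp add: distrib_left)
    ultimately show ?thesis by linarith
  qed
  have u1: "(1 + \<epsilon>) * ru \<le> rF - rFm + \<epsilon> * rF"
  proof -
    have "\<epsilon> * ru \<le> \<epsilon> * rF" using ruF rm \<epsilon> by (intro mult_left_mono) auto
    then show ?thesis using ruF by (simp add: distrib_right)
  qed
  have FH: "\<epsilon> * rH + \<epsilon> * rF \<le> \<epsilon> * N" using sum rG \<epsilon> by (simp add: distrib_left[symmetric] mult_left_mono)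
  have A13: "13 / \<sigma> * rA + E / 2 * rA \<le> E * rA"
  proof -
    have "13 / \<sigma> \<le> E / 2" using \<sigma> N by (simp add: E_def divide_simps)
    then have "13 / \<sigma> * rA \<le> E / 2 * rA" using rA by (intro mult_right_mono)
    moreover have "E / 2 * rA + E / 2 * rA = E * rA" by simp
    ultimately show ?thesis by linarith
  qed
  have \<kappa>\<epsilon>: "\<kappa> * \<epsilon> \<le> 1 * \<epsilon>" using \<kappa>0 \<epsilon> by (intro mult_right_mono) auto
  have Q4: "\<kappa> * l / 8 + \<kappa> / 32 * (l + r) \<le> Q / 2 + \<epsilon>"
  proof -
    have "0 \<le> \<kappa> * l" "0 \<le> \<kappa> * r" using \<kappa>0 lr by auto
    moreover have "\<kappa> / 32 * (l + r) = \<kappa> * l / 32 + \<kappa> * r / 32" by (simp add: distrib_left)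
    ultimately show ?thesis using int(1,2) \<kappa>\<epsilon> \<epsilon> Q by linarith
  qed
  have "rGm + rFm + \<kappa> * l / 8 \<le> E * rA + 25 / \<sigma> / S^2 + 2 * N / D + (51 * \<epsilon> + \<epsilon> * N + 2 * \<epsilon> * (N + 1) + 46 * \<epsilon> * S)"
    using M G1 w1 w2 u1 FH A13 Q4 El by linarith
  also have "51 * \<epsilon> + \<epsilon> * N + 2 * \<epsilon> * (N + 1) + 46 * \<epsilon> * S \<le> (1 - h) * (3 * N + 46 * S + 60)"
    unfolding \<epsilon>_def[symmetric] using \<epsilon> by (simp add: algebra_simps)
  finally show ?thesis using k8 unfolding locm rA E_def[symmetric] enn2real_ennreal[OF rA(2)] by linarith
qed

text \<open>By connectedness the angle cannot cross a zero of the cosine, so one multiple of 2 pi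
  serves the whole interval.\<close>

lemma near_multiple_of_2pi:
  assumes s: "sob \<phi> g" and pos: "\<And>x. x \<in> {z1<..<z2} \<Longrightarrow> cos (\<phi> x) > 0" and z: "z1 < z2"
  shows "\<exists>k::int. \<forall>x\<in>{z1<..<z2}. \<bar>\<phi> x - 2 * pi * of_int k\<bar> \<le> pi / 2"
proof -
  obtain x0 where x0: "x0 \<in> {z1<..<z2}" using z dense by force
  define k where "k = round (\<phi> x0 / (2 * pi))"
  define r where "r = \<phi> x0 - 2 * pi * of_int k"
  have "\<bar>of_int k - \<phi> x0 / (2 * pi)\<bar> \<le> 1/2" unfolding k_def by (rule of_int_round_abs_le)
  then have "2 * pi * \<bar>of_int k - \<phi> x0 / (2 * pi)\<bar> \<le> 2 * pi * (1/2)" by (intro mult_left_mono) auto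
  moreover have "2 * pi * \<bar>of_int k - \<phi> x0 / (2 * pi)\<bar> = \<bar>r\<bar>"
  proof -
    have "2 * pi * \<bar>of_int k - \<phi> x0 / (2 * pi)\<bar> = \<bar>2 * pi * (of_int k - \<phi> x0 / (2 * pi))\<bar>" by (simp add: abs_mult)
    also have "2 * pi * (of_int k - \<phi> x0 / (2 * pi)) = - r" by (simp add: r_def right_diff_distrib)
    finally show ?thesis by simp
  qed
  ultimately have r: "\<bar>r\<bar> \<le> pi" by simp
  have cosk: "cos (t - 2 * pi * of_int k) = cos t" for t
    by (simp add: cos_diff)
  have r2: "\<bar>r\<bar> < pi / 2"
  proof (rule ccontr)
    assume "\<not> ?thesis"
    then have "cos \<bar>r\<bar> \<le> cos (pi / 2)" using r by (intro cos_monotone_0_pi_le) auto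
    then show False using pos[OF x0] cosk[of "\<phi> x0"] by (simp add: r_def)
  qed
  have r3: "\<phi> x0 - 2 * pi * of_int k < pi / 2" "- (pi / 2) < \<phi> x0 - 2 * pi * of_int k" using r2 unfolding r_def by linarith+
  have conn: "connected (\<phi> ` {z1<..<z2})"
    using sob_continuous[OF s] by (intro connected_continuous_image) (auto intro: continuous_on_subset)
  have no: "v \<notin> \<phi> ` {z1<..<z2}" if "cos v = 0" for v using pos that by fastforce
  have "\<bar>\<phi> x - 2 * pi * of_int k\<bar> \<le> pi / 2" if x: "x \<in> {z1<..<z2}" for x
  proof (rule ccontr)
    assume "\<not> ?thesis"
    then consider "\<phi> x > 2 * pi * of_int k + pi / 2" | "\<phi> x < 2 * pi * of_int k - pi / 2" by linarith
    then show False
    proof cases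
      case 1
      have "2 * pi * of_int k + pi / 2 \<in> \<phi> ` {z1<..<z2}"
        by (rule connectedD_interval[OF conn, of "\<phi> x0" "\<phi> x"]) (use x x0 1 r3 in auto)
      then show False using no[of "2 * pi * of_int k + pi / 2"] cosk[of "2 * pi * of_int k + pi / 2"] by simp
    next
      case 2
      have "2 * pi * of_int k - pi / 2 \<in> \<phi> ` {z1<..<z2}"
        by (rule connectedD_interval[OF conn, of "\<phi> x" "\<phi> x0"]) (use x x0 2 r3 in auto)
      then show False using no[of "2 * pi * of_int k - pi / 2"] cosk[of "2 * pi * of_int k - pi / 2"] by simp
    qed
  qed
  then show ?thesis by blast
qed

text \<open>Source of the scale \<tau> and of the threshold 1/4: over this distance Hoelder
  continuity moves the angle by at most 1/2, so cos \<phi> \<le> 1/2, while h \<ge> 3/4.\<close>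

lemma cos_stays_low:
  assumes s: "sob \<phi> g" and N: "L2 g \<le> ennreal N" "N \<ge> 0" and h: "3/4 \<le> h" and z: "cos (\<phi> z) \<le> 0"
    and x: "\<bar>x - z\<bar> \<le> min 1 (1 / (4 * (N + 1)))"
  shows "cos (\<phi> x) - h \<le> - 1/4"
proof -
  have "(\<phi> x - \<phi> z)^2 \<le> N * \<bar>x - z\<bar>" using sob_holder[OF s N] .
  also have "\<dots> \<le> (N + 1) * (1 / (4 * (N + 1)))" using x N by (intro mult_mono) auto
  also have "\<dots> = (1/2)^2" using N by (simp add: field_simps power2_eq_square)
  finally have "\<bar>\<phi> x - \<phi> z\<bar> \<le> 1/2" by (metis abs_le_square_iff abs_of_nonneg zero_le_divide_1_iff zero_le_numeral)
  moreover have "\<bar>cos (\<phi> x) - cos (\<phi> z)\<bar> \<le> \<bar>\<phi> x - \<phi> z\<bar>" by (rule abs_cos_diff_le)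
  ultimately show ?thesis using z h by linarith
qed

text \<open>Iterating \<open>gap_step\<close> over nine nested windows of width \<open>S = \<sigma> ^ 4\<close> yields a factor \<open>\<sigma> ^ (- 9)\<close>, which
  beats the gain of order \<open>S ^ (- 2)\<close>.\<close>

lemma gap_bound:
  assumes N: "N \<ge> 0"
  shows "\<exists>\<epsilon>1 L. 0 < \<epsilon>1 \<and> \<epsilon>1 \<le> 1/4 \<and> 0 < L \<and> (\<forall>h \<beta> \<rho> \<phi> g z1 z2. 1 - \<epsilon>1 < h \<longrightarrow> h < 1 \<longrightarrow> minimal h \<beta> \<rho> \<phi> g \<longrightarrow> ee h \<phi> g \<le> ennreal N
    \<longrightarrow> cos (\<phi> z1) \<le> 0 \<longrightarrow> cos (\<phi> z2) \<le> 0 \<longrightarrow> (\<forall>x\<in>{z1<..<z2}. cos (\<phi> x) > 0) \<longrightarrow> z2 - z1 \<le> L)"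
proof -
  define \<tau> where "\<tau> = min 1 (1 / (4 * (N + 1)))"
  define \<kappa> where "\<kappa> = \<tau> / (4 * (10 + 3)^2)"
  define c where "c = \<kappa> * \<tau> / (32 * (10 + 1)^2)"
  have \<tau>: "\<tau> > 0" "\<tau> \<le> 1" using N by (auto simp: \<tau>_def)
  have pos: "\<kappa> > 0" "c > 0" using \<tau> by (auto simp: \<kappa>_def c_def)
  define B where "B = (100 * (N + 1)) ^ 9"
  have B: "B > 0" using N by (simp add: B_def)
  \<comment> \<open>The summands are, in order: \<sigma> \<ge> 1; absorption of the localisation
    error by the gain; 25/\<sigma> \<le> c/4 for the kinetic error; and the final contradiction with
    the bound obtained from nine cuts.\<close>
  define \<sigma> where "\<sigma> = 1 + 1600 * (N + 1) / \<kappa> + 100 / c + 4 * B * (N + 1) / c"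
  have \<sigma>: "\<sigma> \<ge> 1" "\<sigma> \<ge> 1600 * (N + 1) / \<kappa>" "\<sigma> \<ge> 100 / c" "\<sigma> > 4 * B * N / c"
  proof -
    have n: "0 \<le> 1600 * (N + 1) / \<kappa>" "0 \<le> 100 / c" "0 \<le> 4 * B * (N + 1) / c" using pos N B by auto
    have "4 * B * N / c \<le> 4 * B * (N + 1) / c" using pos B by (intro divide_right_mono mult_left_mono) auto
    then show "\<sigma> \<ge> 1" "\<sigma> \<ge> 1600 * (N + 1) / \<kappa>" "\<sigma> \<ge> 100 / c" "\<sigma> > 4 * B * N / c" using n unfolding \<sigma>_def by linarith+
  qed
  define S where "S = \<sigma> ^ 4"
  have S1: "S \<ge> 1" using \<sigma> by (simp add: S_def)
  \<comment> \<open>Chosen so that the loss 2 N / D from the separated halves is at most c / (4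
    S^2).\<close>
  define D where "D = 8 * (N + 1) * S^2 / c"
  have D: "D > 0" using pos S1 N by (simp add: D_def)
  define K where "K = 3 * N + 46 * S + 60"
  have K: "K > 0" using N S1 by (simp add: K_def)
  define \<epsilon>1 where "\<epsilon>1 = min (1/4) (c / (4 * S^2) / K)"
  have \<epsilon>1: "\<epsilon>1 > 0" "\<epsilon>1 \<le> 1/4" using K pos S1 by (auto simp: \<epsilon>1_def)
  \<comment> \<open>Nine windows at each end take 18 S, and the two ramps with the zero region kept
    between them 3 S; at least D is left to excise.\<close>
  have main: "z2 - z1 \<le> 21 * S + D"
    if h: "1 - \<epsilon>1 < h" "h < 1" and min: "minimal h \<beta> \<rho> \<phi> g" and en: "ee h \<phi> g \<le> ennreal N"
      and z: "cos (\<phi> z1) \<le> 0" "cos (\<phi> z2) \<le> 0" and p: "\<And>x. x \<in> {z1<..<z2} \<Longrightarrow> cos (\<phi> x) > 0"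
    for h \<beta> \<rho> \<phi> g z1 z2
  proof (rule ccontr)
    assume "\<not> z2 - z1 \<le> 21 * S + D"
    then have big: "z2 - z1 > 21 * S + D" by simp
    have h34: "3/4 \<le> h" using h \<epsilon>1 by linarith
    have s: "sob \<phi> g" using min by (simp add: minimal_def profile_def)
    have gN: "L2 g \<le> ennreal N" using en unfolding ee_def by (rule ennreal_add_leD(1)[OF ennreal_add_leD(1)])
    have "z1 < z2" using big S1 D by linarith
    then obtain k :: int where k: "\<And>x. x \<in> {z1<..<z2} \<Longrightarrow> \<bar>\<phi> x - 2 * pi * of_int k\<bar> \<le> pi / 2"
      using near_multiple_of_2pi[OF s p] by blast
    define A where "A j = enn2real (loc_energy h \<phi> g (z1 + real j * S) (z2 - real j * S))" for j
    define \<eta> where "\<eta> = 100 * (N + 1) / \<sigma>"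
    have \<eta>: "\<eta> \<ge> 0" using N \<sigma> by (simp add: \<eta>_def)
    have A0: "0 \<le> A j" for j by (simp add: A_def)
    have AN: "A j \<le> N" for j
    proof -
      have "loc_energy h \<phi> g (z1 + real j * S) (z2 - real j * S) \<le> ennreal N" using loc_energy_le en by (rule order_trans)
      then have "A j \<le> enn2real (ennreal N)" unfolding A_def by (rule enn2real_mono) simp
      then show ?thesis using N by simp
    qed
    have small: "25 / \<sigma> / S^2 \<le> c / (4 * S^2)" "(1 - h) * K \<le> c / (4 * S^2)" "2 * N / D \<le> c / (4 * S^2)"
    proof -
      have "25 / \<sigma> \<le> c / 4" using \<sigma>(1,3) pos by (simp add: divide_simps mult.commute)
      then have "25 / \<sigma> / S^2 \<le> c / 4 / S^2" by (rule divide_right_mono) simp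
      then show "25 / \<sigma> / S^2 \<le> c / (4 * S^2)" by simp
      have "(1 - h) * K \<le> c / (4 * S^2) / K * K" using h K by (intro mult_right_mono) (auto simp: \<epsilon>1_def)
      then show "(1 - h) * K \<le> c / (4 * S^2)" using K by simp
      have "2 * N / D \<le> 2 * (N + 1) / D" using D by (intro divide_right_mono) auto
      also have "\<dots> = c / (4 * S^2)" using N pos S1 by (simp add: D_def divide_simps)
      finally show "2 * N / D \<le> c / (4 * S^2)" .
    qed
    \<comment> \<open>The gain c / S^2 consists of four quarters: one pays for the kinetic error,
      one for 2 N / D, one for the terms with 1 - h, and one is left.\<close>
    have step: "A (Suc j) + c / (4 * S^2) \<le> \<eta> * A j" if j: "1 \<le> j" "j \<le> 9" for j
    proof -
      define y where "y = z1 + real j * S"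
      define z where "z = z2 - real j * S"
      define D' where "D' = z - y - 3 * S"
      have jS: "S \<le> real j * S" "real j * S \<le> 9 * S" using j S1 by auto
      have DD: "D \<le> D'" using big jS unfolding D'_def y_def z_def by linarith
      have ym: "y + S = z1 + real (Suc j) * S" "z - S = z2 - real (Suc j) * S" by (simp_all add: y_def z_def algebra_simps)
      have "enn2real (loc_energy h \<phi> g (y + S) (z - S)) + \<kappa> * \<tau> / (32 * (10 + 1)^2) / S^2
        \<le> 100 * (N + 1) / \<sigma> * enn2real (loc_energy h \<phi> g y z) + 25 / \<sigma> / S^2 + 2 * N / D' + (1 - h) * (3 * N + 46 * S + 60)"
      \<comment> \<open>The chunks of length \<tau> \<le> S at the ends z1 and z2 stay within 9 S +
        \<tau> \<le> 10 S of the window, hence m = 10.\<close>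
      proof (rule gap_step[OF min en N h34 h(2) \<sigma>(1) S_def, where k = k and m = 10 and qL = "z1 - \<tau>" and qR = z2])
        show "\<bar>\<phi> x - 2 * pi * of_int k\<bar> \<le> pi / 2" if "x \<in> {y..z}" for x
        proof (rule k)
          have "y \<le> x" "x \<le> z" using that by auto
          then have "z1 < x" "x < z2" using jS S1 unfolding y_def z_def by linarith+
          then show "x \<in> {z1<..<z2}" by simp
        qed
        show "cos (\<phi> x) - h \<le> - 1/4" if "x \<in> {z1 - \<tau>..z1 - \<tau> + \<tau>}" for x
        proof (rule cos_stays_low[OF s gN N h34 z(1)])
          have "\<bar>x - z1\<bar> \<le> \<tau>" using that by auto
          then show "\<bar>x - z1\<bar> \<le> min 1 (1 / (4 * (N + 1)))" unfolding \<tau>_def .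
        qed
        show "cos (\<phi> x) - h \<le> - 1/4" if "x \<in> {z2..z2 + \<tau>}" for x
        proof (rule cos_stays_low[OF s gN N h34 z(2)])
          have "\<bar>x - z2\<bar> \<le> \<tau>" using that by auto
          then show "\<bar>x - z2\<bar> \<le> min 1 (1 / (4 * (N + 1)))" unfolding \<tau>_def .
        qed
        have "200 * (N + 1) = 1600 * (N + 1) / \<kappa> * (\<kappa> / 8)" using pos by simp
        also have "\<dots> \<le> \<sigma> * (\<kappa> / 8)" using \<sigma>(2) pos by (intro mult_right_mono) auto
        finally show "200 * (N + 1) / \<sigma> \<le> \<kappa> / 8" using \<sigma>(1) by (simp add: divide_le_eq mult.commute)
        show "0 < D'" using D DD by linarith
        show "z = y + 3 * S + D'" by (simp add: D'_def)
        show "z1 - \<tau> + \<tau> \<le> y" "y - (z1 - \<tau>) \<le> 10 * S" using jS S1 \<tau> unfolding y_def by linarith+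
        show "z \<le> z2" "z2 + \<tau> - z \<le> 10 * S" using jS S1 \<tau> unfolding z_def by linarith+
      qed (use \<tau> in \<open>auto simp: \<kappa>_def\<close>)
      moreover have "2 * N / D' \<le> 2 * N / D" using DD D N by (intro divide_left_mono) auto
      ultimately have "A (Suc j) + c / S^2 \<le> \<eta> * A j + 25 / \<sigma> / S^2 + 2 * N / D + (1 - h) * K"
        unfolding A_def ym[symmetric] y_def[symmetric] z_def[symmetric] c_def[symmetric] \<eta>_def[symmetric] K_def[symmetric] by linarith
      moreover have "c / S^2 = 4 * (c / (4 * S^2))" by simp
      ultimately show ?thesis using small by linarith
    qed
    have c0: "c / (4 * S^2) > 0" using pos S1 by simp
    have iter: "A (Suc j) \<le> \<eta> ^ j * N" if "j \<le> 8" for j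
      using that
    proof (induction j)
      case 0 then show ?case using AN by simp
    next
      case (Suc j)
      have "A (Suc (Suc j)) \<le> \<eta> * A (Suc j)" using step[of "Suc j"] Suc.prems c0 by simp
      also have "\<dots> \<le> \<eta> * (\<eta> ^ j * N)" using Suc \<eta> by (intro mult_left_mono) auto
      finally show ?case by (simp add: mult.assoc)
    qed
    \<comment> \<open>In the innermost window the remaining quarter of the gain alone is compared
      with \<eta>^9 N. Since \<sigma>^9 = S^2 \<sigma>, a full factor \<sigma> survives.\<close>
    have "c / (4 * S^2) \<le> \<eta> * A 9" using step[of 9] A0[of 10] by simp
    also have "\<dots> \<le> \<eta> * (\<eta> ^ 8 * N)" using iter[of 8] \<eta> by (intro mult_left_mono) auto
    also have "\<dots> = \<eta> ^ 9 * N" by (simp add: eval_nat_numeral)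
    also have "\<dots> = B * N / \<sigma> ^ 9" by (simp add: \<eta>_def B_def power_divide)
    finally have "c / (4 * S^2) * \<sigma> ^ 9 \<le> B * N" using \<sigma>(1) by (simp add: le_divide_eq)
    moreover have e: "c / (4 * S^2) * \<sigma> ^ 9 = c / 4 * \<sigma>"
    proof -
      have "\<sigma> ^ 9 = S^2 * \<sigma>" by (simp add: S_def eval_nat_numeral mult.assoc)
      then show ?thesis using S1 by simp
    qed
    ultimately have "c / 4 * \<sigma> \<le> B * N" by (simp only: e)
    then have "c * \<sigma> \<le> 4 * B * N" by linarith
    then have "\<sigma> \<le> 4 * B * N / c" using pos by (simp add: le_divide_eq mult.commute)
    then show False using \<sigma>(4) by simp
  qed
  have "0 < 21 * S + D" using S1 D by simp
  with \<epsilon>1 main show ?thesis by (intro exI[of _ \<epsilon>1] exI[of _ "21 * S + D"]) blast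
qed

text \<open>Every stretch of length 2 L in the core contains a point with cos \<phi> \<le> 0, since
  otherwise the gap around it would exceed L. Around such a point f \<le> -1/4 on a length \<tau>,
  so each block of length 2 L + 2 uses up \<tau>/16 of the L2 norm. There are at most 16 N / \<tau>
  full blocks, and the summand 1 covers the incomplete one.\<close>

lemma core_bounded:
  assumes s: "sob \<phi> g" and N: "L2 g \<le> ennreal N" "L2 (\<lambda>x. cos (\<phi> x) - h) \<le> ennreal N" "N \<ge> 0" and h: "3/4 \<le> h"
    and a: "cos (\<phi> a') \<le> 0" "cos (\<phi> a) \<le> 0" and L: "L > 0"
    and gap_bound: "\<And>z1 z2. cos (\<phi> z1) \<le> 0 \<Longrightarrow> cos (\<phi> z2) \<le> 0 \<Longrightarrow> (\<forall>x\<in>{z1<..<z2}. cos (\<phi> x) > 0) \<Longrightarrow> z2 - z1 \<le> L"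
  shows "a - a' \<le> (64 * (N + 1)^2 + 16 * N + 1) * (2 * L + 2)"
proof (cases "a' \<le> a")
  case False
  then have "a - a' \<le> 0 * 0" by simp
  also have "\<dots> \<le> (64 * (N + 1)^2 + 16 * N + 1) * (2 * L + 2)" using N L by (intro mult_mono) auto
  finally show ?thesis .
next
  case aa: True
  define \<tau> where "\<tau> = min 1 (1 / (4 * (N + 1)))"
  define B where "B = 2 * L + 2"
  have \<tau>: "\<tau> > 0" "\<tau> \<le> 1" using N by (auto simp: \<tau>_def)
  have B0: "B > 0" using L by (simp add: B_def)
  note [measurable] = sob_borel[OF s]
  have cl: "closed {x. cos (\<phi> x) \<le> 0}"
    using sob_continuous[OF s] by (intro closed_Collect_le continuous_intros)
  have ex: "\<exists>z\<in>{t..t + 2 * L}. cos (\<phi> z) \<le> 0" if t: "a' \<le> t" "t + 2 * L \<le> a" for t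
  proof (rule ccontr)
    assume no: "\<not> ?thesis"
    define A where "A = {x. cos (\<phi> x) \<le> 0} \<inter> {..t}"
    define A2 where "A2 = {x. cos (\<phi> x) \<le> 0} \<inter> {t..}"
    have A: "closed A" "a' \<in> A" "bdd_above A" and A2: "closed A2" "a \<in> A2" "bdd_below A2"
      using cl t a L by (auto simp: A_def A2_def intro: closed_Int)
    have S: "Sup A \<in> A" using A by (intro closed_contains_Sup) auto
    have I: "Inf A2 \<in> A2" using A2 by (intro closed_contains_Inf) auto
    have "cos (\<phi> x) > 0" if "x \<in> {Sup A<..<Inf A2}" for x
    proof (rule ccontr)
      assume "\<not> ?thesis"
      then have "x \<in> A \<or> x \<in> A2" by (auto simp: A_def A2_def)
      then show False using cSup_upper[of x A] cInf_lower[of x A2] A A2 that by auto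
    qed
    then have "Inf A2 - Sup A \<le> L" using S I by (intro gap_bound) (auto simp: A_def A2_def)
    moreover have "Sup A \<le> t" using S by (simp add: A_def)
    moreover have "Inf A2 > t + 2 * L"
    proof (rule ccontr)
      assume "\<not> ?thesis"
      then show False using no I by (auto simp: A2_def)
    qed
    ultimately show False using L by linarith
  qed
  have cnt: "ennreal (real n * \<tau> / 16) \<le> (\<integral>\<^sup>+x\<in>{a'..<a' + real n * B}. ennreal ((cos (\<phi> x) - h)^2) \<partial>lborel)"
    if "a' + real n * B \<le> a" for n
    using that
  proof (induction n)
    case (Suc n)
    define t where "t = a' + real n * B"
    have t: "a' \<le> t" "t + B \<le> a" "a' + real (Suc n) * B = t + B" using Suc.prems B0 by (auto simp: t_def algebra_simps)
    obtain z where z: "t \<le> z" "z \<le> t + 2 * L" "cos (\<phi> z) \<le> 0" using ex[of t] t by (auto simp: B_def)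
    have "ennreal (\<tau> / 16) = (\<integral>\<^sup>+x\<in>{z..z+\<tau>}. ennreal (1/16) \<partial>lborel)"
      using \<tau> by (subst nn_integral_cmult_indicator) (auto simp: emeasure_lborel_Icc_eq ennreal_mult[symmetric])
    also have "\<dots> \<le> (\<integral>\<^sup>+x\<in>{t..<t + B}. ennreal ((cos (\<phi> x) - h)^2) \<partial>lborel)"
    proof (rule nn_integral_mono)
      fix x
      show "ennreal (1/16) * indicator {z..z+\<tau>} x \<le> ennreal ((cos (\<phi> x) - h)^2) * indicator {t..<t + B} x"
      proof (cases "x \<in> {z..z+\<tau>}")
        case True
        then have "cos (\<phi> x) - h \<le> - 1/4" by (intro cos_stays_low[OF s N(1,3) h z(3)]) (auto simp: \<tau>_def)
        then have "(1/4)^2 \<le> (- (cos (\<phi> x) - h))^2" by (intro power_mono) auto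
        then have "1/16 \<le> (cos (\<phi> x) - h)^2" unfolding power2_minus by (simp add: power2_eq_square)
        then have "ennreal (1/16) \<le> ennreal ((cos (\<phi> x) - h)^2)" by (rule ennreal_leI)
        moreover have "x \<in> {t..<t + B}" using True z \<tau> by (auto simp: B_def)
        ultimately show ?thesis using True by simp
      qed simp
    qed
    finally have new: "ennreal (\<tau> / 16) \<le> (\<integral>\<^sup>+x\<in>{t..<t + B}. ennreal ((cos (\<phi> x) - h)^2) \<partial>lborel)" .
    have "ennreal (real (Suc n) * \<tau> / 16) = ennreal (real n * \<tau> / 16) + ennreal (\<tau> / 16)"
      using \<tau> by (simp add: ennreal_plus[symmetric] field_simps del: ennreal_plus)
    also have "\<dots> \<le> (\<integral>\<^sup>+x\<in>{a'..<t}. ennreal ((cos (\<phi> x) - h)^2) \<partial>lborel) + (\<integral>\<^sup>+x\<in>{t..<t + B}. ennreal ((cos (\<phi> x) - h)^2) \<partial>lborel)"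
      using Suc.IH t B0 by (intro add_mono new) (auto simp: t_def)
    also have "\<dots> = (NN x. ennreal ((cos (\<phi> x) - h)^2) * indicator {a'..<t} x + ennreal ((cos (\<phi> x) - h)^2) * indicator {t..<t + B} x)"
      by (rule nn_integral_add[symmetric]) auto
    also have "\<dots> = (\<integral>\<^sup>+x\<in>{a'..<t + B}. ennreal ((cos (\<phi> x) - h)^2) \<partial>lborel)"
      using t B0 by (intro nn_integral_cong) (auto simp: indicator_def)
    finally show ?case unfolding t(3) .
  qed simp
  define n where "n = nat \<lfloor>(a - a') / B\<rfloor>"
  have q0: "0 \<le> (a - a') / B" using aa B0 by simp
  have n: "real n \<le> (a - a') / B" "(a - a') / B < real n + 1" unfolding n_def using q0 by linarith+
  have "a' + real n * B \<le> a" using n(1) B0 by (simp add: pos_le_divide_eq)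
  from cnt[OF this] have "ennreal (real n * \<tau> / 16) \<le> (\<integral>\<^sup>+x\<in>{a'..<a' + real n * B}. ennreal ((cos (\<phi> x) - h)^2) \<partial>lborel)" .
  also have "\<dots> \<le> L2 (\<lambda>x. cos (\<phi> x) - h)" unfolding L2_norm_sq_real by (intro nn_integral_mono) (auto simp: indicator_def)
  also have "\<dots> \<le> ennreal N" by (rule N)
  finally have "real n * \<tau> \<le> 16 * N" using N by simp
  then have "real n \<le> 16 * N / \<tau>" using \<tau> by (simp add: pos_le_divide_eq)
  also have "\<dots> \<le> 64 * (N + 1)^2 + 16 * N"
  proof -
    have "1 / \<tau> \<le> 4 * (N + 1) + 1" unfolding \<tau>_def min_def using N by (auto simp: divide_simps)
    then have "16 * N * (1 / \<tau>) \<le> 16 * N * (4 * (N + 1) + 1)" using N by (intro mult_left_mono) auto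
    also have "\<dots> \<le> 64 * (N + 1)^2 + 16 * N" using N by (simp add: power2_eq_square algebra_simps)
    finally show ?thesis by simp
  qed
  finally have "(a - a') / B \<le> 64 * (N + 1)^2 + 16 * N + 1" using n by linarith
  then show ?thesis using B0 by (simp add: pos_divide_le_eq B_def)
qed

section \<open>Domination of attraction by repulsion, and the effect of stretching small
  angles\<close>

lemma Qp_add_right:
  fixes v p q :: "real \<Rightarrow> real"
  assumes [measurable]: "v \<in> borel_measurable borel" "p \<in> borel_measurable borel" "q \<in> borel_measurable borel"
    and nn: "\<And>x. 0 \<le> v x" "\<And>x. 0 \<le> p x" "\<And>x. 0 \<le> q x"
  shows "Qp v (\<lambda>x. p x + q x) = Qp v p + Qp v q"
proof -
  have "Qp v (\<lambda>x. p x + q x) = DI (\<lambda>s t. max 0 (v s * p t) / (s - t)^2 + max 0 (v s * q t) / (s - t)^2)"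
    unfolding Qp_def using nn by (simp add: distrib_left add_divide_distrib)
  also have "\<dots> = Qp v p + Qp v q" unfolding Qp_def by (rule DI_add) auto
  finally show ?thesis .
qed

text \<open>Seen from any point of the support of \<open>p\<close>, all of the mass M of
  \<open>v\<close> is at least half as far away as a chunk of length \<tau> on which n \<ge> 1/4.
  Comparing with each point of the chunk and averaging gives 4 * 4 M / \<tau>: one 4 from the
  distances, one from the size of \<open>n\<close>.\<close>

lemma interaction_dominated:
  fixes v p n :: "real \<Rightarrow> real"
  assumes [measurable]: "v \<in> borel_measurable borel" "p \<in> borel_measurable borel" "n \<in> borel_measurable borel"
    and nn: "\<And>x. 0 \<le> v x" "\<And>x. 0 \<le> p x" "\<And>x. 0 \<le> n x" and M: "(NN x. ennreal (v x)) \<le> ennreal M" "M \<ge> 0" and \<tau>: "\<tau> > 0"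
    and c: "\<And>t. p t \<noteq> 0 \<Longrightarrow> \<exists>c. \<forall>x\<in>{c..c+\<tau>}. n x \<ge> 1/4 \<and> x \<noteq> t \<and> (\<forall>s. v s \<noteq> 0 \<longrightarrow> \<bar>t - x\<bar> \<le> 2 * \<bar>t - s\<bar>)"
  shows "Qp v p \<le> ennreal (16 * M / \<tau>) * Qp n p"
proof -
  have "Qp v p \<le> (NN t. ennreal (16 * M / \<tau>) * (NN s. ennreal (max 0 (n s * p t) / (s - t)^2)))"
    unfolding Qp_def DI_def
  proof (rule nn_integral_mono)
    fix t
    show "(NN s. ennreal (max 0 (v s * p t) / (s - t)^2)) \<le> ennreal (16 * M / \<tau>) * (NN s. ennreal (max 0 (n s * p t) / (s - t)^2))"
    proof (cases "p t = 0")
      case False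
      then obtain c where c: "\<And>x. x \<in> {c..c+\<tau>} \<Longrightarrow> n x \<ge> 1/4" "\<And>x. x \<in> {c..c+\<tau>} \<Longrightarrow> x \<noteq> t"
        "\<And>x s. x \<in> {c..c+\<tau>} \<Longrightarrow> v s \<noteq> 0 \<Longrightarrow> \<bar>t - x\<bar> \<le> 2 * \<bar>t - s\<bar>" using c by metis
      define I where "I = (NN s. ennreal (max 0 (v s * p t) / (s - t)^2))"
      have Ile: "I \<le> ennreal (16 * M * (n x * p t / (x - t)^2))" if x: "x \<in> {c..c+\<tau>}" for x
      proof -
        have x0: "(x - t)^2 > 0" using c(2)[OF x] by simp
        have "I \<le> (NN s. ennreal (4 * p t / (x - t)^2) * ennreal (v s))"
          unfolding I_def
        proof (rule nn_integral_mono)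
          fix s
          show "ennreal (max 0 (v s * p t) / (s - t)^2) \<le> ennreal (4 * p t / (x - t)^2) * ennreal (v s)"
          proof (cases "v s = 0")
            case False
            have "\<bar>t - x\<bar>^2 \<le> (2 * \<bar>t - s\<bar>)^2" using c(3)[OF x False] by (intro power_mono) auto
            then have d: "(x - t)^2 \<le> 4 * (s - t)^2" by (simp add: power_mult_distrib power2_commute)
            then have "(s - t)^2 > 0" using x0 by linarith
            with d x0 have "1 / (s - t)^2 \<le> 4 / (x - t)^2" by (simp add: divide_simps)
            then have "v s * p t * (1 / (s - t)^2) \<le> v s * p t * (4 / (x - t)^2)" using nn by (intro mult_left_mono) auto
            then have "max 0 (v s * p t) / (s - t)^2 \<le> 4 * p t / (x - t)^2 * v s" using nn by (simp add: max_absorb2 mult_ac)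
            then show ?thesis using nn by (subst ennreal_mult[symmetric]) (auto intro: ennreal_leI)
          qed simp
        qed
        also have "\<dots> = ennreal (4 * p t / (x - t)^2) * (NN s. ennreal (v s))" by (rule nn_integral_cmult) simp
        also have "\<dots> \<le> ennreal (4 * p t / (x - t)^2) * ennreal M" by (intro mult_left_mono M) simp
        also have "\<dots> = ennreal (4 * M * (p t / (x - t)^2))" using nn M by (simp add: ennreal_mult[symmetric] mult_ac)
        also have "\<dots> \<le> ennreal (16 * M * (n x * p t / (x - t)^2))"
        proof (rule ennreal_leI)
          have "1 * (4 * M * (p t / (x - t)^2)) \<le> (4 * n x) * (4 * M * (p t / (x - t)^2))"
            using c(1)[OF x] nn(2)[of t] M by (intro mult_right_mono) auto
          then show "4 * M * (p t / (x - t)^2) \<le> 16 * M * (n x * p t / (x - t)^2)" by (simp add: mult_ac)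
        qed
        finally show ?thesis .
      qed
      have "ennreal \<tau> * I = (\<integral>\<^sup>+x\<in>{c..c+\<tau>}. I \<partial>lborel)"
        using \<tau> by (subst nn_integral_cmult_indicator) (auto simp: emeasure_lborel_Icc_eq mult.commute)
      also have "\<dots> \<le> (NN x. ennreal (16 * M) * ennreal (max 0 (n x * p t) / (x - t)^2))"
      proof (rule nn_integral_mono)
        fix x
        show "I * indicator {c..c+\<tau>} x \<le> ennreal (16 * M) * ennreal (max 0 (n x * p t) / (x - t)^2)"
          using Ile[of x] M nn by (cases "x \<in> {c..c+\<tau>}") (auto simp: ennreal_mult[symmetric] max_absorb2)
      qed
      also have "\<dots> = ennreal (16 * M) * (NN s. ennreal (max 0 (n s * p t) / (s - t)^2))" by (rule nn_integral_cmult) simp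
      finally have "ennreal (1 / \<tau>) * (ennreal \<tau> * I) \<le> ennreal (1 / \<tau>) * (ennreal (16 * M) * (NN s. ennreal (max 0 (n s * p t) / (s - t)^2)))"
        by (rule mult_left_mono) simp
      moreover have "ennreal (1 / \<tau>) * (ennreal \<tau> * I) = I"
        unfolding mult.assoc[symmetric] using \<tau> by (simp add: ennreal_mult[symmetric])
      moreover have "ennreal (1 / \<tau>) * ennreal (16 * M) = ennreal (16 * M / \<tau>)" using \<tau> M by (simp add: ennreal_mult[symmetric])
      ultimately show ?thesis unfolding I_def by (simp add: mult.assoc[symmetric])
    qed simp
  qed
  also have "\<dots> = ennreal (16 * M / \<tau>) * Qp n p"
    unfolding Qp_def DI_def by (rule nn_integral_cmult) measurable
  finally show ?thesis .
qed

lemma sin_over_id_antimono: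
  assumes "0 < t" "t \<le> s" "s \<le> pi / 2" shows "sin s * t \<le> s * sin (t::real)"
proof (cases "t = s")
  case False
  then have ts: "t < s" using assms by simp
  obtain x where x: "0 < x" "x < t" "sin t - sin 0 = (t - 0) * cos x" using MVT2[OF assms(1), of sin cos] by auto
  obtain y where y: "t < y" "y < s" "sin s - sin t = (s - t) * cos y" using MVT2[OF ts, of sin cos] by auto
  have "cos y \<le> cos x" using x y assms by (intro cos_monotone_0_pi_le) auto
  then have "(s - t) * cos y * t \<le> (s - t) * cos x * t" using ts assms by (intro mult_right_mono mult_left_mono) auto
  moreover have st: "sin s = sin t + (s - t) * cos y" "sin t = t * cos x" using x y by auto
  moreover have "sin s * t = sin t * t + (s - t) * cos y * t" unfolding st(1) by (simp add: distrib_right)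
  moreover have "s * sin t = sin t * t + (s - t) * cos x * t" unfolding st(2) by (simp add: algebra_simps)
  ultimately show ?thesis by linarith
qed auto

text \<open>Stretching multiplies both the sum and the difference of two clamped angles by at most
  k. In cos p - cos q = 2 sin((p+q)/2) sin((q-p)/2) each sine grows by at most k as well, because
  sin t / t decreases; hence k^2.\<close>

lemma cos_clamp_lipschitz:
  fixes k \<alpha> x y :: real
  assumes k: "1 \<le> k" and \<alpha>: "0 < \<alpha>" "\<alpha> \<le> 1" and xy: "0 \<le> x" "0 \<le> y"
  shows "\<bar>cos (min (k * x) \<alpha>) - cos (min (k * y) \<alpha>)\<bar> \<le> k^2 * \<bar>cos (min x \<alpha>) - cos (min y \<alpha>)\<bar>"
proof -
  have *: "\<bar>cos (min (k * x) \<alpha>) - cos (min (k * y) \<alpha>)\<bar> \<le> k^2 * \<bar>cos (min x \<alpha>) - cos (min y \<alpha>)\<bar>" if xy: "0 \<le> x" "x \<le> y" for x y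
  proof -
    define u v where "u = min (k * x) \<alpha>" and "v = min (k * y) \<alpha>"
    define u' v' where "u' = min x \<alpha>" and "v' = min y \<alpha>"
    have kx: "x \<le> k * x" "\<alpha> \<le> k * \<alpha>" using k xy \<alpha> mult_right_mono[of 1 k x] mult_right_mono[of 1 k \<alpha>] by auto
    have kxy: "k * x \<le> k * y" using k xy by (intro mult_left_mono) auto
    have "0 \<le> u'" "u' \<le> v'" "v' \<le> \<alpha>" using xy \<alpha> by (auto simp: u'_def v'_def)
    note uv' = this
    have "u' \<le> u" "u \<le> v" "v \<le> \<alpha>" using kx kxy by (auto simp: u_def v_def u'_def min_def)
    note uv = this
    have v'v: "v' \<le> v" using k xy mult_right_mono[of 1 k y] by (auto simp: v_def v'_def min_def)
    have d: "u + v \<le> k * (u' + v')" "v - u \<le> k * (v' - u')"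
    proof -
      have "k * u' = min (k * x) (k * \<alpha>)" "k * v' = min (k * y) (k * \<alpha>)" using k by (simp_all add: u'_def v'_def min_mult_distrib_left)
      then have e: "u = min (k * u') \<alpha>" "v = min (k * v') \<alpha>" using kx(2) by (simp_all add: u_def v_def)
      have m: "k * u' \<le> k * v'" using uv' k by (intro mult_left_mono) auto
      have "u \<le> k * u'" "v \<le> k * v'" unfolding e by auto
      then show "u + v \<le> k * (u' + v')" by (simp add: distrib_left)
      show "v - u \<le> k * (v' - u')" unfolding right_diff_distrib using m unfolding e by linarith
    qed
    have sk: "sin s \<le> k * sin t" if t: "0 \<le> t" "t \<le> \<alpha>" "s \<le> k * t" "0 \<le> s" "s \<le> \<alpha>" for s t
    proof (cases "s \<le> t")
      case True
      have sn: "0 \<le> sin t" using t \<alpha> pi_gt3 by (intro sin_ge_zero) auto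
      have "sin s \<le> sin t" using True t \<alpha> pi_gt3 by (intro sin_monotone_2pi_le) auto
      also have "\<dots> \<le> k * sin t" using k sn mult_right_mono[of 1 k "sin t"] by simp
      finally show ?thesis .
    next
      case False
      then have t0: "t > 0" using t by (cases "t = 0") auto
      have sn: "0 \<le> sin t" using t \<alpha> pi_gt3 by (intro sin_ge_zero) auto
      have "sin s * t \<le> s * sin t" using False t0 t \<alpha> pi_gt3 by (intro sin_over_id_antimono) auto
      also have "\<dots> \<le> k * t * sin t" using t sn by (intro mult_right_mono) auto
      finally have "sin s * t \<le> (k * sin t) * t" by (simp add: mult_ac)
      then show ?thesis using t0 by simp
    qed
    have c: "cos p - cos q = 2 * (sin ((p + q) / 2) * sin ((q - p) / 2))" for p q :: real by (simp add: cos_diff_cos)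
    have s1: "0 \<le> sin t" if "0 \<le> t" "t \<le> \<alpha>" for t using that \<alpha> pi_gt3 by (intro sin_ge_zero) auto
    have m: "sin ((u + v) / 2) * sin ((v - u) / 2) \<le> (k * sin ((u' + v') / 2)) * (k * sin ((v' - u') / 2))"
      using uv uv' d k by (intro mult_mono sk s1 mult_nonneg_nonneg) auto
    have p1: "0 \<le> sin ((u + v) / 2) * sin ((v - u) / 2)" using uv uv' by (intro mult_nonneg_nonneg s1) auto
    have p2: "0 \<le> sin ((u' + v') / 2) * sin ((v' - u') / 2)" using uv' by (intro mult_nonneg_nonneg s1) auto
    have "\<bar>cos u - cos v\<bar> = 2 * (sin ((u + v) / 2) * sin ((v - u) / 2))" unfolding c using p1 by simp
    also have "\<dots> \<le> k^2 * (2 * (sin ((u' + v') / 2) * sin ((v' - u') / 2)))" using m by (simp add: power2_eq_square mult_ac)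
    also have "\<dots> = k^2 * \<bar>cos u' - cos v'\<bar>" unfolding c using p2 by simp
    finally show ?thesis by (simp add: u_def v_def u'_def v'_def)
  qed
  show ?thesis
  proof (cases "x \<le> y")
    case True then show ?thesis using *[OF xy(1)] by simp
  next
    case False then show ?thesis using *[OF xy(2), of x] by (simp add: abs_minus_commute)
  qed
qed

text \<open>Either the stretched angle reaches the clamp \<alpha> and the whole difference to cos
  \<alpha> is gained, or two applications of the mean value theorem compare the increment with 1 -
  cos D at the rate k - 1.\<close>

lemma cos_scaled_lower:
  fixes D k \<alpha> :: real
  assumes D: "0 \<le> D" "D \<le> \<alpha>" and \<alpha>: "\<alpha> \<le> 1" and k: "1 \<le> k"
  shows "min (cos D - cos \<alpha>) ((k - 1) * (1 - cos D)) \<le> cos D - cos (min (k * D) \<alpha>)"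
proof (cases "k * D \<le> \<alpha> \<and> k \<noteq> 1 \<and> D \<noteq> 0")
  case True
  then have D0: "D > 0" "D < k * D" using D k by auto
  obtain \<xi> where \<xi>: "D < \<xi>" "\<xi> < k * D" "cos (k * D) - cos D = (k * D - D) * (- sin \<xi>)"
    using MVT2[OF D0(2), of cos "\<lambda>x. - sin x"] by (auto intro!: derivative_eq_intros)
  obtain \<zeta> where \<zeta>: "0 < \<zeta>" "\<zeta> < D" "cos D - cos 0 = (D - 0) * (- sin \<zeta>)"
    using MVT2[OF D0(1), of cos "\<lambda>x. - sin x"] by (auto intro!: derivative_eq_intros)
  have "sin \<zeta> \<le> sin \<xi>" using \<xi> \<zeta> True \<alpha> pi_gt3 by (intro sin_monotone_2pi_le) auto
  then have "(k - 1) * D * sin \<zeta> \<le> (k - 1) * D * sin \<xi>" using D0 k by (intro mult_left_mono mult_nonneg_nonneg) auto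
  moreover have "1 - cos D = D * sin \<zeta>" "cos D - cos (k * D) = (k - 1) * D * sin \<xi>" using \<xi>(3) \<zeta>(3) by (auto simp: algebra_simps)
  ultimately have "(k - 1) * (1 - cos D) \<le> cos D - cos (k * D)" by (simp only: mult.assoc)
  then show ?thesis using True by (simp add: min_absorb1 min.coboundedI2)
next
  case False
  then consider "k * D > \<alpha>" | "k = 1" | "D = 0" by linarith
  then show ?thesis using D by cases auto
qed

text \<open>With k = 1 + 1/(i+1) the integrand divided by k - 1 is p min((i+1) p, \<epsilon> - p),
  which increases to p (\<epsilon> - p); monotone convergence concludes.\<close>

lemma mass_from_quotients:
  fixes p :: "real \<Rightarrow> real"
  assumes [measurable]: "p \<in> borel_measurable borel" and p: "\<And>x. 0 \<le> p x" "\<And>x. p x \<le> \<epsilon>" and B: "B \<ge> 0"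
    and q: "\<And>k. 1 < k \<Longrightarrow> k \<le> 2 \<Longrightarrow> (NN x. ennreal (p x * min (p x) ((k - 1) * (\<epsilon> - p x)))) \<le> ennreal ((k ^ 4 - 1) * B)"
  shows "(NN x. ennreal (p x * (\<epsilon> - p x))) \<le> ennreal (15 * B)"
proof -
  define F where "F i x = ennreal (p x * min (real (Suc i) * p x) (\<epsilon> - p x))" for i x
  have [measurable]: "F i \<in> borel_measurable lborel" for i unfolding F_def by measurable
  have inc: "incseq F"
    unfolding F_def incseq_def le_fun_def
    by (intro allI impI ennreal_leI mult_left_mono min.mono mult_right_mono p) auto
  have b: "(NN x. F i x) \<le> ennreal (15 * B)" for i
  proof -
    define k where "k = 1 + 1 / real (Suc i)"
    have k: "1 < k" "k \<le> 2" "real (Suc i) * (k - 1) = 1" by (auto simp: k_def divide_simps)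
    have "F i x = ennreal (real (Suc i)) * ennreal (p x * min (p x) ((k - 1) * (\<epsilon> - p x)))" for x
    proof -
      have "real (Suc i) * min (p x) ((k - 1) * (\<epsilon> - p x)) = min (real (Suc i) * p x) (real (Suc i) * ((k - 1) * (\<epsilon> - p x)))"
        by (simp add: min_mult_distrib_left)
      also have "real (Suc i) * ((k - 1) * (\<epsilon> - p x)) = \<epsilon> - p x" using k(3) by (simp only: mult.assoc[symmetric] mult_1)
      finally have e: "p x * min (real (Suc i) * p x) (\<epsilon> - p x) = real (Suc i) * (p x * min (p x) ((k - 1) * (\<epsilon> - p x)))"
        by (simp only: mult.left_commute)
      show ?thesis unfolding F_def e by (rule ennreal_mult) (use p k in \<open>auto intro!: mult_nonneg_nonneg\<close>)
    qed
    then have "(NN x. F i x) = ennreal (real (Suc i)) * (NN x. ennreal (p x * min (p x) ((k - 1) * (\<epsilon> - p x))))"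
      by (simp add: nn_integral_cmult)
    also have "\<dots> \<le> ennreal (real (Suc i)) * ennreal ((k ^ 4 - 1) * B)" by (intro mult_left_mono q k) simp
    also have "\<dots> = ennreal (real (Suc i) * ((k ^ 4 - 1) * B))" using k B by (intro ennreal_mult[symmetric]) auto
    also have "\<dots> \<le> ennreal (15 * B)"
    proof (rule ennreal_leI)
      \<comment> \<open>The constant 15 bounds (k + 1)(k^2 + 1) for k \<le> 2.\<close>
      have "k ^ 4 - 1 = (k - 1) * ((k + 1) * (k^2 + 1))" by (simp add: eval_nat_numeral algebra_simps)
      also have "\<dots> \<le> (k - 1) * ((2 + 1) * (2^2 + 1))" using k by (intro mult_left_mono mult_mono add_right_mono power_mono) auto
      finally have "real (Suc i) * (k ^ 4 - 1) \<le> real (Suc i) * ((k - 1) * 15)" by (intro mult_left_mono) auto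
      also have "\<dots> = 15" using k(3) by (simp only: mult.assoc[symmetric] mult_1)
      finally have "real (Suc i) * (k ^ 4 - 1) * B \<le> 15 * B" using B by (rule mult_right_mono)
      then show "real (Suc i) * ((k ^ 4 - 1) * B) \<le> 15 * B" by (simp only: mult.assoc)
    qed
    finally show ?thesis .
  qed
  have "(NN x. ennreal (p x * (\<epsilon> - p x))) \<le> (NN x. (SUP i. F i x))"
  proof (rule nn_integral_mono)
    fix x
    show "ennreal (p x * (\<epsilon> - p x)) \<le> (SUP i. F i x)"
    proof (cases "p x = 0")
      case False
      then have px: "p x > 0" using p(1)[of x] by simp
      obtain i :: nat where "(\<epsilon> - p x) / p x < real i" using reals_Archimedean2 by blast
      then have "\<epsilon> - p x \<le> real (Suc i) * p x" using px by (simp add: divide_less_eq distrib_right)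
      then have "ennreal (p x * (\<epsilon> - p x)) = F i x" by (simp add: F_def min_absorb2)
      also have "\<dots> \<le> (SUP i. F i x)" by (rule SUP_upper) simp
      finally show ?thesis .
    qed simp
  qed
  also have "\<dots> = (SUP i. (NN x. F i x))" by (rule nn_integral_monotone_convergence_SUP[OF inc]) simp
  also have "\<dots> \<le> ennreal (15 * B)" by (intro SUP_least b)
  finally show ?thesis .
qed

lemma sob_sign_change:
  assumes u: "sob u g" and c: "u c = 0"
  shows "sob (\<lambda>x. (if x \<le> c then - 1 else 1) * u x) (\<lambda>x. (if x \<le> c then - 1 else 1) * g x)"
proof -
  have "sob (\<lambda>x. if x \<le> c then - u x else u x) (\<lambda>x. if x \<le> c then - g x else g x)"
    using c by (intro sob_join sob_minus u) simp
  then show ?thesis by (simp add: if_distrib[of "\<lambda>s. s * _"] cong: if_cong)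
qed

section \<open>The part of a minimal profile above h outside its core\<close>

text \<open>The signs \<open>sL\<close> and \<open>sR\<close> turn the unsigned angle \<open>arccos (cos \<phi>)\<close> and its modifications into
  liftings with the same limits as \<open>\<phi>\<close>, to the left of \<open>a'\<close> and to the right of \<open>a\<close>. The core is \<open>{a'..a}\<close>.\<close>

locale far_pattern =
  fixes h \<alpha> \<beta> \<Lambda> a' a \<tau> x0 :: real and \<phi> g sL sR :: "real \<Rightarrow> real"
  assumes min: "minimal h \<beta> (\<Lambda> + \<alpha>) \<phi> g" and h: "3/4 \<le> h" "h < 1" and \<alpha>: "\<alpha> = arccos h" "\<alpha> \<le> 1"
    and \<Lambda>: "\<And>x. cos (\<Lambda> + x) = cos x" "\<And>x. sin (\<Lambda> + x) = sin x"
    and aa: "a' \<le> a" "\<phi> a' = pi" "\<phi> a = \<Lambda> - pi" "a < x0" "\<phi> x0 = \<Lambda>"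
    and \<tau>: "\<tau> > 0" "\<And>x. \<bar>x - a'\<bar> \<le> \<tau> \<Longrightarrow> cos (\<phi> x) - h \<le> - 1/4" "\<And>x. \<bar>x - a\<bar> \<le> \<tau> \<Longrightarrow> cos (\<phi> x) - h \<le> - 1/4"
    and core: "(1 - h) * (a - a') \<le> \<tau> / 64"
    and sL: "\<And>x. \<bar>sL x\<bar> = 1" "sL a' = 1" "eventually (\<lambda>x. sL x * \<alpha> = \<beta>) at_bot"
      "\<And>u k. sob u k \<Longrightarrow> (\<And>x. cos (\<phi> x) = 1 \<Longrightarrow> u x = 0) \<Longrightarrow> sob (\<lambda>x. sL x * u x) (\<lambda>x. sL x * k x)"
    and sR: "\<And>x. \<bar>sR x\<bar> = 1" "sR a = - 1" "eventually (\<lambda>x. sR x = 1) at_top"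
      "\<And>u k. sob u k \<Longrightarrow> (\<And>x. cos (\<phi> x) = 1 \<Longrightarrow> u x = 0) \<Longrightarrow> sob (\<lambda>x. sR x * u x) (\<lambda>x. sR x * k x)"
begin

definition D :: "real \<Rightarrow> real" where "D x = arccos (cos (\<phi> x))"
definition gD :: "real \<Rightarrow> real" where "gD x = sgn (sin (\<phi> x)) * g x"
definition f :: "real \<Rightarrow> real" where "f x = cos (\<phi> x) - h"
definition out :: "real \<Rightarrow> bool" where "out x \<longleftrightarrow> x < a' \<or> a < x"
text \<open>The positive part of \<open>f\<close> outside the core (\<open>pl\<close> left,
  \<open>pr\<close> right of it), \<open>q\<close> the one inside, \<open>n\<close> the negative
  part everywhere. Then f = w + p with disjoint supports; competitors alter \<open>p\<close> or
  pieces of it and leave \<open>w\<close> as it is.\<close>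

definition p :: "real \<Rightarrow> real" where "p x = (if out x then max 0 (f x) else 0)"
definition pl :: "real \<Rightarrow> real" where "pl x = (if x < a' then max 0 (f x) else 0)"
definition pr :: "real \<Rightarrow> real" where "pr x = (if a < x then max 0 (f x) else 0)"
definition q :: "real \<Rightarrow> real" where "q x = (if out x then 0 else max 0 (f x))"
definition n :: "real \<Rightarrow> real" where "n x = max 0 (- f x)"
definition w :: "real \<Rightarrow> real" where "w x = q x - n x"
definition \<epsilon> :: real where "\<epsilon> = 1 - h"
text \<open>Kinetic energy of the region in which competitors change the angle.\<close>

definition K :: ennreal where "K = (\<integral>\<^sup>+x\<in>{x. out x \<and> D x \<le> \<alpha>}. ennreal ((g x)^2) \<partial>lborel)"

lemma prof: "sob \<phi> g" "ee h \<phi> g < \<infinity>" "(\<phi> \<longlongrightarrow> \<beta>) at_bot" "(\<phi> \<longlongrightarrow> \<Lambda> + \<alpha>) at_top"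
  using min by (auto simp: minimal_def profile_def)

lemma alpha: "0 < \<alpha>" "cos \<alpha> = h" "sin \<alpha> \<noteq> 0" "\<alpha> < pi"
proof -
  show 1: "0 < \<alpha>" using h arccos_lt_bounded[of h] by (simp add: \<alpha>(1))
  show "cos \<alpha> = h" unfolding \<alpha>(1) using h by (intro cos_arccos) auto
  show 2: "\<alpha> < pi" using \<alpha>(2) pi_gt3 by simp
  show "sin \<alpha> \<noteq> 0" using sin_gt_zero[OF 1 2] by simp
qed

lemma eps: "0 < \<epsilon>" "\<epsilon> \<le> 1/4" using h by (auto simp: \<epsilon>_def)

lemma sobD: "sob D gD" unfolding D_def[abs_def] gD_def[abs_def] by (rule sob_arccos_cos[OF prof(1)])

lemma D_bounds: "0 \<le> D x" "D x \<le> pi" "cos (D x) = cos (\<phi> x)"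
  unfolding D_def by (auto intro: arccos_lbound arccos_ubound cos_arccos)

lemma gD_le: "\<bar>gD x\<bar> \<le> \<bar>g x\<bar>" by (auto simp: gD_def abs_mult sgn_if)

lemma cosD: "D x \<le> \<alpha> \<Longrightarrow> 0 \<le> f x" "\<alpha> \<le> D x \<Longrightarrow> f x \<le> 0"
proof -
  show "0 \<le> f x" if "D x \<le> \<alpha>" using cos_monotone_0_pi_le[of "D x" \<alpha>] D_bounds[of x] alpha that by (simp add: f_def)
  show "f x \<le> 0" if "\<alpha> \<le> D x" using cos_monotone_0_pi_le[of \<alpha> "D x"] D_bounds[of x] alpha that by (simp add: f_def)
qed

lemma parts_measurable [measurable]: "\<phi> \<in> borel_measurable borel" "g \<in> borel_measurable borel" "D \<in> borel_measurable borel" "gD \<in> borel_measurable borel"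
  "f \<in> borel_measurable borel" "p \<in> borel_measurable borel" "pl \<in> borel_measurable borel" "pr \<in> borel_measurable borel"
  "q \<in> borel_measurable borel" "n \<in> borel_measurable borel" "w \<in> borel_measurable borel" "Measurable.pred borel out"
proof -
  note [measurable] = sob_borel[OF prof(1)] sob_meas[OF prof(1)] sob_borel[OF sobD] sob_meas[OF sobD]
  show "\<phi> \<in> borel_measurable borel" "g \<in> borel_measurable borel" "D \<in> borel_measurable borel" "gD \<in> borel_measurable borel" by measurable
  show [measurable]: "Measurable.pred borel out" unfolding out_def by measurable
  show [measurable]: "f \<in> borel_measurable borel" unfolding f_def by measurable
  show [measurable]: "p \<in> borel_measurable borel" "pl \<in> borel_measurable borel" "pr \<in> borel_measurable borel" "q \<in> borel_measurable borel" "n \<in> borel_measurable borel"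
    unfolding p_def pl_def pr_def q_def n_def by measurable
  show "w \<in> borel_measurable borel" unfolding w_def by measurable
qed

lemma f_le: "f x \<le> \<epsilon>" by (simp add: f_def \<epsilon>_def)
lemma parts_nonneg: "0 \<le> p x" "0 \<le> pl x" "0 \<le> pr x" "0 \<le> q x" "0 \<le> n x" "p x \<le> \<epsilon>"
  using f_le[of x] eps by (auto simp: p_def pl_def pr_def q_def n_def)
lemma p_split: "p x = pl x + pr x" using aa(1) by (auto simp: p_def pl_def pr_def out_def)
lemma f_split: "f x = w x + p x" by (auto simp: w_def p_def q_def n_def)

text \<open>Around the end points of the core \<open>f\<close> is negative on the scale \<tau>. This
  separation makes the interactions with the core finite.\<close>

lemma p_far: "p t \<noteq> 0 \<Longrightarrow> a + \<tau> < t \<or> t < a' - \<tau>"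
proof (rule ccontr)
  assume p: "p t \<noteq> 0" and "\<not> (a + \<tau> < t \<or> t < a' - \<tau>)"
  then have "out t" "f t > 0" "t \<le> a + \<tau>" "a' - \<tau> \<le> t" by (auto simp: p_def split: if_splits)
  then have "\<bar>t - a'\<bar> \<le> \<tau> \<or> \<bar>t - a\<bar> \<le> \<tau>" using \<tau>(1) by (auto simp: out_def)
  then show False using \<tau>(2,3)[of t] \<open>f t > 0\<close> by (auto simp: f_def)
qed

lemma w_disjoint: "p x \<noteq> 0 \<Longrightarrow> w x = 0" by (auto simp: p_def w_def q_def n_def split: if_splits)

lemma energies: "L2 g < \<infinity>" "Hh f < \<infinity>" "L2 f < \<infinity>"
proof -
  have "L2 g \<le> ee h \<phi> g" "Hh f \<le> ee h \<phi> g" "L2 f \<le> ee h \<phi> g"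
    unfolding ee_def f_def[abs_def] by (auto simp: add.assoc intro: add_increasing add_increasing2)
  then show "L2 g < \<infinity>" "Hh f < \<infinity>" "L2 f < \<infinity>" using prof(2) by (auto intro: le_less_trans)
qed

lemma L2_parts: "L2 q < \<infinity>" "L2 p < \<infinity>" "L2 w < \<infinity>"
proof -
  have "L2 q \<le> L2 f" "L2 p \<le> L2 f" "L2 w \<le> L2 f"
    unfolding L2_norm_sq_real by (intro nn_integral_mono ennreal_leI; auto simp: q_def p_def w_def n_def max_def)+
  then show "L2 q < \<infinity>" "L2 p < \<infinity>" "L2 w < \<infinity>" using energies(3) by (auto intro: le_less_trans)
qed

text \<open>Here the bounded length of the core enters: q is at most 1 - h and lives on the
  core.\<close>

lemma q_mass: "(NN x. ennreal (q x)) \<le> ennreal (\<tau> / 64)"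
proof -
  have "(NN x. ennreal (q x)) \<le> (\<integral>\<^sup>+x\<in>{a'..a}. ennreal \<epsilon> \<partial>lborel)"
    using f_le eps by (intro nn_integral_mono) (auto simp: q_def out_def indicator_def intro!: ennreal_leI)
  also have "\<dots> = ennreal (\<epsilon> * (a - a'))" using aa(1) eps by (subst nn_integral_cmult_indicator) (auto simp: emeasure_lborel_Icc_eq ennreal_mult)
  also have "\<dots> \<le> ennreal (\<tau> / 64)" using core by (intro ennreal_leI) (simp add: \<epsilon>_def)
  finally show ?thesis .
qed

text \<open>The chunk is [a - \<tau>, a]. Since t lies beyond a + \<tau>, the length of the chunk at
  most doubles the distance of t from a, and everything else in question lies to the left of
  a.\<close>

lemma chunk_right: "a + \<tau> < t \<Longrightarrow> \<exists>c. \<forall>x\<in>{c..c+\<tau>}. n x \<ge> 1/4 \<and> x \<noteq> t \<and> (\<forall>s. s \<le> a \<longrightarrow> \<bar>t - x\<bar> \<le> 2 * \<bar>t - s\<bar>)"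
proof (intro exI[of _ "a - \<tau>"] ballI conjI allI impI)
  fix x assume t: "a + \<tau> < t" and x: "x \<in> {a - \<tau>..a - \<tau> + \<tau>}"
  show "n x \<ge> 1/4" using \<tau>(3)[of x] x \<tau>(1) by (auto simp: n_def f_def)
  show "x \<noteq> t" using t x \<tau>(1) by auto
  show "\<bar>t - x\<bar> \<le> 2 * \<bar>t - s\<bar>" if "s \<le> a" for s using t x that \<tau>(1) by auto
qed

lemma chunk_left: "t < a' - \<tau> \<Longrightarrow> \<exists>c. \<forall>x\<in>{c..c+\<tau>}. n x \<ge> 1/4 \<and> x \<noteq> t \<and> (\<forall>s. a' \<le> s \<longrightarrow> \<bar>t - x\<bar> \<le> 2 * \<bar>t - s\<bar>)"
proof (intro exI[of _ "a'"] ballI conjI allI impI)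
  fix x assume t: "t < a' - \<tau>" and x: "x \<in> {a'..a' + \<tau>}"
  show "n x \<ge> 1/4" using \<tau>(2)[of x] x \<tau>(1) by (auto simp: n_def f_def)
  show "x \<noteq> t" using t x \<tau>(1) by auto
  show "\<bar>t - x\<bar> \<le> 2 * \<bar>t - s\<bar>" if "a' \<le> s" for s using t x that \<tau>(1) by auto
qed

text \<open>Mass \<tau>/64 in \<open>interaction_dominated\<close> gives the factor 1/4: the
  positive part in the core attracts less than the negative part repels.\<close>

lemma repulsion:
  assumes [measurable]: "r \<in> borel_measurable borel" and r: "\<And>x. 0 \<le> r x" "\<And>x. r x \<noteq> 0 \<Longrightarrow> p x \<noteq> 0"
  shows "Qp q r \<le> Qp n r"
proof -
  have "Qp q r \<le> ennreal (16 * (\<tau> / 64) / \<tau>) * Qp n r"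
  proof (rule interaction_dominated[OF _ _ _ parts_nonneg(4) r(1) parts_nonneg(5) q_mass _ \<tau>(1)])
    fix t assume "r t \<noteq> 0"
    then have "a + \<tau> < t \<or> t < a' - \<tau>" using r(2) p_far by blast
    moreover have qs: "q s \<noteq> 0 \<Longrightarrow> a' \<le> s \<and> s \<le> a" for s by (auto simp: q_def out_def split: if_splits)
    ultimately show "\<exists>c. \<forall>x\<in>{c..c+\<tau>}. n x \<ge> 1/4 \<and> x \<noteq> t \<and> (\<forall>s. q s \<noteq> 0 \<longrightarrow> \<bar>t - x\<bar> \<le> 2 * \<bar>t - s\<bar>)"
      using chunk_right[of t] chunk_left[of t] by (meson qs)
  qed (use \<tau> in auto)
  also have "\<dots> \<le> 1 * Qp n r" using \<tau>(1) by (intro mult_right_mono) (auto simp: ennreal_le_1)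
  finally show ?thesis by simp
qed

lemma Qp_finite:
  assumes v[measurable]: "v \<in> borel_measurable borel" and b: "L2 v < \<infinity>" "\<And>x. a < x \<Longrightarrow> v x = 0"
    and r[measurable]: "r \<in> borel_measurable borel" and r2: "L2 r < \<infinity>" "\<And>x. x \<le> a + \<tau> \<Longrightarrow> r x = 0"
  shows "Qp v r < \<infinity>"
proof -
  have "Qp v r \<le> ennreal (1 / (2 * (a + \<tau> - a))) * (L2 v + L2 r)"
    by (rule Qp_far) (use b r2 \<tau>(1) in auto)
  also have "\<dots> < \<infinity>" using b(1) r2(1) by (simp add: ennreal_mult_less_top)
  finally show ?thesis .
qed

text \<open>Attractive interactions have to be finite before they can be cancelled in the identities
  below. The function is split at the core, and each side is a distance \<tau> away from it.\<close>

lemma Qp_q_finite: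
  assumes r[measurable]: "r \<in> borel_measurable borel" and r2: "\<And>x. 0 \<le> r x" "\<And>x. r x \<le> p x"
  shows "Qp q r < \<infinity>"
proof -
  define r1 where "r1 x = (if a < x then r x else 0)" for x
  define r0 where "r0 x = (if a < x then 0 else r x)" for x
  have [measurable]: "r1 \<in> borel_measurable borel" "r0 \<in> borel_measurable borel" unfolding r1_def r0_def by measurable
  have "L2 r1 \<le> L2 p" "L2 r0 \<le> L2 p"
    unfolding L2_norm_sq_real using r2 parts_nonneg(1) by (intro nn_integral_mono ennreal_leI power_mono; auto simp: r1_def r0_def)+
  then have L: "L2 r1 < \<infinity>" "L2 r0 < \<infinity>" using L2_parts(2) by (auto intro: le_less_trans)
  have rp: "r x = 0" if "\<not> (a + \<tau> < x \<or> x < a' - \<tau>)" for x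
  proof -
    have "p x = 0" using p_far[of x] that by blast
    then show ?thesis using r2(1)[of x] r2(2)[of x] by simp
  qed
  have z: "x \<le> a + \<tau> \<Longrightarrow> r1 x = 0" "a' - \<tau> < x \<Longrightarrow> r0 x = 0" for x
    using rp[of x] \<tau>(1) aa(1) by (auto simp: r1_def r0_def)
  have 1: "Qp q r1 < \<infinity>" by (rule Qp_finite) (use L L2_parts z in \<open>auto simp: q_def out_def\<close>)
  have "Qp q r0 = Qp r0 q" by (rule Qp_commute) auto
  also have "\<dots> \<le> ennreal (1 / (2 * (a' - (a' - \<tau>)))) * (L2 r0 + L2 q)"
    by (rule Qp_far) (use z \<tau>(1) in \<open>auto simp: q_def out_def\<close>)
  also have "\<dots> < \<infinity>" using L L2_parts by (simp add: ennreal_mult_less_top)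
  finally have 2: "Qp q r0 < \<infinity>" .
  have "r = (\<lambda>x. r1 x + r0 x)" by (auto simp: r1_def r0_def)
  then have "Qp q r = Qp q r1 + Qp q r0" using Qp_add_right[of q r1 r0] parts_nonneg(4) r2(1) by (simp add: r1_def r0_def)
  then show ?thesis using 1 2 by simp
qed

text \<open>As r is nonnegative, the signs of the interaction are those of w, whose positive and
  negative parts are \<open>q\<close> and \<open>n\<close>.\<close>

lemma Hh_w_plus:
  assumes r[measurable]: "r \<in> borel_measurable borel" and r2: "\<And>x. 0 \<le> r x" "\<And>x. r x \<noteq> 0 \<Longrightarrow> p x \<noteq> 0"
  shows "Hh (\<lambda>x. w x + r x) + ennreal (2/pi) * Qp q r = Hh w + Hh r + ennreal (2/pi) * Qp n r"
proof -
  have m: "max 0 (x * y) = max 0 (max 0 x * y)" if "0 \<le> y" for x y :: real using that mult_nonpos_nonneg[of x y] by (cases "0 \<le> x") (auto simp: max_absorb1 max_absorb2)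
  have wq: "max 0 (w x) = q x" "max 0 (- w x) = n x" for x by (auto simp: w_def q_def n_def max_def)
  have "Qp w r = Qp q r" "Qp (\<lambda>x. - w x) r = Qp n r"
  proof -
    have "max 0 (w s * r t) = max 0 (q s * r t)" "max 0 (- w s * r t) = max 0 (n s * r t)" for s t
      using m[OF r2(1)[of t], of "w s"] m[OF r2(1)[of t], of "- w s"] unfolding wq by auto
    then show "Qp w r = Qp q r" "Qp (\<lambda>x. - w x) r = Qp n r" unfolding Qp_def by simp_all
  qed
  moreover have "w x = 0 \<or> r x = 0" for x using r2(2)[of x] w_disjoint[of x] by auto
  ultimately show ?thesis using Hh_split[of w r] by simp
qed

lemma D_tendsto: "(D \<longlongrightarrow> \<alpha>) at_bot" "(D \<longlongrightarrow> \<alpha>) at_top"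
proof -
  have c: "isCont arccos h" using h by (intro isCont_arccos) auto
  have b: "cos \<beta> = h"
  proof -
    obtain x where "sL x * \<alpha> = \<beta>" using eventually_happens[OF sL(3)] by auto
    then have "\<beta> = \<alpha> \<or> \<beta> = - \<alpha>" using sL(1)[of x] by (auto simp: abs_if split: if_splits)
    then show ?thesis using alpha by auto
  qed
  have t: "((\<lambda>x. cos (\<phi> x)) \<longlongrightarrow> h) at_bot" "((\<lambda>x. cos (\<phi> x)) \<longlongrightarrow> h) at_top"
    using tendsto_cos[OF prof(3)] tendsto_cos[OF prof(4)] b alpha \<Lambda>(1)[of \<alpha>] by auto
  show "(D \<longlongrightarrow> \<alpha>) at_bot" "(D \<longlongrightarrow> \<alpha>) at_top" unfolding D_def[abs_def] \<alpha>(1)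
    using isCont_tendsto_compose[OF c t(1)] isCont_tendsto_compose[OF c t(2)] by auto
qed

lemma beta: "\<beta> = \<alpha> \<or> \<beta> = - \<alpha>"
proof -
  obtain x where "sL x * \<alpha> = \<beta>" using eventually_happens[OF sL(3)] by auto
  then show ?thesis using sL(1)[of x] by (auto simp: abs_if split: if_splits)
qed

lemma signed_tendsto:
  fixes s u :: "real \<Rightarrow> real"
  assumes s: "\<And>x. \<bar>s x\<bar> = 1" "eventually (\<lambda>x. s x * \<alpha> = \<gamma>) F" and u: "(u \<longlongrightarrow> \<alpha>) F"
  shows "((\<lambda>x. s x * u x) \<longlongrightarrow> \<gamma>) F"
proof -
  have "((\<lambda>x. \<bar>u x - \<alpha>\<bar>) \<longlongrightarrow> 0) F" by (rule tendsto_rabs_zero[OF LIM_zero[OF u]])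
  moreover have "eventually (\<lambda>x. norm (s x * u x - \<gamma>) \<le> \<bar>u x - \<alpha>\<bar>) F"
    using s(2)
  proof eventually_elim
    case (elim x)
    have "\<bar>s x * u x - \<gamma>\<bar> = \<bar>s x\<bar> * \<bar>u x - \<alpha>\<bar>" unfolding elim[symmetric] abs_mult[symmetric] by (simp add: right_diff_distrib)
    then show ?case using s(1) by simp
  qed
  ultimately have "((\<lambda>x. s x * u x - \<gamma>) \<longlongrightarrow> 0) F" using Lim_null_comparison[of "\<lambda>x. s x * u x - \<gamma>" "\<lambda>x. \<bar>u x - \<alpha>\<bar>" F] by blast
  then show ?thesis by (rule LIM_zero_cancel)
qed

text \<open>Construction scheme for competitors: \<phi> is kept on the core, and outside it the
  unsigned angle is replaced by \<open>u\<close> with signs \<open>s1\<close> and \<open>s2\<close>,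
  which determine the limits. The value pi of \<open>u\<close> at both ends fits \<phi> a' = pi and
  \<phi> a = \<Lambda> - pi.\<close>

lemma joined_profile:
  fixes s1 s2 u k :: "real \<Rightarrow> real"
  assumes s1: "\<And>x. \<bar>s1 x\<bar> = 1" "s1 a' = 1" "eventually (\<lambda>x. s1 x * \<alpha> = \<gamma>) at_bot" "sob (\<lambda>x. s1 x * u x) (\<lambda>x. s1 x * k x)"
    and s2: "\<And>x. \<bar>s2 x\<bar> = 1" "s2 a = - 1" "eventually (\<lambda>x. s2 x * \<alpha> = \<delta>) at_top" "sob (\<lambda>x. s2 x * u x) (\<lambda>x. s2 x * k x)"
    and u: "u a' = pi" "u a = pi" "(u \<longlongrightarrow> \<alpha>) at_bot" "(u \<longlongrightarrow> \<alpha>) at_top"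
    and r: "\<And>x. out x \<Longrightarrow> cos (u x) - h = w x + r x" "\<And>x. \<not> out x \<Longrightarrow> r x = 0"
    and fin: "Hh (\<lambda>x. w x + r x) < \<infinity>" "L2 (\<lambda>x. w x + r x) < \<infinity>"
  defines "G \<equiv> \<lambda>x. if x \<le> a' then s1 x * k x else if x \<le> a then g x else s2 x * k x"
  shows "\<exists>\<Phi>. profile h \<gamma> (\<Lambda> + \<delta>) \<Phi> G \<and> ee h \<Phi> G = L2 G + Hh (\<lambda>x. w x + r x) + L2 (\<lambda>x. w x + r x)"
proof -
  define \<Phi> where "\<Phi> x = (if x \<le> a' then s1 x * u x else if x \<le> a then \<phi> x else \<Lambda> + s2 x * u x)" for x
  have s: "sob \<Phi> G" unfolding \<Phi>_def[abs_def] G_def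
    using aa s1(2) s2(2) u(1,2) by (intro sob_join s1(4) prof(1) sob_shift_const s2(4)) auto
  have cs: "cos (s * x) = cos x" if "\<bar>s\<bar> = 1" for s x :: real using that by (auto simp: abs_if split: if_splits)
  have fid: "cos (\<Phi> x) - h = w x + r x" for x
  proof (cases "out x")
    case True
    then have "cos (\<Phi> x) = cos (u x)" using aa(1) cs[OF s1(1)] cs[OF s2(1)] by (auto simp: \<Phi>_def out_def \<Lambda>)
    then show ?thesis using r(1)[OF True] by simp
  next
    case False
    then have "x = a' \<or> \<Phi> x = \<phi> x" by (auto simp: \<Phi>_def out_def)
    then have "cos (\<Phi> x) = cos (\<phi> x)" using s1(2) u(1) aa(2) by (auto simp: \<Phi>_def)
    then show ?thesis using r(2)[OF False] f_split[of x] False by (simp add: f_def p_def)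
  qed
  have e: "ee h \<Phi> G = L2 G + Hh (\<lambda>x. w x + r x) + L2 (\<lambda>x. w x + r x)"
    unfolding ee_def fid ..
  have "eventually (\<lambda>x. s1 x * u x = \<Phi> x) at_bot" using eventually_le_at_bot[of a'] by eventually_elim (simp add: \<Phi>_def)
  then have l: "(\<Phi> \<longlongrightarrow> \<gamma>) at_bot" using signed_tendsto[OF s1(1,3) u(3)] by (rule Lim_transform_eventually[rotated])
  have "eventually (\<lambda>x. \<Lambda> + s2 x * u x = \<Phi> x) at_top" using eventually_gt_at_top[of a] by eventually_elim (use aa(1) in \<open>simp add: \<Phi>_def\<close>)
  then have "(\<Phi> \<longlongrightarrow> \<Lambda> + \<delta>) at_top"
    using tendsto_add[OF tendsto_const signed_tendsto[OF s2(1,3) u(4)]] by (rule Lim_transform_eventually[rotated])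
  then have "profile h \<gamma> (\<Lambda> + \<delta>) \<Phi> G" using s l fin sob_L2[OF s] by (simp add: profile_def e)
  with e show ?thesis by blast
qed

text \<open>Raising the unsigned angle to at least \<alpha> erases the positive part of
  \<open>f\<close> and keeps the negative one.\<close>

definition hi :: "real \<Rightarrow> real" where "hi x = max \<alpha> (D x)"
definition ghi :: "real \<Rightarrow> real" where "ghi x = (0 + gD x + sgn (\<alpha> - D x) * (0 - gD x)) / 2"

lemma hi_facts: "sob hi ghi" "(hi \<longlongrightarrow> \<alpha>) at_bot" "(hi \<longlongrightarrow> \<alpha>) at_top" "hi a' = pi" "hi a = pi"
  "D x < \<alpha> \<Longrightarrow> ghi x = 0" "D x = \<alpha> \<Longrightarrow> (ghi x)^2 \<le> (g x)^2 / 4" "(ghi x)^2 \<le> (g x)^2" "cos (hi x) - h = - n x"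
proof -
  show "sob hi ghi" unfolding hi_def[abs_def] ghi_def[abs_def] by (rule sob_max[OF sob_const sobD])
  show "(hi \<longlongrightarrow> \<alpha>) at_bot" "(hi \<longlongrightarrow> \<alpha>) at_top"
    using tendsto_max[OF tendsto_const D_tendsto(1), of \<alpha>] tendsto_max[OF tendsto_const D_tendsto(2), of \<alpha>] by (auto simp: hi_def[abs_def])
  have "cos (\<Lambda> - pi) = - 1" using \<Lambda>(1)[of "- pi"] by simp
  then show "hi a' = pi" "hi a = pi" using aa(2,3) alpha(4) by (auto simp: hi_def D_def)
  have g2: "(gD x)^2 \<le> (g x)^2" using gD_le[of x] by (simp add: abs_le_square_iff)
  show "D x < \<alpha> \<Longrightarrow> ghi x = 0" by (simp add: ghi_def)
  show "D x = \<alpha> \<Longrightarrow> (ghi x)^2 \<le> (g x)^2 / 4" using g2 by (simp add: ghi_def power_divide)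
  show "(ghi x)^2 \<le> (g x)^2" 
  proof -
    have "(gD x)^2 \<le> (g x)^2 * 4" using g2 zero_le_power2[of "g x"] by linarith
    then show ?thesis using g2 by (auto simp: ghi_def sgn_if power_divide)
  qed
  show "cos (hi x) - h = - n x"
  proof (cases "D x \<le> \<alpha>")
    case True then show ?thesis using cosD(1)[of x] alpha by (simp add: hi_def n_def max_def)
  next
    case False then show ?thesis using cosD(2)[of x] D_bounds(3)[of x] by (simp add: hi_def n_def f_def max_def)
  qed
qed

lemma w_finite: "Hh w < \<infinity>" "Hh p < \<infinity>" "Qp n p < \<infinity>" "Qp q p < \<infinity>"
proof -
  show q: "Qp q p < \<infinity>" by (rule Qp_q_finite) (auto simp: parts_nonneg)
  have "Hh (\<lambda>x. w x + p x) + ennreal (2/pi) * Qp q p = Hh w + Hh p + ennreal (2/pi) * Qp n p"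
    by (rule Hh_w_plus) (auto simp: parts_nonneg)
  then have e: "Hh w + Hh p + ennreal (2/pi) * Qp n p = Hh f + ennreal (2/pi) * Qp q p" unfolding f_split[symmetric] by simp
  have "Hh f + ennreal (2/pi) * Qp q p < \<infinity>" using energies q by (simp add: ennreal_mult_less_top)
  then show "Hh w < \<infinity>" "Hh p < \<infinity>" "Qp n p < \<infinity>"
    unfolding e[symmetric] by (auto simp: ennreal_mult_less_top)
qed

text \<open>An angle from \<alpha> to \<Lambda> - \<alpha> lacks the crossing of \<Lambda> on the
  right and, if \<beta> = -\<alpha>, also the crossing of 0 on the left. Each is supplied by a
  transition layer infinitely far away, so at most two layers are paid for.\<close>

lemma energy_le_walls:
  assumes wall: "profile h (- \<alpha>) \<alpha> \<phi>0 g0" "ee h \<phi>0 g0 \<le> ennreal e0" "e0 \<ge> 0" and \<Phi>: "profile h \<alpha> (\<Lambda> + - \<alpha>) \<Phi> G"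
  shows "ee h \<phi> g \<le> ee h \<Phi> G + ennreal (2 * e0)"
proof -
  have es: "ee h (\<lambda>x. \<Lambda> + \<phi>0 x) g0 = ee h \<phi>0 g0" by (simp add: ee_def \<Lambda>)
  have s: "profile h (\<Lambda> + - \<alpha>) (\<Lambda> + \<alpha>) (\<lambda>x. \<Lambda> + \<phi>0 x) g0" unfolding profile_def es
    by (intro conjI sob_shift_const tendsto_add tendsto_const) (use wall(1) in \<open>auto simp: profile_def\<close>)
  have \<mu>: "cos (\<Lambda> + - \<alpha>) = h" "sin (\<Lambda> + - \<alpha>) \<noteq> 0" unfolding \<Lambda> using alpha by auto
  have 2: "ennreal (2 * e0) = ennreal e0 + ennreal e0" using wall(3) by (simp add: ennreal_plus[symmetric] del: ennreal_plus)
  from beta show ?thesis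
  proof
    assume b: "\<beta> = \<alpha>"
    have "ee h \<phi> g \<le> ee h \<Phi> G + ee h \<phi>0 g0" unfolding es[symmetric] by (rule minimal_concat[OF min _ s \<mu>]) (use \<Phi> b in simp)
    also have "\<dots> \<le> ee h \<Phi> G + (ennreal e0 + ennreal e0)" using wall(2) by (intro add_left_mono) (simp add: add_increasing2)
    finally show ?thesis unfolding 2 .
  next
    assume b: "\<beta> = - \<alpha>"
    have "ee h \<phi> g \<le> ee h \<phi>0 g0 + ee h \<Phi> G + ee h (\<lambda>x. \<Lambda> + \<phi>0 x) g0"
      by (rule minimal_concat3[OF min _ \<Phi> s alpha(2,3) \<mu>]) (use wall(1) b in simp)
    also have "\<dots> \<le> ennreal e0 + ee h \<Phi> G + ennreal e0" unfolding es using wall(2) by (intro add_mono) auto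
    finally show ?thesis unfolding 2 by (simp add: ac_simps)
  qed
qed

text \<open>Where D < \<alpha> the derivative of \<open>hi\<close> vanishes. On the level set D =
  \<alpha> the chosen representative is half the derivative of D, so that three quarters of the
  kinetic energy are saved there; one half is a safe common value.\<close>

lemma half_K: "L2 (\<lambda>x. if x \<le> a' then 1 * ghi x else if x \<le> a then g x else - 1 * ghi x) + ennreal (1/2) * K \<le> L2 g"
proof -
  let ?G = "\<lambda>x. if x \<le> a' then 1 * ghi x else if x \<le> a then g x else - 1 * ghi x"
  note [measurable] = sob_meas[OF hi_facts(1)]
  have "L2 ?G + ennreal (1/2) * K = (NN x. ennreal ((?G x)^2) + ennreal (1/2) * (ennreal ((g x)^2) * indicator {x. out x \<and> D x \<le> \<alpha>} x))"
    unfolding L2_norm_sq_real K_def by (subst nn_integral_add, simp, simp, subst nn_integral_cmult) auto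
  also have "\<dots> \<le> L2 g" unfolding L2_norm_sq_real
  proof (rule nn_integral_mono)
    fix x
    have le: "(?G x)^2 \<le> (g x)^2" using hi_facts(8)[of x] by auto
    show "ennreal ((?G x)^2) + ennreal (1/2) * (ennreal ((g x)^2) * indicator {x. out x \<and> D x \<le> \<alpha>} x) \<le> ennreal ((g x)^2)"
    proof (cases "out x \<and> D x \<le> \<alpha>")
      case True
      have "(?G x)^2 \<le> (g x)^2 / 4"
        using True hi_facts(6)[of x] hi_facts(7)[of x] aa(1) by (cases "D x = \<alpha>") (auto simp: out_def)
      moreover have "X + 1/2 * Y \<le> Y" if "X \<le> Y / 4" "0 \<le> Y" for X Y :: real using that by simp
      ultimately have "(?G x)^2 + 1/2 * (g x)^2 \<le> (g x)^2" using zero_le_power2 by blast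
      then have "ennreal ((?G x)^2 + 1/2 * (g x)^2) \<le> ennreal ((g x)^2)" by (rule ennreal_leI)
      then show ?thesis using True by (subst (asm) ennreal_plus, simp, simp, subst (asm) ennreal_mult) auto
    next
      case False
      then show ?thesis using ennreal_leI[OF le] by simp
    qed
  qed
  finally show ?thesis .
qed

text \<open>Competitor: \<open>p\<close> is removed, and the lost angle is restored by transition layers at infinity.\<close>

lemma wall_bound:
  assumes wall: "profile h (- \<alpha>) \<alpha> \<phi>0 g0" "ee h \<phi>0 g0 \<le> ennreal e0" "e0 \<ge> 0"
  shows "ennreal (1/2) * K + Hh p + L2 p \<le> ennreal (2 * e0)"
proof -
  let ?G = "\<lambda>x. if x \<le> a' then 1 * ghi x else if x \<le> a then g x else - 1 * ghi x"
  have r0: "(\<lambda>x. w x + 0) = w" by simp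
  have "\<exists>\<Phi>. profile h \<alpha> (\<Lambda> + - \<alpha>) \<Phi> ?G \<and> ee h \<Phi> ?G = L2 ?G + Hh (\<lambda>x. w x + 0) + L2 (\<lambda>x. w x + 0)"
  proof (rule joined_profile)
    show "sob (\<lambda>x. 1 * hi x) (\<lambda>x. 1 * ghi x)" "sob (\<lambda>x. - 1 * hi x) (\<lambda>x. - 1 * ghi x)" by (rule sob_cmult[OF hi_facts(1)])+
    show "cos (hi x) - h = w x + 0" if "out x" for x using hi_facts(9)[of x] that by (simp add: w_def q_def)
  qed (use hi_facts w_finite L2_parts in auto)
  then obtain \<Phi> where \<Phi>: "profile h \<alpha> (\<Lambda> + - \<alpha>) \<Phi> ?G" "ee h \<Phi> ?G = L2 ?G + Hh w + L2 w" unfolding r0 by blast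
  have "ee h \<phi> g \<le> L2 ?G + Hh w + L2 w + ennreal (2 * e0)" using energy_le_walls[OF wall \<Phi>(1)] unfolding \<Phi>(2) .
  then have m: "L2 g + Hh f + L2 f \<le> L2 ?G + Hh w + L2 w + ennreal (2 * e0)"
    unfolding ee_def f_def[abs_def] .
  have L: "L2 f = L2 w + L2 p"
    using L2_disjoint[of w p] w_disjoint unfolding f_split[symmetric] by auto
  have id: "Hh f + ennreal (2/pi) * Qp q p = Hh w + Hh p + ennreal (2/pi) * Qp n p"
    using Hh_w_plus[of p] parts_nonneg(1) unfolding f_split[symmetric] by simp
  have rep: "Qp q p \<le> Qp n p" by (rule repulsion) (auto simp: parts_nonneg)
  have Kf: "K < \<infinity>" "L2 ?G < \<infinity>"
    using ennreal_add_leD[OF half_K] energies(1) by (auto intro: le_less_trans simp: ennreal_mult_less_top dest!: le_less_trans)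
  obtain rg where rg: "L2 g = ennreal rg" "rg \<ge> 0" using energies(1) by (rule finite_ennrealE)
  obtain rG where rG: "L2 ?G = ennreal rG" "rG \<ge> 0" using Kf(2) by (rule finite_ennrealE)
  obtain rK where rK: "K = ennreal rK" "rK \<ge> 0" using Kf(1) by (rule finite_ennrealE)
  obtain Hf where Hf: "Hh f = ennreal Hf" "Hf \<ge> 0" using energies(2) by (rule finite_ennrealE)
  obtain Hw where Hw: "Hh w = ennreal Hw" "Hw \<ge> 0" using w_finite(1) by (rule finite_ennrealE)
  obtain Hp where Hp: "Hh p = ennreal Hp" "Hp \<ge> 0" using w_finite(2) by (rule finite_ennrealE)
  obtain Lw where Lw: "L2 w = ennreal Lw" "Lw \<ge> 0" using L2_parts(3) by (rule finite_ennrealE)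
  obtain Lp where Lp: "L2 p = ennreal Lp" "Lp \<ge> 0" using L2_parts(2) by (rule finite_ennrealE)
  obtain Qn where Qn: "Qp n p = ennreal Qn" "Qn \<ge> 0" using w_finite(3) by (rule finite_ennrealE)
  obtain Qq where Qq: "Qp q p = ennreal Qq" "Qq \<ge> 0" using w_finite(4) by (rule finite_ennrealE)
  define c where "c = 2 / pi"
  have c: "c \<ge> 0" by (simp add: c_def)
  have QQ: "Qq \<le> Qn" using rep Qn unfolding Qn Qq by simp
  have "ennreal (Hf + c * Qq) = ennreal (Hw + Hp + c * Qn)"
    using id unfolding Hf Hw Hp Qn Qq c_def[symmetric] using Hf Hw Hp Qn Qq c by (simp add: ennreal_real del: ennreal_plus)
  then have "Hf + c * Qq = Hw + Hp + c * Qn" using Hf Hw Hp Qn Qq c by (subst (asm) ennreal_inj) auto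
  then have 1: "Hw + Hp \<le> Hf" using mult_left_mono[OF QQ c] by linarith
  have "ennreal (rG + 1/2 * rK) \<le> ennreal rg"
    using half_K unfolding rg rG rK using rg rG rK by (simp only: ennreal_plus ennreal_mult mult_nonneg_nonneg zero_le_divide_1_iff zero_le_numeral)
  then have 2: "rG + 1/2 * rK \<le> rg" unfolding ennreal_le_iff[OF rg(2)] .
  have "ennreal (rg + Hf + (Lw + Lp)) \<le> ennreal (rG + Hw + Lw + 2 * e0)"
    using m unfolding L rg rG Hf Hw Lw Lp using rg rG Hf Hw Lw Lp wall(3) by (simp only: ennreal_plus add_nonneg_nonneg mult_nonneg_nonneg zero_le_numeral)
  then have 3: "rg + Hf + (Lw + Lp) \<le> rG + Hw + Lw + 2 * e0" using rG Hw Lw wall(3) by (subst (asm) ennreal_le_iff) auto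
  have "1/2 * rK + Hp + Lp \<le> 2 * e0" using 1 2 3 by linarith
  then have "ennreal (1/2 * rK + Hp + Lp) \<le> ennreal (2 * e0)" by (rule ennreal_leI)
  then show ?thesis unfolding rK Hp Lp using rK Hp Lp by (simp only: ennreal_plus ennreal_mult add_nonneg_nonneg mult_nonneg_nonneg zero_le_divide_1_iff zero_le_numeral)
qed

end

text \<open>Derivatives of maxima and minima have this form, with s a sign: convex combinations with
  weights (1 + s)/2 and (1 - s)/2.\<close>

lemma convex_abs_le:
  fixes x y s B :: real
  assumes "\<bar>s\<bar> \<le> 1" "\<bar>x\<bar> \<le> B" "\<bar>y\<bar> \<le> B"
  shows "\<bar>(x + y + s * (x - y)) / 2\<bar> \<le> B"
proof -
  have "\<bar>(1 + s) * x + (1 - s) * y\<bar> \<le> (1 + s) * \<bar>x\<bar> + (1 - s) * \<bar>y\<bar>"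
    using assms(1) abs_triangle_ineq[of "(1 + s) * x" "(1 - s) * y"] by (simp add: abs_mult)
  also have "\<dots> \<le> (1 + s) * B + (1 - s) * B" using assms by (intro add_mono mult_left_mono) auto
  also have "\<dots> = 2 * B" by (simp add: algebra_simps)
  finally show ?thesis by (simp add: algebra_simps)
qed

context far_pattern
begin

text \<open>For k \<ge> 1 this is min(k D, \<alpha>) where D \<le> \<alpha>, and D elsewhere. Zeros
  of D remain zeros, so a lifting may still change sign there.\<close>

definition lo :: "real \<Rightarrow> real \<Rightarrow> real" where "lo k x = max (D x) (min (k * D x) \<alpha>)"
definition gmi :: "real \<Rightarrow> real \<Rightarrow> real" where "gmi k x = (k * gD x + 0 - sgn (k * D x - \<alpha>) * (k * gD x - 0)) / 2"
definition glo :: "real \<Rightarrow> real \<Rightarrow> real" where "glo k x = (gD x + gmi k x + sgn (D x - min (k * D x) \<alpha>) * (gD x - gmi k x)) / 2"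
definition pk :: "real \<Rightarrow> real \<Rightarrow> real" where "pk k x = (if out x then cos (min (k * D x) \<alpha>) - h else 0)"

lemma sob_gmi: "sob (\<lambda>x. min (k * D x) \<alpha>) (gmi k)"
  unfolding gmi_def[abs_def] by (rule sob_min[OF sob_cmult[OF sobD] sob_const])

lemma D_cos_1: "cos (\<phi> x) = 1 \<Longrightarrow> D x = 0" by (simp add: D_def)

lemma D_a: "D a' = pi" "D a = pi"
proof -
  have "cos (\<Lambda> - pi) = - 1" using \<Lambda>(1)[of "- pi"] by simp
  then show "D a' = pi" "D a = pi" using aa(2,3) by (auto simp: D_def)
qed

lemma p_alt: "p x = (if out x then cos (min (D x) \<alpha>) - h else 0)"
proof (cases "D x \<le> \<alpha>")
  case True then show ?thesis using cosD(1)[of x] D_bounds(3)[of x] by (simp add: p_def f_def)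
next
  case False then show ?thesis using cosD(2)[of x] alpha by (simp add: p_def)
qed

lemma lo_facts:
  assumes k: "1 \<le> k"
  shows "sob (lo k) (glo k)" "(lo k \<longlongrightarrow> \<alpha>) at_bot" "(lo k \<longlongrightarrow> \<alpha>) at_top" "lo k a' = pi" "lo k a = pi"
    "\<bar>glo k x\<bar> \<le> k * \<bar>g x\<bar>" "\<alpha> < D x \<Longrightarrow> glo k x = gD x" "D x = 0 \<Longrightarrow> lo k x = 0"
    "out x \<Longrightarrow> cos (lo k x) - h = w x + pk k x" "0 \<le> pk k x" "pk k x \<le> p x"
proof -
  show "sob (lo k) (glo k)" unfolding lo_def[abs_def] glo_def[abs_def] by (rule sob_max[OF sobD sob_gmi])
  have "max \<alpha> (min (k * \<alpha>) \<alpha>) = \<alpha>" by simp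
  then show "(lo k \<longlongrightarrow> \<alpha>) at_bot" "(lo k \<longlongrightarrow> \<alpha>) at_top"
    using tendsto_max[OF D_tendsto(1) tendsto_min[OF tendsto_mult_left[OF D_tendsto(1)] tendsto_const], of k \<alpha>]
      tendsto_max[OF D_tendsto(2) tendsto_min[OF tendsto_mult_left[OF D_tendsto(2)] tendsto_const], of k \<alpha>]
    by (auto simp: lo_def[abs_def])
  have "min y \<alpha> \<le> pi" for y by (rule order_trans[OF min.cobounded2]) (use alpha(4) in simp)
  then show "lo k a' = pi" "lo k a = pi" by (simp_all only: lo_def D_a max_absorb1)
  have g1: "\<bar>gD x\<bar> \<le> k * \<bar>g x\<bar>" using gD_le[of x] k mult_right_mono[of 1 k "\<bar>g x\<bar>"] by simp
  have "\<bar>k * gD x\<bar> \<le> k * \<bar>g x\<bar>" using gD_le[of x] k by (simp add: abs_mult mult_left_mono)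
  then have "\<bar>gmi k x\<bar> \<le> k * \<bar>g x\<bar>"
    using convex_abs_le[of "- sgn (k * D x - \<alpha>)" "k * gD x" "k * \<bar>g x\<bar>" 0] k by (simp add: gmi_def abs_sgn_eq)
  then show "\<bar>glo k x\<bar> \<le> k * \<bar>g x\<bar>" unfolding glo_def using g1 by (intro convex_abs_le) (auto simp: abs_sgn_eq)
  have kD: "D x \<le> k * D x" using mult_right_mono[OF k D_bounds(1)[of x]] by simp
  show "glo k x = gD x" if "\<alpha> < D x"
  proof -
    have "\<alpha> < k * D x" using that kD by linarith
    then show ?thesis using that by (simp add: glo_def gmi_def)
  qed
  show "D x = 0 \<Longrightarrow> lo k x = 0" using alpha by (simp add: lo_def)
  have 1: "pk k x = 0" if "\<alpha> \<le> D x" 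
  proof -
    have "min (k * D x) \<alpha> = \<alpha>" using that kD by (intro min_absorb2) linarith
    then show ?thesis using alpha(2) by (simp add: pk_def)
  qed
  have 2: "lo k x = min (k * D x) \<alpha>" if "D x \<le> \<alpha>" using that kD by (simp add: lo_def)
  have c: "h \<le> cos (min (k * D x) \<alpha>)" "cos (min (k * D x) \<alpha>) \<le> cos (D x)" if "D x \<le> \<alpha>"
  proof -
    have m: "D x \<le> min (k * D x) \<alpha>" "0 \<le> min (k * D x) \<alpha>" "min (k * D x) \<alpha> \<le> \<alpha>" "min (k * D x) \<alpha> \<le> pi"
      using that kD D_bounds(1)[of x] alpha(1,4) by (auto simp: min_def)
    have "cos \<alpha> \<le> cos (min (k * D x) \<alpha>)" by (rule cos_monotone_0_pi_le[OF m(2,3)]) (use alpha(4) in simp)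
    then show "h \<le> cos (min (k * D x) \<alpha>)" unfolding alpha(2) .
    show "cos (min (k * D x) \<alpha>) \<le> cos (D x)" by (rule cos_monotone_0_pi_le[OF D_bounds(1) m(1,4)])
  qed
  show "out x \<Longrightarrow> cos (lo k x) - h = w x + pk k x"
  proof (cases "D x \<le> \<alpha>")
    case True
    assume "out x"
    then show ?thesis using 2[OF True] cosD(1)[OF True] by (simp add: pk_def w_def q_def n_def)
  next
    case False
    assume "out x"
    moreover have "lo k x = D x" using False kD by (simp add: lo_def)
    ultimately show ?thesis using 1 False cosD(2)[of x] D_bounds(3)[of x] by (simp add: w_def q_def n_def f_def)
  qed
  show "0 \<le> pk k x" using 1 c(1) by (cases "D x \<le> \<alpha>") (auto simp: pk_def)
  show "pk k x \<le> p x"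
  proof (cases "D x \<le> \<alpha>")
    case True then show ?thesis using c(2) by (simp add: pk_def p_alt min_absorb1)
  next
    case False then show ?thesis using 1 parts_nonneg(1)[of x] by simp
  qed
qed

lemma pk_measurable [measurable]: "pk k \<in> borel_measurable borel" unfolding pk_def[abs_def] by measurable

text \<open>Competitor: outside the core the angles below \<open>\<alpha>\<close> are multiplied by \<open>k\<close> (and cut off at \<open>\<alpha>\<close>). For
  \<open>k \<rightarrow> 1\<close> this controls the integral of \<open>p\<close>, which is not a priori finite.\<close>

lemma stretch:
  assumes wall: "profile h (- \<alpha>) \<alpha> \<phi>0 g0" "ee h \<phi>0 g0 \<le> ennreal e0" "e0 \<ge> 0" and k: "1 < k" "k \<le> 2"
  shows "(NN x. ennreal (p x * min (p x) ((k - 1) * (\<epsilon> - p x)))) \<le> ennreal ((k ^ 4 - 1) * (4 * e0))"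
proof -
  have k1: "1 \<le> k" using k by simp
  note l = lo_facts[OF k1]
  define d where "d x = p x - pk k x" for x
  have [measurable]: "d \<in> borel_measurable borel" unfolding d_def by measurable
  have d: "0 \<le> d x" "d x \<noteq> 0 \<Longrightarrow> p x \<noteq> 0" "pk k x \<noteq> 0 \<Longrightarrow> p x \<noteq> 0" for x
    using l(10)[of x] l(11)[of x] by (auto simp: d_def)
  have pd: "p = (\<lambda>x. pk k x + d x)" by (simp add: d_def)
  have Nadd: "Qp n p = Qp n (pk k) + Qp n d" "Qp q p = Qp q (pk k) + Qp q d"
    using Qp_add_right[of n "pk k" d] Qp_add_right[of q "pk k" d] parts_nonneg l(10) d(1) unfolding pd[symmetric] by auto
  have Hk: "Hh (pk k) \<le> ennreal ((k^2)^2) * Hh p"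
  proof (rule Hh_lipschitz)
    fix s t
    have c: "\<bar>cos (min (k * x) \<alpha>) - cos (min (k * y) \<alpha>)\<bar> \<le> k^2 * \<bar>cos (min x \<alpha>) - cos (min y \<alpha>)\<bar>" if "0 \<le> x" "0 \<le> y" for x y
      using that k1 alpha(1) \<alpha>(2) by (intro cos_clamp_lipschitz) auto
    have ka: "min (k * \<alpha>) \<alpha> = \<alpha>" using mult_right_mono[OF k1, of \<alpha>] alpha(1) by simp
    \<comment> \<open>Inside the core the angle is replaced by \<alpha>, where both p and
      \<open>pk k\<close> vanish, so that one formula covers the whole line.\<close>
    define e where "e x = (if out x then D x else \<alpha>)" for x
    have e: "0 \<le> e x" for x using D_bounds(1) alpha(1) by (simp add: e_def)
    have "pk k x = cos (min (k * e x) \<alpha>) - h" "p x = cos (min (e x) \<alpha>) - h" for x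
      using ka alpha(2) by (simp_all add: pk_def p_alt e_def)
    then show "\<bar>pk k s - pk k t\<bar> \<le> k^2 * \<bar>p s - p t\<bar>" using c[OF e[of s] e[of t]] by simp
  qed auto
  have Kfin: "K < \<infinity>"
  proof -
    have "K \<le> L2 g" unfolding K_def L2_norm_sq_real by (intro nn_integral_mono) (auto simp: indicator_def)
    then show ?thesis using energies(1) by (rule le_less_trans)
  qed
  have idk: "Hh (\<lambda>x. w x + pk k x) + ennreal (2/pi) * Qp q (pk k) = Hh w + Hh (pk k) + ennreal (2/pi) * Qp n (pk k)"
    by (rule Hh_w_plus) (auto simp: l d)
  have id: "Hh f + ennreal (2/pi) * Qp q p = Hh w + Hh p + ennreal (2/pi) * Qp n p"
    using Hh_w_plus[of p] parts_nonneg(1) unfolding f_split[symmetric] by simp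
  \<comment> \<open>The removed part \<open>d\<close> is repelled by \<open>n\<close> at least as
    strongly as it is attracted by \<open>q\<close>, so its removal does not raise the interaction
    energy.\<close>
  have rep: "Qp q d \<le> Qp n d" by (rule repulsion) (auto simp: d)
  have fin: "Qp n (pk k) < \<infinity>" "Qp n d < \<infinity>" "Qp q (pk k) < \<infinity>" "Qp q d < \<infinity>"
    using w_finite(3,4) unfolding Nadd by auto
  have Hpk: "Hh (pk k) < \<infinity>" using w_finite(2) by (intro le_less_trans[OF Hk]) (simp add: ennreal_mult_less_top)
  have "Hh w + Hh (pk k) + ennreal (2/pi) * Qp n (pk k) < \<infinity>"
    using w_finite(1) Hpk fin by (simp add: ennreal_mult_less_top)
  then have Hwk: "Hh (\<lambda>x. w x + pk k x) < \<infinity>" unfolding idk[symmetric] by simp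
  have Lk: "L2 (\<lambda>x. w x + pk k x) = L2 w + L2 (pk k)"
    by (rule L2_disjoint) (use w_disjoint d(3) in auto)
  have Lf: "L2 f = L2 w + L2 p"
    using L2_disjoint[of w p] w_disjoint unfolding f_split[symmetric] by auto
  have Lpk: "L2 (pk k) < \<infinity>"
  proof -
    have "L2 (pk k) \<le> L2 p" unfolding L2_norm_sq_real using l(10,11) by (intro nn_integral_mono ennreal_leI power_mono) auto
    then show ?thesis using L2_parts(2) by (rule le_less_trans)
  qed
  let ?G = "\<lambda>x. if x \<le> a' then sL x * glo k x else if x \<le> a then g x else sR x * glo k x"
  have sLs: "sob (\<lambda>x. sL x * lo k x) (\<lambda>x. sL x * glo k x)" and sRs: "sob (\<lambda>x. sR x * lo k x) (\<lambda>x. sR x * glo k x)"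
    using l(1,8) D_cos_1 by (auto intro!: sL(4) sR(4))
  have "\<exists>\<Phi>. profile h \<beta> (\<Lambda> + \<alpha>) \<Phi> ?G \<and> ee h \<Phi> ?G = L2 ?G + Hh (\<lambda>x. w x + pk k x) + L2 (\<lambda>x. w x + pk k x)"
  proof (rule joined_profile[OF sL(1-3) sLs sR(1,2) _ sRs l(4,5,2,3) l(9)])
    show "eventually (\<lambda>x. sR x * \<alpha> = \<alpha>) at_top" using sR(3) by eventually_elim simp
    show "L2 (\<lambda>x. w x + pk k x) < \<infinity>" unfolding Lk using L2_parts(3) Lpk by simp
    show "Hh (\<lambda>x. w x + pk k x) < \<infinity>" by (rule Hwk)
    show "pk k x = 0" if "\<not> out x" for x using that by (simp add: pk_def)
  qed
  then obtain \<Phi> where \<Phi>: "profile h \<beta> (\<Lambda> + \<alpha>) \<Phi> ?G" "ee h \<Phi> ?G = L2 ?G + Hh (\<lambda>x. w x + pk k x) + (L2 w + L2 (pk k))"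
    unfolding Lk by blast
  have "ee h \<phi> g \<le> ee h \<Phi> ?G" using min \<Phi>(1) by (auto simp: minimal_def)
  then have m: "L2 g + Hh f + (L2 w + L2 p) \<le> L2 ?G + Hh (\<lambda>x. w x + pk k x) + (L2 w + L2 (pk k))"
    unfolding \<Phi>(2) Lf[symmetric] unfolding ee_def f_def[abs_def] .
  have GK: "L2 ?G \<le> L2 g + ennreal (k^2 - 1) * K"
  proof -
    have "L2 ?G \<le> (NN x. ennreal ((g x)^2) + ennreal (k^2 - 1) * (ennreal ((g x)^2) * indicator {x. out x \<and> D x \<le> \<alpha>} x))"
      unfolding L2_norm_sq_real
    proof (rule nn_integral_mono)
      fix x
      have sg: "(sL x * y)^2 = y^2" "(sR x * y)^2 = y^2" for y using sL(1)[of x] sR(1)[of x] by (auto simp: power_mult_distrib abs_if split: if_splits)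
      have k21: "1 \<le> k^2" using k by simp
      show "ennreal ((?G x)^2) \<le> ennreal ((g x)^2) + ennreal (k^2 - 1) * (ennreal ((g x)^2) * indicator {x. out x \<and> D x \<le> \<alpha>} x)"
      proof (cases "out x \<and> D x \<le> \<alpha>")
        case True
        have "(glo k x)^2 \<le> (k * \<bar>g x\<bar>)^2" using l(6)[of x] by (metis abs_ge_zero power2_abs power_mono)
        then have "(glo k x)^2 \<le> k^2 * (g x)^2" by (simp add: power_mult_distrib)
        moreover have "(?G x)^2 = (glo k x)^2" using True aa(1) by (auto simp: out_def sg)
        ultimately have "(?G x)^2 \<le> (g x)^2 + (k^2 - 1) * (g x)^2" by (simp add: left_diff_distrib)
        then have "ennreal ((?G x)^2) \<le> ennreal ((g x)^2 + (k^2 - 1) * (g x)^2)" by (rule ennreal_leI)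
        also have "\<dots> = ennreal ((g x)^2) + ennreal (k^2 - 1) * ennreal ((g x)^2)" using k21 by (simp add: ennreal_mult)
        finally show ?thesis using True by simp
      next
        case False
        have "(?G x)^2 \<le> (g x)^2"
        proof (cases "x \<le> a' \<or> a < x")
          case True
          then have "\<alpha> < D x" using False D_a alpha(4) by (cases "x = a'") (auto simp: out_def)
          then have "glo k x = gD x" by (rule l(7))
          moreover have "(gD x)^2 \<le> (g x)^2" using gD_le[of x] by (simp add: abs_le_square_iff)
          ultimately show ?thesis using True aa(1) by (auto simp: sg)
        next
          case F: False
          then show ?thesis by simp
        qed
        then show ?thesis using False by (simp add: ennreal_leI)
      qed
    qed
    also have "\<dots> = L2 g + ennreal (k^2 - 1) * K"
      unfolding L2_norm_sq_real K_def by (subst nn_integral_add, simp, simp, subst nn_integral_cmult) auto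
    finally show ?thesis .
  qed
  have GF: "L2 ?G < \<infinity>" using energies(1) Kfin by (intro le_less_trans[OF GK]) (simp add: ennreal_mult_less_top)
  define c where "c = 2 / pi"
  have c: "c \<ge> 0" by (simp add: c_def)
  obtain rg where rg: "L2 g = ennreal rg" "rg \<ge> 0" using energies(1) by (rule finite_ennrealE)
  obtain rG where rG: "L2 ?G = ennreal rG" "rG \<ge> 0" using GF by (rule finite_ennrealE)
  obtain rK where rK: "K = ennreal rK" "rK \<ge> 0" using Kfin by (rule finite_ennrealE)
  obtain Hf where Hf: "Hh f = ennreal Hf" "Hf \<ge> 0" using energies(2) by (rule finite_ennrealE)
  obtain Hw where Hw: "Hh w = ennreal Hw" "Hw \<ge> 0" using w_finite(1) by (rule finite_ennrealE)
  obtain Hp where Hp: "Hh p = ennreal Hp" "Hp \<ge> 0" using w_finite(2) by (rule finite_ennrealE)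
  obtain Hq where Hq: "Hh (pk k) = ennreal Hq" "Hq \<ge> 0" using Hpk by (rule finite_ennrealE)
  obtain Hv where Hv: "Hh (\<lambda>x. w x + pk k x) = ennreal Hv" "Hv \<ge> 0" using Hwk by (rule finite_ennrealE)
  obtain Lw where Lw: "L2 w = ennreal Lw" "Lw \<ge> 0" using L2_parts(3) by (rule finite_ennrealE)
  obtain Lp where Lp: "L2 p = ennreal Lp" "Lp \<ge> 0" using L2_parts(2) by (rule finite_ennrealE)
  obtain Lq where Lq: "L2 (pk k) = ennreal Lq" "Lq \<ge> 0" using Lpk by (rule finite_ennrealE)
  obtain n1 where n1: "Qp n (pk k) = ennreal n1" "n1 \<ge> 0" using fin(1) by (rule finite_ennrealE)
  obtain n2 where n2: "Qp n d = ennreal n2" "n2 \<ge> 0" using fin(2) by (rule finite_ennrealE)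
  obtain q1 where q1: "Qp q (pk k) = ennreal q1" "q1 \<ge> 0" using fin(3) by (rule finite_ennrealE)
  obtain q2 where q2: "Qp q d = ennreal q2" "q2 \<ge> 0" using fin(4) by (rule finite_ennrealE)
  note all = rg(2) rG(2) rK(2) Hf(2) Hw(2) Hp(2) Hq(2) Hv(2) Lw(2) Lp(2) Lq(2) n1(2) n2(2) q1(2) q2(2) c wall(3)
  have qn: "q2 \<le> n2" using rep all unfolding q2(1) n2(1) by simp
  have "ennreal (Hf + c * (q1 + q2)) = ennreal (Hw + Hp + c * (n1 + n2))"
    using id unfolding Nadd Hf(1) Hw(1) Hp(1) n1(1) n2(1) q1(1) q2(1) c_def[symmetric] using all
    by (simp only: ennreal_plus ennreal_mult add_nonneg_nonneg mult_nonneg_nonneg)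
  then have 1: "Hf + c * (q1 + q2) = Hw + Hp + c * (n1 + n2)" using all by (subst (asm) ennreal_inj) auto
  have "ennreal (Hv + c * q1) = ennreal (Hw + Hq + c * n1)"
    using idk unfolding Hv(1) Hw(1) Hq(1) n1(1) q1(1) c_def[symmetric] using all
    by (simp only: ennreal_plus ennreal_mult add_nonneg_nonneg mult_nonneg_nonneg)
  then have 2: "Hv + c * q1 = Hw + Hq + c * n1" using all by (subst (asm) ennreal_inj) auto
  have 3: "Hv + Hp \<le> Hf + Hq" using 1 2 mult_left_mono[OF qn c] by (simp add: distrib_left)
  have k24: "(k^2)^2 = k ^ 4" by simp
  have "ennreal Hq \<le> ennreal (k ^ 4 * Hp)" using Hk all unfolding Hq(1) Hp(1) k24 by (simp add: ennreal_mult)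
  then have 4: "Hq \<le> k ^ 4 * Hp" using all by (subst (asm) ennreal_le_iff) auto
  have k2: "0 \<le> k^2 - 1" using k by simp
  have "ennreal rG \<le> ennreal (rg + (k^2 - 1) * rK)" using GK all k2 unfolding rG(1) rg(1) rK(1) by (simp only: ennreal_plus ennreal_mult mult_nonneg_nonneg)
  then have 5: "rG \<le> rg + (k^2 - 1) * rK" using all k2 by (subst (asm) ennreal_le_iff) auto
  have "ennreal (rg + Hf + (Lw + Lp)) \<le> ennreal (rG + Hv + (Lw + Lq))"
    using m all unfolding rg(1) rG(1) Hf(1) Hv(1) Lw(1) Lp(1) Lq(1) by (simp only: ennreal_plus add_nonneg_nonneg)
  then have 6: "rg + Hf + (Lw + Lp) \<le> rG + Hv + (Lw + Lq)" using all by (subst (asm) ennreal_le_iff) auto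
  have "ennreal (1/2 * rK + Hp + Lp) \<le> ennreal (2 * e0)"
    using wall_bound[OF wall] all unfolding rK(1) Hp(1) Lp(1) by (simp only: ennreal_plus ennreal_mult add_nonneg_nonneg mult_nonneg_nonneg zero_le_divide_1_iff zero_le_numeral)
  then have 7: "1/2 * rK + Hp + Lp \<le> 2 * e0" using all by (subst (asm) ennreal_le_iff) auto
  have k14: "k^2 \<le> k ^ 4" using k by (intro power_increasing) auto
  \<comment> \<open>Minimality bounds the saved L2 norm by the growth of the kinetic energy and of
    the seminorm, with factors k^2 - 1 and k^4 - 1. \<open>wall_bound\<close> gives rK / 2 + Hp
    \<le> 2 e0, hence rK + Hp \<le> 4 e0.\<close>
  have 8: "Lp \<le> Lq + (k ^ 4 - 1) * (4 * e0)"
  proof -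
    have "Lp \<le> Lq + (k^2 - 1) * rK + (k ^ 4 * Hp - Hp)" using 3 4 5 6 by linarith
    also have "\<dots> \<le> Lq + (k ^ 4 - 1) * rK + (k ^ 4 - 1) * Hp"
      using k14 all by (intro add_mono mult_right_mono) (auto simp: left_diff_distrib)
    also have "\<dots> = Lq + (k ^ 4 - 1) * (rK + Hp)" by (simp add: distrib_left)
    also have "\<dots> \<le> Lq + (k ^ 4 - 1) * (4 * e0)"
      using k14 k2 7 all by (intro add_left_mono mult_left_mono) linarith+
    finally show ?thesis .
  qed
  \<comment> \<open>Since 0 \<le> pk \<le> p, pointwise p (p - pk) \<le> p^2 - pk^2; so the integral
    in question is at most the L2 norm that stretching saves.\<close>
  have "(NN x. ennreal (p x * min (p x) ((k - 1) * (\<epsilon> - p x)))) + L2 (pk k) = (NN x. ennreal (p x * min (p x) ((k - 1) * (\<epsilon> - p x))) + ennreal ((pk k x)^2))"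
    unfolding L2_norm_sq_real by (rule nn_integral_add[symmetric]) auto
  also have "\<dots> \<le> L2 p" unfolding L2_norm_sq_real
  proof (rule nn_integral_mono)
    fix x
    have "min (p x) ((k - 1) * (\<epsilon> - p x)) \<le> p x - pk k x"
    proof (cases "out x \<and> D x \<le> \<alpha>")
      case True
      then have e: "p x = cos (D x) - cos \<alpha>" "\<epsilon> - p x = 1 - cos (D x)" "p x - pk k x = cos (D x) - cos (min (k * D x) \<alpha>)"
        using alpha(2) by (auto simp: p_alt pk_def \<epsilon>_def min_absorb1)
      have "min (cos (D x) - cos \<alpha>) ((k - 1) * (1 - cos (D x))) \<le> cos (D x) - cos (min (k * D x) \<alpha>)"
        using True D_bounds(1) \<alpha>(2) k1 by (intro cos_scaled_lower) auto
      then show ?thesis unfolding e(2,3) unfolding e(1) .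
    next
      case False
      then have "p x = 0" using alpha(2) by (auto simp: p_alt min_absorb2)
      then show ?thesis using l(10,11)[of x] by simp
    qed
    then have "p x * min (p x) ((k - 1) * (\<epsilon> - p x)) \<le> p x * (p x - pk k x)" using parts_nonneg(1) by (intro mult_left_mono)
    also have "\<dots> \<le> (p x)^2 - (pk k x)^2"
    proof -
      have "0 \<le> pk k x * (p x - pk k x)" using l(10,11)[of x] by simp
      then show ?thesis by (simp add: power2_eq_square algebra_simps)
    qed
    finally have "p x * min (p x) ((k - 1) * (\<epsilon> - p x)) + (pk k x)^2 \<le> (p x)^2" by simp
    moreover have "0 \<le> p x * min (p x) ((k - 1) * (\<epsilon> - p x))" using parts_nonneg(1,6)[of x] k by simp
    ultimately show "ennreal (p x * min (p x) ((k - 1) * (\<epsilon> - p x))) + ennreal ((pk k x)^2) \<le> ennreal ((p x)^2)"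
      by (simp only: ennreal_plus[symmetric] zero_le_power2 ennreal_leI)
  qed
  finally have le: "(NN x. ennreal (p x * min (p x) ((k - 1) * (\<epsilon> - p x)))) + ennreal Lq \<le> ennreal Lp" unfolding Lp(1) Lq(1) .
  then obtain I where I: "(NN x. ennreal (p x * min (p x) ((k - 1) * (\<epsilon> - p x)))) = ennreal I" "I \<ge> 0"
    using le_ennrealE[OF ennreal_add_leD(1)[OF le]] by blast
  have "I + Lq \<le> Lp" using le all I(2) unfolding I(1) by (simp add: ennreal_plus[symmetric] del: ennreal_plus)
  then have "I \<le> (k ^ 4 - 1) * (4 * e0)" using 8 by linarith
  then show ?thesis unfolding I(1) by (rule ennreal_leI)
qed

text \<open>\<epsilon> p = p (\<epsilon> - p) + p^2. The first term is bounded by 15 * 4 e0 through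
  stretching, the second by 2 e0 through \<open>wall_bound\<close>; together 62 e0.\<close>

lemma p_mass:
  assumes wall: "profile h (- \<alpha>) \<alpha> \<phi>0 g0" "ee h \<phi>0 g0 \<le> ennreal e0" "e0 \<ge> 0"
  shows "(NN x. ennreal (p x)) \<le> ennreal (62 * e0 / \<epsilon>)"
proof -
  have 1: "(NN x. ennreal (p x * (\<epsilon> - p x))) \<le> ennreal (15 * (4 * e0))"
    by (rule mass_from_quotients[OF _ parts_nonneg(1) parts_nonneg(6) _ stretch[OF wall]]) (use wall(3) in auto)
  have 2: "L2 p \<le> ennreal (2 * e0)" by (rule ennreal_add_leD(2)[OF wall_bound[OF wall]])
  have "ennreal \<epsilon> * (NN x. ennreal (p x)) = (NN x. ennreal \<epsilon> * ennreal (p x))" by (rule nn_integral_cmult[symmetric]) simp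
  also have "\<dots> = (NN x. ennreal (p x * (\<epsilon> - p x)) + ennreal ((p x)^2))"
  proof (rule nn_integral_cong)
    fix x
    have "ennreal \<epsilon> * ennreal (p x) = ennreal (p x * (\<epsilon> - p x) + (p x)^2)"
      using parts_nonneg(1) eps by (simp add: ennreal_mult[symmetric] power2_eq_square algebra_simps)
    also have "\<dots> = ennreal (p x * (\<epsilon> - p x)) + ennreal ((p x)^2)" using parts_nonneg(1,6)[of x] by (intro ennreal_plus) auto
    finally show "ennreal \<epsilon> * ennreal (p x) = ennreal (p x * (\<epsilon> - p x)) + ennreal ((p x)^2)" .
  qed
  also have "\<dots> = (NN x. ennreal (p x * (\<epsilon> - p x))) + L2 p"
    unfolding L2_norm_sq_real by (rule nn_integral_add) auto
  also have "\<dots> \<le> ennreal (15 * (4 * e0)) + ennreal (2 * e0)" by (intro add_mono 1 2)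
  also have "\<dots> = ennreal (62 * e0)" using wall(3) by (subst ennreal_plus[symmetric]) auto
  finally have "ennreal (1/\<epsilon>) * (ennreal \<epsilon> * (NN x. ennreal (p x))) \<le> ennreal (1/\<epsilon>) * ennreal (62 * e0)" by (rule mult_left_mono) simp
  moreover have "ennreal (1/\<epsilon>) * (ennreal \<epsilon> * X) = X" for X
    unfolding mult.assoc[symmetric] using eps by (simp add: ennreal_mult[symmetric])
  moreover have "ennreal (1/\<epsilon>) * ennreal (62 * e0) = ennreal (62 * e0 / \<epsilon>)" using eps wall(3) by (simp add: ennreal_mult[symmetric])
  ultimately show ?thesis by simp
qed

text \<open>Competitor: the part \<open>pr\<close> is moved to infinity. Its repulsion by \<open>n\<close> outweighs its attraction by \<open>q\<close>
  and \<open>pl\<close>, so this lowers the energy.\<close>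

lemma expel:
  assumes mass: "(NN x. ennreal (p x)) \<le> ennreal (\<tau> / 64)"
  shows False
proof -
  define v where "v x = q x + pl x" for x
  have [measurable]: "v \<in> borel_measurable borel" unfolding v_def by measurable
  have v0: "0 \<le> v x" "a < x \<Longrightarrow> v x = 0" for x using parts_nonneg aa(1) by (auto simp: v_def q_def pl_def out_def)
  have prp: "pr x \<noteq> 0 \<Longrightarrow> p x \<noteq> 0" "pr x \<noteq> 0 \<Longrightarrow> a < x" for x by (auto simp: pr_def p_def out_def split: if_splits)
  have pr_far: "pr x \<noteq> 0 \<Longrightarrow> a + \<tau> < x" for x using prp[of x] p_far[of x] aa(1) \<tau>(1) by fastforce
  have "(NN x. ennreal (v x)) = (NN x. ennreal (q x)) + (NN x. ennreal (pl x))"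
    unfolding v_def using parts_nonneg by (simp add: ennreal_plus nn_integral_add)
  also have "\<dots> \<le> ennreal (\<tau> / 64) + (NN x. ennreal (p x))"
    using p_split parts_nonneg by (intro add_mono q_mass nn_integral_mono ennreal_leI) auto
  also have "\<dots> \<le> ennreal (\<tau> / 64) + ennreal (\<tau> / 64)" by (intro add_left_mono mass)
  also have "\<dots> = ennreal (\<tau> / 32)" using \<tau>(1) by (simp add: ennreal_plus[symmetric] del: ennreal_plus)
  finally have vm: "(NN x. ennreal (v x)) \<le> ennreal (\<tau> / 32)" .
  \<comment> \<open>The positive mass in the core and to its left is at most \<tau>/32, which gives
    the factor 16/32 in \<open>interaction_dominated\<close>. A factor strictly below 1 is what the
    contradiction needs.\<close>
  have half: "Qp v pr \<le> ennreal (1/2) * Qp n pr"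
  proof -
    have "Qp v pr \<le> ennreal (16 * (\<tau> / 32) / \<tau>) * Qp n pr"
    proof (rule interaction_dominated[OF _ _ _ v0(1) parts_nonneg(3) parts_nonneg(5) vm _ \<tau>(1)])
      fix t assume "pr t \<noteq> 0"
      then have "a + \<tau> < t" by (rule pr_far)
      moreover have vs: "v s \<noteq> 0 \<Longrightarrow> s \<le> a" for s using v0(2)[of s] by force
      ultimately show "\<exists>c. \<forall>x\<in>{c..c+\<tau>}. n x \<ge> 1/4 \<and> x \<noteq> t \<and> (\<forall>s. v s \<noteq> 0 \<longrightarrow> \<bar>t - x\<bar> \<le> 2 * \<bar>t - s\<bar>)"
        using chunk_right[of t] by (meson vs)
    qed (use \<tau> in auto)
    then show ?thesis using \<tau>(1) by simp
  qed
  have L: "L2 v < \<infinity>" "L2 pr < \<infinity>" "L2 (\<lambda>x. w x + pl x) < \<infinity>"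
  proof -
    have "L2 v \<le> L2 f" "L2 pr \<le> L2 f" "L2 (\<lambda>x. w x + pl x) \<le> L2 f"
      unfolding L2_norm_sq_real by (intro nn_integral_mono ennreal_leI; auto simp: v_def pr_def q_def pl_def w_def n_def out_def max_def)+
    then show "L2 v < \<infinity>" "L2 pr < \<infinity>" "L2 (\<lambda>x. w x + pl x) < \<infinity>" using energies(3) by (auto intro: le_less_trans)
  qed
  have Qv: "Qp v pr < \<infinity>" using pr_far by (intro Qp_finite L v0) force+
  have fs: "f x = (w x + pl x) + pr x" for x using f_split[of x] p_split[of x] by simp
  have dis: "w x + pl x = 0 \<or> pr x = 0" for x
    using prp[of x] w_disjoint[of x] aa(1) by (auto simp: pl_def)
  have id: "Hh f + ennreal (2/pi) * Qp v pr = Hh (\<lambda>x. w x + pl x) + Hh pr + ennreal (2/pi) * Qp n pr"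
  proof -
    have m: "max 0 (x * y) = max 0 (max 0 x * y)" if "0 \<le> y" for x y :: real using that mult_nonpos_nonneg[of x y] by (cases "0 \<le> x") (auto simp: max_absorb1 max_absorb2)
    have wq: "max 0 (w x + pl x) = v x" "max 0 (- (w x + pl x)) = n x" for x
      using aa(1) by (auto simp: w_def q_def n_def v_def pl_def out_def max_def)
    have "max 0 ((w s + pl s) * pr t) = max 0 (v s * pr t)" "max 0 (- (w s + pl s) * pr t) = max 0 (n s * pr t)" for s t
      using m[OF parts_nonneg(3)[of t], of "w s + pl s"] m[OF parts_nonneg(3)[of t], of "- (w s + pl s)"] unfolding wq by auto
    then have "Qp (\<lambda>x. w x + pl x) pr = Qp v pr" "Qp (\<lambda>x. - (w x + pl x)) pr = Qp n pr" unfolding Qp_def by simp_all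
    then show ?thesis using Hh_split[of "\<lambda>x. w x + pl x" pr] dis unfolding fs[symmetric] by simp
  qed
  have "Hh f + ennreal (2/pi) * Qp v pr < \<infinity>" using energies(2) Qv by (simp add: ennreal_mult_less_top)
  then have fin: "Hh (\<lambda>x. w x + pl x) < \<infinity>" "Hh pr < \<infinity>" "Qp n pr < \<infinity>"
    unfolding id by (auto simp: ennreal_mult_less_top)
  have Lf: "L2 f = L2 (\<lambda>x. w x + pl x) + L2 pr"
    using L2_disjoint[of "\<lambda>x. w x + pl x" pr] dis unfolding fs[symmetric] by auto
  \<comment> \<open>\<Phi>1 is \<phi> without \<open>pr\<close>; it stops at \<Lambda> - \<alpha>.
    \<Phi>2 carries \<open>pr\<close> alone, from -\<alpha> to \<alpha>. Shifted by \<Lambda>, it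
    continues \<Phi>1 to the original limit.\<close>
  define \<Phi>1 where "\<Phi>1 x = (if x \<le> a then \<phi> x else \<Lambda> + - 1 * hi x)" for x
  define G1 where "G1 x = (if x \<le> a then g x else - 1 * ghi x)" for x
  define \<Phi>2 where "\<Phi>2 x = (if x \<le> a then - \<alpha> else sR x * min (1 * D x) \<alpha>)" for x
  define G2 where "G2 x = (if x \<le> a then 0 else sR x * gmi 1 x)" for x
  have s1: "sob \<Phi>1 G1" unfolding \<Phi>1_def[abs_def] G1_def[abs_def]
    using aa(3) hi_facts(5) by (intro sob_join prof(1) sob_shift_const sob_cmult hi_facts(1)) auto
  have "sob (\<lambda>x. sR x * min (1 * D x) \<alpha>) (\<lambda>x. sR x * gmi 1 x)"
    using D_cos_1 alpha(1) by (intro sR(4) sob_gmi) auto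
  then have s2: "sob \<Phi>2 G2" unfolding \<Phi>2_def[abs_def] G2_def[abs_def]
    using sR(2) D_a(2) alpha(4) by (intro sob_join sob_const) auto
  have cs: "cos (s * x) = cos x" if "\<bar>s\<bar> = 1" for s x :: real using that by (auto simp: abs_if split: if_splits)
  have f1: "cos (\<Phi>1 x) - h = w x + pl x" for x
  proof (cases "x \<le> a")
    case True then show ?thesis using fs[of x] by (simp add: \<Phi>1_def f_def pr_def)
  next
    case False then show ?thesis using hi_facts(9)[of x] aa(1) \<Lambda>(1)[of "- hi x"] by (simp add: \<Phi>1_def w_def q_def out_def pl_def)
  qed
  have f2: "cos (\<Phi>2 x) - h = pr x" for x
  proof (cases "x \<le> a")
    case True then show ?thesis using alpha(2) by (simp add: \<Phi>2_def pr_def)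
  next
    case False
    then have "p x = pr x" by (simp add: p_def pr_def out_def)
    then show ?thesis using False cs[OF sR(1)] p_alt[of x] by (simp add: \<Phi>2_def out_def)
  qed
  have "(\<lambda>x. cos (\<Phi>1 x) - h) = (\<lambda>x. w x + pl x)" "(\<lambda>x. cos (\<Phi>2 x) - h) = pr" using f1 f2 by auto
  then have e1: "ee h \<Phi>1 G1 = L2 G1 + Hh (\<lambda>x. w x + pl x) + L2 (\<lambda>x. w x + pl x)"
    and e2: "ee h \<Phi>2 G2 = L2 G2 + Hh pr + L2 pr" unfolding ee_def by simp_all
  have "eventually (\<lambda>x. \<phi> x = \<Phi>1 x) at_bot" using eventually_le_at_bot[of a] by eventually_elim (simp add: \<Phi>1_def)
  then have l1: "(\<Phi>1 \<longlongrightarrow> \<beta>) at_bot" using prof(3) by (rule Lim_transform_eventually[rotated])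
  have "eventually (\<lambda>x. \<Lambda> + - 1 * hi x = \<Phi>1 x) at_top" using eventually_gt_at_top[of a] by eventually_elim (simp add: \<Phi>1_def)
  then have l2: "(\<Phi>1 \<longlongrightarrow> \<Lambda> + - 1 * \<alpha>) at_top"
    using tendsto_add[OF tendsto_const tendsto_mult_left[OF hi_facts(3), of "- 1"]] by (rule Lim_transform_eventually[rotated])
  have "eventually (\<lambda>x. - \<alpha> = \<Phi>2 x) at_bot" using eventually_le_at_bot[of a] by eventually_elim (simp add: \<Phi>2_def)
  then have l3: "(\<Phi>2 \<longlongrightarrow> - \<alpha>) at_bot" using tendsto_const by (rule Lim_transform_eventually[rotated])
  have "eventually (\<lambda>x. sR x * \<alpha> = \<alpha>) at_top" using sR(3) by eventually_elim simp
  moreover have "((\<lambda>x. min (1 * D x) \<alpha>) \<longlongrightarrow> \<alpha>) at_top" using tendsto_min[OF D_tendsto(2) tendsto_const, of \<alpha>] by simp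
  ultimately have t: "((\<lambda>x. sR x * min (1 * D x) \<alpha>) \<longlongrightarrow> \<alpha>) at_top" by (intro signed_tendsto sR(1))
  have "eventually (\<lambda>x. sR x * min (1 * D x) \<alpha> = \<Phi>2 x) at_top" using eventually_gt_at_top[of a] by eventually_elim (simp add: \<Phi>2_def)
  then have l4: "(\<Phi>2 \<longlongrightarrow> \<alpha>) at_top" using t by (rule Lim_transform_eventually[rotated])
  have P1: "profile h \<beta> (\<Lambda> + - 1 * \<alpha>) \<Phi>1 G1" using s1 l1 l2 fin(1) L(3) sob_L2[OF s1] by (simp add: profile_def e1)
  have es: "ee h (\<lambda>x. \<Lambda> + \<Phi>2 x) G2 = ee h \<Phi>2 G2" by (simp add: ee_def \<Lambda>)
  have "ee h \<Phi>2 G2 < \<infinity>" using fin(2) L(2) sob_L2[OF s2] by (simp add: e2)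
  moreover have "((\<lambda>x. \<Lambda> + \<Phi>2 x) \<longlongrightarrow> \<Lambda> + - 1 * \<alpha>) at_bot" using tendsto_add[OF tendsto_const l3, of \<Lambda>] by simp
  ultimately have P2: "profile h (\<Lambda> + - 1 * \<alpha>) (\<Lambda> + \<alpha>) (\<lambda>x. \<Lambda> + \<Phi>2 x) G2"
    using sob_shift_const[OF s2] tendsto_add[OF tendsto_const l4] unfolding profile_def es by blast
  have "cos (\<Lambda> + - 1 * \<alpha>) = h" "sin (\<Lambda> + - 1 * \<alpha>) \<noteq> 0" unfolding \<Lambda> using alpha by auto
  from minimal_concat[OF min P1 P2 this] have "ee h \<phi> g \<le> ee h \<Phi>1 G1 + ee h \<Phi>2 G2" unfolding es .
  then have m: "L2 g + Hh f + L2 f \<le> (L2 G1 + L2 G2) + (Hh (\<lambda>x. w x + pl x) + Hh pr) + L2 f"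
    unfolding e1 e2 Lf unfolding ee_def f_def[abs_def, symmetric] Lf by (simp only: ac_simps)
  have GG: "L2 G1 + L2 G2 \<le> L2 g"
  proof -
    note [measurable] = sob_meas[OF s1] sob_meas[OF s2]
    have "L2 G1 + L2 G2 = (NN x. ennreal ((G1 x)^2) + ennreal ((G2 x)^2))"
      unfolding L2_norm_sq_real by (rule nn_integral_add[symmetric]) auto
    also have "\<dots> \<le> L2 g" unfolding L2_norm_sq_real
    proof (rule nn_integral_mono)
      fix x
      have "(G1 x)^2 + (G2 x)^2 \<le> (g x)^2"
      proof (cases "x \<le> a")
        case False
        have "(sR x)^2 = 1" using sR(1)[of x] by (metis one_power2 power2_abs)
        then have "(G1 x)^2 + (G2 x)^2 = (ghi x)^2 + (gmi 1 x)^2" using False by (simp add: G1_def G2_def power_mult_distrib)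
        \<comment> \<open>Away from D = \<alpha> one of the two derivatives vanishes and the other
          is \<open>gD\<close>; at D = \<alpha> both are half of it.\<close>
        also have "\<dots> \<le> (gD x)^2"
          using zero_le_power2[of "gD x"] by (auto simp: ghi_def gmi_def sgn_if power_divide)
        also have "\<dots> \<le> (g x)^2" using gD_le[of x] by (simp add: abs_le_square_iff)
        finally show ?thesis .
      qed (simp add: G1_def G2_def)
      then show "ennreal ((G1 x)^2) + ennreal ((G2 x)^2) \<le> ennreal ((g x)^2)" by (simp add: ennreal_plus[symmetric] ennreal_leI del: ennreal_plus)
    qed
    finally show ?thesis .
  qed
  define c where "c = 2 / pi"
  have c: "c > 0" by (simp add: c_def)
  obtain rg where rg: "L2 g = ennreal rg" "rg \<ge> 0" using energies(1) by (rule finite_ennrealE)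
  obtain rf where rf: "L2 f = ennreal rf" "rf \<ge> 0" using energies(3) by (rule finite_ennrealE)
  obtain Hf where Hf: "Hh f = ennreal Hf" "Hf \<ge> 0" using energies(2) by (rule finite_ennrealE)
  obtain Hw where Hw: "Hh (\<lambda>x. w x + pl x) = ennreal Hw" "Hw \<ge> 0" using fin(1) by (rule finite_ennrealE)
  obtain Hp where Hp: "Hh pr = ennreal Hp" "Hp \<ge> 0" using fin(2) by (rule finite_ennrealE)
  obtain n1 where n1: "Qp n pr = ennreal n1" "n1 \<ge> 0" using fin(3) by (rule finite_ennrealE)
  obtain q1 where q1: "Qp v pr = ennreal q1" "q1 \<ge> 0" using Qv by (rule finite_ennrealE)
  note all = rg(2) rf(2) Hf(2) Hw(2) Hp(2) n1(2) q1(2) less_imp_le[OF c]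
  have "ennreal rg + ennreal Hf + ennreal rf \<le> ennreal rg + (ennreal Hw + ennreal Hp) + ennreal rf"
    using order_trans[OF m add_right_mono[OF add_right_mono[OF GG]]] unfolding rg(1) rf(1) Hf(1) Hw(1) Hp(1) .
  then have "ennreal (rg + Hf + rf) \<le> ennreal (rg + (Hw + Hp) + rf)" using all by (simp only: ennreal_plus add_nonneg_nonneg)
  then have 1: "Hf \<le> Hw + Hp" using all by (subst (asm) ennreal_le_iff) auto
  have "ennreal (Hf + c * q1) = ennreal (Hw + Hp + c * n1)"
    using id unfolding Hf(1) Hw(1) Hp(1) n1(1) q1(1) c_def[symmetric] using all
    by (simp only: ennreal_plus ennreal_mult add_nonneg_nonneg mult_nonneg_nonneg)
  then have "Hf + c * q1 = Hw + Hp + c * n1" using all by (subst (asm) ennreal_inj) auto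
  then have "c * n1 \<le> c * q1" using 1 by linarith
  then have 2: "n1 \<le> q1" using c by simp
  have "ennreal q1 \<le> ennreal (1/2 * n1)" using half all unfolding n1(1) q1(1) by (simp only: ennreal_mult zero_le_divide_1_iff zero_le_numeral)
  then have "q1 \<le> 1/2 * n1" using all by (subst (asm) ennreal_le_iff) auto
  \<comment> \<open>Minimality gives n1 \<le> q1 and domination q1 \<le> n1 / 2, so there is no
    interaction at all.\<close>
  then have "n1 = 0" using 2 all by linarith
  then have Z: "Qp n pr = 0" using n1(1) by simp
  \<comment> \<open>But \<open>pr\<close> is positive near x0, where the angle crosses \<Lambda> and
    f = \<epsilon>, and \<open>n\<close> is at least 1/4 near a; their interaction cannot
    vanish.\<close>
  have "isCont f x0" unfolding f_def[abs_def] using sob_cont_at[OF prof(1)] by (intro continuous_intros) auto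
  moreover have fx0: "f x0 = \<epsilon>" using aa(5) \<Lambda>(1)[of 0] by (simp add: f_def \<epsilon>_def)
  ultimately obtain \<delta> where \<delta>: "\<delta> > 0" "\<And>x. \<bar>x - x0\<bar> < \<delta> \<Longrightarrow> \<bar>f x - \<epsilon>\<bar> < \<epsilon> / 2"
    using eps unfolding continuous_at_eps_delta by (metis dist_real_def half_gt_zero)
  have pr2: "\<epsilon> / 2 \<le> pr x" if "x \<in> {x0..x0 + \<delta>/2}" for x
  proof -
    have "\<bar>f x - \<epsilon>\<bar> < \<epsilon> / 2" using \<delta>(1) that by (intro \<delta>(2)) auto
    moreover have "a < x" using that aa(4) by auto
    ultimately show ?thesis unfolding pr_def by (auto simp: abs_if split: if_splits)
  qed
  define M where "M = x0 + \<delta> - a + \<tau> + 1"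
  have M: "M > 0" using aa(4) \<delta> \<tau>(1) by (simp add: M_def)
  have "ennreal (\<tau> / (4 * M^2)) * (\<integral>\<^sup>+s\<in>{x0..x0 + \<delta>/2}. ennreal (max 0 (- (- pr s)) / 1^2) \<partial>lborel) \<le> Qp (\<lambda>x. - pr x) (\<lambda>x. - n x)"
  proof (rule Qp_lower[where q = "a - \<tau>" and M = M])
    show "- n t \<le> - 1/4" if "t \<in> {a - \<tau>..a - \<tau> + \<tau>}" for t using \<tau>(3)[of t] that by (auto simp: n_def f_def)
    show "s \<noteq> t \<and> \<bar>s - t\<bar> \<le> M * 1" if "s \<in> {x0..x0 + \<delta>/2}" "t \<in> {a - \<tau>..a - \<tau> + \<tau>}" for s t
      using that aa(4) \<delta> \<tau>(1) by (auto simp: M_def)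
  qed (use \<tau>(1) M in auto)
  also have "Qp (\<lambda>x. - pr x) (\<lambda>x. - n x) = Qp pr n" by (simp add: Qp_def)
  also have "\<dots> = Qp n pr" by (rule Qp_commute) auto
  finally have "ennreal (\<tau> / (4 * M^2)) * (\<integral>\<^sup>+s\<in>{x0..x0 + \<delta>/2}. ennreal (max 0 (pr s)) \<partial>lborel) = 0" unfolding Z by simp
  then have "(\<integral>\<^sup>+s\<in>{x0..x0 + \<delta>/2}. ennreal (max 0 (pr s)) \<partial>lborel) = 0" using \<tau>(1) M by simp
  moreover have "ennreal (\<epsilon> / 2 * (\<delta> / 2)) \<le> (\<integral>\<^sup>+s\<in>{x0..x0 + \<delta>/2}. ennreal (max 0 (pr s)) \<partial>lborel)"
  proof -
    have "ennreal (\<epsilon> / 2 * (\<delta> / 2)) = (\<integral>\<^sup>+s\<in>{x0..x0 + \<delta>/2}. ennreal (\<epsilon> / 2) \<partial>lborel)"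
      using eps \<delta>(1) by (subst nn_integral_cmult_indicator) (auto simp: emeasure_lborel_Icc_eq ennreal_mult[symmetric])
    also have "\<dots> \<le> (\<integral>\<^sup>+s\<in>{x0..x0 + \<delta>/2}. ennreal (max 0 (pr s)) \<partial>lborel)"
      using pr2 parts_nonneg(3) by (intro nn_integral_mono) (auto simp: indicator_def max_absorb2 intro!: ennreal_leI)
    finally show ?thesis .
  qed
  ultimately show False using eps(1) \<delta>(1) by (auto simp: mult_le_0_iff)
qed

end

section \<open>Nonexistence of minimisers\<close>

lemma sob_ivt:
  assumes s: "sob \<phi> g" and xy: "x \<le> y" "\<phi> x \<le> v" "v \<le> \<phi> y"
  obtains z where "x \<le> z" "z \<le> y" "\<phi> z = v"
  using IVT'[of \<phi> x v y] xy continuous_on_subset[OF sob_continuous[OF s]] by blast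

text \<open>The order of choices matters: N, then L, \<tau>, C and W depend on l only, and the
  threshold for h is fixed last. Both left limits are treated together, since they differ only in
  the sign function on the left.\<close>

lemma no_minimal:
  fixes l :: nat
  assumes l: "l \<ge> 1"
  shows "\<exists>\<epsilon>0. 0 < \<epsilon>0 \<and> \<epsilon>0 \<le> 1/4 \<and> (\<forall>h. 1 - \<epsilon>0 < h \<longrightarrow> h < 1 \<longrightarrow> arccos h < 1 \<and>
    (\<forall>\<beta> \<phi> g. \<beta> = arccos h \<or> \<beta> = - arccos h \<longrightarrow> \<not> minimal h \<beta> (2 * pi * real l + arccos h) \<phi> g))"
proof -
  define \<Lambda> where "\<Lambda> = 2 * pi * real l"
  have "cos \<Lambda> = 1 \<and> sin \<Lambda> = 0" using cos_int_2pin[of "int l"] sin_int_2pin[of "int l"] by (simp add: \<Lambda>_def)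
  then have \<Lambda>: "cos (\<Lambda> + x) = cos x" "sin (\<Lambda> + x) = sin x" for x by (simp_all add: cos_add sin_add)
  have \<Lambda>2: "2 * pi \<le> \<Lambda>" unfolding \<Lambda>_def using l by (simp add: mult_left_mono)
  \<comment> \<open>Energy of \<open>linear_profile\<close> with W = 1 and M = 2; the limits differ
    by at most \<Lambda> + 2 because \<alpha> < 1.\<close>
  define N where "N = 2 * (\<Lambda> + 2)^2 + 12"
  have N: "N \<ge> 0" by (simp add: N_def)
  obtain \<epsilon>1 L where \<epsilon>1: "0 < \<epsilon>1" "\<epsilon>1 \<le> 1/4" and L: "0 < L"
    and gap_bound: "\<And>h \<beta> \<rho> \<phi> g z1 z2. 1 - \<epsilon>1 < h \<Longrightarrow> h < 1 \<Longrightarrow> minimal h \<beta> \<rho> \<phi> g \<Longrightarrow> ee h \<phi> g \<le> ennreal N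
    \<Longrightarrow> cos (\<phi> z1) \<le> 0 \<Longrightarrow> cos (\<phi> z2) \<le> 0 \<Longrightarrow> (\<forall>x\<in>{z1<..<z2}. cos (\<phi> x) > 0) \<Longrightarrow> z2 - z1 \<le> L"
    using gap_bound[OF N] by metis
  define \<tau> where "\<tau> = min 1 (1 / (4 * (N + 1)))"
  have \<tau>: "\<tau> > 0" using N by (simp add: \<tau>_def)
  define C where "C = (64 * (N + 1)^2 + 16 * N + 1) * (2 * L + 2)"
  have C: "C \<ge> 0" using N L by (simp add: C_def)
  \<comment> \<open>With \<alpha>^2 \<le> 8 (1 - h), a layer of width W costs at most (1 - h)(64/W +
    3 (1 - h) W). After the factor 62/(1 - h) from \<open>p_mass\<close> the first term is
    \<tau>/128 by the choice of W, and the second one at most \<tau>/128 by the last bound on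
    \<epsilon>0.\<close>
  define W where "W = 62 * 64 * 128 / \<tau>"
  have W: "W > 0" using \<tau> by (simp add: W_def)
  have c1: "cos (1::real) < 1" using cos_monotone_0_pi[of 0 "1::real"] pi_gt3 by simp
  \<comment> \<open>The four bounds provide, in order: the gap length, \<alpha> < 1, a small
    integral of the positive part in the core, and cheap transition layers.\<close>
  define \<epsilon>0 where "\<epsilon>0 = min (min \<epsilon>1 (1 - cos 1)) (min (\<tau> / (64 * (C + 1))) (\<tau> / (128 * 186 * W)))"
  have e0: "\<epsilon>0 > 0" "\<epsilon>0 \<le> \<epsilon>1" "\<epsilon>0 \<le> 1 - cos 1" "\<epsilon>0 \<le> \<tau> / (64 * (C + 1))" "\<epsilon>0 \<le> \<tau> / (128 * 186 * W)"
    using \<epsilon>1 c1 \<tau> C W by (auto simp: \<epsilon>0_def)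
  have main: "arccos h < 1 \<and> (\<forall>\<beta> \<phi> g. \<beta> = arccos h \<or> \<beta> = - arccos h \<longrightarrow> \<not> minimal h \<beta> (\<Lambda> + arccos h) \<phi> g)"
    if h: "1 - \<epsilon>0 < h" "h < 1" for h
  proof -
    define \<alpha> where "\<alpha> = arccos h"
    have h34: "3/4 \<le> h" using h e0 \<epsilon>1 by linarith
    have a0: "0 < \<alpha>" "\<alpha> < pi" using arccos_lt_bounded[of h] h h34 by (auto simp: \<alpha>_def)
    have ca: "cos \<alpha> = h" unfolding \<alpha>_def using h h34 by (intro cos_arccos) auto
    have a1: "\<alpha> < 1"
    proof (rule ccontr)
      assume "\<not> ?thesis"
      then have "cos \<alpha> \<le> cos 1" using a0 by (intro cos_monotone_0_pi_le) auto
      then show False using ca h e0 by linarith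
    qed
    have "\<not> minimal h \<beta> (\<Lambda> + \<alpha>) \<phi> g" if \<beta>: "\<beta> = \<alpha> \<or> \<beta> = - \<alpha>" for \<beta> \<phi> g
    proof
      assume min: "minimal h \<beta> (\<Lambda> + \<alpha>) \<phi> g"
      then have prof: "sob \<phi> g" "(\<phi> \<longlongrightarrow> \<beta>) at_bot" "(\<phi> \<longlongrightarrow> \<Lambda> + \<alpha>) at_top" by (auto simp: minimal_def profile_def)
      note s = prof(1)
      have cb: "cos \<beta> = h" using \<beta> ca by auto
      have \<beta>\<rho>: "\<beta> \<le> \<Lambda> + \<alpha>" "\<Lambda> + \<alpha> - \<beta> \<le> \<Lambda> + 2" using \<beta> a0 a1 \<Lambda>2 pi_gt3 by auto
      have en: "ee h \<phi> g \<le> ennreal N"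
      proof -
        have "\<bar>cos y - h\<bar> \<le> 2" for y using cos_le_one[of y] cos_ge_minus_one[of y] h h34 by linarith
        then obtain \<phi>1 g1 where p1: "profile h \<beta> (\<Lambda> + \<alpha>) \<phi>1 g1" "ee h \<phi>1 g1 \<le> ennreal (2 * (\<Lambda> + \<alpha> - \<beta>)^2 / 1 + 3 * 2^2 * 1)"
          using linear_profile[of 1 \<beta> "\<Lambda> + \<alpha>" h 2] \<beta>\<rho>(1) cb ca \<Lambda>(1)[of \<alpha>] by auto
        have "ee h \<phi> g \<le> ee h \<phi>1 g1" using min p1(1) by (auto simp: minimal_def)
        also note p1(2)
        also have "ennreal (2 * (\<Lambda> + \<alpha> - \<beta>)^2 / 1 + 3 * 2^2 * 1) \<le> ennreal N"
          unfolding N_def using \<beta>\<rho> by (intro ennreal_leI add_mono mult_left_mono) (auto intro: power_mono)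
        finally show ?thesis .
      qed
      have parts: "L2 g \<le> ennreal N" "L2 (\<lambda>x. cos (\<phi> x) - h) \<le> ennreal N"
        using ennreal_add_leD[OF en[unfolded ee_def]] ennreal_add_leD(1)[OF ennreal_add_leD(1)[OF en[unfolded ee_def]]] by auto
      have "\<beta> < pi" "\<Lambda> < \<Lambda> + \<alpha>" using \<beta> a0 by auto
      then have ev: "eventually (\<lambda>x. \<phi> x < pi) at_bot" "eventually (\<lambda>x. \<Lambda> < \<phi> x) at_top"
        using order_tendstoD(2)[OF prof(2)] order_tendstoD(1)[OF prof(3)] by auto
      obtain xb where xb: "\<phi> xb < pi" using eventually_happens[OF ev(1)] by auto
      obtain X where X: "\<And>x. X \<le> x \<Longrightarrow> \<Lambda> < \<phi> x" using ev(2) by (auto simp: eventually_at_top_linorder)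
      have mX: "\<Lambda> < \<phi> (max y X)" for y by (rule X) simp
      have ivt: "\<exists>z\<ge>y. \<phi> z = v" if "\<phi> y \<le> v" "v \<le> \<Lambda>" for y v
      proof -
        have "v \<le> \<phi> (max y X)" using mX[of y] that by linarith
        from sob_ivt[OF s max.cobounded1 that(1) this] show ?thesis by blast
      qed
      \<comment> \<open>Since \<Lambda> \<ge> 2 pi, the levels pi, \<Lambda> - pi, \<Lambda> are
        increasing and are met in this order; for l = 1 the first two coincide.\<close>
      obtain a' where a': "\<phi> a' = pi" using ivt[of xb pi] xb \<Lambda>2 pi_gt3 by auto
      obtain a where a: "a' \<le> a" "\<phi> a = \<Lambda> - pi" using ivt[of a' "\<Lambda> - pi"] a' \<Lambda>2 pi_gt3 by auto
      obtain x0 where x0': "a \<le> x0" "\<phi> x0 = \<Lambda>" using ivt[of a \<Lambda>] a pi_gt3 by auto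
      then have x0: "a < x0" using a pi_gt3 by (cases "a = x0") auto
      have ca': "cos (\<phi> a') \<le> 0" "cos (\<phi> a) \<le> 0" using a' a(2) \<Lambda>(1)[of "- pi"] by auto
      have core: "(1 - h) * (a - a') \<le> \<tau> / 64"
      proof -
        have "a - a' \<le> C" unfolding C_def
          by (rule core_bounded[OF s parts N h34 ca' L]) (rule gap_bound[OF _ h(2) min en], use h e0 in auto)
        then have "(1 - h) * (a - a') \<le> \<tau> / (64 * (C + 1)) * (C + 1)" using h e0 C a(1) by (intro mult_mono) auto
        also have "\<dots> = \<tau> / 64"
        proof -
          have g: "x / (64 * B) * B = x / 64" if "B > 0" for x B :: real using that by simp
          show ?thesis by (rule g) (use C in simp)
        qed
        finally show ?thesis .
      qed
      have ch: "cos (\<phi> x) - h \<le> - 1/4" if "\<bar>x - z\<bar> \<le> \<tau>" "cos (\<phi> z) \<le> 0" for x z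
        using cos_stays_low[OF s parts(1) N h34 that(2)] that(1) unfolding \<tau>_def by blast
      define sR where "sR x = (if x \<le> x0 then - 1 else 1 :: real)" for x
      \<comment> \<open>For \<beta> = -\<alpha> the angle crosses 0 to the left of a', and the sign
        changes at such a zero, where every angle in question vanishes. For \<beta> = \<alpha> the
        constant sign 1 suffices. On the right, \<open>sR\<close> changes at x0, where \<phi> =
        \<Lambda>.\<close>
      have "\<exists>sL. (\<forall>x. \<bar>sL x\<bar> = 1) \<and> sL a' = 1 \<and> eventually (\<lambda>x. sL x * \<alpha> = \<beta>) at_bot \<and>
        (\<forall>u k. sob u k \<longrightarrow> (\<forall>x. cos (\<phi> x) = 1 \<longrightarrow> u x = 0) \<longrightarrow> sob (\<lambda>x. sL x * u x) (\<lambda>x. sL x * k x))"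
        using \<beta>
      proof
        assume "\<beta> = \<alpha>"
        then show ?thesis by (intro exI[of _ "\<lambda>x. 1"]) auto
      next
        assume b: "\<beta> = - \<alpha>"
        have "eventually (\<lambda>x. \<phi> x < 0) at_bot" using order_tendstoD(2)[OF prof(2), of 0] b a0 by auto
        then obtain Y where Y: "\<And>x. x \<le> Y \<Longrightarrow> \<phi> x < 0" by (auto simp: eventually_at_bot_linorder)
        have mY: "\<phi> (min Y a') < 0" by (rule Y) simp
        have "0 \<le> \<phi> a'" using a' by simp
        from sob_ivt[OF s min.cobounded2 less_imp_le[OF mY] this] obtain z where z: "z \<le> a'" "\<phi> z = 0" by blast
        then have za: "z < a'" using a' by (cases "z = a'") auto
        show ?thesis
        proof (intro exI[of _ "\<lambda>x. if x \<le> z then - 1 else 1"] conjI allI impI)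
          show "eventually (\<lambda>x. (if x \<le> z then - 1 else 1) * \<alpha> = \<beta>) at_bot"
            using eventually_le_at_bot[of z] by eventually_elim (simp add: b)
          show "sob (\<lambda>x. (if x \<le> z then - 1 else 1) * u x) (\<lambda>x. (if x \<le> z then - 1 else 1) * k x)"
            if "sob u k" "\<forall>x. cos (\<phi> x) = 1 \<longrightarrow> u x = 0" for u k
            using that z by (intro sob_sign_change) auto
        qed (use za in auto)
      qed
      then obtain sL where sL: "\<And>x. \<bar>sL x\<bar> = 1" "sL a' = 1" "eventually (\<lambda>x. sL x * \<alpha> = \<beta>) at_bot"
        "\<And>u k. sob u k \<Longrightarrow> (\<And>x. cos (\<phi> x) = 1 \<Longrightarrow> u x = 0) \<Longrightarrow> sob (\<lambda>x. sL x * u x) (\<lambda>x. sL x * k x)" by blast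
      have sR3: "eventually (\<lambda>x. sR x = 1) at_top" using eventually_gt_at_top[of x0] by eventually_elim (simp add: sR_def)
      have sR4: "sob (\<lambda>x. sR x * u x) (\<lambda>x. sR x * k x)" if "sob u k" "\<And>x. cos (\<phi> x) = 1 \<Longrightarrow> u x = 0" for u k
        unfolding sR_def using that x0'(2) \<Lambda>(1)[of 0] by (intro sob_sign_change) auto
      interpret far_pattern h \<alpha> \<beta> \<Lambda> a' a \<tau> x0 \<phi> g sL sR
        by unfold_locales
          (use min h34 h(2) a1 \<Lambda> a a' x0 x0'(2) \<tau> ch ca' core sL sR3 sR4 in \<open>auto simp: \<alpha>_def sR_def\<close>)
      have lin: "\<exists>\<phi>0 g0. profile h (- \<alpha>) \<alpha> \<phi>0 g0 \<and> ee h \<phi>0 g0 \<le> ennreal (2 * (\<alpha> - - \<alpha>)^2 / W + 3 * (1 - h)^2 * W)"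
      proof (rule linear_profile[OF W])
        fix y assume y: "- \<alpha> \<le> y" "y \<le> \<alpha>"
        have "cos \<alpha> \<le> cos \<bar>y\<bar>" using y a0 by (intro cos_monotone_0_pi_le) auto
        then show "\<bar>cos y - h\<bar> \<le> 1 - h" using ca cos_le_one[of y] by (simp add: abs_le_iff)
      qed (use a0 ca in auto)
      define e where "e = 2 * (\<alpha> - - \<alpha>)^2 / W + 3 * (1 - h)^2 * W"
      have e: "e \<ge> 0" using W by (simp add: e_def)
      obtain \<phi>0 g0 where wall: "profile h (- \<alpha>) \<alpha> \<phi>0 g0" "ee h \<phi>0 g0 \<le> ennreal e" using lin unfolding e_def by blast
      \<comment> \<open>Concavity of the sine, in the form of monotonicity of sin t / t between
        \<alpha>/2 and pi/2, gives sin(\<alpha>/2) \<ge> \<alpha>/4.\<close>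
      have \<alpha>2: "\<alpha>^2 \<le> 8 * (1 - h)"
      proof -
        have "sin (pi / 2) * (\<alpha> / 2) \<le> pi / 2 * sin (\<alpha> / 2)" using a0 a1 pi_gt3 by (intro sin_over_id_antimono) auto
        also have "\<dots> \<le> 2 * sin (\<alpha> / 2)" using a0 pi_less_4 sin_ge_zero[of "\<alpha> / 2"] by (intro mult_right_mono) auto
        finally have "\<alpha> / 4 \<le> sin (\<alpha> / 2)" by simp
        then have "(\<alpha> / 4)^2 \<le> (sin (\<alpha> / 2))^2" using a0 by (intro power_mono) auto
        moreover have "1 - h = 2 * (sin (\<alpha> / 2))^2" using cos_double_sin[of "\<alpha> / 2"] ca by simp
        ultimately show ?thesis by (simp add: power_divide)
      qed
      have "62 * e / (1 - h) \<le> \<tau> / 64"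
      proof -
        have "e = 8 * \<alpha>^2 / W + 3 * (1 - h)^2 * W" by (simp add: e_def power2_eq_square)
        also have "\<dots> \<le> 8 * (8 * (1 - h)) / W + 3 * (1 - h)^2 * W"
          using \<alpha>2 W by (intro add_right_mono divide_right_mono mult_left_mono) auto
        also have "\<dots> = (1 - h) * (64 / W + 3 * (1 - h) * W)" by (simp add: power2_eq_square algebra_simps)
        finally have "62 * e \<le> 62 * ((1 - h) * (64 / W + 3 * (1 - h) * W))" by simp
        also have "62 * (x * (64 / W + 3 * x * W)) = x * (62 * 64 / W + 186 * x * W)" for x
          using W by (simp add: field_simps)
        finally have "62 * e \<le> (1 - h) * (62 * 64 / W + 186 * (1 - h) * W)" .
        then have "62 * e / (1 - h) \<le> 62 * 64 / W + 186 * (1 - h) * W" using h(2) by (simp add: pos_divide_le_eq mult.commute)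
        also have "62 * 64 / W = \<tau> / 128" using \<tau> by (simp add: W_def)
        also have "186 * (1 - h) * W \<le> 186 * (\<tau> / (128 * 186 * W)) * W"
        proof -
          have "1 - h \<le> \<tau> / (128 * 186 * W)" using \<open>1 - \<epsilon>0 < h\<close> e0(5) by linarith
          then show ?thesis using W by (intro mult_right_mono mult_left_mono) simp_all
        qed
        also have "186 * (\<tau> / (128 * 186 * W)) * W = \<tau> / 128" using W by simp
        finally show ?thesis by simp
      qed
      then have "(NN x. ennreal (p x)) \<le> ennreal (\<tau> / 64)"
        using p_mass[OF wall e] unfolding \<epsilon>_def by (meson ennreal_leI order_trans)
      then show False by (rule expel)
    qed
    then show ?thesis using a1 unfolding \<alpha>_def by blast
  qed
  have "\<epsilon>0 \<le> 1/4" using e0 \<epsilon>1 by linarith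
  with e0(1) main show ?thesis unfolding \<Lambda>_def by blast
qed

theorem theorem3:
  fixes l :: nat
  assumes "l \<ge> 1"
  shows "\<exists>H0 Hp :: real. H0 \<in> {0<..<1} \<and> Hp \<in> {0<..<1} \<and>
           (\<forall>h\<in>{H0<..<1}. \<not> attains_infimum h (real l)) \<and>
           (\<forall>h\<in>{Hp<..<1}. \<not> attains_infimum h (real l + arccos h / pi))"
proof -
  \<comment> \<open>One threshold serves both degrees, since both left limits are excluded at once;
    the bound \<open>arccos h < 1\<close> feeds the normalisation of the limits.\<close>
  obtain \<epsilon> where \<epsilon>: "0 < \<epsilon>" "\<epsilon> \<le> 1/4"
    and no: "\<And>h. 1 - \<epsilon> < h \<Longrightarrow> h < 1 \<Longrightarrow> arccos h < 1 \<and> (\<forall>\<beta> \<phi> g. \<beta> = arccos h \<or> \<beta> = - arccos h \<longrightarrow> \<not> minimal h \<beta> (2 * pi * real l + arccos h) \<phi> g)"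
    using no_minimal[OF assms] by blast
  have *: "\<not> attains_infimum h d" if h: "h \<in> {1 - \<epsilon><..<1}" and d: "d = real l \<or> d = real l + arccos h / pi" for h d
    using attains_infimum_minimal[of h d l] no[of h] h d \<epsilon> by auto
  show ?thesis using * \<epsilon> by (intro exI[of _ "1 - \<epsilon>"]) auto
qed

end
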